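(* Let $m,n\ge1$ be integers, $\ell:=\min\{m,n\}$, and let $A : \mathbb{R} \to \mathbb{C}^{m \times n}$ be a curve of $m \times n$ complex matrices of class $C^1 \cap DC \cap W^{2,1}_{\mathrm{loc}}$. If $\operatorname{rank} A(t) = \ell$ for all $t\in\mathbb{R}$, then there exists a system $\sigma = (\sigma_1,\ldots,\sigma_\ell)$ of the singular values of $A$ such that \[ \sigma \in C^1(\mathbb{R},\mathbb{R}^\ell) \cap DC(\mathbb{R},\mathbb{R}^\ell)\cap W^{2,1}_{\mathrm{loc}}(\mathbb{R},\mathbb{R}^\ell). \] This result is uniform in the following sense. Let $I\subseteq\mathbb{R}$ be a bounded open interval, let $k\ge1$ be an integer, and let $U$ be an open neighborhood of the closure of $I^{1+k}$ in $\mathbb{R}^{1+k}$. Suppose that $A:U\to\mathbb{C}^{m\times n}$ satisfies $\operatorname{rank} A=\ell$ everywhere on $U$, that $A$ is locally $DC$ on $U$, and that $A(\cdot,r)$ is of class $C^1\cap W^{2,1}$ on $\overline I$ for all $r\in\overline I^k$. Assume that, for each $r\in\overline I^k$, a $C^1$-system $\sigma(\cdot,r)$ of the singular values of $A(\cdot,r)$ is fixed. Then the family $\sigma(\cdot,r)$, $r\in\overline I^k$, is bounded in $C^1(\overline I,\mathbb{R}^\ell)$, and there is a non-negative $L^1$-function $M:I^k\to\mathbb{R}_{\ge0}$ such that \[ \|\sigma(\cdot,r)\|_{W^{2,1}(I,\mathbb{R}^\ell)}\le M(r)\quad\text{for a.e. } r\in I^k. \]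
   Context: For $A\in\mathbb{C}^{m\times n}$ the singular values are the non-negative square roots $\sigma_1^\downarrow(A)\ge\cdots\ge\sigma_n^\downarrow(A)\ge0$ of the eigenvalues of $A^*A$ (with multiplicity); since $\sigma_j^\downarrow(A)=0$ for $j>\operatorname{rank}A$, only $\sigma_1^\downarrow(A),\ldots,\sigma_\ell^\downarrow(A)$ with $\ell=\min\{m,n\}$ are considered. Given a curve $A:J\to\mathbb{C}^{m\times n}$ on an interval $J\subseteq\mathbb{R}$, a system of the singular values of $A$ is a mapping $\sigma=(\sigma_1,\ldots,\sigma_\ell):J\to\mathbb{R}^\ell$ such that for every $t\in J$ the unordered $\ell$-tuples $(\sigma_1(t),\ldots,\sigma_\ell(t))$ and $(\sigma_1^\downarrow(A(t)),\ldots,\sigma_\ell^\downarrow(A(t)))$ coincide. It is a $C^1$-system if $\sigma$ is $C^1$. A real function on a convex set is difference-convex ($DC$) if it is the difference of two continuous convex functions on that set; a function is locally $DC$ if every point of its domain has a convex neighborhood on which it is $DC$. A map into a finite-dimensional real vector space is (locally) $DC$ if each of its real components is; $\mathbb{C}^{m\times n}$ is viewed as a real vector space. $W^{2,1}$ denotes the Sobolev space of integrable functions with integrable weak derivatives up to order $2$, and $W^{2,1}_{\mathrm{loc}}$ its local version. *)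

theory Defs
  imports
    "HOL-Analysis.Analysis"
    "Jordan_Normal_Form.Schur_Decomposition"
    "Jordan_Normal_Form.DL_Rank"
begin

text \<open>
  Complex m x n matrices are elements of \<^term>\<open>carrier_mat m n\<close>; maps into the real vector space
  of such matrices are handled through the real and imaginary parts of the entries.
  Tuples of length \<open>l\<close> are functions on \<^typ>\<open>nat\<close> of which only the values at indices
  below \<open>l\<close> matter.
\<close>

definition mat_components ::
    "nat \<Rightarrow> nat \<Rightarrow> (('a \<Rightarrow> real) \<Rightarrow> bool) \<Rightarrow> ('a \<Rightarrow> complex mat) \<Rightarrow> bool" where
  "mat_components m n P A \<longleftrightarrow>
     (\<forall>i<m. \<forall>j<n. P (\<lambda>x. Re (A x $$ (i, j))) \<and> P (\<lambda>x. Im (A x $$ (i, j))))"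

definition tuple_components ::
    "nat \<Rightarrow> (('a \<Rightarrow> real) \<Rightarrow> bool) \<Rightarrow> ('a \<Rightarrow> nat \<Rightarrow> real) \<Rightarrow> bool" where
  "tuple_components l P f \<longleftrightarrow> (\<forall>j<l. P (\<lambda>x. f x j))"

subsection \<open>Singular values\<close>

text \<open>
  The eigenvalues of \<open>A\<^sup>* A\<close> are taken with their multiplicities as roots of the characteristic
  polynomial. They are real and non-negative, so passing to the real part loses nothing.
\<close>

definition singular_values :: "complex mat \<Rightarrow> real list" where
  "singular_values A =
     rev (sorted_list_of_multiset
       (image_mset (\<lambda>z. sqrt (Re z)) (proots (char_poly (mat_adjoint A * A)))))"

definition singular_value_system ::
    "nat \<Rightarrow> real set \<Rightarrow> (real \<Rightarrow> complex mat) \<Rightarrow> (real \<Rightarrow> nat \<Rightarrow> real) \<Rightarrow> bool" where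
  "singular_value_system l J A \<sigma> \<longleftrightarrow>
     (\<forall>t\<in>J. mset (map (\<sigma> t) [0..<l]) = mset (take l (singular_values (A t))))"

subsection \<open>Regularity classes\<close>

text \<open>
  Derivatives are taken within \<open>S\<close>, hence one-sided at end points of an interval; the library
  predicate \<^const>\<open>C1_differentiable_on\<close> would demand two-sided derivatives there.
\<close>

definition C1_on :: "real set \<Rightarrow> (real \<Rightarrow> real) \<Rightarrow> bool" where
  "C1_on S f \<longleftrightarrow>
     (\<exists>f'. (\<forall>t\<in>S. (f has_real_derivative f' t) (at t within S)) \<and> continuous_on S f')"

text \<open>Convexity of \<open>S\<close> is part of \<^const>\<open>convex_on\<close>.\<close>

definition DC_on :: "'a::real_normed_vector set \<Rightarrow> ('a \<Rightarrow> real) \<Rightarrow> bool" where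
  "DC_on S f \<longleftrightarrow>
     (\<exists>g h. convex_on S g \<and> continuous_on S g \<and> convex_on S h \<and> continuous_on S h \<and>
            (\<forall>x\<in>S. f x = g x - h x))"

definition locally_DC_on :: "'a::real_normed_vector set \<Rightarrow> ('a \<Rightarrow> real) \<Rightarrow> bool" where
  "locally_DC_on U f \<longleftrightarrow>
     (\<forall>x\<in>U. \<exists>V N. openin (top_of_set U) V \<and> x \<in> V \<and> V \<subseteq> N \<and> N \<subseteq> U \<and> DC_on N f)"

definition test_function :: "real set \<Rightarrow> (real \<Rightarrow> real) \<Rightarrow> bool" where
  "test_function \<Omega> \<phi> \<longleftrightarrow>
     (\<forall>i. (deriv ^^ i) \<phi> differentiable_on UNIV) \<and>
     compact (closure {t. \<phi> t \<noteq> 0}) \<and> closure {t. \<phi> t \<noteq> 0} \<subseteq> \<Omega>"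

definition locally_integrable_on :: "real set \<Rightarrow> (real \<Rightarrow> real) \<Rightarrow> bool" where
  "locally_integrable_on \<Omega> f \<longleftrightarrow>
     (\<forall>K. compact K \<and> K \<subseteq> \<Omega> \<longrightarrow> f absolutely_integrable_on K)"

definition has_weak_deriv ::
    "nat \<Rightarrow> real set \<Rightarrow> (real \<Rightarrow> real) \<Rightarrow> (real \<Rightarrow> real) \<Rightarrow> bool" where
  "has_weak_deriv i \<Omega> f g \<longleftrightarrow>
     locally_integrable_on \<Omega> f \<and> locally_integrable_on \<Omega> g \<and>
     (\<forall>\<phi>. test_function \<Omega> \<phi> \<longrightarrow>
        (LINT t:\<Omega>|lebesgue. f t * (deriv ^^ i) \<phi> t) =
        (- 1) ^ i * (LINT t:\<Omega>|lebesgue. g t * \<phi> t))"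

text \<open>A weak derivative on an open set is unique up to a null set.\<close>

definition weak_deriv :: "nat \<Rightarrow> real set \<Rightarrow> (real \<Rightarrow> real) \<Rightarrow> real \<Rightarrow> real" where
  "weak_deriv i \<Omega> f = (SOME g. has_weak_deriv i \<Omega> f g)"

definition W21_on :: "real set \<Rightarrow> (real \<Rightarrow> real) \<Rightarrow> bool" where
  "W21_on \<Omega> f \<longleftrightarrow>
     f absolutely_integrable_on \<Omega> \<and>
     (\<forall>i\<in>{1, 2}. \<exists>g. g absolutely_integrable_on \<Omega> \<and> has_weak_deriv i \<Omega> f g)"

definition W21_loc_on :: "real set \<Rightarrow> (real \<Rightarrow> real) \<Rightarrow> bool" where
  "W21_loc_on \<Omega> f \<longleftrightarrow>
     (\<forall>V. open V \<and> compact (closure V) \<and> closure V \<subseteq> \<Omega> \<longrightarrow> W21_on V f)"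

text \<open>
  The sum of the \<open>L\<^sup>1\<close> norms of the Euclidean lengths of \<open>f\<close> and of its first two weak
  derivatives; meaningful only if all components satisfy \<^const>\<open>W21_on\<close>, since the integral of a
  non-integrable function is 0.
\<close>

definition W21_norm :: "nat \<Rightarrow> real set \<Rightarrow> (real \<Rightarrow> nat \<Rightarrow> real) \<Rightarrow> real" where
  "W21_norm l \<Omega> f =
     (LINT t:\<Omega>|lebesgue. L2_set (f t) {..<l}) +
     (\<Sum>i\<in>{1, 2}. LINT t:\<Omega>|lebesgue. L2_set (\<lambda>j. weak_deriv i \<Omega> (\<lambda>s. f s j) t) {..<l})"

definition C1_bounded_family ::
    "nat \<Rightarrow> real set \<Rightarrow> 'r set \<Rightarrow> ('r \<Rightarrow> real \<Rightarrow> nat \<Rightarrow> real) \<Rightarrow> bool" where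
  "C1_bounded_family l S R f \<longleftrightarrow>
     (\<forall>r\<in>R. tuple_components l (C1_on S) (f r)) \<and>
     (\<exists>C. \<forall>r\<in>R. \<forall>t\<in>S. \<forall>j<l.
        \<bar>f r t j\<bar> \<le> C \<and> \<bar>vector_derivative (\<lambda>s. f r s j) (at t within S)\<bar> \<le> C)"

definition cube :: "real set \<Rightarrow> (real ^ 'k) set" where
  "cube S = {r. \<forall>i. Finite_Cartesian_Product.vec_nth r i \<in> S}"

end

theory Submission
  imports Defs
begin

text \<open>
  By Ky Fan, the sum of the \<open>k\<close> largest singular values is a maximum of real-linear functionals whose
  coefficients have modulus at most \<open>k\<close>, so it becomes convex on adding a multiple of the convex parts of the
  entries, and the decreasing singular values are difference-convex. A continuous selection from finitely many convex
  functions becomes convex on adding all pairwise maxima of them, with Lipschitz constants inherited from the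
  entries. Hence every \<open>C\<^sup>1\<close> choice \<open>s\<close> of a singular value is difference-convex, and the total
  variation of \<open>s'\<close> is bounded in terms of the Lipschitz constants of the convex parts of the entries.

  The measure \<open>ds'\<close> has no singular part: \<open>s\<close> is a root of a monic polynomial with \<open>W\<^sup>2\<^sup>,\<^sup>1\<close>
  coefficients, the characteristic polynomial of \<open>A\<^sup>* A\<close> at \<open>x\<^sup>2\<close>, and on the set where this root has a
  given multiplicity, a derivative of the root equation expresses \<open>s'\<close> through absolutely continuous functions.
  So \<open>s\<close> is of class \<open>W\<^sup>2\<^sup>,\<^sup>1\<close> and the \<open>L\<^sup>1\<close> norm of \<open>s''\<close> is that total variation. Since
  difference-convexity is locally uniform on compact sets, all bounds are uniform in the parameter \<open>r\<close>, and \<open>M\<close>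
  can be taken constant.

  A \<open>C\<^sup>1\<close> system exists because the pairs of an eigenvalue of \<open>A\<^sup>* A\<close> and its derivative, taken from
  first-order perturbation theory, form a continuous unordered tuple, which has a continuous selection; full rank
  makes the square roots of the positive eigenvalues smooth.
\<close>

section \<open>Hermitian matrices\<close>

text \<open>The obstacle is that multiplicities may change on a Cantor-like set, near which no
  formula for s'' is available. Convexity alone controls the variation of s'; absolute continuity is
  then a question about null sets only. To settle it, ds' is written as a difference of two finite
  positive measures, which must agree on every Lebesgue null set. The interval splits into countably
  many sets according to the exact multiplicity of the root. On each of them s' coincides locally
  with a function that has an integrable density, and this coincidence on the bare set, without a
  neighbourhood, already forces the agreement. Isolated points of these sets are harmless because s'
  is continuous. The family estimate is uniform because every bound is a function of one number L,
  which bounds the entries, the Lipschitz constants of their convex parts and the inverse length of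
  the intervals on which these parts are used. Beyond the smoothness of the square roots, full rank
  supplies the supporting functionals of Ky Fan, whose left singular vectors arise by division by
  singular values, and it identifies the first l singular values with the positive ones.\<close>

definition ip :: "nat \<Rightarrow> (nat \<Rightarrow> complex) \<Rightarrow> (nat \<Rightarrow> complex) \<Rightarrow> complex" where
  "ip n x y = (\<Sum>i<n. cnj (x i) * y i)"

definition nrm2 :: "nat \<Rightarrow> (nat \<Rightarrow> complex) \<Rightarrow> real" where
  "nrm2 n x = (\<Sum>i<n. (cmod (x i))\<^sup>2)"

definition mv :: "nat \<Rightarrow> (nat \<Rightarrow> nat \<Rightarrow> complex) \<Rightarrow> (nat \<Rightarrow> complex) \<Rightarrow> nat \<Rightarrow> complex" where
  "mv n M x i = (\<Sum>j<n. M i j * x j)"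

definition herm :: "nat \<Rightarrow> (nat \<Rightarrow> nat \<Rightarrow> complex) \<Rightarrow> bool" where
  "herm n M \<longleftrightarrow> (\<forall>i<n. \<forall>j<n. M j i = cnj (M i j))"

text \<open>The number k of vectors is separate from the dimension n, so that a system can be
  extended one vector at a time.\<close>

definition orthon :: "nat \<Rightarrow> nat \<Rightarrow> (nat \<Rightarrow> nat \<Rightarrow> complex) \<Rightarrow> bool" where
  "orthon n k u \<longleftrightarrow> (\<forall>p<k. \<forall>q<k. ip n (u p) (u q) = (if p = q then 1 else 0))"

lemma ip_cong: "(\<And>i. i < n \<Longrightarrow> x i = x' i) \<Longrightarrow> (\<And>i. i < n \<Longrightarrow> y i = y' i) \<Longrightarrow> ip n x y = ip n x' y'"
  unfolding ip_def by (intro sum.cong) auto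

lemma ip_add_right: "ip n x (\<lambda>i. y i + z i) = ip n x y + ip n x z"
  by (simp add: ip_def algebra_simps sum.distrib)
lemma ip_diff_right: "ip n x (\<lambda>i. y i - z i) = ip n x y - ip n x z"
  by (simp add: ip_def algebra_simps sum_subtractf)
lemma ip_scale_right: "ip n x (\<lambda>i. c * y i) = c * ip n x y"
  by (simp add: ip_def algebra_simps sum_distrib_left)
lemma ip_sum_right: "ip n x (\<lambda>i. \<Sum>k\<in>K. f k i) = (\<Sum>k\<in>K. ip n x (f k))"
  unfolding ip_def by (subst sum.swap) (simp add: sum_distrib_left)
lemma ip_add_left: "ip n (\<lambda>i. y i + z i) x = ip n y x + ip n z x"
  by (simp add: ip_def algebra_simps sum.distrib)
lemma ip_diff_left: "ip n (\<lambda>i. y i - z i) x = ip n y x - ip n z x"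
  by (simp add: ip_def algebra_simps sum_subtractf)
lemma ip_scale_left: "ip n (\<lambda>i. c * y i) x = cnj c * ip n y x"
  by (simp add: ip_def algebra_simps sum_distrib_left)
lemma ip_sum_left: "ip n (\<lambda>i. \<Sum>k\<in>K. f k i) x = (\<Sum>k\<in>K. ip n (f k) x)"
  unfolding ip_def cnj_sum sum_distrib_right by (rule sum.swap)

lemmas ip_linear = ip_add_right ip_diff_right ip_scale_right ip_sum_right
  ip_add_left ip_diff_left ip_scale_left ip_sum_left

lemma cnj_ip: "cnj (ip n x y) = ip n y x"
  by (simp add: ip_def mult.commute)

lemma ip_self: "ip n x x = of_real (nrm2 n x)"
  unfolding ip_def nrm2_def of_real_sum
  by (intro sum.cong refl) (metis complex_norm_square mult.commute of_real_power)

lemma nrm2_nonneg: "0 \<le> nrm2 n x"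
  by (simp add: nrm2_def sum_nonneg)

lemma nrm2_eq_0: "nrm2 n x = 0 \<longleftrightarrow> (\<forall>i<n. x i = 0)"
  unfolding nrm2_def by (subst sum_nonneg_eq_0_iff) auto

lemma cmod_le_nrm2: "i < n \<Longrightarrow> (cmod (x i))\<^sup>2 \<le> nrm2 n x"
  unfolding nrm2_def by (rule member_le_sum) auto

lemma mv_cong: "(\<And>i. i < n \<Longrightarrow> x i = y i) \<Longrightarrow> mv n M x = mv n M y"
  unfolding mv_def by (intro ext sum.cong) auto

lemma mv_add: "mv n M (\<lambda>i. x i + y i) = (\<lambda>i. mv n M x i + mv n M y i)"
  by (auto simp: mv_def algebra_simps sum.distrib)
lemma mv_scale: "mv n M (\<lambda>i. c * x i) = (\<lambda>i. c * mv n M x i)"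
  by (auto simp: mv_def algebra_simps sum_distrib_left)
lemma mv_sum: "mv n M (\<lambda>i. \<Sum>k\<in>K. f k i) = (\<lambda>i. \<Sum>k\<in>K. mv n M (f k) i)"
  unfolding mv_def sum_distrib_left by (rule ext) (rule sum.swap)

lemma herm_ip:
  assumes "herm n M"
  shows "ip n (mv n M x) y = ip n x (mv n M y)"
proof -
  have "ip n (mv n M x) y = (\<Sum>i<n. \<Sum>j<n. cnj (M i j) * cnj (x j) * y i)"
    by (simp add: ip_def mv_def sum_distrib_right)
  also have "\<dots> = (\<Sum>j<n. \<Sum>i<n. cnj (M i j) * cnj (x j) * y i)"
    by (rule sum.swap)
  also have "\<dots> = (\<Sum>j<n. \<Sum>i<n. cnj (x j) * (M j i * y i))"
  proof (intro sum.cong refl)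
    fix i j assume "j \<in> {..<n}" "i \<in> {..<n}"
    then have "M j i = cnj (M i j)" using assms unfolding herm_def by blast
    then show "cnj (M i j) * cnj (x j) * y i = cnj (x j) * (M j i * y i)" by (simp only: mult_ac)
  qed
  also have "\<dots> = ip n x (mv n M y)"
    by (simp add: ip_def mv_def sum_distrib_left)
  finally show ?thesis .
qed

lemma orthon_mono: "orthon n k u \<Longrightarrow> j \<le> k \<Longrightarrow> orthon n j u"
  unfolding orthon_def by auto

text \<open>Bessel's inequality together with its defect. Bessel, the existence of orthogonal
  vectors and Parseval are all read off from the norm of the residual.\<close>

lemma orthon_residual:
  assumes "orthon n k u"
  defines "r \<equiv> \<lambda>x i. x i - (\<Sum>p<k. ip n (u p) x * u p i)"
  shows "p < k \<Longrightarrow> ip n (u p) (r x) = 0"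
    and "nrm2 n (r x) = nrm2 n x - (\<Sum>p<k. (cmod (ip n (u p) x))\<^sup>2)"
proof -
  have 1: "ip n (u p) (r x) = 0" if "p < k" for p
  proof -
    have "ip n (u p) (r x) = ip n (u p) x - (\<Sum>q<k. ip n (u q) x * ip n (u p) (u q))"
      by (simp add: r_def ip_linear)
    also have "(\<Sum>q<k. ip n (u q) x * ip n (u p) (u q)) = (\<Sum>q<k. if q = p then ip n (u q) x else 0)"
      using assms(1) that unfolding orthon_def by (intro sum.cong) auto
    finally show ?thesis using that by simp
  qed
  then show "p < k \<Longrightarrow> ip n (u p) (r x) = 0" .
  have "ip n (r x) (r x) = ip n x (r x) - (\<Sum>p<k. cnj (ip n (u p) x) * ip n (u p) (r x))"
    by (subst (1) r_def) (simp add: ip_linear)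
  also have "\<dots> = ip n x (r x)" using 1 by simp
  also have "\<dots> = ip n x x - (\<Sum>p<k. ip n (u p) x * cnj (ip n (u p) x))"
    by (simp add: r_def ip_linear cnj_ip)
  also have "(\<Sum>p<k. ip n (u p) x * cnj (ip n (u p) x)) = of_real (\<Sum>p<k. (cmod (ip n (u p) x))\<^sup>2)"
    unfolding of_real_sum complex_norm_square ..
  finally have "complex_of_real (nrm2 n (r x)) = of_real (nrm2 n x - (\<Sum>p<k. (cmod (ip n (u p) x))\<^sup>2))"
    by (simp add: ip_self)
  then show "nrm2 n (r x) = nrm2 n x - (\<Sum>p<k. (cmod (ip n (u p) x))\<^sup>2)"
    using of_real_eq_iff by blast
qed

lemma bessel:
  assumes "orthon n k u"
  shows "(\<Sum>p<k. (cmod (ip n (u p) x))\<^sup>2) \<le> nrm2 n x"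
  using orthon_residual(2)[OF assms, of x] nrm2_nonneg
    [of n "\<lambda>i. x i - (\<Sum>p<k. ip n (u p) x * u p i)"] by linarith

abbreviation (input) unit :: "nat \<Rightarrow> nat \<Rightarrow> complex" where
  "unit a \<equiv> (\<lambda>i. if i = a then 1 else 0)"

lemma ip_unit: "a < n \<Longrightarrow> ip n x (unit a) = cnj (x a)"
proof -
  assume "a < n"
  have "ip n x (unit a) = (\<Sum>i<n. if i = a then cnj (x i) else 0)"
    unfolding ip_def by (intro sum.cong) auto
  then show ?thesis using \<open>a < n\<close> by simp
qed

lemma nrm2_unit: "a < n \<Longrightarrow> nrm2 n (unit a) = 1"
proof -
  assume "a < n"
  have "nrm2 n (unit a) = (\<Sum>i<n. if i = a then 1 else 0)"
    unfolding nrm2_def by (intro sum.cong) auto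
  then show ?thesis using \<open>a < n\<close> by simp
qed

lemma orthon_nrm2: "orthon n k u \<Longrightarrow> p < k \<Longrightarrow> nrm2 n (u p) = 1"
  using ip_self[of n "u p"] unfolding orthon_def by (metis of_real_eq_1_iff)

lemma orthon_row_le:
  assumes "orthon n k u" "a < n"
  shows "(\<Sum>p<k. (cmod (u p a))\<^sup>2) \<le> 1"
  using bessel[OF assms(1), of "unit a"] assms(2) by (simp add: ip_unit nrm2_unit)

text \<open>Dimension theory is replaced by counting squared entries of the array of coordinates:
  each of the k vectors contributes 1, while Bessel for the unit vectors bounds each of the n rows
  by 1.\<close>

lemma orthon_total:
  assumes "orthon n k u"
  shows "(\<Sum>a<n. \<Sum>p<k. (cmod (u p a))\<^sup>2) = real k"
proof -
  have "(\<Sum>a<n. \<Sum>p<k. (cmod (u p a))\<^sup>2) = (\<Sum>p<k. nrm2 n (u p))"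
    unfolding nrm2_def by (rule sum.swap)
  then show ?thesis using orthon_nrm2[OF assms] by simp
qed

lemma orthon_card_le: "orthon n k u \<Longrightarrow> k \<le> n"
proof -
  assume *: "orthon n k u"
  have "real k \<le> (\<Sum>a<n. 1)"
    unfolding orthon_total[OF *, symmetric] using orthon_row_le[OF *] by (intro sum_mono) auto
  then show ?thesis by simp
qed

text \<open>If every row sum were at least 1, the total would be at least n instead of k. A unit
  vector with a smaller row sum has a nonzero residual, which is normalized.\<close>

lemma orthon_complement:
  assumes "orthon n k u" "k < n"
  obtains x where "nrm2 n x = 1" "\<And>p. p < k \<Longrightarrow> ip n (u p) x = 0"
proof -
  obtain a where a: "a < n" "(\<Sum>p<k. (cmod (u p a))\<^sup>2) < 1"
  proof (rule ccontr)
    assume "\<not> thesis"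
    then have "\<And>a. a < n \<Longrightarrow> (\<Sum>p<k. (cmod (u p a))\<^sup>2) \<ge> 1" using that by force
    then have "(\<Sum>a<n. 1) \<le> (\<Sum>a<n. \<Sum>p<k. (cmod (u p a))\<^sup>2)" by (intro sum_mono) auto
    then show False using orthon_total[OF assms(1)] assms(2) by simp
  qed
  define y where "y = (\<lambda>i. unit a i - (\<Sum>p<k. ip n (u p) (unit a) * u p i))"
  have y: "nrm2 n y > 0"
    using orthon_residual(2)[OF assms(1), of "unit a"] a by (simp add: y_def ip_unit nrm2_unit)
  have y0: "\<And>p. p < k \<Longrightarrow> ip n (u p) y = 0"
    unfolding y_def by (rule orthon_residual(1)[OF assms(1)])
  define x where "x = (\<lambda>i. of_real (1 / sqrt (nrm2 n y)) * y i)"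
  have "nrm2 n x = (1 / sqrt (nrm2 n y))\<^sup>2 * nrm2 n y"
    unfolding x_def nrm2_def sum_distrib_left norm_mult power_mult_distrib norm_of_real power2_abs by simp
  then have "nrm2 n x = 1" using y by (simp add: power_divide)
  moreover have "ip n (u p) x = 0" if "p < k" for p
    unfolding x_def ip_scale_right using y0[OF that] by simp
  ultimately show ?thesis using that by blast
qed

text \<open>With n vectors the total is n, so every row sum equals 1 and every unit vector has
  residual 0.\<close>

lemma parseval:
  assumes "orthon n n u"
  shows "nrm2 n x = (\<Sum>p<n. (cmod (ip n (u p) x))\<^sup>2)"
    and "i < n \<Longrightarrow> x i = (\<Sum>p<n. ip n (u p) x * u p i)"
proof -
  have row: "(\<Sum>p<n. (cmod (u p a))\<^sup>2) = 1" if "a < n" for a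
  proof (rule ccontr)
    assume "(\<Sum>p<n. (cmod (u p a))\<^sup>2) \<noteq> 1"
    then have "(\<Sum>p<n. (cmod (u p a))\<^sup>2) < 1" using orthon_row_le[OF assms that] by simp
    then have "(\<Sum>a<n. \<Sum>p<n. (cmod (u p a))\<^sup>2) < (\<Sum>a<n. 1)"
      using that orthon_row_le[OF assms] by (intro sum_strict_mono_ex1) auto
    then show False using orthon_total[OF assms] by simp
  qed
  have e: "(if i = a then 1 else 0) = (\<Sum>p<n. cnj (u p a) * u p i)" if "a < n" "i < n" for a i
  proof -
    have "nrm2 n (\<lambda>i. unit a i - (\<Sum>p<n. ip n (u p) (unit a) * u p i)) = 0"
      using orthon_residual(2)[OF assms, of "unit a"] row[OF that(1)] that by (simp add: ip_unit nrm2_unit)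
    then show ?thesis using that by (simp add: nrm2_eq_0 ip_unit)
  qed
  have exp: "x i = (\<Sum>p<n. ip n (u p) x * u p i)" if "i < n" for i
  proof -
    have "(\<Sum>p<n. ip n (u p) x * u p i) = (\<Sum>p<n. \<Sum>a<n. cnj (u p a) * u p i * x a)"
      by (simp add: ip_def sum_distrib_right sum_distrib_left mult_ac)
    also have "\<dots> = (\<Sum>a<n. (\<Sum>p<n. cnj (u p a) * u p i) * x a)"
      by (subst sum.swap) (simp add: sum_distrib_right)
    also have "\<dots> = (\<Sum>a<n. if a = i then x a else 0)"
      by (intro sum.cong refl) (use e that in force)
    finally show ?thesis using that by simp
  qed
  then show "i < n \<Longrightarrow> x i = (\<Sum>p<n. ip n (u p) x * u p i)" .
  have "nrm2 n (\<lambda>i. x i - (\<Sum>p<n. ip n (u p) x * u p i)) = 0"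
    unfolding nrm2_eq_0 using exp by force
  then show "nrm2 n x = (\<Sum>p<n. (cmod (ip n (u p) x))\<^sup>2)"
    using orthon_residual(2)[OF assms, of x] by simp
qed

text \<open>Coordinates are treated one after another: tuples are plain functions here, and only
  finitely many of their values matter.\<close>

lemma finite_convergent_subsequence:
  fixes f :: "nat \<Rightarrow> 'a \<Rightarrow> 'b::heine_borel"
  assumes "finite S" "\<And>s. s \<in> S \<Longrightarrow> bounded (range (\<lambda>k. f k s))"
  obtains r :: "nat \<Rightarrow> nat" and l where "strict_mono r" "\<And>s. s \<in> S \<Longrightarrow> (\<lambda>k. f (r k) s) \<longlonglongrightarrow> l s"
proof -
  have "\<exists>r l. strict_mono (r::nat\<Rightarrow>nat) \<and> (\<forall>s\<in>S. (\<lambda>k. f (r k) s) \<longlonglongrightarrow> l s)"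
    using assms
  proof (induction S rule: finite_induct)
    case empty
    then show ?case by (auto intro!: exI[of _ id] simp: strict_mono_def)
  next
    case (insert s S)
    then obtain r l where r: "strict_mono (r::nat\<Rightarrow>nat)" "\<forall>s\<in>S. (\<lambda>k. f (r k) s) \<longlonglongrightarrow> l s"
      by auto
    have "bounded (range (\<lambda>k. f k s))" using insert.prems by simp
    then have "bounded (range (\<lambda>k. f (r k) s))" by (rule bounded_subset) auto
    then obtain l0 r' where r': "strict_mono (r'::nat\<Rightarrow>nat)" "((\<lambda>k. f (r k) s) \<circ> r') \<longlonglongrightarrow> l0"
      using bounded_imp_convergent_subsequence by blast
    have "(\<lambda>k. f ((r \<circ> r') k) s') \<longlonglongrightarrow> (l(s := l0)) s'" if "s' \<in> insert s S" for s'
    proof (cases "s' = s")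
      case True then show ?thesis using r'(2) by (simp add: o_def)
    next
      case False
      then have "(\<lambda>k. f (r k) s') \<longlonglongrightarrow> l s'" using r that by auto
      from LIMSEQ_subseq_LIMSEQ[OF this r'(1)] show ?thesis using False by (simp add: o_def)
    qed
    moreover have "strict_mono (r \<circ> r')" using r r' by (simp add: strict_mono_o)
    ultimately show ?case by blast
  qed
  then show ?thesis using that by blast
qed

text \<open>Maximize the quadratic form over the unit vectors orthogonal to the given system. The
  residual \<open>M x - s x\<close> of a maximizer is again orthogonal to the system and, if it were
  nonzero, would be a direction of increase.\<close>

lemma hermitian_max_eigenvector:
  assumes M: "herm n M" and u: "orthon n k u" and k: "k < n"
    and ev: "\<And>p i. p < k \<Longrightarrow> i < n \<Longrightarrow> mv n M (u p) i = of_real (\<mu> p) * u p i"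
  obtains x \<nu> where "nrm2 n x = 1" "\<And>p. p < k \<Longrightarrow> ip n (u p) x = 0"
    "\<And>i. i < n \<Longrightarrow> mv n M x i = of_real \<nu> * x i"
proof -
  define Q where "Q = {x. nrm2 n x = 1 \<and> (\<forall>p<k. ip n (u p) x = 0)}"
  define q where "q x = Re (ip n x (mv n M x))" for x
  have bnd: "cmod (x i) \<le> 1" if "x \<in> Q" "i < n" for x i
    using cmod_le_nrm2[OF that(2), of x] that(1) unfolding Q_def
    by (simp add: abs_square_le_1)
  have "q x \<le> (\<Sum>i<n. \<Sum>j<n. cmod (M i j))" if "x \<in> Q" for x
  proof -
    have "q x \<le> cmod (ip n x (mv n M x))" unfolding q_def by (rule complex_Re_le_cmod)
    also have "\<dots> = cmod (\<Sum>i<n. \<Sum>j<n. cnj (x i) * (M i j * x j))"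
      by (simp add: ip_def mv_def sum_distrib_left)
    also have "\<dots> \<le> (\<Sum>i<n. \<Sum>j<n. cmod (cnj (x i) * (M i j * x j)))"
      by (intro sum_norm_le norm_sum)
    also have "\<dots> \<le> (\<Sum>i<n. \<Sum>j<n. cmod (M i j))"
    proof (intro sum_mono)
      fix i j assume "i \<in> {..<n}" "j \<in> {..<n}"
      then have "cmod (x i) * (cmod (M i j) * cmod (x j)) \<le> 1 * (cmod (M i j) * 1)"
        using bnd[OF that] by (intro mult_mono) auto
      then show "cmod (cnj (x i) * (M i j * x j)) \<le> cmod (M i j)" by (simp add: norm_mult)
    qed
    finally show ?thesis .
  qed
  then have bdd: "bdd_above (q ` Q)" by (auto intro!: bdd_aboveI)
  obtain x0 where "x0 \<in> Q" using orthon_complement[OF u k] unfolding Q_def by blast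
  then have ne: "q ` Q \<noteq> {}" by auto
  define s where "s = Sup (q ` Q)"
  have "\<exists>x\<in>Q. q x > s - 1 / real (Suc j)" for j
    using less_cSup_iff[OF ne bdd, of "s - 1 / real (Suc j)"] unfolding s_def by auto
  \<comment> \<open>A maximizing sequence; coordinatewise limits preserve the norm and the
    orthogonality relations.\<close>
  then obtain X where X: "\<And>j. X j \<in> Q" "\<And>j. q (X j) > s - 1 / real (Suc j)" by metis
  obtain r x where r: "strict_mono (r::nat\<Rightarrow>nat)" and x: "\<And>i. i \<in> {..<n} \<Longrightarrow> (\<lambda>j. X (r j) i) \<longlonglongrightarrow> x i"
  proof (rule finite_convergent_subsequence[of "{..<n}" X])
    show "bounded (range (\<lambda>k. X k s))" if "s \<in> {..<n}" for s
      using bnd[OF X(1)] that by (auto intro!: boundedI[of _ 1])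
  qed auto
  have x: "(\<lambda>j. X (r j) i) \<longlonglongrightarrow> x i" if "i < n" for i using x that by auto
  have lim_ip: "(\<lambda>j. ip n v (X (r j))) \<longlonglongrightarrow> ip n v x" for v
    unfolding ip_def by (intro tendsto_intros x) auto
  have "(\<lambda>j. nrm2 n (X (r j))) \<longlonglongrightarrow> nrm2 n x"
    unfolding nrm2_def by (intro tendsto_intros x) auto
  moreover have "(\<lambda>j. nrm2 n (X (r j))) = (\<lambda>j. 1)" using X unfolding Q_def by auto
  ultimately have x1: "nrm2 n x = 1" using LIMSEQ_const_iff by metis
  have x2: "ip n (u p) x = 0" if "p < k" for p
  proof -
    have "(\<lambda>j. ip n (u p) (X (r j))) = (\<lambda>j. 0)" using X that unfolding Q_def by auto
    then show ?thesis using lim_ip[of "u p"] LIMSEQ_const_iff by metis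
  qed
  have "(\<lambda>j. q (X (r j))) \<longlonglongrightarrow> q x"
    unfolding q_def ip_def mv_def by (intro tendsto_intros x) auto
  moreover have "(\<lambda>j. s - 1 / real (Suc (r j))) \<longlonglongrightarrow> s - 0"
    by (intro tendsto_intros LIMSEQ_subseq_LIMSEQ[OF lim_1_over_n[THEN LIMSEQ_Suc] r, unfolded o_def])
  ultimately have qx: "s \<le> q x" using X(2) by (intro LIMSEQ_le) (auto intro: less_imp_le)
  \<comment> \<open>By homogeneity the bound passes from the unit vectors to the whole orthogonal
    complement.\<close>
  have qle: "q y \<le> s * nrm2 n y" if y: "\<And>p. p < k \<Longrightarrow> ip n (u p) y = 0" for y
  proof (cases "nrm2 n y = 0")
    case True
    then have "q y = 0" unfolding q_def ip_def nrm2_eq_0 by simp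
    then show ?thesis using True by simp
  next
    case False
    then have pos: "nrm2 n y > 0" using nrm2_nonneg[of n y] by simp
    define c where "c = 1 / sqrt (nrm2 n y)"
    define w where "w = (\<lambda>i. of_real c * y i)"
    have c2: "c\<^sup>2 * nrm2 n y = 1" using pos by (simp add: c_def power_divide)
    have "nrm2 n w = c\<^sup>2 * nrm2 n y"
      unfolding w_def nrm2_def sum_distrib_left norm_mult power_mult_distrib norm_of_real power2_abs ..
    then have "w \<in> Q" using c2 y unfolding Q_def w_def by (simp add: ip_scale_right)
    then have "q w \<le> s" unfolding s_def by (intro cSup_upper bdd) auto
    moreover have "q w = c\<^sup>2 * q y"
      unfolding q_def w_def mv_scale ip_scale_right ip_scale_left by (simp add: power2_eq_square)
    ultimately have "c\<^sup>2 * q y * nrm2 n y \<le> s * nrm2 n y" using pos by (simp add: mult_right_mono)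
    then show ?thesis using c2 by (metis mult.assoc mult.commute mult_1)
  qed
  have qx: "q x = s" using qle[of x] x1 x2 qx by auto
  define z where "z = (\<lambda>i. mv n M x i - of_real s * x i)"
  have z2: "ip n (u p) z = 0" if "p < k" for p
  proof -
    have "ip n (u p) (mv n M x) = ip n (mv n M (u p)) x" by (simp add: herm_ip[OF M])
    also have "\<dots> = ip n (\<lambda>i. of_real (\<mu> p) * u p i) x" using ev[OF that] by (intro ip_cong) auto
    finally show ?thesis using x2[OF that] unfolding z_def by (simp add: ip_linear)
  qed
  have nz: "nrm2 n z = Re (ip n z (mv n M x)) - s * Re (ip n z x)"
  proof -
    have "complex_of_real (nrm2 n z) = ip n z (mv n M x) - of_real s * ip n z x"
      unfolding ip_self[symmetric] by (subst (2) z_def) (simp add: ip_linear)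
    then have "Re (complex_of_real (nrm2 n z)) = Re (ip n z (mv n M x) - of_real s * ip n z x)" by simp
    then show ?thesis by simp
  qed
  \<comment> \<open>Insert \<open>x + t z\<close> into \<open>qle\<close>: the terms of order 0
    cancel since \<open>q x = s\<close>, and the linear term is exactly
    \<open>2 t nrm2 z\<close>.\<close>
  have quad: "2 * t * nrm2 n z + t\<^sup>2 * (q z - s * nrm2 n z) \<le> 0" for t :: real
  proof -
    let ?y = "\<lambda>i. x i + of_real t * z i"
    have "q ?y \<le> s * nrm2 n ?y" using x2 z2 by (intro qle) (simp add: ip_linear)
    moreover have "q ?y = q x + 2 * t * Re (ip n z (mv n M x)) + t\<^sup>2 * q z"
    proof -
      have "Re (ip n x (mv n M z)) = Re (ip n z (mv n M x))"
        using herm_ip[OF M, of x z] cnj_ip[of n z "mv n M x"] by (metis cnj.simps(1))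
      then show ?thesis
        unfolding q_def mv_add mv_scale ip_linear by (simp add: power2_eq_square algebra_simps)
    qed
    moreover have "nrm2 n ?y = nrm2 n x + 2 * t * Re (ip n z x) + t\<^sup>2 * nrm2 n z"
    proof -
      have "Re (ip n x z) = Re (ip n z x)" using cnj_ip[of n z x] by (metis cnj.simps(1))
      moreover have "nrm2 n ?y = Re (ip n ?y ?y)" by (simp add: ip_self)
      moreover have "nrm2 n x = Re (ip n x x)" "nrm2 n z = Re (ip n z z)" by (simp_all add: ip_self)
      ultimately show ?thesis unfolding ip_linear by (simp add: power2_eq_square algebra_simps)
    qed
    ultimately have *: "q x + 2 * t * Re (ip n z (mv n M x)) + t\<^sup>2 * q z
        \<le> s * (nrm2 n x + 2 * t * Re (ip n z x) + t\<^sup>2 * nrm2 n z)" by metis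
    have R: "Re (ip n z (mv n M x)) = nrm2 n z + s * Re (ip n z x)" using nz by simp
    show ?thesis using * unfolding R qx x1 by (simp add: algebra_simps)
  qed
  have "nrm2 n z = 0"
  proof (rule ccontr)
    assume "nrm2 n z \<noteq> 0"
    then have pos: "nrm2 n z > 0" using nrm2_nonneg[of n z] by simp
    \<comment> \<open>With this B and t the quadratic term is at most half of the linear one; the
      summand 1 keeps B positive.\<close>
    define B where "B = \<bar>q z - s * nrm2 n z\<bar> + 1"
    define t where "t = nrm2 n z / B"
    have B: "B > 0" unfolding B_def by simp
    have t: "t > 0" using pos B by (simp add: t_def)
    have "t\<^sup>2 * - B \<le> t\<^sup>2 * (q z - s * nrm2 n z)" unfolding B_def by (intro mult_left_mono) auto
    then have "2 * t * nrm2 n z - t\<^sup>2 * B \<le> 0" using quad[of t] by simp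
    moreover have "t\<^sup>2 * B = t * nrm2 n z" using B by (simp add: t_def power2_eq_square)
    ultimately have "t * nrm2 n z \<le> 0" by simp
    then show False using t pos by (simp add: mult_le_0_iff)
  qed
  then have "mv n M x i = of_real s * x i" if "i < n" for i
    using that unfolding nrm2_eq_0 z_def by simp
  then show ?thesis using that x1 x2 by blast
qed

theorem hermitian_spectral:
  assumes M: "herm n M"
  obtains u \<mu> where "orthon n n u" "\<And>p i. p < n \<Longrightarrow> i < n \<Longrightarrow> mv n M (u p) i = of_real (\<mu> p) * u p i"
proof -
  have "\<exists>u \<mu>. orthon n k u \<and> (\<forall>p<k. \<forall>i<n. mv n M (u p) i = of_real (\<mu> p) * u p i)" if "k \<le> n" for k
    using that
  proof (induction k)
    case 0
    then show ?case by (simp add: orthon_def)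
  next
    case (Suc k)
    then obtain u \<mu> where u: "orthon n k u"
      "\<And>p i. p < k \<Longrightarrow> i < n \<Longrightarrow> mv n M (u p) i = of_real (\<mu> p) * u p i" by auto
    obtain x \<nu> where x: "nrm2 n x = 1" "\<And>p. p < k \<Longrightarrow> ip n (u p) x = 0"
      "\<And>i. i < n \<Longrightarrow> mv n M x i = of_real \<nu> * x i"
      using hermitian_max_eigenvector[OF M u(1) _ u(2)] Suc.prems by (metis Suc_le_lessD)
    have "ip n x (u p) = 0" if "p < k" for p using x(2)[OF that] cnj_ip[of n "u p" x] by simp
    then have "orthon n (Suc k) (u(k := x))"
      using u(1) x(1,2) unfolding orthon_def by (auto simp: less_Suc_eq ip_self)
    moreover have "\<forall>p<Suc k. \<forall>i<n. mv n M ((u(k := x)) p) i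
        = of_real ((\<mu>(k := \<nu>)) p) * (u(k := x)) p i"
      using u(2) x(3) by (auto simp: less_Suc_eq)
    ultimately show ?case by blast
  qed
  from this[of n] show ?thesis using that by blast
qed

section \<open>Singular values and the Ky Fan variational principle\<close>

abbreviation (input) mf :: "complex mat \<Rightarrow> nat \<Rightarrow> nat \<Rightarrow> complex" where
  "mf A \<equiv> (\<lambda>i j. A $$ (i, j))"

lemma gram_entry:
  assumes "A \<in> carrier_mat m n" "i < n" "j < n"
  shows "(mat_adjoint A * A) $$ (i, j) = (\<Sum>a<m. cnj (A $$ (a, i)) * A $$ (a, j))"
  using assms by (auto simp: mat_adjoint_def scalar_prod_def lessThan_atLeast0 mat_of_rows_def intro!: sum.cong)

lemma gram_carrier: "A \<in> carrier_mat m n \<Longrightarrow> mat_adjoint A * A \<in> carrier_mat n n"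
  by (auto simp: mat_adjoint_def)

lemma gram_ip:
  assumes A: "A \<in> carrier_mat m n"
  shows "ip m (mv n (mf A) x) (mv n (mf A) y) = ip n x (mv n (mf (mat_adjoint A * A)) y)"
proof -
  have "ip n x (mv n (mf (mat_adjoint A * A)) y)
      = (\<Sum>i<n. \<Sum>j<n. \<Sum>a<m. cnj (x i) * (cnj (A $$ (a, i)) * A $$ (a, j) * y j))"
    unfolding ip_def mv_def using gram_entry[OF A]
    by (simp add: sum_distrib_left sum_distrib_right)
  also have "\<dots> = (\<Sum>i<n. \<Sum>a<m. \<Sum>j<n. cnj (x i) * (cnj (A $$ (a, i)) * A $$ (a, j) * y j))"
    by (rule sum.cong[OF refl]) (rule sum.swap)
  also have "\<dots> = (\<Sum>a<m. \<Sum>i<n. \<Sum>j<n. cnj (x i) * (cnj (A $$ (a, i)) * A $$ (a, j) * y j))"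
    by (rule sum.swap)
  also have "\<dots> = ip m (mv n (mf A) x) (mv n (mf A) y)"
    unfolding ip_def mv_def cnj_sum sum_product by (simp add: mult_ac)
  finally show ?thesis ..
qed

text \<open>The matrix U of eigenvectors is unitary: orthonormality gives \<open>V U = 1\<close>,
  hence \<open>U V = 1\<close>, and \<open>G = U D V\<close> is similar to a diagonal
  matrix.\<close>

lemma char_poly_orthonormal_eigenbasis:
  assumes G: "G \<in> carrier_mat n n" and u: "orthon n n u"
    and ev: "\<And>p i. p < n \<Longrightarrow> i < n \<Longrightarrow> mv n (mf G) (u p) i = c p * u p i"
  shows "char_poly G = (\<Prod>p\<leftarrow>[0..<n]. [:- c p, 1:])"
proof -
  define U where "U = mat n n (\<lambda>(i, p). u p i)"
  define V where "V = mat n n (\<lambda>(p, i). cnj (u p i))"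
  define D where "D = mat n n (\<lambda>(p, q). if p = q then c p else 0)"
  have car: "U \<in> carrier_mat n n" "V \<in> carrier_mat n n" "D \<in> carrier_mat n n"
    by (auto simp: U_def V_def D_def)
  have VU: "V * U = 1\<^sub>m n"
  proof (rule eq_matI)
    fix p q assume "p < dim_row (1\<^sub>m n :: complex mat)" "q < dim_col (1\<^sub>m n :: complex mat)"
    then show "(V * U) $$ (p, q) = 1\<^sub>m n $$ (p, q)"
      using u unfolding orthon_def ip_def
      by (simp add: U_def V_def scalar_prod_def lessThan_atLeast0)
  qed (simp_all add: U_def V_def)
  have UV: "U * V = 1\<^sub>m n" by (rule mat_mult_left_right_inverse[OF car(2,1) VU])
  have "G * U = U * D"
  proof (rule eq_matI)
    fix i p assume "i < dim_row (U * D)" "p < dim_col (U * D)"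
    then have ip: "i < n" "p < n" by (auto simp: U_def D_def)
    have "(G * U) $$ (i, p) = mv n (mf G) (u p) i"
      using G ip by (simp add: mv_def U_def scalar_prod_def lessThan_atLeast0)
    also have "\<dots> = (\<Sum>q<n. if q = p then c p * u p i else 0)" using ev ip by simp
    also have "\<dots> = (\<Sum>q<n. u q i * (if q = p then c q else 0))"
      by (intro sum.cong) auto
    also have "\<dots> = (U * D) $$ (i, p)"
      using ip by (simp add: U_def D_def scalar_prod_def lessThan_atLeast0)
    finally show "(G * U) $$ (i, p) = (U * D) $$ (i, p)" .
  qed (use G in \<open>auto simp: U_def D_def\<close>)
  then have "G = U * D * V"
    using UV G car by (metis assoc_mult_mat right_mult_one_mat)
  then have "similar_mat G D"
    using car G UV VU by (intro similar_matI[of _ _ U V n]) auto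
  then have "char_poly G = char_poly D" by (rule char_poly_similar)
  also have "\<dots> = (\<Prod>a\<leftarrow>diag_mat D. [:- a, 1:])"
    by (rule char_poly_upper_triangular[OF car(3)]) (auto simp: upper_triangular_def D_def)
  also have "diag_mat D = map c [0..<n]"
    by (auto simp: diag_mat_def D_def)
  finally show ?thesis by (simp add: o_def)
qed

text \<open>The eigenvalues may come in any order, because the C1 eigenvalues constructed later are
  not sorted.\<close>

lemma mset_singular_values:
  assumes A: "A \<in> carrier_mat m n" and u: "orthon n n u"
    and ev: "\<And>p i. p < n \<Longrightarrow> i < n \<Longrightarrow> mv n (mf (mat_adjoint A * A)) (u p) i = of_real (\<mu> p) * u p i"
  shows "mset (singular_values A) = mset (map (\<lambda>p. sqrt (\<mu> p)) [0..<n])"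
proof -
  have cp: "char_poly (mat_adjoint A * A) = (\<Prod>p\<leftarrow>[0..<n]. [:- of_real (\<mu> p), 1:])"
    by (rule char_poly_orthonormal_eigenbasis[OF gram_carrier[OF A] u ev])
  have "proots (\<Prod>p\<leftarrow>xs. [:- complex_of_real (\<mu> p), 1:]) = mset (map (\<lambda>p. of_real (\<mu> p)) xs)" for xs
  proof (induction xs)
    case (Cons a xs)
    have "(\<Prod>p\<leftarrow>xs. [:- complex_of_real (\<mu> p), 1:]) \<noteq> 0"
      by (auto simp: prod_list_zero_iff)
    then show ?case using Cons by (simp add: proots_mult del: mult_pCons_left)
  qed simp
  then have "proots (char_poly (mat_adjoint A * A)) = mset (map (\<lambda>p. of_real (\<mu> p)) [0..<n])" unfolding cp .
  then show ?thesis
    unfolding singular_values_def by (simp add: multiset.map_comp o_def)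
qed

text \<open>Right singular vectors in the order of decreasing singular values, obtained by permuting
  an arbitrary eigenbasis of the Gram matrix. Their images under A are orthogonal with the singular
  values as lengths.\<close>

lemma singular_values_basis:
  assumes A: "A \<in> carrier_mat m n"
  obtains u where "orthon n n u"
    "\<And>p q. p < n \<Longrightarrow> q < n \<Longrightarrow> ip m (mv n (mf A) (u p)) (mv n (mf A) (u q))
       = (if p = q then of_real ((singular_values A ! p)\<^sup>2) else 0)"
    "\<And>p i. p < n \<Longrightarrow> i < n \<Longrightarrow> mv n (mf (mat_adjoint A * A)) (u p) i
       = of_real ((singular_values A ! p)\<^sup>2) * u p i"
    "char_poly (mat_adjoint A * A) = (\<Prod>p\<leftarrow>[0..<n]. [:- of_real ((singular_values A ! p)\<^sup>2), 1:])"
    "length (singular_values A) = n" "\<And>p. p < n \<Longrightarrow> 0 \<le> singular_values A ! p"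
    "\<And>p q. p \<le> q \<Longrightarrow> q < n \<Longrightarrow> singular_values A ! q \<le> singular_values A ! p"
proof -
  define G where "G = mat_adjoint A * A"
  have "herm n (mf G)"
    unfolding herm_def G_def using gram_entry[OF A] by (simp add: mult.commute)
  then obtain u \<mu> where u: "orthon n n u"
    and ev: "\<And>p i. p < n \<Longrightarrow> i < n \<Longrightarrow> mv n (mf G) (u p) i = of_real (\<mu> p) * u p i"
    using hermitian_spectral by metis
  have ipA: "ip m (mv n (mf A) (u p)) (mv n (mf A) (u q)) = (if p = q then of_real (\<mu> p) else 0)"
    if "p < n" "q < n" for p q
  proof -
    have "ip m (mv n (mf A) (u p)) (mv n (mf A) (u q)) = ip n (u p) (\<lambda>i. of_real (\<mu> q) * u q i)"
      unfolding gram_ip[OF A] using ev[OF that(2)] unfolding G_def by (intro ip_cong) auto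
    then show ?thesis using u that unfolding orthon_def ip_scale_right by auto
  qed
  have \<mu>: "0 \<le> \<mu> p" if "p < n" for p
  proof -
    have "complex_of_real (\<mu> p) = of_real (nrm2 m (mv n (mf A) (u p)))"
      using ipA[OF that that] by (simp add: ip_self)
    then show ?thesis using nrm2_nonneg by (metis of_real_eq_iff)
  qed
  have ms: "mset (singular_values A) = mset (map (\<lambda>p. sqrt (\<mu> p)) [0..<n])"
    by (rule mset_singular_values[OF A u ev[unfolded G_def]])
  then obtain f where f: "f permutes {..<n}"
    and fs: "permute_list f (map (\<lambda>p. sqrt (\<mu> p)) [0..<n]) = singular_values A"
    by (rule mset_eq_permutation) auto
  have len: "length (singular_values A) = n"
    using arg_cong[OF ms, of size] by simp
  have fn: "f p < n" if "p < n" for p using permutes_in_image[OF f, of p] that by simp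
  have sv: "singular_values A ! p = sqrt (\<mu> (f p))" if "p < n" for p
    unfolding fs[symmetric] using that fn by (subst permute_list_nth) (auto simp: f)
  have sv2: "(singular_values A ! p)\<^sup>2 = \<mu> (f p)" if "p < n" for p
    using sv \<mu> fn that by simp
  have inj: "f p = f q \<longleftrightarrow> p = q" for p q
    using permutes_inj[OF f] by (auto dest: injD)
  have 1: "orthon n n (\<lambda>p. u (f p))"
    using u fn inj unfolding orthon_def by auto
  have 2: "ip m (mv n (mf A) (u (f p))) (mv n (mf A) (u (f q)))
       = (if p = q then of_real ((singular_values A ! p)\<^sup>2) else 0)" if "p < n" "q < n" for p q
    using ipA[OF fn fn] sv2 inj that by auto
  have 3: "mv n (mf (mat_adjoint A * A)) (u (f p)) i
       = of_real ((singular_values A ! p)\<^sup>2) * u (f p) i" if "p < n" "i < n" for p i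
    using ev[OF fn that(2)] sv2 that unfolding G_def by auto
  have "sorted_wrt (\<ge>) (singular_values A)"
    unfolding singular_values_def sorted_wrt_rev by simp
  then have 6: "singular_values A ! q \<le> singular_values A ! p" if "p \<le> q" "q < n" for p q
    using that len unfolding sorted_wrt_iff_nth_less by (cases "p = q") auto
  have 5: "0 \<le> singular_values A ! p" if "p < n" for p using sv \<mu> fn that by simp
  have 4: "char_poly (mat_adjoint A * A) = (\<Prod>p\<leftarrow>[0..<n]. [:- of_real ((singular_values A ! p)\<^sup>2), 1:])"
    by (rule char_poly_orthonormal_eigenbasis[OF gram_carrier[OF A] 1 3])
  show ?thesis by (rule that[of "\<lambda>p. u (f p)"]) (fact 1 2 3 4 5 6 len)+
qed

text \<open>A bathtub argument: in the difference of the two sides, replacing \<open>s p\<close> by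
  the threshold \<open>\<tau> = s (k - 1)\<close> only increases the value, since
  \<open>s p - \<tau>\<close> and \<open>c p - [p < k]\<close> have opposite signs. For k = 0 there
  is no such threshold.\<close>

lemma decreasing_weights_sum_le:
  fixes s c :: "nat \<Rightarrow> real"
  assumes s: "\<And>p q. p \<le> q \<Longrightarrow> q < n \<Longrightarrow> s q \<le> s p" "\<And>p. p < n \<Longrightarrow> 0 \<le> s p"
    and c: "\<And>p. p < n \<Longrightarrow> 0 \<le> c p" "\<And>p. p < n \<Longrightarrow> c p \<le> 1" "(\<Sum>p<n. c p) \<le> real k" and k: "k \<le> n"
  shows "(\<Sum>p<n. s p * c p) \<le> (\<Sum>p<k. s p)"
proof (cases "k = 0")
  case True
  then have "(\<Sum>p<n. c p) = 0" using c(1,3) by (intro antisym) (auto intro: sum_nonneg)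
  then have "\<forall>p<n. c p = 0" using c(1) by (subst (asm) sum_nonneg_eq_0_iff) auto
  then show ?thesis using True by simp
next
  case False
  define \<tau> where "\<tau> = s (k - 1)"
  have "(\<Sum>p<n. s p * c p) - (\<Sum>p<k. s p) = (\<Sum>p<n. s p * (c p - (if p < k then 1 else 0)))"
  proof -
    have "(\<Sum>p<k. s p) = (\<Sum>p<n. if p < k then s p else 0)"
      using k by (simp add: sum.If_cases) (metis Int_absorb1 Collect_conj_eq lessThan_def lessThan_subset_iff)
    then show ?thesis by (simp add: sum_subtractf[symmetric] algebra_simps if_distrib cong: if_cong)
  qed
  also have "\<dots> \<le> (\<Sum>p<n. \<tau> * (c p - (if p < k then 1 else 0)))"
  proof (rule sum_mono)
    fix p assume "p \<in> {..<n}"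
    then show "s p * (c p - (if p < k then 1 else 0)) \<le> \<tau> * (c p - (if p < k then 1 else 0))"
      using s(1)[of p "k - 1"] s(1)[of "k - 1" p] c(1,2)[of p] False k
      by (auto simp: \<tau>_def intro: mult_right_mono mult_right_mono_neg)
  qed
  also have "\<dots> = \<tau> * ((\<Sum>p<n. c p) - real k)"
  proof -
    have "(\<Sum>p<n. if p < k then 1 else 0) = real k"
      using k by (simp add: sum.If_cases) (metis Int_absorb1 Collect_conj_eq lessThan_def lessThan_subset_iff card_lessThan)
    then show ?thesis by (simp add: sum_distrib_left[symmetric] sum_subtractf)
  qed
  also have "\<dots> \<le> 0" using s(2)[of "k - 1"] c(3) k False by (simp add: \<tau>_def mult_nonneg_nonpos)
  finally show ?thesis by simp
qed

text \<open>With \<open>A u\<^sub>j = s\<^sub>j v\<^sub>j\<close>, the left-hand side is a combination of the \<open>s\<^sub>j\<close> whose weights lie in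
  \<open>[0,1]\<close> and sum up to at most \<open>k\<close>, by Bessel's inequality in both spaces.\<close>

lemma ky_fan_le:
  assumes A: "A \<in> carrier_mat m n" and x: "orthon n k x" and y: "orthon m k y"
  shows "Re (\<Sum>p<k. ip m (y p) (mv n (mf A) (x p))) \<le> (\<Sum>p<k. singular_values A ! p)"
proof -
  obtain u where u: "orthon n n u"
    and Au: "\<And>p q. p < n \<Longrightarrow> q < n \<Longrightarrow> ip m (mv n (mf A) (u p)) (mv n (mf A) (u q))
       = (if p = q then of_real ((singular_values A ! p)\<^sup>2) else 0)"
    and s0: "\<And>p. p < n \<Longrightarrow> 0 \<le> singular_values A ! p"
    and smono: "\<And>p q. p \<le> q \<Longrightarrow> q < n \<Longrightarrow> singular_values A ! q \<le> singular_values A ! p"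
    using singular_values_basis[OF A] by metis
  define s where "s p = singular_values A ! p" for p
  define r where "r = card {p. p < n \<and> 0 < s p}"
  \<comment> \<open>Since the singular values decrease, the positive ones form an initial segment,
    and r counts them.\<close>
  have rpos: "{p. p < n \<and> 0 < s p} = {..<r}"
  proof -
    have "{p. p < n \<and> 0 < s p} = {..<card {p. p < n \<and> 0 < s p}}"
    proof (cases "\<exists>p<n. \<not> 0 < s p")
      case True
      define q where "q = (LEAST p. p < n \<and> \<not> 0 < s p)"
      have q: "q < n" "\<not> 0 < s q" using LeastI_ex[OF True] unfolding q_def by auto
      have "0 < s p" if "p < q" for p
        using not_less_Least[of p "\<lambda>p. p < n \<and> \<not> 0 < s p"] that q unfolding q_def[symmetric] by auto
      moreover have "\<not> 0 < s p" if "q \<le> p" "p < n" for p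
        using smono[OF that] q unfolding s_def by auto
      ultimately have "{p. p < n \<and> 0 < s p} = {..<q}" using q by (auto simp: not_less[symmetric])
      then show ?thesis by simp
    next
      case False
      then have "{p. p < n \<and> 0 < s p} = {..<n}" by auto
      then show ?thesis by simp
    qed
    then show ?thesis unfolding r_def .
  qed
  have rp: "p < r \<longleftrightarrow> p < n \<and> 0 < s p" for p
    using rpos by (metis (no_types, lifting) lessThan_iff mem_Collect_eq)
  have rn: "r \<le> n" using rp[of n] by simp
  define v where "v p i = mv n (mf A) (u p) i / of_real (s p)" for p i
  have v: "orthon m r v"
    unfolding orthon_def
  proof (intro allI impI)
    fix p q assume pq: "p < r" "q < r"
    then have pn: "p < n" "0 < s p" "q < n" "0 < s q" using rp by auto
    have "ip m (v p) (v q) = ip m (mv n (mf A) (u p)) (mv n (mf A) (u q)) / (of_real (s p) * of_real (s q))"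
      unfolding v_def ip_def by (simp add: sum_divide_distrib)
    then show "ip m (v p) (v q) = (if p = q then 1 else 0)"
      using Au[OF pn(1,3)] pn unfolding s_def by (simp add: power2_eq_square)
  qed
  have Auv: "mv n (mf A) (u p) i = of_real (s p) * v p i" if "p < r" for p i
    using that unfolding rp v_def by simp
  have Au0: "mv n (mf A) (u p) i = 0" if "p < n" "\<not> p < r" "i < m" for p i
  proof -
    have "s p = 0" using that(1,2) s0[OF that(1)] unfolding rp s_def by simp
    then have "nrm2 m (mv n (mf A) (u p)) = 0"
      using Au[OF that(1) that(1)] unfolding s_def ip_self by simp
    then show ?thesis using that(3) by (simp add: nrm2_eq_0)
  qed
  have kn: "k \<le> n" using orthon_card_le[OF x] .
  define a where "a j p = ip n (u j) (x p)" for j p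
  define b where "b j p = ip m (y p) (v j)" for j p
  \<comment> \<open>The weight of \<open>s j\<close> once \<open>Re (a b)\<close> is bounded by the
    mean of the squared moduli. It is set to 0 from r on, where the singular values vanish.\<close>
  define c where "c j = (if j < r then (\<Sum>p<k. ((cmod (a j p))\<^sup>2 + (cmod (b j p))\<^sup>2) / 2) else 0)" for j
  have ip_eq: "ip m (y p) (mv n (mf A) (x p)) = (\<Sum>j<r. of_real (s j) * (a j p * b j p))" for p
  proof -
    have "mv n (mf A) (x p) = mv n (mf A) (\<lambda>i. \<Sum>j<n. a j p * u j i)"
      unfolding a_def by (rule mv_cong) (rule parseval(2)[OF u])
    then have "ip m (y p) (mv n (mf A) (x p)) = (\<Sum>j<n. a j p * ip m (y p) (mv n (mf A) (u j)))"
      by (simp add: mv_sum mv_scale ip_linear)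
    also have "\<dots> = (\<Sum>j<n. if j < r then of_real (s j) * (a j p * b j p) else 0)"
    proof (intro sum.cong refl)
      fix j assume "j \<in> {..<n}"
      then show "a j p * ip m (y p) (mv n (mf A) (u j)) = (if j < r then of_real (s j) * (a j p * b j p) else 0)"
        using Auv[of j] Au0[of j] by (auto simp: b_def ip_def sum_distrib_left mult_ac)
    qed
    also have "\<dots> = (\<Sum>j<r. of_real (s j) * (a j p * b j p))"
      using rn by (intro sum.mono_neutral_cong_right) auto
    finally show ?thesis .
  qed
  have "Re (\<Sum>p<k. ip m (y p) (mv n (mf A) (x p))) = (\<Sum>p<k. \<Sum>j<r. s j * Re (a j p * b j p))"
    unfolding ip_eq by (simp add: sum_distrib_left)
  also have "\<dots> = (\<Sum>j<r. s j * (\<Sum>p<k. Re (a j p * b j p)))"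
    by (subst sum.swap) (simp add: sum_distrib_left)
  also have "\<dots> \<le> (\<Sum>j<r. s j * c j)"
  proof (rule sum_mono)
    fix j assume j: "j \<in> {..<r}"
    have "Re (a j p * b j p) \<le> ((cmod (a j p))\<^sup>2 + (cmod (b j p))\<^sup>2) / 2" for p
    proof -
      have "Re (a j p * b j p) \<le> cmod (a j p) * cmod (b j p)"
        using complex_Re_le_cmod[of "a j p * b j p"] by (simp add: norm_mult)
      also have "\<dots> \<le> ((cmod (a j p))\<^sup>2 + (cmod (b j p))\<^sup>2) / 2"
        using sum_squares_bound[of "cmod (a j p)" "cmod (b j p)"] by simp
      finally show ?thesis .
    qed
    then have "(\<Sum>p<k. Re (a j p * b j p)) \<le> c j" using j unfolding c_def by (auto intro!: sum_mono)
    moreover have "0 \<le> s j" using j rp by (simp add: less_imp_le)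
    ultimately show "s j * (\<Sum>p<k. Re (a j p * b j p)) \<le> s j * c j" by (rule mult_left_mono)
  qed
  also have "\<dots> = (\<Sum>j<n. s j * c j)"
    using rn by (intro sum.mono_neutral_left) (auto simp: c_def)
  also have "\<dots> \<le> (\<Sum>p<k. s p)"
  proof (rule decreasing_weights_sum_le[OF _ _ _ _ _ kn])
    fix j assume j: "j < n"
    show "0 \<le> c j" by (simp add: c_def sum_nonneg)
    have "(\<Sum>p<k. (cmod (a j p))\<^sup>2) \<le> 1"
      using bessel[OF x, of "u j"] orthon_nrm2[OF u j] unfolding a_def
      by (metis (no_types, lifting) cnj_ip complex_mod_cnj sum.cong)
    moreover have "(\<Sum>p<k. (cmod (b j p))\<^sup>2) \<le> 1" if "j < r"
      using bessel[OF y, of "v j"] orthon_nrm2[OF v that] unfolding b_def by simp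
    ultimately show "c j \<le> 1"
      by (cases "j < r") (simp_all add: c_def add_divide_distrib sum.distrib sum_divide_distrib[symmetric])
  next
    have "(\<Sum>j<n. \<Sum>p<k. (cmod (a j p))\<^sup>2) = real k"
      unfolding a_def using parseval(1)[OF u] orthon_nrm2[OF x]
      by (subst sum.swap) simp
    moreover have "(\<Sum>j<r. \<Sum>p<k. (cmod (a j p))\<^sup>2) \<le> (\<Sum>j<n. \<Sum>p<k. (cmod (a j p))\<^sup>2)"
      using rn by (intro sum_mono2) (auto intro: sum_nonneg)
    moreover have "(\<Sum>j<r. \<Sum>p<k. (cmod (b j p))\<^sup>2) \<le> real k"
    proof -
      have "(\<Sum>j<r. (cmod (b j p))\<^sup>2) \<le> 1" if "p < k" for p
        using bessel[OF v, of "y p"] orthon_nrm2[OF y that] unfolding b_def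
        by (metis (no_types, lifting) cnj_ip complex_mod_cnj sum.cong)
      then have "(\<Sum>p<k. \<Sum>j<r. (cmod (b j p))\<^sup>2) \<le> (\<Sum>p<k. 1)" by (intro sum_mono) auto
      then show ?thesis by (subst sum.swap) simp
    qed
    moreover have "(\<Sum>j<n. c j) = (\<Sum>j<r. c j)"
      using rn by (intro sum.mono_neutral_right) (auto simp: c_def)
    ultimately show "(\<Sum>j<n. c j) \<le> real k"
      by (simp add: c_def add_divide_distrib sum.distrib sum_divide_distrib[symmetric])
  qed (use smono s0 in \<open>auto simp: s_def\<close>)
  finally show ?thesis unfolding s_def .
qed

text \<open>The left singular vectors are the normalized images \<open>A u_p / s_p\<close>;
  positivity of the first k values permits the division.\<close>

lemma positive_singular_vectors:
  assumes A: "A \<in> carrier_mat m n" and k: "k \<le> n" "\<And>p. p < k \<Longrightarrow> 0 < singular_values A ! p"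
  obtains u v where "orthon n k u" "orthon m k v"
    "\<And>p i. p < k \<Longrightarrow> i < m \<Longrightarrow> mv n (mf A) (u p) i = of_real (singular_values A ! p) * v p i"
proof -
  obtain u where u: "orthon n n u"
    and Au: "\<And>p q. p < n \<Longrightarrow> q < n \<Longrightarrow> ip m (mv n (mf A) (u p)) (mv n (mf A) (u q))
       = (if p = q then of_real ((singular_values A ! p)\<^sup>2) else 0)"
    using singular_values_basis[OF A] by metis
  define v where "v p i = mv n (mf A) (u p) i / of_real (singular_values A ! p)" for p i
  have "orthon m k v"
    unfolding orthon_def
  proof (intro allI impI)
    fix p q assume "p < k" "q < k"
    then have pn: "p < n" "0 < singular_values A ! p" "q < n" "0 < singular_values A ! q" using k by auto
    have "ip m (v p) (v q) = ip m (mv n (mf A) (u p)) (mv n (mf A) (u q))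
        / (of_real (singular_values A ! p) * of_real (singular_values A ! q))"
      unfolding v_def ip_def by (simp add: sum_divide_distrib)
    then show "ip m (v p) (v q) = (if p = q then 1 else 0)"
      using Au[OF pn(1,3)] pn by (simp add: power2_eq_square)
  qed
  then show ?thesis using that[of u v] orthon_mono[OF u k(1)] k(2)
    by (auto simp: v_def order_less_imp_not_eq2)
qed

text \<open>The functional sends B to the sum of the products \<open>(v_p, B u_p)\<close> formed
  with singular vectors of A. It is a subgradient at A of the sum of the k largest singular values.
  Its coefficients are sums of k products of entries of unit vectors.\<close>

lemma ky_fan_functional:
  assumes A: "A \<in> carrier_mat m n" and k: "k \<le> n" "\<And>p. p < k \<Longrightarrow> 0 < singular_values A ! p"
  obtains c :: "nat \<Rightarrow> nat \<Rightarrow> complex" where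
    "\<And>i j. i < m \<Longrightarrow> j < n \<Longrightarrow> cmod (c i j) \<le> real k"
    "(\<Sum>p<k. singular_values A ! p) = Re (\<Sum>i<m. \<Sum>j<n. c i j * A $$ (i, j))"
    "\<And>B. B \<in> carrier_mat m n \<Longrightarrow> Re (\<Sum>i<m. \<Sum>j<n. c i j * B $$ (i, j)) \<le> (\<Sum>p<k. singular_values B ! p)"
proof -
  obtain u v where u: "orthon n k u" and v: "orthon m k v"
    and Au: "\<And>p i. p < k \<Longrightarrow> i < m \<Longrightarrow> mv n (mf A) (u p) i = of_real (singular_values A ! p) * v p i"
    using positive_singular_vectors[OF assms] by blast
  define c where "c i j = (\<Sum>p<k. cnj (v p i) * u p j)" for i j
  have c: "(\<Sum>i<m. \<Sum>j<n. c i j * M i j) = (\<Sum>p<k. ip m (v p) (mv n M (u p)))" for M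
  proof -
    have "(\<Sum>p<k. ip m (v p) (mv n M (u p))) = (\<Sum>p<k. \<Sum>i<m. \<Sum>j<n. cnj (v p i) * u p j * M i j)"
      by (simp add: ip_def mv_def sum_distrib_left mult_ac)
    also have "\<dots> = (\<Sum>i<m. \<Sum>p<k. \<Sum>j<n. cnj (v p i) * u p j * M i j)" by (rule sum.swap)
    also have "\<dots> = (\<Sum>i<m. \<Sum>j<n. \<Sum>p<k. cnj (v p i) * u p j * M i j)"
      by (rule sum.cong[OF refl]) (rule sum.swap)
    finally show ?thesis by (simp add: c_def sum_distrib_right)
  qed
  have le1: "cmod (w p i) \<le> 1" if "orthon d k w" "p < k" "i < d" for w :: "nat \<Rightarrow> nat \<Rightarrow> complex" and d p i
    using cmod_le_nrm2[OF that(3), of "w p"] orthon_nrm2[OF that(1,2)] by (simp add: abs_square_le_1)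
  have "cmod (c i j) \<le> real k" if "i < m" "j < n" for i j
  proof -
    have "cmod (c i j) \<le> (\<Sum>p<k. 1)"
      unfolding c_def
    proof (rule sum_norm_le)
      fix p assume "p \<in> {..<k}"
      then have "cmod (v p i) * cmod (u p j) \<le> 1 * 1"
        using le1[OF v _ that(1)] le1[OF u _ that(2)] by (intro mult_mono) auto
      then show "cmod (cnj (v p i) * u p j) \<le> 1" by (simp add: norm_mult)
    qed
    then show ?thesis by simp
  qed
  moreover have "(\<Sum>p<k. singular_values A ! p) = Re (\<Sum>i<m. \<Sum>j<n. c i j * A $$ (i, j))"
  proof -
    have "ip m (v p) (mv n (mf A) (u p)) = of_real (singular_values A ! p)" if "p < k" for p
    proof -
      have "ip m (v p) (mv n (mf A) (u p)) = ip m (v p) (\<lambda>i. of_real (singular_values A ! p) * v p i)"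
        using Au[OF that] by (intro ip_cong) auto
      then show ?thesis using v that unfolding orthon_def ip_scale_right by simp
    qed
    then show ?thesis unfolding c by simp
  qed
  moreover have "Re (\<Sum>i<m. \<Sum>j<n. c i j * B $$ (i, j)) \<le> (\<Sum>p<k. singular_values B ! p)"
    if "B \<in> carrier_mat m n" for B
    unfolding c[of "mf B"] by (rule ky_fan_le[OF that u v])
  ultimately show ?thesis using that by blast
qed

section \<open>Rank and the vanishing of singular values\<close>

lemma rank_sum_rank_one_le:
  fixes f g :: "nat \<Rightarrow> nat \<Rightarrow> complex"
  shows "vec_space.rank m (mat m n (\<lambda>(i, j). \<Sum>q<p. f q i * g q j)) \<le> p"
proof (induction p)
  case 0
  have "mat m n (\<lambda>(i, j). \<Sum>q<0. f q i * g q j) = 0\<^sub>m m n" by (rule eq_matI) auto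
  then show ?case by (simp only: vec_space.rank_0I order.refl)
next
  case (Suc p)
  let ?R = "mat m n (\<lambda>(i, j). f p i * g p j)"
  have "mat m n (\<lambda>(i, j). \<Sum>q<Suc p. f q i * g q j) = mat m n (\<lambda>(i, j). \<Sum>q<p. f q i * g q j) + ?R"
    by (rule eq_matI) auto
  moreover have "vec_space.rank m ?R \<le> 1"
    by (rule vec_space.rank_le_1_product_entries[of _ _ n "f p" "g p"]) auto
  ultimately show ?case
    using Suc vec_space.rank_subadditive[of "mat m n (\<lambda>(i, j). \<Sum>q<p. f q i * g q j)" m n ?R] by simp
qed

text \<open>If the value with index p vanishes, so do all later ones, and in the expansion of A into
  the rank-one terms \<open>(A u_q) u_q^*\<close> at most p terms survive.\<close>

lemma singular_values_pos_below_rank: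
  assumes A: "A \<in> carrier_mat m n" and p: "p < vec_space.rank m A"
  shows "0 < singular_values A ! p"
proof (rule ccontr)
  assume neg: "\<not> 0 < singular_values A ! p"
  have pn: "p < n" using vec_space.rank_le_nc[OF A] p by simp
  obtain u where u: "orthon n n u"
    and Au: "\<And>p q. p < n \<Longrightarrow> q < n \<Longrightarrow> ip m (mv n (mf A) (u p)) (mv n (mf A) (u q))
       = (if p = q then of_real ((singular_values A ! p)\<^sup>2) else 0)"
    and s0: "\<And>p. p < n \<Longrightarrow> 0 \<le> singular_values A ! p"
    and smono: "\<And>p q. p \<le> q \<Longrightarrow> q < n \<Longrightarrow> singular_values A ! q \<le> singular_values A ! p"
    using singular_values_basis[OF A] by metis
  have Au0: "mv n (mf A) (u q) i = 0" if "q < n" "p \<le> q" "i < m" for q i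
  proof -
    have "singular_values A ! q = 0" using smono[OF that(2,1)] s0[OF that(1)] neg by simp
    then have "nrm2 m (mv n (mf A) (u q)) = 0" using Au[OF that(1) that(1)] unfolding ip_self by simp
    then show ?thesis using that(3) by (simp add: nrm2_eq_0)
  qed
  have A_eq: "A = mat m n (\<lambda>(i, j). \<Sum>q<p. mv n (mf A) (u q) i * cnj (u q j))"
  proof (rule eq_matI)
    fix i j assume "i < dim_row (mat m n (\<lambda>(i, j). \<Sum>q<p. mv n (mf A) (u q) i * cnj (u q j)))"
      "j < dim_col (mat m n (\<lambda>(i, j). \<Sum>q<p. mv n (mf A) (u q) i * cnj (u q j)))"
    then have ij: "i < m" "j < n" by auto
    have "A $$ (i, j) = (\<Sum>k<n. if k = j then A $$ (i, k) else 0)" using ij by simp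
    also have "\<dots> = mv n (mf A) (unit j) i"
      unfolding mv_def by (intro sum.cong) auto
    also have "mv n (mf A) (unit j) = mv n (mf A) (\<lambda>i. \<Sum>q<n. ip n (u q) (unit j) * u q i)"
      by (rule mv_cong) (rule parseval(2)[OF u])
    also have "\<dots> i = (\<Sum>q<n. cnj (u q j) * mv n (mf A) (u q) i)"
      using ij by (simp add: mv_sum mv_scale ip_unit)
    also have "\<dots> = (\<Sum>q<p. cnj (u q j) * mv n (mf A) (u q) i)"
      using pn Au0 ij by (intro sum.mono_neutral_right) auto
    finally show "A $$ (i, j) = mat m n (\<lambda>(i, j). \<Sum>q<p. mv n (mf A) (u q) i * cnj (u q j)) $$ (i, j)"
      using ij by (simp add: mult.commute)
  qed (use A in auto)
  have "vec_space.rank m A \<le> p"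
    by (subst A_eq) (rule rank_sum_rank_one_le[where p = p and f = "\<lambda>q. mv n (mf A) (u q)" and g = "\<lambda>q j. cnj (u q j)"])
  then show False using p by simp
qed

text \<open>A positive value with index p would give \<open>p + 1\<close> orthonormal left singular
  vectors in an m-dimensional space. Hence cutting the list at \<open>min m n\<close> removes only
  zeros.\<close>

lemma singular_values_zero_above_rows:
  assumes A: "A \<in> carrier_mat m n" and p: "m \<le> p" "p < n"
  shows "singular_values A ! p = 0"
proof (rule ccontr)
  assume nz: "singular_values A ! p \<noteq> 0"
  obtain u where "orthon n n u" and s0: "\<And>p. p < n \<Longrightarrow> 0 \<le> singular_values A ! p"
    and smono: "\<And>p q. p \<le> q \<Longrightarrow> q < n \<Longrightarrow> singular_values A ! q \<le> singular_values A ! p"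
    using singular_values_basis[OF A] by metis
  have "0 < singular_values A ! q" if "q < Suc p" for q
    using smono[of q p] s0[of p] nz p that by simp
  then obtain v where "orthon m (Suc p) v"
    using positive_singular_vectors[OF A, of "Suc p"] p(2) by (metis Suc_leI)
  then have "Suc p \<le> m" by (rule orthon_card_le)
  then show False using p by simp
qed

section \<open>Selections from convex branches\<close>

lemma convex_on_real_linorderI:
  fixes f :: "real \<Rightarrow> real"
  assumes "convex S"
    and "\<And>x y z. x \<in> S \<Longrightarrow> y \<in> S \<Longrightarrow> x < z \<Longrightarrow> z < y \<Longrightarrow>
      f z * (y - x) \<le> f x * (y - z) + f y * (z - x)"
  shows "convex_on S f"
proof (rule convex_on_linorderI[OF _ assms(1)])
  fix t x y :: real
  assume t: "0 < t" "t < 1" and xy: "x \<in> S" "y \<in> S" "x < y"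
  define z where "z = (1 - t) * x + t * y"
  have e: "z - x = t * (y - x)" "y - z = (1 - t) * (y - x)" by (auto simp: z_def algebra_simps)
  have "0 < z - x" "0 < y - z" unfolding e using t xy by simp_all
  then have "x < z" "z < y" by simp_all
  from assms(2)[OF xy(1,2) this] have "f z * (y - x) \<le> ((1 - t) * f x + t * f y) * (y - x)"
    unfolding e by (simp add: algebra_simps)
  then show "f ((1 - t) *\<^sub>R x + t *\<^sub>R y) \<le> (1 - t) * f x + t * f y"
    using xy by (simp add: z_def)
qed

text \<open>A local criterion, suited to selections that may change their branch at t. If the graph
  exceeded a chord, adding a small strictly convex parabola that vanishes at both ends would leave a
  positive interior maximum, and there the second difference of G would be negative.\<close>

lemma convex_on_second_difference:
  fixes G :: "real \<Rightarrow> real"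
  assumes cont: "continuous_on {c..d} G"
    and sd: "\<And>t. c < t \<Longrightarrow> t < d \<Longrightarrow> \<exists>e>0. \<forall>h. 0 < h \<and> h < e \<longrightarrow> 2 * G t \<le> G (t + h) + G (t - h)"
  shows "convex_on {c..d} G"
proof (rule convex_on_real_linorderI)
  fix x y z assume xy: "x \<in> {c..d}" "y \<in> {c..d}" "x < z" "z < y"
  show "G z * (y - x) \<le> G x * (y - z) + G y * (z - x)"
  proof (rule ccontr)
    assume neg: "\<not> ?thesis"
    define K where "K = (G y - G x) / (y - x)"
    have K: "K * (y - x) = G y - G x" using xy by (simp add: K_def)
    define L where "L s = G x + K * (s - x)" for s
    have "L z * (y - x) = G x * (y - x) + K * (y - x) * (z - x)"
      by (simp add: L_def algebra_simps)
    then have "L z * (y - x) = G x * (y - z) + G y * (z - x)"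
      unfolding K by (simp add: algebra_simps)
    then have "L z * (y - x) < G z * (y - x)" using neg by simp
    then have gap: "0 < G z - L z" using xy by (simp add: mult_less_cancel_right)
    \<comment> \<open>As \<open>(z - x) (y - z)\<close> is at most \<open>(y - x)^2\<close>, the
      parabola takes away at most half of the gap at z.\<close>
    define \<epsilon> where "\<epsilon> = (G z - L z) / (2 * (y - x)\<^sup>2)"
    have \<epsilon>: "\<epsilon> > 0" using gap xy by (simp add: \<epsilon>_def)
    define \<phi> where "\<phi> s = G s - L s + \<epsilon> * ((s - x) * (s - y))" for s
    have c\<phi>: "continuous_on {x..y} \<phi>"
      unfolding \<phi>_def L_def using xy by (intro continuous_intros continuous_on_subset[OF cont]) auto
    obtain m where m: "m \<in> {x..y}" "\<And>s. s \<in> {x..y} \<Longrightarrow> \<phi> s \<le> \<phi> m"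
      using continuous_attains_sup[OF compact_Icc _ c\<phi>] xy by auto
    have "(z - x) * (y - z) \<le> (y - x) * (y - x)" using xy by (intro mult_mono) auto
    then have "\<epsilon> * ((z - x) * (y - z)) \<le> \<epsilon> * (y - x)\<^sup>2"
      using \<epsilon> by (simp add: power2_eq_square)
    also have "\<dots> = (G z - L z) / 2" using xy by (simp add: \<epsilon>_def)
    finally have "\<phi> z > 0" using gap unfolding \<phi>_def by (simp add: algebra_simps)
    then have "\<phi> m > 0" using m(2)[of z] xy by auto
    moreover have "\<phi> x = 0" "\<phi> y = 0" using xy K by (auto simp: \<phi>_def L_def)
    ultimately have mxy: "x < m" "m < y" using m(1) by (metis atLeastAtMost_iff less_le_not_le order_le_less)+
    obtain e where e: "e > 0" "\<And>h. 0 < h \<Longrightarrow> h < e \<Longrightarrow> 2 * G m \<le> G (m + h) + G (m - h)"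
      using sd[of m] mxy xy by auto
    define h where "h = min e (min (m - x) (y - m)) / 2"
    have h: "0 < h" "h < e" "m + h \<in> {x..y}" "m - h \<in> {x..y}"
      using e(1) mxy unfolding h_def by (auto simp: min_def field_simps)
    have "\<phi> (m + h) + \<phi> (m - h) \<le> 2 * \<phi> m" using m(2)[OF h(3)] m(2)[OF h(4)] by simp
    moreover have "L (m + h) + L (m - h) = 2 * L m" by (simp add: L_def algebra_simps)
    moreover have "(m + h - x) * (m + h - y) + (m - h - x) * (m - h - y) = 2 * ((m - x) * (m - y)) + 2 * h\<^sup>2"
      by (simp add: algebra_simps power2_eq_square)
    then have "\<epsilon> * ((m + h - x) * (m + h - y)) + \<epsilon> * ((m - h - x) * (m - h - y))
        = 2 * (\<epsilon> * ((m - x) * (m - y))) + 2 * (\<epsilon> * h\<^sup>2)"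
      by (metis distrib_left mult.left_commute)
    ultimately have "G (m + h) + G (m - h) + 2 * (\<epsilon> * h\<^sup>2) \<le> 2 * G m" unfolding \<phi>_def by simp
    moreover have "\<epsilon> * h\<^sup>2 > 0" using \<epsilon> h by simp
    ultimately show False using e(2)[OF h(1,2)] by simp
  qed
qed simp

lemma convex_on_max:
  fixes f g :: "'a::real_vector \<Rightarrow> real"
  assumes "convex_on S f" "convex_on S g"
  shows "convex_on S (\<lambda>x. max (f x) (g x))"
proof (rule convex_onI)
  fix t :: real and x y assume *: "0 < t" "t < 1" "x \<in> S" "y \<in> S"
  have "f ((1 - t) *\<^sub>R x + t *\<^sub>R y) \<le> (1 - t) * f x + t * f y"
    "g ((1 - t) *\<^sub>R x + t *\<^sub>R y) \<le> (1 - t) * g x + t * g y"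
    using assms * by (auto intro: convex_onD)
  moreover have "(1 - t) * f x \<le> (1 - t) * max (f x) (g x)" "t * f y \<le> t * max (f y) (g y)"
    "(1 - t) * g x \<le> (1 - t) * max (f x) (g x)" "t * g y \<le> t * max (f y) (g y)"
    using * by auto
  ultimately show "max (f ((1 - t) *\<^sub>R x + t *\<^sub>R y)) (g ((1 - t) *\<^sub>R x + t *\<^sub>R y))
      \<le> (1 - t) * max (f x) (g x) + t * max (f y) (g y)" by linarith
qed (use assms in \<open>auto simp: convex_on_def\<close>)

lemma convex_on_finite_sum:
  assumes "convex S" "\<And>i. i \<in> I \<Longrightarrow> convex_on S (f i)"
  shows "convex_on S (\<lambda>x. \<Sum>i\<in>I. f i x)"
proof (cases "finite I")
  case True
  then show ?thesis using assms(2)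
    by (induction I rule: finite_induct) (auto intro: convex_on_add simp: convex_on_const assms(1))
qed (simp add: convex_on_const assms(1))

lemma convex_on_midpoint:
  fixes g :: "real \<Rightarrow> real"
  assumes "convex_on S g" "t + h \<in> S" "t - h \<in> S"
  shows "2 * g t \<le> g (t + h) + g (t - h)"
proof -
  have "(1 - 1/2) *\<^sub>R (t + h) + (1/2) *\<^sub>R (t - h) = t" by (simp add: field_simps)
  then show ?thesis using convex_onD[OF assms(1), of "1/2" "t + h" "t - h"] assms by simp
qed

text \<open>All ordered pairs occur, including the diagonal, so that the two branches used just
  before and just after any t are always among them.\<close>

definition pairmax :: "nat \<Rightarrow> (nat \<Rightarrow> real \<Rightarrow> real) \<Rightarrow> real \<Rightarrow> real" where
  "pairmax k F t = (\<Sum>x\<in>{..<k} \<times> {..<k}. max (F (fst x) t) (F (snd x) t))"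

text \<open>Where the selection passes from \<open>F\<^sub>q\<close> to \<open>F\<^sub>p\<close>, its possible concave kink is compensated by that of
  \<open>max F\<^sub>p F\<^sub>q\<close>.\<close>

lemma convex_on_selection:
  fixes F :: "nat \<Rightarrow> real \<Rightarrow> real"
  assumes F: "\<And>p. p < k \<Longrightarrow> convex_on {c..d} (F p)" "\<And>p. p < k \<Longrightarrow> continuous_on {c..d} (F p)"
    and f: "continuous_on {c..d} f" "\<And>t. t \<in> {c..d} \<Longrightarrow> \<exists>p<k. f t = F p t"
  shows "convex_on {c..d} (pairmax k F)" "convex_on {c..d} (\<lambda>t. f t + pairmax k F t)"
proof -
  have mx: "convex_on {c..d} (\<lambda>t. max (F (fst x) t) (F (snd x) t))" if "x \<in> {..<k} \<times> {..<k}" for x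
    using that by (intro convex_on_max F) auto
  show "convex_on {c..d} (pairmax k F)"
    unfolding pairmax_def[abs_def] by (intro convex_on_finite_sum mx) auto
  show "convex_on {c..d} (\<lambda>t. f t + pairmax k F t)"
  proof (rule convex_on_second_difference)
    have "continuous_on {c..d} (pairmax k F)"
      unfolding pairmax_def[abs_def] by (intro continuous_on_sum continuous_on_max F) auto
    then show "continuous_on {c..d} (\<lambda>t. f t + pairmax k F t)"
      by (intro continuous_intros f)
    fix t assume t: "c < t" "t < d"
    \<comment> \<open>By continuity a branch that differs from f at t is not selected near t. Hence
      the branches active at \<open>t + h\<close> and at \<open>t - h\<close> both agree with f at
      t.\<close>
    have "\<forall>p\<in>{..<k}. \<exists>e>0. \<forall>s. \<bar>s - t\<bar> < e \<longrightarrow> s \<in> {c..d} \<and> (F p t \<noteq> f t \<longrightarrow> F p s \<noteq> f s)"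
    proof
      fix p assume p: "p \<in> {..<k}"
      show "\<exists>e>0. \<forall>s. \<bar>s - t\<bar> < e \<longrightarrow> s \<in> {c..d} \<and> (F p t \<noteq> f t \<longrightarrow> F p s \<noteq> f s)"
      proof (cases "F p t = f t")
        case True
        then show ?thesis using t by (intro exI[of _ "min (t - c) (d - t)"]) auto
      next
        case False
        have "continuous_on {c<..<d} (\<lambda>s. F p s - f s)"
          using p by (intro continuous_intros continuous_on_subset[OF F(2)] continuous_on_subset[OF f(1)]) auto
        then have "open ({c<..<d} \<inter> (\<lambda>s. F p s - f s) -` (- {0}))"
          by (rule continuous_open_preimage) auto
        moreover have "t \<in> {c<..<d} \<inter> (\<lambda>s. F p s - f s) -` (- {0})" using False t by auto
        ultimately obtain e where "e > 0" "ball t e \<subseteq> {c<..<d} \<inter> (\<lambda>s. F p s - f s) -` (- {0})"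
          using openE by blast
        then show ?thesis
          by (intro exI[of _ e]) (auto simp: ball_def dist_real_def subset_iff abs_minus_commute)
      qed
    qed
    then obtain E where E: "\<And>p. p < k \<Longrightarrow> E p > 0"
      "\<And>p s. p < k \<Longrightarrow> \<bar>s - t\<bar> < E p \<Longrightarrow> s \<in> {c..d} \<and> (F p t \<noteq> f t \<longrightarrow> F p s \<noteq> f s)"
      by (metis lessThan_iff)
    have k: "k > 0" using f(2)[of t] t by auto
    define e where "e = Min (E ` {..<k})"
    have e: "e > 0" unfolding e_def using E(1) k by (subst Min_gr_iff) auto
    have le: "e \<le> E p" if "p < k" for p unfolding e_def using that by (intro Min_le) auto
    show "\<exists>e>0. \<forall>h. 0 < h \<and> h < e \<longrightarrow>
        2 * (f t + pairmax k F t) \<le> f (t + h) + pairmax k F (t + h) + (f (t - h) + pairmax k F (t - h))"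
    proof (intro exI[of _ e] conjI allI impI e)
      fix h assume h: "0 < h \<and> h < e"
      have E': "s \<in> {c..d} \<and> (F p t \<noteq> f t \<longrightarrow> F p s \<noteq> f s)" if "p < k" "s = t + h \<or> s = t - h" for p s
      proof (rule E(2)[OF that(1)])
        show "\<bar>s - t\<bar> < E p" using le[OF that(1)] h that(2) by auto
      qed
      have in_cd: "t + h \<in> {c..d}" "t - h \<in> {c..d}" using E'[of 0] k by blast+
      obtain p q where p: "p < k" "f (t + h) = F p (t + h)" and q: "q < k" "f (t - h) = F q (t - h)"
        using f(2) in_cd by meson
      have pq: "F p t = f t" "F q t = f t" using E' p q by metis+
      define D where "D x = max (F (fst x) (t + h)) (F (snd x) (t + h)) + max (F (fst x) (t - h)) (F (snd x) (t - h))
          - 2 * max (F (fst x) t) (F (snd x) t)" for x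
      have D0: "D x \<ge> 0" if "x \<in> {..<k} \<times> {..<k}" for x
        using convex_on_midpoint[OF mx[OF that] in_cd] unfolding D_def by simp
      have "D (p, q) \<le> (\<Sum>x\<in>{..<k} \<times> {..<k}. D x)"
        using p q D0 by (intro member_le_sum) auto
      also have "\<dots> = pairmax k F (t + h) + pairmax k F (t - h) - 2 * pairmax k F t"
        unfolding pairmax_def D_def sum_distrib_left by (simp only: sum.distrib sum_subtractf)
      finally have 1: "D (p, q) \<le> \<dots>" .
      have "2 * F p t \<le> F p (t + h) + F p (t - h)" "2 * F q t \<le> F q (t + h) + F q (t - h)"
        using convex_on_midpoint[OF F(1) in_cd] p q by auto
      \<comment> \<open>Each maximum is bounded below by the branch that is not selected there:
        \<open>F q\<close> on the right and \<open>F p\<close> on the left. With the two midpoint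
        inequalities all four outer values are then covered.\<close>
      moreover have "D (p, q) \<ge> F q (t + h) + F p (t - h) - 2 * f t"
        unfolding D_def using pq by auto
      ultimately have "2 * f t \<le> f (t + h) + f (t - h) + D (p, q)" using p q pq by linarith
      then show "2 * (f t + pairmax k F t) \<le> f (t + h) + pairmax k F (t + h) + (f (t - h) + pairmax k F (t - h))"
        using 1 by (simp add: distrib_left)
    qed
  qed
qed

lemma convex_on_UNIV_real:
  fixes f :: "real \<Rightarrow> real"
  assumes "\<And>c d. c < d \<Longrightarrow> convex_on {c..d} f"
  shows "convex_on UNIV f"
proof (rule convex_onI)
  fix t x y :: real assume t: "0 < t" "t < 1"
  have "convex_on {min x y..max x y + 1} f" by (rule assms) (auto simp: min_def max_def)
  from convex_onD[OF this, of t x y] t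
  show "f ((1 - t) *\<^sub>R x + t *\<^sub>R y) \<le> (1 - t) * f x + t * f y" by auto
qed simp

section \<open>Continuous selections of unordered tuples\<close>

text \<open>Equality of unordered tuples. The entries are complex so that one entry can carry an
  eigenvalue together with its derivative.\<close>

definition same_tuple :: "nat set \<Rightarrow> (nat \<Rightarrow> complex) \<Rightarrow> (nat \<Rightarrow> complex) \<Rightarrow> bool" where
  "same_tuple I x y \<longleftrightarrow> (\<exists>\<pi>. \<pi> permutes I \<and> (\<forall>k\<in>I. x k = y (\<pi> k)))"

text \<open>Continuity for the matching distance on unordered tuples; the permutation may change
  from point to point.\<close>

definition unordered_continuous :: "nat set \<Rightarrow> real set \<Rightarrow> (real \<Rightarrow> nat \<Rightarrow> complex) \<Rightarrow> bool" where
  "unordered_continuous I S z \<longleftrightarrow> (\<forall>t0\<in>S. \<forall>e>0. \<exists>\<delta>>0. \<forall>t\<in>S. \<bar>t - t0\<bar> < \<delta> \<longrightarrow>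
     (\<exists>\<pi>. \<pi> permutes I \<and> (\<forall>k\<in>I. norm (z t k - z t0 (\<pi> k)) < e)))"

definition continuous_selection ::
    "nat set \<Rightarrow> real set \<Rightarrow> (real \<Rightarrow> nat \<Rightarrow> complex) \<Rightarrow> (real \<Rightarrow> nat \<Rightarrow> complex) \<Rightarrow> bool" where
  "continuous_selection I S z x \<longleftrightarrow>
     (\<forall>k\<in>I. continuous_on S (\<lambda>t. x t k)) \<and> (\<forall>t\<in>S. same_tuple I (x t) (z t))"

lemma same_tuple_refl: "same_tuple I x x"
  unfolding same_tuple_def using permutes_id by (auto intro!: exI[of _ id])

lemma same_tuple_trans: "same_tuple I x y \<Longrightarrow> same_tuple I y w \<Longrightarrow> same_tuple I x w"
  unfolding same_tuple_def
proof (elim exE conjE)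
  fix \<pi> \<rho> assume *: "\<pi> permutes I" "\<rho> permutes I" "\<forall>k\<in>I. x k = y (\<pi> k)" "\<forall>k\<in>I. y k = w (\<rho> k)"
  then have "\<rho> \<circ> \<pi> permutes I" by (simp add: permutes_compose)
  moreover have "\<forall>k\<in>I. x k = w ((\<rho> \<circ> \<pi>) k)"
    using * by (simp add: permutes_in_image)
  ultimately show "\<exists>\<pi>. \<pi> permutes I \<and> (\<forall>k\<in>I. x k = w (\<pi> k))" by blast
qed

lemma same_tuple_sym: "same_tuple I x y \<Longrightarrow> same_tuple I y x"
  unfolding same_tuple_def
proof (elim exE conjE)
  fix \<pi> assume *: "\<pi> permutes I" "\<forall>k\<in>I. x k = y (\<pi> k)"
  have "\<forall>k\<in>I. y k = x (inv_into UNIV \<pi> k)"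
    using * permutes_inv[OF *(1)] by (simp add: permutes_in_image permutes_inverses)
  then show "\<exists>\<pi>. \<pi> permutes I \<and> (\<forall>k\<in>I. y k = x (\<pi> k))" using permutes_inv[OF *(1)] by blast
qed

lemma same_tuple_permute: "\<rho> permutes I \<Longrightarrow> same_tuple I (\<lambda>k. x (\<rho> k)) x"
  unfolding same_tuple_def by blast

text \<open>At the common point both selections list the same unordered tuple, so a fixed
  permutation of the right-hand one makes them fit. The permutation appears in the conclusion
  because \<open>continuous_selection_extend\<close> has to undo it.\<close>

lemma continuous_selection_glue:
  assumes x: "continuous_selection I {p..q} z x" and y: "continuous_selection I {q..r} z y"
    and pqr: "p \<le> q" "q \<le> r"
  obtains w where "continuous_selection I {p..r} z w" "\<And>t k. t \<in> {p..q} \<Longrightarrow> k \<in> I \<Longrightarrow> w t k = x t k"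
    "\<exists>\<rho>. \<rho> permutes I \<and> (\<forall>t\<in>{q..r}. \<forall>k\<in>I. w t k = y t (\<rho> k))"
proof -
  have "same_tuple I (x q) (y q)"
    using x y pqr unfolding continuous_selection_def
    by (meson atLeastAtMost_iff order_refl same_tuple_sym same_tuple_trans)
  then obtain \<rho> where \<rho>: "\<rho> permutes I" "\<And>k. k \<in> I \<Longrightarrow> x q k = y q (\<rho> k)"
    unfolding same_tuple_def by blast
  define w where "w t k = (if t \<le> q then x t k else y t (\<rho> k))" for t k
  have "continuous_on {p..r} (\<lambda>t. w t k)" if "k \<in> I" for k
    unfolding w_def
  proof (rule continuous_on_cases_le)
    show "continuous_on {t \<in> {p..r}. t \<le> q} (\<lambda>t. x t k)"
      using x that unfolding continuous_selection_def by (auto intro: continuous_on_subset)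
    have "\<rho> k \<in> I" using that \<rho>(1) by (simp add: permutes_in_image)
    then have "continuous_on {q..r} (\<lambda>t. y t (\<rho> k))"
      using y unfolding continuous_selection_def by blast
    then show "continuous_on {t \<in> {p..r}. q \<le> t} (\<lambda>t. y t (\<rho> k))"
      by (rule continuous_on_subset) auto
  qed (use \<rho>(2)[OF that] in auto)
  moreover have "same_tuple I (w t) (z t)" if "t \<in> {p..r}" for t
  proof (cases "t \<le> q")
    case True
    then show ?thesis using x that unfolding continuous_selection_def w_def by auto
  next
    case False
    then have "same_tuple I (y t) (z t)" using y that unfolding continuous_selection_def by auto
    then show ?thesis using same_tuple_trans[OF same_tuple_permute[OF \<rho>(1), of "y t"]] False
      unfolding w_def by auto
  qed
  ultimately have 1: "continuous_selection I {p..r} z w" unfolding continuous_selection_def by blast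
  have 2: "w t k = x t k" if "t \<in> {p..q}" for t k using that by (auto simp: w_def)
  have 3: "w t k = y t (\<rho> k)" if "t \<in> {q..r}" "k \<in> I" for t k
    using that \<rho>(2) by (cases "t = q") (auto simp: w_def)
  show ?thesis using that[OF 1 2] 3 \<rho>(1) by blast
qed

text \<open>Gluing keeps the left piece and permutes the right one. An extension to the left
  therefore permutes the given x, and the inverse permutation restores it on the middle
  interval.\<close>

lemma continuous_selection_extend:
  assumes x: "continuous_selection I {u..v} z x" and uv: "u' \<le> u" "u \<le> v" "v \<le> v'"
    and ex: "\<exists>y. continuous_selection I {u'..u} z y" "\<exists>y. continuous_selection I {v..v'} z y"
  obtains w where "continuous_selection I {u'..v'} z w" "\<And>t k. t \<in> {u..v} \<Longrightarrow> k \<in> I \<Longrightarrow> w t k = x t k"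
proof -
  obtain y where y: "continuous_selection I {v..v'} z y" using ex by blast
  obtain w1 where w1: "continuous_selection I {u..v'} z w1" "\<And>t k. t \<in> {u..v} \<Longrightarrow> k \<in> I \<Longrightarrow> w1 t k = x t k"
    using continuous_selection_glue[OF x y uv(2,3)] by metis
  obtain y' where y': "continuous_selection I {u'..u} z y'" using ex by blast
  have "u \<le> v'" using uv by simp
  then obtain w2 \<rho> where w2: "continuous_selection I {u'..v'} z w2" and \<rho>: "\<rho> permutes I"
    and w2': "\<And>t k. t \<in> {u..v'} \<Longrightarrow> k \<in> I \<Longrightarrow> w2 t k = w1 t (\<rho> k)"
    using continuous_selection_glue[OF y' w1(1) uv(1)] by metis
  define w where "w t k = w2 t (inv_into UNIV \<rho> k)" for t k
  have inv: "inv_into UNIV \<rho> k \<in> I" "\<rho> (inv_into UNIV \<rho> k) = k" if "k \<in> I" for k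
    using that permutes_inv[OF \<rho>] permutes_inverses(1)[OF \<rho>] by (auto simp: permutes_in_image)
  have "continuous_selection I {u'..v'} z w"
    unfolding continuous_selection_def
  proof (intro conjI ballI)
    show "continuous_on {u'..v'} (\<lambda>t. w t k)" if "k \<in> I" for k
      using w2 inv(1)[OF that] unfolding w_def continuous_selection_def by blast
    show "same_tuple I (w t) (z t)" if "t \<in> {u'..v'}" for t
      using w2 that same_tuple_trans[OF same_tuple_permute[OF permutes_inv[OF \<rho>], of "w2 t"]]
      unfolding w_def continuous_selection_def by blast
  qed
  moreover have "w t k = x t k" if "t \<in> {u..v}" "k \<in> I" for t k
    using w1(2) w2'[of t "inv_into UNIV \<rho> k"] inv[OF that(2)] that uv unfolding w_def by auto
  ultimately show ?thesis using that by blast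
qed

text \<open>This treats the right end; the left end is obtained by reflecting C at 0.\<close>

lemma open_interval_exhaustion:
  fixes C :: "real set"
  assumes C: "open C" "connected C" "c \<in> C"
  obtains v :: "nat \<Rightarrow> real" where "v 0 = c" "\<And>n. v n \<le> v (Suc n)" "\<And>n. v n \<in> C" "\<And>t. t \<in> C \<Longrightarrow> \<exists>n. t < v n"
proof (cases "bdd_above C")
  case True
  define \<beta> where "\<beta> = Sup C"
  have lt: "t < \<beta>" if t: "t \<in> C" for t
  proof -
    obtain e where "e > 0" "ball t e \<subseteq> C" using C(1) t openE by blast
    then have "t + e/2 \<in> C" by (auto simp: dist_real_def subset_iff)
    then have "t + e/2 \<le> \<beta>" unfolding \<beta>_def by (rule cSup_upper[OF _ True])
    then show ?thesis using \<open>e > 0\<close> by simp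
  qed
  define v where "v n = \<beta> - (\<beta> - c) / real (Suc n)" for n
  have c: "0 < \<beta> - c" using lt C(3) by simp
  have "v n \<in> C" for n
  proof -
    have "v n < \<beta>" using c by (simp add: v_def)
    then obtain s where s: "s \<in> C" "v n < s" unfolding \<beta>_def using less_cSup_iff[of C "v n"] C(3) True by auto
    have "(\<beta> - c) * 1 \<le> (\<beta> - c) * real (Suc n)" using c by (intro mult_left_mono) auto
    then have "(\<beta> - c) / real (Suc n) \<le> \<beta> - c" by (simp add: pos_divide_le_eq del: of_nat_Suc)
    then have "c \<le> v n" by (simp add: v_def)
    then show ?thesis using connected_contains_Icc[OF C(2,3) s(1)] s(2) by auto
  qed
  moreover have "v n \<le> v (Suc n)" for n
    using c unfolding v_def by (intro diff_mono divide_left_mono) auto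
  moreover have "\<exists>n. t < v n" if "t \<in> C" for t
  proof -
    obtain n where n: "(\<beta> - c) / (\<beta> - t) < real n" using reals_Archimedean2 by blast
    have "0 < \<beta> - t" using lt[OF that] by simp
    then have "\<beta> - c < real n * (\<beta> - t)" using n by (simp add: divide_less_eq)
    also have "\<dots> \<le> real (Suc n) * (\<beta> - t)" using \<open>0 < \<beta> - t\<close> by (intro mult_right_mono) auto
    finally have "(\<beta> - c) / real (Suc n) < \<beta> - t" by (simp add: divide_less_eq mult.commute)
    then have "t < v n" by (simp add: v_def)
    then show ?thesis ..
  qed
  ultimately show ?thesis using that[of v] by (simp add: v_def)
next
  case False
  have "c + real n \<in> C" for n
  proof -
    obtain s where "s \<in> C" "c + real n < s" using False unfolding bdd_above_def by (meson not_le)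
    then show ?thesis using connected_contains_Icc[OF C(2,3) \<open>s \<in> C\<close>] by auto
  qed
  moreover have "\<exists>n. t < c + real n" for t
    using reals_Archimedean2[of "t - c"] by (auto simp: algebra_simps)
  ultimately show ?thesis using that[of "\<lambda>n. c + real n"] by simp
qed

text \<open>Independent selections on different compact intervals need not match, so they are chosen
  successively, each extending the previous one.\<close>

lemma continuous_selection_exhaust:
  assumes C: "open C" "connected C"
    and ex: "\<And>u v. u \<le> v \<Longrightarrow> {u..v} \<subseteq> C \<Longrightarrow> \<exists>x. continuous_selection I {u..v} z x"
  shows "\<exists>x. continuous_selection I C z x"
proof (cases "C = {}")
  case True
  then show ?thesis by (simp add: continuous_selection_def)
next
  case False
  then obtain c where c: "c \<in> C" by blast
  obtain v where v: "v 0 = c" "\<And>n. v n \<le> v (Suc n)" "\<And>n. v n \<in> C" "\<And>t. t \<in> C \<Longrightarrow> \<exists>n. t < v n"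
    using open_interval_exhaustion[OF C c] by metis
  have "connected (uminus ` C)"
    by (rule connected_continuous_image[OF _ C(2)]) (intro continuous_intros)
  then have nC: "open (uminus ` C)" "connected (uminus ` C)" "- c \<in> uminus ` C"
    using C c by (auto intro: open_negations)
  obtain u' where u': "u' 0 = - c" "\<And>n. u' n \<le> u' (Suc n)" "\<And>n. u' n \<in> uminus ` C"
    "\<And>t. t \<in> uminus ` C \<Longrightarrow> \<exists>n. t < u' n"
    using open_interval_exhaustion[OF nC] by metis
  define u where "u n = - u' n" for n
  have u: "u 0 = c" "\<And>n. u (Suc n) \<le> u n" using u'(1,2) by (simp_all add: u_def)
  have u3: "u n \<in> C" for n using u'(3)[of n] by (auto simp: u_def)
  have u4: "\<exists>n. u n < t" if "t \<in> C" for t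
    using u'(4)[of "- t"] that by (auto simp: u_def minus_less_iff)
  have mono: "u n \<le> u m" "v m \<le> v n" if "m \<le> n" for m n
    using lift_Suc_antimono_le[of u, OF u(2) that] lift_Suc_mono_le[of v, OF v(2) that] by auto
  have uv: "u n \<le> v n" for n using mono[of 0 n] u(1) v(1) by simp
  have sub: "{p..q} \<subseteq> C" if "p \<in> C" "q \<in> C" for p q
    by (rule connected_contains_Icc[OF C(2) that])
  have "\<exists>X. \<forall>n. continuous_selection I {u n..v n} z (X n) \<and>
      (\<forall>t\<in>{u n..v n}. \<forall>k\<in>I. X (Suc n) t k = X n t k)"
  proof (rule dependent_nat_choice)
    show "\<exists>x. continuous_selection I {u 0..v 0} z x" using ex[OF uv sub[OF u3 v(3)]] .
    fix x n assume x: "continuous_selection I {u n..v n} z x"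
    have "\<exists>y. continuous_selection I {u (Suc n)..u n} z y" "\<exists>y. continuous_selection I {v n..v (Suc n)} z y"
      using ex[OF u(2) sub[OF u3 u3]] ex[OF v(2) sub[OF v(3) v(3)]] by auto
    then show "\<exists>y. continuous_selection I {u (Suc n)..v (Suc n)} z y \<and> (\<forall>t\<in>{u n..v n}. \<forall>k\<in>I. y t k = x t k)"
      using continuous_selection_extend[OF x u(2) uv v(2)] by metis
  qed
  then obtain X where X: "\<And>n. continuous_selection I {u n..v n} z (X n)"
    "\<And>n t k. t \<in> {u n..v n} \<Longrightarrow> k \<in> I \<Longrightarrow> X (Suc n) t k = X n t k" by blast
  have Xle: "X n t k = X m t k" if "m \<le> n" "t \<in> {u m..v m}" "k \<in> I" for m n t k
    using that(1)
  proof (induction n rule: dec_induct)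
    case (step n)
    have "t \<in> {u n..v n}" using mono[OF step(1)] that(2) by auto
    then show ?case using step X(2) that(3) by simp
  qed simp
  have cover: "\<exists>n. t \<in> {u n<..<v n}" if "t \<in> C" for t
  proof -
    obtain n m where nm: "u n < t" "t < v m" using u4[OF \<open>t \<in> C\<close>] v(4)[OF \<open>t \<in> C\<close>] by blast
    have "t \<in> {u (max n m)<..<v (max n m)}"
      using nm mono[of n "max n m"] mono[of m "max n m"] by auto
    then show ?thesis by blast
  qed
  \<comment> \<open>Open intervals are used here, so that x agrees with a single member of the
    sequence in a neighbourhood of t.\<close>
  define N where "N t = (SOME n. t \<in> {u n<..<v n})" for t
  have N: "t \<in> {u (N t)<..<v (N t)}" if "t \<in> C" for t
    unfolding N_def by (rule someI_ex[OF cover[OF that]])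
  define x where "x t k = X (N t) t k" for t k
  have xX: "x t k = X n t k" if "t \<in> C" "t \<in> {u n..v n}" "k \<in> I" for t k n
    using Xle[of n "N t" t k] Xle[of "N t" n t k] N[OF that(1)] that unfolding x_def
    by (cases "n \<le> N t") auto
  have "continuous_on C (\<lambda>t. x t k)" if "k \<in> I" for k
  proof (rule continuous_at_imp_continuous_on, rule ballI)
    fix t assume t: "t \<in> C"
    have "{u (N t)..v (N t)} \<subseteq> C" by (rule sub[OF u3 v(3)])
    then have sub': "{u (N t)<..<v (N t)} \<subseteq> C" by (auto simp: subset_iff)
    have "continuous_on {u (N t)..v (N t)} (\<lambda>s. X (N t) s k)"
      using X(1)[of "N t"] \<open>k \<in> I\<close> unfolding continuous_selection_def by blast
    then have "continuous_on {u (N t)<..<v (N t)} (\<lambda>s. X (N t) s k)"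
      by (rule continuous_on_subset) auto
    then have "isCont (\<lambda>s. X (N t) s k) t"
      using N[OF t] by (simp add: continuous_on_eq_continuous_at)
    moreover have "\<forall>\<^sub>F s in nhds t. x s k = X (N t) s k"
      unfolding eventually_nhds using N[OF t] sub' xX[OF _ _ \<open>k \<in> I\<close>]
      by (intro exI[of _ "{u (N t)<..<v (N t)}"]) (auto simp: subset_iff)
    ultimately show "isCont (\<lambda>t. x t k) t" using isCont_cong by fast
  qed
  moreover have "same_tuple I (x t) (z t)" if "t \<in> C" for t
    using X(1)[of "N t"] N[OF that] unfolding continuous_selection_def x_def by auto
  ultimately show ?thesis unfolding continuous_selection_def by blast
qed

text \<open>Used with g the clamping to an interval, which extends a tuple from that interval to the
  whole line.\<close>

lemma unordered_continuous_compose: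
  assumes "unordered_continuous I S z" "\<And>s t. \<bar>g s - g t\<bar> \<le> \<bar>s - t\<bar>" "\<And>t. t \<in> T \<Longrightarrow> g t \<in> S"
  shows "unordered_continuous I T (\<lambda>t. z (g t))"
  unfolding unordered_continuous_def
proof (intro ballI allI impI)
  fix t0 e assume "t0 \<in> T" "0 < (e::real)"
  obtain \<delta> where \<delta>: "\<delta> > 0" "\<And>t. t \<in> S \<Longrightarrow> \<bar>t - g t0\<bar> < \<delta> \<Longrightarrow>
      \<exists>\<pi>. \<pi> permutes I \<and> (\<forall>k\<in>I. norm (z t k - z (g t0) (\<pi> k)) < e)"
    using assms(1)[unfolded unordered_continuous_def, rule_format, OF assms(3)[OF \<open>t0 \<in> T\<close>] \<open>0 < e\<close>]
    by blast
  show "\<exists>\<delta>>0. \<forall>t\<in>T. \<bar>t - t0\<bar> < \<delta> \<longrightarrow> (\<exists>\<pi>. \<pi> permutes I \<and> (\<forall>k\<in>I. norm (z (g t) k - z (g t0) (\<pi> k)) < e))"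
    by (intro exI[of _ \<delta>] conjI ballI impI \<delta> assms(3) le_less_trans[OF assms(2)])
qed

lemma clamp_lipschitz: "\<bar>max u (min v s) - max u (min v t)\<bar> \<le> \<bar>s - t\<bar>" for u v s t :: real
  by (auto simp: max_def min_def abs_if)

lemma permutes_restrict:
  assumes "\<pi> permutes I" "finite K" "K \<subseteq> I" "\<pi> ` K \<subseteq> K"
  shows "(\<lambda>k. if k \<in> K then \<pi> k else k) permutes K"
proof (rule bij_imp_permutes)
  have "inj_on \<pi> K" using permutes_inj[OF assms(1)] by (rule inj_on_subset) auto
  then have "bij_betw \<pi> K K"
    using assms(2,4) by (simp add: bij_betw_def endo_inj_surj)
  then show "bij_betw (\<lambda>k. if k \<in> K then \<pi> k else k) K K"
    by (rule bij_betw_cong[THEN iffD1, rotated]) auto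
qed auto

text \<open>Near a point where the tuple is not constant, it splits into two smaller tuples that remain
  apart from each other.\<close>

lemma unordered_continuous_split:
  assumes z: "unordered_continuous I UNIV z" and I: "finite I" and ij: "i \<in> I" "j \<in> I" "z t0 i \<noteq> z t0 j"
    and IH: "\<And>K w. K \<subset> I \<Longrightarrow> unordered_continuous K UNIV w \<Longrightarrow> \<exists>x. continuous_selection K UNIV w x"
  shows "\<exists>\<delta>>0. \<forall>u v. u \<le> v \<and> {u..v} \<subseteq> {t0 - \<delta><..<t0 + \<delta>} \<longrightarrow> (\<exists>x. continuous_selection I {u..v} z x)"
proof -
  \<comment> \<open>The group of i at t0. Neither K nor its complement in I is empty, so the
    induction hypothesis applies to both.\<close>
  define K where "K = {k \<in> I. z t0 k = z t0 i}"
  define G where "G = Min ((\<lambda>k. norm (z t0 k - z t0 i)) ` (I - K))"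
  have "i \<in> K" "j \<in> I - K" "K \<subseteq> I" using ij unfolding K_def by auto
  then have KI: "K \<subset> I" "I - K \<subset> I" "finite K" "I - K \<noteq> {}" using ij(1) I finite_subset by blast+
  have G: "G > 0" unfolding G_def using I KI by (subst Min_gr_iff) (auto simp: K_def)
  have Gle: "G \<le> norm (z t0 k - z t0 i)" if "k \<in> I - K" for k
    unfolding G_def using I that by (intro Min_le) auto
  \<comment> \<open>Three displacements smaller than e add up to less than the gap G between the two
    groups, so no matching can exchange members of the groups.\<close>
  define e where "e = G / 4"
  have e: "e > 0" using G by (simp add: e_def)
  obtain \<delta> where \<delta>: "\<delta> > 0" "\<And>t. \<bar>t - t0\<bar> < \<delta> \<Longrightarrow> \<exists>\<pi>. \<pi> permutes I \<and> (\<forall>k\<in>I. norm (z t k - z t0 (\<pi> k)) < e)"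
    using z e unfolding unordered_continuous_def by (meson UNIV_I)
  have "\<exists>x. continuous_selection I {u..v} z x" if uv: "u \<le> v" "{u..v} \<subseteq> {t0 - \<delta><..<t0 + \<delta>}" for u v
  proof -
    \<comment> \<open>Renumber the tuple at each t so that entry k lies near \<open>z t0 k\<close>.
      The single entries need not become continuous, but each of the two groups is continuous as an
      unordered tuple.\<close>
    have "\<forall>t\<in>{u..v}. \<exists>y. same_tuple I y (z t) \<and> (\<forall>k\<in>I. norm (y k - z t0 k) < e)"
    proof
      fix t assume "t \<in> {u..v}"
      then have "\<bar>t - t0\<bar> < \<delta>" using uv(2) by (auto simp: abs_less_iff)
      then obtain \<pi> where \<pi>: "\<pi> permutes I" "\<forall>k\<in>I. norm (z t k - z t0 (\<pi> k)) < e" using \<delta>(2) by blast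
      have "norm (z t (inv_into UNIV \<pi> k) - z t0 k) < e" if "k \<in> I" for k
        using \<pi>(2)[rule_format, of "inv_into UNIV \<pi> k"] permutes_inverses(1)[OF \<pi>(1)] permutes_inv[OF \<pi>(1)] that
        by (simp add: permutes_in_image)
      then show "\<exists>y. same_tuple I y (z t) \<and> (\<forall>k\<in>I. norm (y k - z t0 k) < e)"
        using same_tuple_permute[OF permutes_inv[OF \<pi>(1)], of "z t"] by blast
    qed
    then obtain y where y: "\<And>t. t \<in> {u..v} \<Longrightarrow> same_tuple I (y t) (z t)"
      "\<And>t k. t \<in> {u..v} \<Longrightarrow> k \<in> I \<Longrightarrow> norm (y t k - z t0 k) < e" by metis
    have stay: "\<pi> k \<in> K \<longleftrightarrow> k \<in> K" if \<pi>: "\<pi> permutes I" "k \<in> I" "t \<in> {u..v}" "t1 \<in> {u..v}"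
        "norm (y t k - y t1 (\<pi> k)) < e" for t t1 \<pi> k
    proof -
      have pk: "\<pi> k \<in> I" using \<pi>(1,2) by (simp add: permutes_in_image)
      have "norm (z t0 k - z t0 (\<pi> k)) < 3 * e"
      proof -
        have "dist (z t0 k) (z t0 (\<pi> k))
          \<le> dist (z t0 k) (y t k) + (dist (y t k) (y t1 (\<pi> k)) + dist (y t1 (\<pi> k)) (z t0 (\<pi> k)))"
          by (meson add_left_mono dist_triangle order_trans)
        then have "norm (z t0 k - z t0 (\<pi> k))
          \<le> norm (z t0 k - y t k) + (norm (y t k - y t1 (\<pi> k)) + norm (y t1 (\<pi> k) - z t0 (\<pi> k)))"
          by (simp only: dist_norm)
        moreover have "norm (z t0 k - y t k) < e" using y(2)[OF \<pi>(3,2)] by (simp add: norm_minus_commute)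
        moreover have "norm (y t1 (\<pi> k) - z t0 (\<pi> k)) < e" using y(2)[OF \<pi>(4) pk] .
        ultimately show ?thesis using \<pi>(5) by argo
      qed
      then have lt: "norm (z t0 k - z t0 (\<pi> k)) < G" using e by (simp add: e_def)
      show ?thesis
      proof
        assume "\<pi> k \<in> K"
        then have "norm (z t0 k - z t0 i) < G" using lt unfolding K_def by simp
        then show "k \<in> K" using Gle[of k] \<pi>(2) by fastforce
      next
        assume "k \<in> K"
        then have "norm (z t0 (\<pi> k) - z t0 i) < G" using lt unfolding K_def by (simp add: norm_minus_commute)
        then show "\<pi> k \<in> K" using Gle[of "\<pi> k"] pk by fastforce
      qed
    qed
    have cont: "unordered_continuous L {u..v} y" if L: "L = K \<or> L = I - K" for L
      unfolding unordered_continuous_def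
    proof (intro ballI allI impI)
      fix t1 e' assume t1: "t1 \<in> {u..v}" and e': "0 < (e'::real)"
      have "0 < min e e'" using e e' by simp
      then obtain \<delta>' where \<delta>': "\<delta>' > 0" "\<And>t. \<bar>t - t1\<bar> < \<delta>' \<Longrightarrow>
          \<exists>\<pi>. \<pi> permutes I \<and> (\<forall>k\<in>I. norm (z t k - z t1 (\<pi> k)) < min e e')"
        using z unfolding unordered_continuous_def by (meson UNIV_I)
      show "\<exists>\<delta>>0. \<forall>t\<in>{u..v}. \<bar>t - t1\<bar> < \<delta> \<longrightarrow>
          (\<exists>\<pi>. \<pi> permutes L \<and> (\<forall>k\<in>L. norm (y t k - y t1 (\<pi> k)) < e'))"
      proof (intro exI[of _ \<delta>'] conjI ballI impI \<delta>'(1))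
        fix t assume t: "t \<in> {u..v}" "\<bar>t - t1\<bar> < \<delta>'"
        obtain \<pi> where \<pi>: "\<pi> permutes I" "\<forall>k\<in>I. norm (z t k - z t1 (\<pi> k)) < min e e'" using \<delta>'(2)[OF t(2)] by blast
        obtain p where p: "p permutes I" "\<forall>k\<in>I. y t k = z t (p k)" using y(1)[OF t(1)] unfolding same_tuple_def by blast
        obtain q where q: "q permutes I" "\<forall>k\<in>I. z t1 k = y t1 (q k)"
          using same_tuple_sym[OF y(1)[OF t1]] unfolding same_tuple_def by blast
        \<comment> \<open>The matching \<open>\<pi>\<close> of the original tuples, transported to
          the new numberings at t and t1.\<close>
        define \<rho> where "\<rho> = q \<circ> \<pi> \<circ> p"
        have \<rho>: "\<rho> permutes I" unfolding \<rho>_def using \<pi>(1) p(1) q(1) by (intro permutes_compose)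
        have near: "norm (y t k - y t1 (\<rho> k)) < min e e'" if "k \<in> I" for k
        proof -
          have "p k \<in> I" "\<pi> (p k) \<in> I" using that p(1) \<pi>(1) by (auto simp: permutes_in_image)
          then show ?thesis using \<pi>(2) p(2) q(2) that unfolding \<rho>_def by auto
        qed
        have LI: "L \<subseteq> I" "finite L" using L KI I by auto
        have "\<rho> k \<in> K \<longleftrightarrow> k \<in> K" if "k \<in> I" for k using stay[OF \<rho> that t(1) t1] near[OF that] by simp
        then have "\<rho> ` L \<subseteq> L" using L \<rho> KI(1) by (auto simp: permutes_in_image)
        from permutes_restrict[OF \<rho> LI(2,1) this]
        show "\<exists>\<pi>. \<pi> permutes L \<and> (\<forall>k\<in>L. norm (y t k - y t1 (\<pi> k)) < e')"
          using near LI(1) by (intro exI[of _ "\<lambda>k. if k \<in> L then \<rho> k else k"]) auto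
      qed
    qed
    define g where "g t = max u (min v t)" for t
    have gl: "\<bar>g s - g t\<bar> \<le> \<bar>s - t\<bar>" for s t unfolding g_def by (rule clamp_lipschitz)
    have g: "g t \<in> {u..v}" for t using uv(1) unfolding g_def by auto
    have g_id: "g t = t" if "t \<in> {u..v}" for t using that unfolding g_def by auto
    obtain x1 where x1: "continuous_selection K UNIV (\<lambda>t. y (g t)) x1"
      using IH[OF KI(1) unordered_continuous_compose[OF cont gl g]] by blast
    obtain x2 where x2: "continuous_selection (I - K) UNIV (\<lambda>t. y (g t)) x2"
      using IH[OF KI(2) unordered_continuous_compose[OF cont gl g]] by blast
    define x where "x t k = (if k \<in> K then x1 t k else x2 t k)" for t k
    have "continuous_selection I {u..v} z x"
      unfolding continuous_selection_def
    proof (intro conjI ballI)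
      show "continuous_on {u..v} (\<lambda>t. x t k)" if "k \<in> I" for k
        using x1 x2 that unfolding x_def continuous_selection_def
        by (cases "k \<in> K") (auto intro: continuous_on_subset)
      fix t assume t: "t \<in> {u..v}"
      obtain p1 where p1: "p1 permutes K" "\<forall>k\<in>K. x1 t k = y t (p1 k)"
        using x1 g_id[OF t] unfolding continuous_selection_def same_tuple_def by (metis UNIV_I)
      obtain p2 where p2: "p2 permutes (I - K)" "\<forall>k\<in>I-K. x2 t k = y t (p2 k)"
        using x2 g_id[OF t] unfolding continuous_selection_def same_tuple_def by (metis UNIV_I)
      have "p1 permutes I" "p2 permutes I" using p1(1) p2(1) KI(1) by (auto intro: permutes_subset)
      then have "p1 \<circ> p2 permutes I" by (rule permutes_compose[rotated])
      moreover have "x t k = y t ((p1 \<circ> p2) k)" if "k \<in> I" for k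
      proof (cases "k \<in> K")
        case True
        then have "p2 k = k" using p2(1) unfolding permutes_def by auto
        then show ?thesis using True p1(2) by (simp add: x_def)
      next
        case False
        then have "p2 k \<in> I - K" using permutes_in_image[OF p2(1), of k] that by simp
        then have "p1 (p2 k) = p2 k" using p1(1) unfolding permutes_def by auto
        then show ?thesis using False p2(2) that by (simp add: x_def)
      qed
      ultimately have "same_tuple I (x t) (y t)" unfolding same_tuple_def by blast
      then show "same_tuple I (x t) (z t)" using y(1)[OF t] by (rule same_tuple_trans)
    qed
    then show ?thesis by blast
  qed
  then show ?thesis using \<delta>(1) by blast
qed

text \<open>Kato, Perturbation Theory for Linear Operators, Theorem II.5.2.\<close>

theorem unordered_continuous_selection:
  assumes "finite I" "unordered_continuous I UNIV z"
  shows "\<exists>x. continuous_selection I UNIV z x"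
  using assms
proof (induction I arbitrary: z rule: finite_psubset_induct)
  case (psubset I)
  note z = psubset.prems
  \<comment> \<open>On F all entries coincide and there is nothing to choose; off F the tuple splits
    locally.\<close>
  define F where "F = {t. \<forall>i\<in>I. \<forall>j\<in>I. z t i = z t j}"
  have split: "\<exists>\<delta>>0. \<forall>u v. u \<le> v \<and> {u..v} \<subseteq> {t0 - \<delta><..<t0 + \<delta>} \<longrightarrow> (\<exists>x. continuous_selection I {u..v} z x)"
    if t0: "t0 \<notin> F" for t0
  proof -
    obtain i j where "i \<in> I" "j \<in> I" "z t0 i \<noteq> z t0 j" using t0 unfolding F_def by blast
    then show ?thesis using psubset.IH by (intro unordered_continuous_split[OF z psubset.hyps]) auto
  qed
  have "open (- F)"
    unfolding open_dist
  proof (intro ballI)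
    fix t0 assume "t0 \<in> - F"
    then obtain i j where ij: "i \<in> I" "j \<in> I" "z t0 i \<noteq> z t0 j" unfolding F_def by blast
    define e where "e = norm (z t0 i - z t0 j) / 2"
    have e: "e > 0" using ij by (simp add: e_def)
    obtain \<delta> where \<delta>: "\<delta> > 0" "\<And>t. \<bar>t - t0\<bar> < \<delta> \<Longrightarrow> \<exists>\<pi>. \<pi> permutes I \<and> (\<forall>k\<in>I. norm (z t k - z t0 (\<pi> k)) < e)"
      using z e unfolding unordered_continuous_def by (meson UNIV_I)
    have "t \<notin> F" if t: "\<bar>t - t0\<bar> < \<delta>" for t
    proof
      assume tF: "t \<in> F"
      obtain \<pi> where \<pi>: "\<pi> permutes I" "\<forall>k\<in>I. norm (z t k - z t0 (\<pi> k)) < e" using \<delta>(2)[OF t] by blast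
      have inv: "inv_into UNIV \<pi> k \<in> I" "\<pi> (inv_into UNIV \<pi> k) = k" if "k \<in> I" for k
        using permutes_inverses(1)[OF \<pi>(1)] permutes_inv[OF \<pi>(1)] that by (auto simp: permutes_in_image)
      have "norm (z t (inv_into UNIV \<pi> i) - z t0 i) < e" "norm (z t (inv_into UNIV \<pi> j) - z t0 j) < e"
        using \<pi>(2) inv ij by (metis)+
      moreover have "z t (inv_into UNIV \<pi> i) = z t (inv_into UNIV \<pi> j)" using tF inv ij unfolding F_def by blast
      ultimately have "norm (z t0 i - z t0 j) < e + e"
        by (metis norm_minus_commute norm_diff_triangle_less)
      then show False by (simp add: e_def)
    qed
    then show "\<exists>e>0. \<forall>y. dist y t0 < e \<longrightarrow> y \<in> - F" using \<delta>(1) by (auto simp: dist_real_def)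
  qed
  have comp: "\<exists>x. continuous_selection I (connected_component_set (- F) t) z x" for t
  proof (rule continuous_selection_exhaust)
    show "open (connected_component_set (- F) t)" by (rule open_connected_component[OF \<open>open (- F)\<close>])
    fix u v :: real assume uv: "u \<le> v" "{u..v} \<subseteq> connected_component_set (- F) t"
    then have sub: "{u..v} \<subseteq> - F" using connected_component_subset by blast
    \<comment> \<open>The inclusion stays a premise because bisection asks for the claim near every
      point; around points of F it is vacuous.\<close>
    have "{u..v} \<subseteq> - F \<longrightarrow> (\<exists>x. continuous_selection I {u..v} z x)"
      using uv(1)
    proof (induction rule: Bolzano)
      case (trans a b c)
      show ?case
      proof
        assume "{a..c} \<subseteq> - F"
        moreover have "{a..b} \<subseteq> {a..c}" "{b..c} \<subseteq> {a..c}" by (simp_all add: trans(3,4))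
        ultimately have "{a..b} \<subseteq> - F" "{b..c} \<subseteq> - F" by blast+
        then show "\<exists>x. continuous_selection I {a..c} z x"
          using trans continuous_selection_glue by metis
      qed
    next
      case (local t0)
      show ?case
      proof (cases "t0 \<in> F")
        case True
        then show ?thesis by (intro exI[of _ 1]) auto
      next
        case False
        then obtain \<delta> where \<delta>: "\<delta> > 0" "\<And>u v. u \<le> v \<Longrightarrow> {u..v} \<subseteq> {t0 - \<delta><..<t0 + \<delta>} \<Longrightarrow> (\<exists>x. continuous_selection I {u..v} z x)"
          using split[OF False] by blast
        show ?thesis
        proof (intro exI[of _ \<delta>] conjI allI impI \<delta>(1))
          fix a b assume ab: "a \<le> t0 \<and> t0 \<le> b \<and> b - a < \<delta>"
          show "\<exists>x. continuous_selection I {a..b} z x" using ab by (intro \<delta>(2)) auto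
        qed
      qed
    qed
    then show "\<exists>x. continuous_selection I {u..v} z x" using sub by blast
  qed simp
  define X where "X C = (SOME x. continuous_selection I C z x)" for C
  have X: "continuous_selection I (connected_component_set (- F) t) z (X (connected_component_set (- F) t))" for t
    unfolding X_def by (rule someI_ex[OF comp])
  \<comment> \<open>Selections on different components need no matching: at a point of F all entries
    are equal, so every numbering is continuous there.\<close>
  define x where "x t = (if t \<in> F then z t else X (connected_component_set (- F) t) t)" for t
  have sx: "same_tuple I (x t) (z t)" for t
    using X[of t] same_tuple_refl unfolding x_def continuous_selection_def
    by (cases "t \<in> F") (auto simp: connected_component_refl)
  have "isCont (\<lambda>t. x t k) t" if k: "k \<in> I" for t k
  proof (cases "t \<in> F")
    case True
    show ?thesis
      unfolding continuous_at_eps_delta dist_real_def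
    proof (intro allI impI)
      fix e :: real assume "e > 0"
      then obtain \<delta> where \<delta>: "\<delta> > 0" "\<And>s. \<bar>s - t\<bar> < \<delta> \<Longrightarrow> \<exists>\<pi>. \<pi> permutes I \<and> (\<forall>k\<in>I. norm (z s k - z t (\<pi> k)) < e)"
        using z unfolding unordered_continuous_def by (meson UNIV_I)
      have "norm (x s k - x t k) < e" if s: "\<bar>s - t\<bar> < \<delta>" for s
      proof -
        obtain \<pi> where \<pi>: "\<pi> permutes I" "\<forall>k\<in>I. norm (z s k - z t (\<pi> k)) < e" using \<delta>(2)[OF s] by blast
        obtain p where p: "p permutes I" "\<forall>k\<in>I. x s k = z s (p k)" using sx[of s] unfolding same_tuple_def by blast
        have pk: "p k \<in> I" "\<pi> (p k) \<in> I" using k p(1) \<pi>(1) by (auto simp: permutes_in_image)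
        have "z t (\<pi> (p k)) = z t k" using True pk(2) k unfolding F_def by blast
        then have "z t (\<pi> (p k)) = x t k" using True by (simp add: x_def)
        then show ?thesis using \<pi>(2) pk p(2) k by metis
      qed
      then show "\<exists>d>0. \<forall>x'. \<bar>x' - t\<bar> < d \<longrightarrow> dist (x x' k) (x t k) < e"
        using \<delta>(1) by (auto simp: dist_norm)
    qed
  next
    case False
    let ?C = "connected_component_set (- F) t"
    have oC: "open ?C" by (rule open_connected_component[OF \<open>open (- F)\<close>])
    have tC: "t \<in> ?C" using False by (simp add: connected_component_refl)
    have "continuous_on ?C (\<lambda>s. X ?C s k)" using X[of t] k unfolding continuous_selection_def by blast
    then have "isCont (\<lambda>s. X ?C s k) t" using oC tC by (simp add: continuous_on_eq_continuous_at)
    moreover have "\<forall>\<^sub>F s in nhds t. x s k = X ?C s k"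
      unfolding eventually_nhds
    proof (intro exI[of _ ?C] conjI oC tC ballI)
      fix s assume s: "s \<in> ?C"
      then have "connected_component_set (- F) s = ?C" by (metis connected_component_eq)
      moreover have "s \<notin> F" using s connected_component_subset by blast
      ultimately show "x s k = X ?C s k" by (simp add: x_def)
    qed
    ultimately show ?thesis using isCont_cong by fast
  qed
  then have "continuous_selection I UNIV z x"
    using sx unfolding continuous_selection_def by (auto intro: continuous_at_imp_continuous_on)
  then show ?case by blast
qed

section \<open>Functions with an integrable density\<close>

text \<open>Absolute continuity of f with density g, expressed by integrals over all subintervals
  instead of a derivative almost everywhere.\<close>

definition has_density :: "(real \<Rightarrow> real) \<Rightarrow> (real \<Rightarrow> real) \<Rightarrow> real \<Rightarrow> real \<Rightarrow> bool" where
  "has_density f g a b \<longleftrightarrow> g absolutely_integrable_on {a..b} \<and>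
     (\<forall>x y. a \<le> x \<and> x \<le> y \<and> y \<le> b \<longrightarrow> (g has_integral (f y - f x)) {x..y})"

text \<open>Bisection carries the bound of R by \<open>\<epsilon> * \<mu>\<close> from short
  intervals around each point to the whole interval, and \<open>\<epsilon>\<close> is
  arbitrary.\<close>

lemma additive_interval_zero:
  fixes R \<mu> :: "real \<Rightarrow> real \<Rightarrow> real"
  assumes "a \<le> b"
    and R: "\<And>u w v. a \<le> u \<Longrightarrow> u \<le> w \<Longrightarrow> w \<le> v \<Longrightarrow> v \<le> b \<Longrightarrow> R u v = R u w + R w v"
    and \<mu>: "\<And>u w v. a \<le> u \<Longrightarrow> u \<le> w \<Longrightarrow> w \<le> v \<Longrightarrow> v \<le> b \<Longrightarrow> \<mu> u v = \<mu> u w + \<mu> w v"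
    and loc: "\<And>\<epsilon> x. \<epsilon> > 0 \<Longrightarrow> a \<le> x \<Longrightarrow> x \<le> b \<Longrightarrow> \<exists>\<delta>>0. \<forall>u v. a \<le> u \<and> u \<le> x \<and> x \<le> v \<and> v \<le> b \<and> v - u < \<delta>
      \<longrightarrow> \<bar>R u v\<bar> \<le> \<epsilon> * \<mu> u v"
  shows "R a b = 0"
proof -
  have *: "\<bar>R a b\<bar> \<le> \<epsilon> * \<mu> a b" if e: "\<epsilon> > 0" for \<epsilon>
  proof -
    have "a \<le> a \<and> b \<le> b \<longrightarrow> \<bar>R a b\<bar> \<le> \<epsilon> * \<mu> a b"
      using assms(1)
    proof (induction rule: Bolzano[where P = "\<lambda>u v. a \<le> u \<and> v \<le> b \<longrightarrow> \<bar>R u v\<bar> \<le> \<epsilon> * \<mu> u v"])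
      case (trans u w v)
      show ?case
      proof
        assume uv: "a \<le> u \<and> v \<le> b"
        have "\<bar>R u w\<bar> \<le> \<epsilon> * \<mu> u w" "\<bar>R w v\<bar> \<le> \<epsilon> * \<mu> w v" using trans uv by auto
        then have "\<bar>R u w + R w v\<bar> \<le> \<epsilon> * (\<mu> u w + \<mu> w v)"
          unfolding distrib_left by (smt (verit))
        then show "\<bar>R u v\<bar> \<le> \<epsilon> * \<mu> u v" using R[of u w v] \<mu>[of u w v] uv trans by simp
      qed
    next
      case (local x)
      obtain \<delta> where "\<delta> > 0" "\<forall>u v. a \<le> u \<and> u \<le> x \<and> x \<le> v \<and> v \<le> b \<and> v - u < \<delta> \<longrightarrow> \<bar>R u v\<bar> \<le> \<epsilon> * \<mu> u v"
        using loc[OF e local] by blast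
      then show ?case by (intro exI[of _ \<delta>]) auto
    qed
    then show ?thesis by simp
  qed
  show ?thesis
  proof (rule ccontr)
    assume "R a b \<noteq> 0"
    then have pos: "\<bar>R a b\<bar> > 0" by simp
    have mu: "0 < \<mu> a b" using *[of 1] pos by simp
    have "\<bar>R a b\<bar> \<le> \<bar>R a b\<bar> / (2 * \<mu> a b) * \<mu> a b" using pos mu by (intro *) simp
    then show False using mu pos by simp
  qed
qed

lemma has_densityD:
  assumes "has_density f g a b"
  shows "g absolutely_integrable_on {a..b}"
    "\<And>x y. a \<le> x \<Longrightarrow> x \<le> y \<Longrightarrow> y \<le> b \<Longrightarrow> (g has_integral (f y - f x)) {x..y}"
    "\<And>x y. a \<le> x \<Longrightarrow> x \<le> y \<Longrightarrow> y \<le> b \<Longrightarrow> integral {x..y} g = f y - f x"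
    "\<And>x y. a \<le> x \<Longrightarrow> x \<le> y \<Longrightarrow> y \<le> b \<Longrightarrow> g absolutely_integrable_on {x..y}"
  using assms unfolding has_density_def
  by (auto intro: integral_unique absolutely_integrable_on_subinterval)

lemma has_density_subinterval:
  assumes "has_density f g a b" "a \<le> a'" "b' \<le> b"
  shows "has_density f g a' b'"
  using assms unfolding has_density_def
  by (auto intro: absolutely_integrable_on_subinterval)

lemma has_density_cong:
  assumes "has_density f g a b" "\<And>x. x \<in> {a..b} \<Longrightarrow> f x = f' x" "\<And>x. x \<in> {a..b} \<Longrightarrow> g x = g' x"
  shows "has_density f' g' a b"
proof -
  have "g' absolutely_integrable_on {a..b}"
    by (rule absolutely_integrable_spike[OF has_densityD(1)[OF assms(1)], of "{}"]) (use assms(3) in auto)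
  moreover have "(g' has_integral f' y - f' x) {x..y}" if "a \<le> x" "x \<le> y" "y \<le> b" for x y
  proof (rule has_integral_eq[where f = g])
    show "(g has_integral f' y - f' x) {x..y}"
      using has_densityD(2)[OF assms(1) that] assms(2)[of x] assms(2)[of y] that by simp
  qed (use assms(3) that in auto)
  ultimately show ?thesis unfolding has_density_def by blast
qed

lemma has_density_continuous:
  assumes "has_density f g a b"
  shows "continuous_on {a..b} f"
proof (cases "a \<le> b")
  case True
  have "continuous_on {a..b} (\<lambda>x. f a + integral {a..x} g)"
    using has_densityD(1)[OF assms]
    by (intro continuous_intros indefinite_integral_continuous_1 set_lebesgue_integral_eq_integral(1)) auto
  then show ?thesis
    by (rule continuous_on_cong[THEN iffD1, rotated 2]) (auto simp: has_densityD(3)[OF assms])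
qed simp

lemma has_density_C1:
  assumes "\<And>x. x \<in> {a..b} \<Longrightarrow> (f has_real_derivative f' x) (at x within {a..b})" "continuous_on {a..b} f'"
  shows "has_density f f' a b"
  unfolding has_density_def
proof (intro conjI allI impI)
  show "f' absolutely_integrable_on {a..b}" by (rule absolutely_integrable_continuous_real[OF assms(2)])
  fix x y assume xy: "a \<le> x \<and> x \<le> y \<and> y \<le> b"
  show "(f' has_integral f y - f x) {x..y}"
  proof (rule fundamental_theorem_of_calculus)
    fix s assume "s \<in> {x..y}"
    then show "(f has_vector_derivative f' s) (at s within {x..y})"
      using assms(1)[of s] xy unfolding has_real_derivative_iff_has_vector_derivative
      by (auto intro: has_vector_derivative_within_subset)
  qed (use xy in auto)
qed

lemma has_density_add:
  assumes "has_density f f' a b" "has_density g g' a b"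
  shows "has_density (\<lambda>t. f t + g t) (\<lambda>t. f' t + g' t) a b"
  unfolding has_density_def
proof (intro conjI allI impI)
  show "(\<lambda>t. f' t + g' t) absolutely_integrable_on {a..b}"
    using has_densityD(1)[OF assms(1)] has_densityD(1)[OF assms(2)] by (rule set_integral_add(1))
  fix x y assume xy: "a \<le> x \<and> x \<le> y \<and> y \<le> b"
  then have "((\<lambda>t. f' t + g' t) has_integral (f y - f x) + (g y - g x)) {x..y}"
    by (intro has_integral_add has_densityD(2)[OF assms(1)] has_densityD(2)[OF assms(2)]) auto
  then show "((\<lambda>t. f' t + g' t) has_integral f y + g y - (f x + g x)) {x..y}"
    by (simp add: algebra_simps)
qed

lemma has_density_cmult:
  assumes "has_density f f' a b"
  shows "has_density (\<lambda>t. c * f t) (\<lambda>t. c * f' t) a b"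
  unfolding has_density_def
proof (intro conjI allI impI)
  show "(\<lambda>t. c * f' t) absolutely_integrable_on {a..b}"
    using has_densityD(1)[OF assms] by simp
  fix x y assume "a \<le> x \<and> x \<le> y \<and> y \<le> b"
  then show "((\<lambda>t. c * f' t) has_integral c * f y - c * f x) {x..y}"
    using has_integral_mult_right[OF has_densityD(2)[OF assms, of x y], of c] by (simp add: algebra_simps)
qed

lemma has_density_const: "has_density (\<lambda>t. c) (\<lambda>t. 0) a b"
  unfolding has_density_def by simp

lemma has_density_diff:
  assumes "has_density f f' a b" "has_density g g' a b"
  shows "has_density (\<lambda>t. f t - g t) (\<lambda>t. f' t - g' t) a b"
  using has_density_add[OF assms(1) has_density_cmult[OF assms(2), of "-1"]] by simp

lemma has_density_sum:
  assumes "\<And>i. i \<in> I \<Longrightarrow> has_density (f i) (f' i) a b"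
  shows "has_density (\<lambda>t. \<Sum>i\<in>I. f i t) (\<lambda>t. \<Sum>i\<in>I. f' i t) a b"
proof (cases "finite I")
  case True
  then show ?thesis using assms
    by (induction I rule: finite_induct) (auto intro: has_density_add has_density_const)
qed (simp add: has_density_const)

lemma absolutely_integrable_mult_continuous:
  fixes f g :: "real \<Rightarrow> real"
  assumes "f absolutely_integrable_on {a..b}" "continuous_on {a..b} g"
  shows "(\<lambda>t. f t * g t) absolutely_integrable_on {a..b}"
proof -
  have "(\<lambda>t. g t * f t) absolutely_integrable_on {a..b}"
  proof (rule absolutely_integrable_bounded_measurable_product_real[OF _ _ _ assms(1)])
    show "g \<in> borel_measurable (lebesgue_on {a..b})"
      by (rule continuous_imp_measurable_on_sets_lebesgue[OF assms(2)]) simp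
    show "bounded (g ` {a..b})"
      by (rule compact_imp_bounded[OF compact_continuous_image[OF assms(2)]]) simp
  qed simp
  then show ?thesis by (simp add: mult.commute)
qed

text \<open>The common core of the product and the quotient rule: both sides are additive functions of the interval
  that differ by \<open>\<epsilon> \<integral> (|f'| + |g'|)\<close> on short intervals.\<close>

lemma has_densityI_local:
  assumes h': "h' absolutely_integrable_on {a..b}" and m: "m absolutely_integrable_on {a..b}"
    and loc: "\<And>\<epsilon> x. \<epsilon> > 0 \<Longrightarrow> a \<le> x \<Longrightarrow> x \<le> b \<Longrightarrow> \<exists>\<delta>>0. \<forall>u v. a \<le> u \<and> u \<le> x \<and> x \<le> v \<and> v \<le> b \<and> v - u < \<delta>
      \<longrightarrow> (\<exists>k. (k has_integral (h v - h u)) {u..v} \<and> (\<forall>t\<in>{u..v}. \<bar>k t - h' t\<bar> \<le> \<epsilon> * m t))"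
  shows "has_density h h' a b"
  unfolding has_density_def
proof (intro conjI allI impI)
  show "h' absolutely_integrable_on {a..b}" by fact
  fix x y assume xy: "a \<le> x \<and> x \<le> y \<and> y \<le> b"
  have int: "h' integrable_on {u..v}" "m integrable_on {u..v}" if "a \<le> u" "v \<le> b" for u v
    using that by (auto intro!: set_lebesgue_integral_eq_integral(1)
      absolutely_integrable_on_subinterval[OF h'] absolutely_integrable_on_subinterval[OF m])
  have comb: "integral {u..v} k = integral {u..w} k + integral {w..v} k"
    if "a \<le> u" "u \<le> w" "w \<le> v" "v \<le> b" "k \<in> {h', m}" for u w v k
    using int[of u v] that by (auto simp: Henstock_Kurzweil_Integration.integral_combine)
  have "h y - h x - integral {x..y} h' = 0"
  proof (rule additive_interval_zero[where R = "\<lambda>u v. h v - h u - integral {u..v} h'" and \<mu> = "\<lambda>u v. integral {u..v} m"])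
    fix \<epsilon> s :: real assume e: "\<epsilon> > 0" "x \<le> s" "s \<le> y"
    then obtain \<delta> where \<delta>: "\<delta> > 0" "\<And>u v. a \<le> u \<Longrightarrow> u \<le> s \<Longrightarrow> s \<le> v \<Longrightarrow> v \<le> b \<Longrightarrow> v - u < \<delta> \<Longrightarrow>
      (\<exists>k. (k has_integral (h v - h u)) {u..v} \<and> (\<forall>t\<in>{u..v}. \<bar>k t - h' t\<bar> \<le> \<epsilon> * m t))"
      using loc[of \<epsilon> s] xy by auto
    show "\<exists>\<delta>>0. \<forall>u v. x \<le> u \<and> u \<le> s \<and> s \<le> v \<and> v \<le> y \<and> v - u < \<delta>
      \<longrightarrow> \<bar>h v - h u - integral {u..v} h'\<bar> \<le> \<epsilon> * integral {u..v} m"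
    proof (intro exI[of _ \<delta>] conjI allI impI \<delta>(1))
      fix u v assume "x \<le> u \<and> u \<le> s \<and> s \<le> v \<and> v \<le> y \<and> v - u < \<delta>"
      then have uv: "a \<le> u" "u \<le> s" "s \<le> v" "v \<le> b" "v - u < \<delta>" using xy by auto
      obtain k where k: "(k has_integral (h v - h u)) {u..v}" "\<And>t. t \<in> {u..v} \<Longrightarrow> \<bar>k t - h' t\<bar> \<le> \<epsilon> * m t"
        using \<delta>(2)[OF uv] by blast
      have d: "((\<lambda>t. k t - h' t) has_integral (h v - h u - integral {u..v} h')) {u..v}"
        using int uv by (intro has_integral_diff k(1) integrable_integral) auto
      have "norm (integral {u..v} (\<lambda>t. k t - h' t)) \<le> integral {u..v} (\<lambda>t. \<epsilon> * m t)"
        using d k(2) integrable_cmul[OF int(2), of u v \<epsilon>] uv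
        by (intro integral_norm_bound_integral) auto
      then show "\<bar>h v - h u - integral {u..v} h'\<bar> \<le> \<epsilon> * integral {u..v} m"
        using integral_unique[OF d] by simp
    qed
  next
    show "x \<le> y" using xy by simp
    fix u w v assume "x \<le> u" "u \<le> w" "w \<le> v" "v \<le> y"
    then have uwv: "a \<le> u" "u \<le> w" "w \<le> v" "v \<le> b" using xy by simp_all
    show "integral {u..v} m = integral {u..w} m + integral {w..v} m" by (rule comb[OF uwv]) simp
    have "integral {u..v} h' = integral {u..w} h' + integral {w..v} h'" by (rule comb[OF uwv]) simp
    then show "h v - h u - integral {u..v} h' = (h w - h u - integral {u..w} h') + (h v - h w - integral {w..v} h')"
      by simp
  qed
  then have e: "h y - h x = integral {x..y} h'" by simp
  have "h' integrable_on {x..y}" using xy by (intro int(1)) auto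
  then show "(h' has_integral h y - h x) {x..y}" unfolding e by (rule integrable_integral)
qed

lemma continuous_on_near:
  fixes f :: "real \<Rightarrow> real"
  assumes "continuous_on {a..b} f" "x \<in> {a..b}" "\<epsilon> > 0"
  obtains \<delta> where "\<delta> > 0" "\<And>t. t \<in> {a..b} \<Longrightarrow> \<bar>t - x\<bar> < \<delta> \<Longrightarrow> \<bar>f t - f x\<bar> < \<epsilon>"
  using assms unfolding continuous_on_iff dist_real_def by metis

lemma has_density_mult:
  assumes f: "has_density f f' a b" and g: "has_density g g' a b"
  shows "has_density (\<lambda>t. f t * g t) (\<lambda>t. f' t * g t + f t * g' t) a b"
proof (rule has_densityI_local[where m = "\<lambda>t. \<bar>f' t\<bar> + \<bar>g' t\<bar>"])
  note cf = has_density_continuous[OF f] and cg = has_density_continuous[OF g]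
  show "(\<lambda>t. f' t * g t + f t * g' t) absolutely_integrable_on {a..b}"
    using absolutely_integrable_mult_continuous[OF has_densityD(1)[OF f] cg]
      absolutely_integrable_mult_continuous[OF has_densityD(1)[OF g] cf]
    by (auto intro!: set_integral_add(1) simp: mult.commute)
  show "(\<lambda>t. \<bar>f' t\<bar> + \<bar>g' t\<bar>) absolutely_integrable_on {a..b}"
    using has_densityD(1)[OF f] has_densityD(1)[OF g]
    by (intro set_integral_add(1)) (auto intro: set_integrable_abs)
  fix \<epsilon> x :: real assume e: "\<epsilon> > 0" "a \<le> x" "x \<le> b"
  then obtain \<delta>1 \<delta>2 where \<delta>1: "\<delta>1 > 0" "\<And>t. t \<in> {a..b} \<Longrightarrow> \<bar>t - x\<bar> < \<delta>1 \<Longrightarrow> \<bar>f t - f x\<bar> < \<epsilon> / 2"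
    and \<delta>2: "\<delta>2 > 0" "\<And>t. t \<in> {a..b} \<Longrightarrow> \<bar>t - x\<bar> < \<delta>2 \<Longrightarrow> \<bar>g t - g x\<bar> < \<epsilon> / 2"
    using continuous_on_near[OF cf, of x "\<epsilon> / 2"] continuous_on_near[OF cg, of x "\<epsilon> / 2"]
    by (metis atLeastAtMost_iff half_gt_zero)
  show "\<exists>\<delta>>0. \<forall>u v. a \<le> u \<and> u \<le> x \<and> x \<le> v \<and> v \<le> b \<and> v - u < \<delta>
      \<longrightarrow> (\<exists>k. (k has_integral (f v * g v - f u * g u)) {u..v} \<and>
        (\<forall>t\<in>{u..v}. \<bar>k t - (f' t * g t + f t * g' t)\<bar> \<le> \<epsilon> * (\<bar>f' t\<bar> + \<bar>g' t\<bar>)))"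
  proof (intro exI[of _ "min \<delta>1 \<delta>2"] conjI allI impI)
    fix u v assume uv: "a \<le> u \<and> u \<le> x \<and> x \<le> v \<and> v \<le> b \<and> v - u < min \<delta>1 \<delta>2"
    have fi: "(f' has_integral f v - f u) {u..v}" and gi: "(g' has_integral g v - g u) {u..v}"
      using uv by (auto intro!: has_densityD(2)[OF f] has_densityD(2)[OF g])
    \<comment> \<open>With one factor frozen at the left end and the other at the right end, the
      integral is exactly the increment of the product. Continuity controls the error against the
      true integrand.\<close>
    have "((\<lambda>t. g u * f' t + f v * g' t) has_integral g u * (f v - f u) + f v * (g v - g u)) {u..v}"
      by (intro has_integral_add has_integral_mult_right fi gi)
    then have "((\<lambda>t. g u * f' t + f v * g' t) has_integral f v * g v - f u * g u) {u..v}"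
      by (simp add: algebra_simps)
    moreover have "\<bar>(g u * f' t + f v * g' t) - (f' t * g t + f t * g' t)\<bar> \<le> \<epsilon> * (\<bar>f' t\<bar> + \<bar>g' t\<bar>)"
      if t: "t \<in> {u..v}" for t
    proof -
      have "u \<in> {a..b}" "\<bar>u - x\<bar> < min \<delta>1 \<delta>2" "t \<in> {a..b}" "\<bar>t - x\<bar> < min \<delta>1 \<delta>2"
        "v \<in> {a..b}" "\<bar>v - x\<bar> < min \<delta>1 \<delta>2"
        using t uv by auto
      then have "\<bar>g u - g x\<bar> < \<epsilon> / 2" "\<bar>g t - g x\<bar> < \<epsilon> / 2" "\<bar>f v - f x\<bar> < \<epsilon> / 2" "\<bar>f t - f x\<bar> < \<epsilon> / 2"
        using \<delta>1(2) \<delta>2(2) by (meson min_less_iff_conj)+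
      then have 1: "\<bar>g u - g t\<bar> \<le> \<epsilon>" "\<bar>f v - f t\<bar> \<le> \<epsilon>" by (smt (verit) field_sum_of_halves)+
      have "(g u * f' t + f v * g' t) - (f' t * g t + f t * g' t) = (g u - g t) * f' t + (f v - f t) * g' t"
        by (simp add: algebra_simps)
      then have "\<bar>(g u * f' t + f v * g' t) - (f' t * g t + f t * g' t)\<bar>
          \<le> \<bar>g u - g t\<bar> * \<bar>f' t\<bar> + \<bar>f v - f t\<bar> * \<bar>g' t\<bar>"
        by (simp add: abs_mult[symmetric] abs_triangle_ineq)
      also have "\<dots> \<le> \<epsilon> * \<bar>f' t\<bar> + \<epsilon> * \<bar>g' t\<bar>"
        using 1 by (intro add_mono mult_right_mono) auto
      finally show ?thesis by (simp add: distrib_left)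
    qed
    ultimately show "\<exists>k. (k has_integral (f v * g v - f u * g u)) {u..v} \<and>
        (\<forall>t\<in>{u..v}. \<bar>k t - (f' t * g t + f t * g' t)\<bar> \<le> \<epsilon> * (\<bar>f' t\<bar> + \<bar>g' t\<bar>))" by blast
  qed (use \<delta>1(1) \<delta>2(1) in auto)
qed

lemma has_density_inverse:
  assumes f: "has_density f f' a b" and nz: "\<And>t. t \<in> {a..b} \<Longrightarrow> f t \<noteq> 0"
  shows "has_density (\<lambda>t. 1 / f t) (\<lambda>t. - (f' t / (f t)\<^sup>2)) a b"
proof (rule has_densityI_local[where m = "\<lambda>t. \<bar>f' t\<bar>"])
  note cf = has_density_continuous[OF f]
  define h where "h t = 1 / f t" for t
  have ch: "continuous_on {a..b} h" unfolding h_def using nz by (intro continuous_intros cf) auto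
  show "(\<lambda>t. - (f' t / (f t)\<^sup>2)) absolutely_integrable_on {a..b}"
  proof -
    have "continuous_on {a..b} (\<lambda>t. - (h t)\<^sup>2)" by (intro continuous_intros ch)
    from absolutely_integrable_mult_continuous[OF has_densityD(1)[OF f] this]
    show ?thesis by (simp add: h_def power_divide)
  qed
  show "(\<lambda>t. \<bar>f' t\<bar>) absolutely_integrable_on {a..b}"
    using has_densityD(1)[OF f] by (rule set_integrable_abs)
  fix \<epsilon> x :: real assume e: "\<epsilon> > 0" "a \<le> x" "x \<le> b"
  \<comment> \<open>The minimum with 1 gives
    \<open>\<bar>h t\<bar> \<le> \<bar>h x\<bar> + 1\<close> near x; the other term makes
    \<open>2 (\<bar>h x\<bar> + 1) \<eta>\<close> at most \<open>\<epsilon> / 2\<close>.\<close>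
  define \<eta> where "\<eta> = min 1 (\<epsilon> / (4 * (\<bar>h x\<bar> + 1)))"
  have \<eta>: "\<eta> > 0" using e by (simp add: \<eta>_def)
  obtain \<delta> where \<delta>: "\<delta> > 0" "\<And>t. t \<in> {a..b} \<Longrightarrow> \<bar>t - x\<bar> < \<delta> \<Longrightarrow> \<bar>h t - h x\<bar> < \<eta>"
    using continuous_on_near[OF ch _ \<eta>, of x] e by auto
  have prod: "\<bar>h s * h t - h x * h x\<bar> \<le> \<epsilon> / 2" if "\<bar>h s - h x\<bar> < \<eta>" "\<bar>h t - h x\<bar> < \<eta>" for s t
  proof -
    have "h s * h t - h x * h x = (h s - h x) * h t + h x * (h t - h x)" by (simp add: algebra_simps)
    then have "\<bar>h s * h t - h x * h x\<bar> \<le> \<bar>h s - h x\<bar> * \<bar>h t\<bar> + \<bar>h x\<bar> * \<bar>h t - h x\<bar>"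
      by (simp add: abs_mult[symmetric] abs_triangle_ineq)
    also have "\<dots> \<le> \<eta> * (\<bar>h x\<bar> + 1) + (\<bar>h x\<bar> + 1) * \<eta>"
    proof (intro add_mono mult_mono)
      show "\<bar>h t\<bar> \<le> \<bar>h x\<bar> + 1" using that(2) unfolding \<eta>_def by (smt (verit) min.cobounded1)
    qed (use that \<eta> in auto)
    also have "\<dots> = 2 * (\<bar>h x\<bar> + 1) * \<eta>" by (simp add: algebra_simps)
    also have "\<dots> \<le> 2 * (\<bar>h x\<bar> + 1) * (\<epsilon> / (4 * (\<bar>h x\<bar> + 1)))"
      by (intro mult_left_mono) (auto simp: \<eta>_def)
    also have "\<dots> = \<epsilon> / 2" by (simp add: field_simps)
    finally show ?thesis .
  qed
  show "\<exists>\<delta>>0. \<forall>u v. a \<le> u \<and> u \<le> x \<and> x \<le> v \<and> v \<le> b \<and> v - u < \<delta>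
      \<longrightarrow> (\<exists>k. (k has_integral (1 / f v - 1 / f u)) {u..v} \<and>
        (\<forall>t\<in>{u..v}. \<bar>k t - - (f' t / (f t)\<^sup>2)\<bar> \<le> \<epsilon> * \<bar>f' t\<bar>))"
  proof (intro exI[of _ \<delta>] conjI allI impI \<delta>(1))
    fix u v assume uv: "a \<le> u \<and> u \<le> x \<and> x \<le> v \<and> v \<le> b \<and> v - u < \<delta>"
    \<comment> \<open>The constant factor \<open>- (h u * h v)\<close> is chosen so that the
      integral is exactly the increment of \<open>1 / f\<close>.\<close>
    have fi: "((\<lambda>t. - (h u * h v) * f' t) has_integral - (h u * h v) * (f v - f u)) {u..v}"
      using uv by (intro has_integral_mult_right has_densityD(2)[OF f]) auto
    have "f u \<noteq> 0" "f v \<noteq> 0" using nz uv by auto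
    then have "- (h u * h v) * (f v - f u) = 1 / f v - 1 / f u" by (simp add: h_def field_simps)
    then have "((\<lambda>t. - (h u * h v) * f' t) has_integral (1 / f v - 1 / f u)) {u..v}" using fi by simp
    moreover have "\<bar>- (h u * h v) * f' t - - (f' t / (f t)\<^sup>2)\<bar> \<le> \<epsilon> * \<bar>f' t\<bar>" if t: "t \<in> {u..v}" for t
    proof -
      have n: "\<bar>h u - h x\<bar> < \<eta>" "\<bar>h v - h x\<bar> < \<eta>" "\<bar>h t - h x\<bar> < \<eta>"
        using t uv by (auto intro!: \<delta>(2))
      have "\<bar>h t * h t - h u * h v\<bar> \<le> \<epsilon>" using prod[OF n(1,2)] prod[OF n(3,3)] by (smt (verit) field_sum_of_halves)
      moreover have "- (h u * h v) * f' t - - (f' t / (f t)\<^sup>2) = (h t * h t - h u * h v) * f' t"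
        by (simp add: h_def algebra_simps power2_eq_square)
      ultimately show ?thesis by (simp add: abs_mult mult_right_mono)
    qed
    ultimately show "\<exists>k. (k has_integral (1 / f v - 1 / f u)) {u..v} \<and>
        (\<forall>t\<in>{u..v}. \<bar>k t - - (f' t / (f t)\<^sup>2)\<bar> \<le> \<epsilon> * \<bar>f' t\<bar>)" by blast
  qed
qed

text \<open>The second part keeps track of the L1 norm, which must add up when many short pieces are
  chained.\<close>

lemma has_density_patch:
  assumes "has_density f g a b" "has_density f g' b c" "a \<le> b" "b \<le> c"
  shows "has_density f (\<lambda>t. if t \<le> b then g t else g' t) a c"
    and "integral {a..c} (\<lambda>t. \<bar>if t \<le> b then g t else g' t\<bar>) = integral {a..b} (\<lambda>t. \<bar>g t\<bar>) + integral {b..c} (\<lambda>t. \<bar>g' t\<bar>)"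
proof -
  let ?h = "\<lambda>t. if t \<le> b then g t else g' t"
  have h1: "?h absolutely_integrable_on {a..b}"
    by (rule absolutely_integrable_spike[OF has_densityD(1)[OF assms(1)], of "{}"]) auto
  have h2: "?h absolutely_integrable_on {b..c}"
    by (rule absolutely_integrable_spike[OF has_densityD(1)[OF assms(2)], of "{b}"]) auto
  have U: "{a..b} \<union> {b..c} = {a..c}" using assms by auto
  have h: "?h absolutely_integrable_on {a..c}"
    using absolutely_integrable_Un[OF h1 h2] unfolding U .
  have i1: "(?h has_integral f y - f x) {x..y}" if "a \<le> x" "x \<le> y" "y \<le> b" for x y
    by (rule has_integral_eq[rotated, OF has_densityD(2)[OF assms(1) that]]) (use that in auto)
  have i2: "(?h has_integral f y - f x) {x..y}" if "b \<le> x" "x \<le> y" "y \<le> c" for x y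
    by (rule has_integral_spike[OF _ _ has_densityD(2)[OF assms(2) that], of "{b}"]) (use that in auto)
  have "(?h has_integral f y - f x) {x..y}" if "a \<le> x" "x \<le> y" "y \<le> c" for x y
  proof (cases "y \<le> b \<or> b \<le> x")
    case True
    then show ?thesis using that i1 i2 by auto
  next
    case False
    then have "(?h has_integral (f b - f x) + (f y - f b)) {x..y}"
      using that by (intro has_integral_combine[OF _ _ i1 i2]) auto
    then show ?thesis by simp
  qed
  then show "has_density f ?h a c" using h unfolding has_density_def by blast
  have "integral {a..c} (\<lambda>t. \<bar>?h t\<bar>) = integral {a..b} (\<lambda>t. \<bar>?h t\<bar>) + integral {b..c} (\<lambda>t. \<bar>?h t\<bar>)"
    using Henstock_Kurzweil_Integration.integral_combine[OF assms(3,4)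
      set_lebesgue_integral_eq_integral(1)[OF set_integrable_abs[OF h]]] by simp
  also have "integral {a..b} (\<lambda>t. \<bar>?h t\<bar>) = integral {a..b} (\<lambda>t. \<bar>g t\<bar>)"
    by (rule integral_cong) auto
  also have "integral {b..c} (\<lambda>t. \<bar>?h t\<bar>) = integral {b..c} (\<lambda>t. \<bar>g' t\<bar>)"
    by (rule integral_spike[of "{b}"]) auto
  finally show "integral {a..c} (\<lambda>t. \<bar>if t \<le> b then g t else g' t\<bar>) = integral {a..b} (\<lambda>t. \<bar>g t\<bar>) + integral {b..c} (\<lambda>t. \<bar>g' t\<bar>)" .
qed

section \<open>Weak derivatives on intervals\<close>

lemma deriv_funpow:
  assumes "\<And>i x. (D i has_real_derivative D (Suc i) x) (at x)"
  shows "(deriv ^^ i) (D 0) = D i"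
proof (induction i)
  case (Suc i)
  have "deriv (D i) = D (Suc i)" by (rule ext) (rule DERIV_imp_deriv[OF assms])
  then show ?case using Suc by simp
qed simp

text \<open>The classical smooth function that is flat at 0, with a polynomial factor in
  \<open>1 / x\<close> so that the class is closed under differentiation.\<close>

definition flat :: "real poly \<Rightarrow> real \<Rightarrow> real" where
  "flat p x = (if 0 < x then poly p (1 / x) * exp (- (1 / x)) else 0)"

lemma poly_mult_exp_tendsto_0: "((\<lambda>y. poly p y * exp (- y)) \<longlongrightarrow> (0::real)) at_top"
proof -
  have "((\<lambda>y. \<Sum>i\<le>degree p. coeff p i * (y ^ i / exp y)) \<longlongrightarrow> (\<Sum>i\<le>degree p. coeff p i * 0)) at_top"
    by (intro tendsto_intros tendsto_power_div_exp_0)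
  moreover have "(\<lambda>y. \<Sum>i\<le>degree p. coeff p i * (y ^ i / exp y)) = (\<lambda>y. poly p y * exp (- y))"
    by (simp add: poly_altdef sum_distrib_right exp_minus divide_inverse mult.assoc)
  ultimately show ?thesis by simp
qed

text \<open>With \<open>y = 1 / x\<close>, the derivative of \<open>p(y) exp(-y)\<close> is
  \<open>y^2 (p(y) - p'(y)) exp(-y)\<close>, and \<open>[:0, 0, 1:]\<close> is the polynomial
  \<open>y^2\<close>. At 0 the right difference quotient is \<open>y p(y) exp(-y)\<close>, which
  tends to 0.\<close>

lemma flat_has_derivative:
  "(flat p has_real_derivative flat ([:0, 0, 1:] * (p - pderiv p)) x) (at x)"
proof -
  consider "x > 0" | "x < 0" | "x = 0" by linarith
  then show ?thesis
  proof cases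
    case 1
    have "((\<lambda>x. poly p (1 / x) * exp (- (1 / x))) has_real_derivative flat ([:0, 0, 1:] * (p - pderiv p)) x) (at x)"
      using 1 by (auto intro!: derivative_eq_intros simp: flat_def field_simps power2_eq_square)
    then show ?thesis
      by (rule has_field_derivative_transform_within_open[of _ _ _ "{0<..}"]) (use 1 in \<open>auto simp: flat_def\<close>)
  next
    case 2
    have "((\<lambda>x. 0) has_real_derivative flat ([:0, 0, 1:] * (p - pderiv p)) x) (at x)"
      using 2 by (simp add: flat_def)
    then show ?thesis
      by (rule has_field_derivative_transform_within_open[of _ _ _ "{..<0}"]) (use 2 in \<open>auto simp: flat_def\<close>)
  next
    case 3
    have "((\<lambda>h. poly (pCons 0 p) (inverse h) * exp (- inverse h)) \<longlongrightarrow> 0) (at_right (0::real))"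
      by (rule filterlim_compose[OF poly_mult_exp_tendsto_0 filterlim_inverse_at_top_right])
    then have "((\<lambda>y. (flat p y - flat p 0) / (y - 0)) \<longlongrightarrow> 0) (at_right 0)"
      by (rule Lim_transform_eventually)
        (auto simp: flat_def eventually_at_right_field divide_inverse intro!: exI[of _ 1])
    moreover have "((\<lambda>y. (flat p y - flat p 0) / (y - 0)) \<longlongrightarrow> 0) (at_left 0)"
      by (rule Lim_transform_eventually[OF tendsto_const])
        (auto simp: flat_def eventually_at_left_field intro!: exI[of _ "-1"])
    ultimately have "((\<lambda>y. (flat p y - flat p 0) / (y - 0)) \<longlongrightarrow> 0) (at 0)"
      by (rule filterlim_split_at[rotated])
    then show ?thesis using 3 by (simp add: has_field_derivative_iff flat_def)
  qed
qed

text \<open>A class that contains the bump function and is closed under differentiation, so that all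
  derivatives of the bump are explicit.\<close>

definition flat_products :: "(real poly \<times> real poly) list \<Rightarrow> real \<Rightarrow> real \<Rightarrow> real \<Rightarrow> real" where
  "flat_products L c d x = (\<Sum>(p, q)\<leftarrow>L. flat p (x - c) * flat q (d - x))"

definition flat_products_deriv :: "(real poly \<times> real poly) list \<Rightarrow> (real poly \<times> real poly) list" where
  "flat_products_deriv L = concat (map (\<lambda>(p, q).
     [([:0, 0, 1:] * (p - pderiv p), q), (- p, [:0, 0, 1:] * (q - pderiv q))]) L)"

lemma flat_uminus: "flat (- p) x = - flat p x"
  by (simp add: flat_def)

lemma flat_products_has_derivative:
  "(flat_products L c d has_real_derivative flat_products (flat_products_deriv L) c d x) (at x)"
proof (induction L)
  case Nil
  then show ?case by (simp add: flat_products_def[abs_def] flat_products_deriv_def)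
next
  case (Cons a L)
  obtain p q where a: "a = (p, q)" by fastforce
  have "((\<lambda>x. flat p (x - c)) has_real_derivative flat ([:0, 0, 1:] * (p - pderiv p)) (x - c) * 1) (at x)"
    by (rule DERIV_chain2[OF flat_has_derivative]) (auto intro!: derivative_eq_intros)
  moreover have "((\<lambda>x. flat q (d - x)) has_real_derivative flat ([:0, 0, 1:] * (q - pderiv q)) (d - x) * (-1)) (at x)"
    by (rule DERIV_chain2[OF flat_has_derivative]) (auto intro!: derivative_eq_intros)
  ultimately have "((\<lambda>x. flat p (x - c) * flat q (d - x) + flat_products L c d x) has_real_derivative
      (flat ([:0, 0, 1:] * (p - pderiv p)) (x - c) * 1 * flat q (d - x)
        + flat ([:0, 0, 1:] * (q - pderiv q)) (d - x) * (-1) * flat p (x - c))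
      + flat_products (flat_products_deriv L) c d x) (at x)"
    by (intro DERIV_add DERIV_mult Cons)
  moreover have "flat_products (a # L) c d = (\<lambda>x. flat p (x - c) * flat q (d - x) + flat_products L c d x)"
    by (simp add: flat_products_def[abs_def] a)
  moreover have "flat_products (flat_products_deriv (a # L)) c d x =
      (flat ([:0, 0, 1:] * (p - pderiv p)) (x - c) * 1 * flat q (d - x)
        + flat ([:0, 0, 1:] * (q - pderiv q)) (d - x) * (-1) * flat p (x - c))
      + flat_products (flat_products_deriv L) c d x"
    unfolding flat_products_def flat_products_deriv_def a by (simp add: flat_uminus algebra_simps del: mult_pCons_left)
  ultimately show ?case by simp
qed

text \<open>\<open>D i\<close> is the i-th derivative of the normalized bump. The whole sequence is
  returned because test functions need derivatives of all orders.\<close>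

lemma bump_exists:
  assumes "c < d"
  obtains D :: "nat \<Rightarrow> real \<Rightarrow> real" where
    "\<And>i x. (D i has_real_derivative D (Suc i) x) (at x)"
    "\<And>x. 0 \<le> D 0 x" "\<And>i x. x \<notin> {c<..<d} \<Longrightarrow> D i x = 0"
    "\<And>p q. p \<le> c \<Longrightarrow> d \<le> q \<Longrightarrow> (D 0 has_integral 1) {p..q}"
proof -
  define E where "E i = flat_products ((flat_products_deriv ^^ i) [([:1:], [:1:])]) c d" for i
  have E: "(E i has_real_derivative E (Suc i) x) (at x)" for i x
    unfolding E_def funpow.simps comp_apply by (rule flat_products_has_derivative)
  have E0: "E 0 x = (if c < x \<and> x < d then exp (- (1 / (x - c))) * exp (- (1 / (d - x))) else 0)" for x
    by (auto simp: E_def flat_products_def flat_def)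
  have Ez: "E i x = 0" if "x \<notin> {c<..<d}" for i x
  proof -
    have "(\<Sum>(p, q)\<leftarrow>L. flat p (x - c) * flat q (d - x)) = 0" for L
      using that by (induction L) (auto simp: flat_def)
    then show ?thesis unfolding E_def flat_products_def .
  qed
  have contE: "continuous_on S (E 0)" for S
    by (rule DERIV_continuous_on) (rule has_field_derivative_at_within[OF E])
  define J where "J = integral {c..d} (E 0)"
  have intE: "(E 0 has_integral J) {c..d}"
    unfolding J_def by (intro integrable_integral integrable_continuous_interval contE)
  have "J \<noteq> 0"
  proof
    assume "J = 0"
    have "E 0 ((c + d) / 2) = 0"
    proof (rule has_integral_0_cbox_imp_0[of c d "E 0"])
      show "continuous_on (cbox c d) (E 0)" by (rule contE)
      show "0 \<le> E 0 x" for x by (simp add: E0)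
      show "(E 0 has_integral 0) (cbox c d)" using intE \<open>J = 0\<close> by simp
      show "box c d \<noteq> {}" "(c + d) / 2 \<in> cbox c d" using assms by simp_all
    qed
    then show False using assms by (simp add: E0)
  qed
  moreover have "J \<ge> 0" using has_integral_nonneg[OF intE] E0 by simp
  ultimately have J: "J > 0" by simp
  define D where "D i x = E i x / J" for i x
  have "(D i has_real_derivative D (Suc i) x) (at x)" for i x
    unfolding D_def[abs_def] by (intro DERIV_cdivide E)
  moreover have "0 \<le> D 0 x" for x using J by (simp add: D_def E0)
  moreover have "D i x = 0" if "x \<notin> {c<..<d}" for i x using Ez[OF that] by (simp add: D_def)
  moreover have "(D 0 has_integral 1) {p..q}" if "p \<le> c" "d \<le> q" for p q
  proof -
    have "((\<lambda>x. E 0 x / J) has_integral J / J) {c..d}" by (rule has_integral_divide[OF intE])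
    then have "(D 0 has_integral 1) {c..d}" using J by (simp add: D_def[abs_def])
    then show ?thesis
      by (rule has_integral_on_superset) (use that Ez in \<open>auto simp: D_def\<close>)
  qed
  ultimately show ?thesis using that by blast
qed

text \<open>The zero integral makes the antiderivative vanish again to the right of the
  support.\<close>

lemma test_function_antiderivative:
  assumes D: "\<And>i x. (D i has_real_derivative D (Suc i) x) (at x)"
    and supp: "\<And>i x. x \<notin> {c..d} \<Longrightarrow> D i x = 0" and cd: "p < c" "c \<le> d" "d < q"
    and zero: "(D 0 has_integral 0) {p..q}"
  obtains \<phi> where "test_function {p<..<q} \<phi>" "deriv \<phi> = D 0"
proof -
  define \<phi> where "\<phi> x = integral {p..x} (D 0)" for x
  have cont: "continuous_on S (D 0)" for S
    by (rule DERIV_continuous_on) (rule has_field_derivative_at_within[OF D])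
  have left: "\<phi> x = 0" if "x < c" for x
  proof -
    have "integral {p..x} (D 0) = integral {p..x} (\<lambda>_. 0)"
      using that supp by (intro integral_cong) auto
    then show ?thesis by (simp add: \<phi>_def)
  qed
  have right: "\<phi> x = 0" if "d < x" for x
  proof -
    have "(D 0 has_integral 0) {p..max x q}"
      by (rule has_integral_on_superset[OF zero]) (use cd supp in auto)
    moreover have "integral {p..x} (D 0) + integral {x..max x q} (D 0) = integral {p..max x q} (D 0)"
      using that cd by (intro Henstock_Kurzweil_Integration.integral_combine integrable_continuous_interval cont) auto
    moreover have "integral {x..max x q} (D 0) = integral {x..max x q} (\<lambda>_. 0)"
      using that supp by (intro integral_cong) auto
    ultimately show ?thesis by (simp add: \<phi>_def integral_unique)
  qed
  have der: "(\<phi> has_real_derivative D 0 x) (at x)" for x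
  proof (cases "x < c")
    case True
    have "((\<lambda>_. 0) has_real_derivative D 0 x) (at x)" using supp[of x 0] True by simp
    then show ?thesis
      by (rule has_field_derivative_transform_within_open[of _ _ _ "{..<c}"]) (use True left in auto)
  next
    case False
    have "(\<phi> has_real_derivative D 0 x) (at x within {p..x+1})"
      unfolding \<phi>_def using False cd by (intro integral_has_real_derivative cont) auto
    moreover have "at x within {p..x+1} = at x" using False cd by (intro at_within_interior) auto
    ultimately show ?thesis by simp
  qed
  \<comment> \<open>The derivatives of \<open>\<phi>\<close>, shifted by one against D.\<close>
  define E where "E i = (case i of 0 \<Rightarrow> \<phi> | Suc j \<Rightarrow> D j)" for i
  have E: "(E i has_real_derivative E (Suc i) x) (at x)" for i x
    unfolding E_def using der D by (cases i) auto
  have "(deriv ^^ i) \<phi> = E i" for i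
    using deriv_funpow[of E, OF E] by (simp add: E_def)
  then have smooth: "(deriv ^^ i) \<phi> differentiable_on UNIV" for i
    using E by (metis differentiable_on_def has_field_derivative_imp_has_derivative differentiableI has_field_derivative_at_within)
  have sub: "{t. \<phi> t \<noteq> 0} \<subseteq> {c..d}"
    using left right by (auto simp: not_less[symmetric])
  then have "closure {t. \<phi> t \<noteq> 0} \<subseteq> {c..d}" by (rule closure_minimal) simp
  moreover have "compact (closure {t. \<phi> t \<noteq> 0})"
    unfolding compact_closure by (rule bounded_subset[OF bounded_closed_interval sub])
  ultimately have "test_function {p<..<q} \<phi>"
    unfolding test_function_def using smooth cd by auto
  moreover have "deriv \<phi> = D 0" by (rule ext) (rule DERIV_imp_deriv[OF der])
  ultimately show ?thesis using that by blast
qed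

text \<open>If h took different values at x and y, the difference of two unit bumps concentrated
  there would be the derivative of a test function against which h does not integrate to 0.\<close>

lemma du_bois_reymond:
  assumes h: "continuous_on {p..q} h"
    and z: "\<And>\<phi>. test_function {p<..<q} \<phi> \<Longrightarrow> integral {p..q} (\<lambda>t. h t * deriv \<phi> t) = 0"
    and xy: "x \<in> {p<..<q}" "y \<in> {p<..<q}"
  shows "h x = h y"
proof -
  have le: "h y \<le> h x" if xy: "x \<in> {p<..<q}" "y \<in> {p<..<q}" for x y
  proof (rule ccontr)
    assume neg: "\<not> h y \<le> h x"
    \<comment> \<open>A third of the gap, so that the averages of h over the two bumps still differ
      by at least \<open>\<gamma>\<close>.\<close>
    define \<gamma> where "\<gamma> = (h y - h x) / 3"
    have \<gamma>: "\<gamma> > 0" using neg by (simp add: \<gamma>_def)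
    obtain \<delta>1 where \<delta>1: "\<delta>1 > 0" "\<And>t. t \<in> {p..q} \<Longrightarrow> \<bar>t - x\<bar> < \<delta>1 \<Longrightarrow> \<bar>h t - h x\<bar> < \<gamma>"
      using continuous_on_near[OF h _ \<gamma>, of x] xy by auto
    obtain \<delta>2 where \<delta>2: "\<delta>2 > 0" "\<And>t. t \<in> {p..q} \<Longrightarrow> \<bar>t - y\<bar> < \<delta>2 \<Longrightarrow> \<bar>h t - h y\<bar> < \<gamma>"
      using continuous_on_near[OF h _ \<gamma>, of y] xy by auto
    define m where "m = Min {\<delta>1, \<delta>2, x - p, q - x, y - p, q - y}"
    have m: "0 < m" unfolding m_def using \<delta>1(1) \<delta>2(1) xy by simp
    have mle: "m \<le> \<delta>1" "m \<le> \<delta>2" "m \<le> x - p" "m \<le> q - x" "m \<le> y - p" "m \<le> q - y"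
      unfolding m_def by (rule Min_le; simp)+
    define e where "e = m / 2"
    have "0 < e" "e < m" using m by (simp_all add: e_def)
    then have e: "e > 0" "e < \<delta>1" "e < \<delta>2" "p < x - e" "x + e < q" "p < y - e" "y + e < q"
      "x - e < x + e" "y - e < y + e" "p \<le> x - e" "x + e \<le> q" "p \<le> y - e" "y + e \<le> q"
      using mle by auto
    obtain D1 where D1: "\<And>i x. (D1 i has_real_derivative D1 (Suc i) x) (at x)" "\<And>x. 0 \<le> D1 0 x"
      "\<And>i t. t \<notin> {x - e<..<x + e} \<Longrightarrow> D1 i t = 0" "(D1 0 has_integral 1) {p..q}"
      using bump_exists[OF e(8)] e(10,11) by metis
    obtain D2 where D2: "\<And>i x. (D2 i has_real_derivative D2 (Suc i) x) (at x)" "\<And>x. 0 \<le> D2 0 x"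
      "\<And>i t. t \<notin> {y - e<..<y + e} \<Longrightarrow> D2 i t = 0" "(D2 0 has_integral 1) {p..q}"
      using bump_exists[OF e(9)] e(12,13) by metis
    obtain \<phi> where \<phi>: "test_function {p<..<q} \<phi>" "deriv \<phi> = (\<lambda>t. D1 0 t - D2 0 t)"
    proof (rule test_function_antiderivative[of "\<lambda>i t. D1 i t - D2 i t" "min (x - e) (y - e)" "max (x + e) (y + e)" p q])
      show "((\<lambda>t. D1 0 t - D2 0 t) has_integral 0) {p..q}"
        using has_integral_diff[OF D1(4) D2(4)] by simp
      show "((\<lambda>t. D1 i t - D2 i t) has_real_derivative D1 (Suc i) s - D2 (Suc i) s) (at s)" for i s
        by (rule DERIV_diff[OF D1(1) D2(1)])
      fix i t assume "t \<notin> {min (x - e) (y - e)..max (x + e) (y + e)}"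
      then have "t \<notin> {x - e<..<x + e}" "t \<notin> {y - e<..<y + e}" by auto
      then show "D1 i t - D2 i t = 0" using D1(3) D2(3) by simp
    qed (use e in auto)
    have cont: "continuous_on S (D1 0)" "continuous_on S (D2 0)" for S
      by (rule DERIV_continuous_on, rule has_field_derivative_at_within[OF D1(1)])
        (rule DERIV_continuous_on, rule has_field_derivative_at_within[OF D2(1)])
    have int: "(\<lambda>t. h t * D1 0 t) integrable_on {p..q}" "(\<lambda>t. h t * D2 0 t) integrable_on {p..q}"
      by (intro integrable_continuous_interval continuous_intros h cont)+
    have "integral {p..q} (\<lambda>t. h t * D1 0 t) \<le> h x + \<gamma>"
    proof (rule integral_le[OF int(1), of "\<lambda>t. (h x + \<gamma>) * D1 0 t", THEN order_trans])
      have i: "((\<lambda>t. (h x + \<gamma>) * D1 0 t) has_integral (h x + \<gamma>) * 1) {p..q}"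
        by (rule has_integral_mult_right[OF D1(4)])
      show "(\<lambda>t. (h x + \<gamma>) * D1 0 t) integrable_on {p..q}" using i by blast
      show "integral {p..q} (\<lambda>t. (h x + \<gamma>) * D1 0 t) \<le> h x + \<gamma>"
        unfolding integral_unique[OF i] by simp
      fix t assume t: "t \<in> {p..q}"
      show "h t * D1 0 t \<le> (h x + \<gamma>) * D1 0 t"
      proof (cases "t \<in> {x - e<..<x + e}")
        case True
        then have "\<bar>t - x\<bar> < \<delta>1" using e(2) by (auto simp: abs_less_iff)
        then have "h t \<le> h x + \<gamma>" using \<delta>1(2)[OF t] by (simp add: abs_less_iff)
        then show ?thesis using D1(2) by (rule mult_right_mono)
      qed (simp add: D1(3))
    qed
    moreover have "h y - \<gamma> \<le> integral {p..q} (\<lambda>t. h t * D2 0 t)"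
    proof (rule order_trans[OF _ integral_le[OF _ int(2), of "\<lambda>t. (h y - \<gamma>) * D2 0 t"]])
      have i: "((\<lambda>t. (h y - \<gamma>) * D2 0 t) has_integral (h y - \<gamma>) * 1) {p..q}"
        by (rule has_integral_mult_right[OF D2(4)])
      show "(\<lambda>t. (h y - \<gamma>) * D2 0 t) integrable_on {p..q}" using i by blast
      show "h y - \<gamma> \<le> integral {p..q} (\<lambda>t. (h y - \<gamma>) * D2 0 t)"
        unfolding integral_unique[OF i] by simp
      fix t assume t: "t \<in> {p..q}"
      show "(h y - \<gamma>) * D2 0 t \<le> h t * D2 0 t"
      proof (cases "t \<in> {y - e<..<y + e}")
        case True
        then have "\<bar>t - y\<bar> < \<delta>2" using e(3) by (auto simp: abs_less_iff)
        then have "h y - \<gamma> \<le> h t" using \<delta>2(2)[OF t] by (simp add: abs_less_iff)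
        then show ?thesis using D2(2) by (rule mult_right_mono)
      qed (simp add: D2(3))
    qed
    moreover have "integral {p..q} (\<lambda>t. h t * D1 0 t) - integral {p..q} (\<lambda>t. h t * D2 0 t) = 0"
      using z[OF \<phi>(1)] integral_diff[OF int] unfolding \<phi>(2) by (simp add: right_diff_distrib)
    ultimately have "h y - \<gamma> \<le> h x + \<gamma>" by argo
    then show False using \<gamma> unfolding \<gamma>_def by argo
  qed
  show ?thesis using le[OF xy] le[OF xy(2,1)] by simp
qed

text \<open>The complement of the support is open, so vanishing there passes to all
  derivatives.\<close>

lemma test_functionD:
  assumes "test_function \<Omega> \<phi>"
  shows "((deriv ^^ i) \<phi> has_real_derivative (deriv ^^ Suc i) \<phi> x) (at x)"
    "x \<notin> \<Omega> \<Longrightarrow> (deriv ^^ i) \<phi> x = 0"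
proof -
  show 1: "((deriv ^^ i) \<phi> has_real_derivative (deriv ^^ Suc i) \<phi> x) (at x)" for i x
  proof -
    have "(deriv ^^ i) \<phi> differentiable (at x)"
      using assms unfolding test_function_def differentiable_on_def by simp
    then show ?thesis by (simp add: DERIV_deriv_iff_real_differentiable)
  qed
  let ?K = "closure {t. \<phi> t \<noteq> 0}"
  have "\<forall>x\<in>-?K. (deriv ^^ i) \<phi> x = 0" for i
  proof (induction i)
    case 0
    then show ?case using closure_subset[of "{t. \<phi> t \<noteq> 0}"] by auto
  next
    case (Suc i)
    show ?case
    proof
      fix x assume x: "x \<in> - ?K"
      have "((\<lambda>_. 0) has_real_derivative 0) (at x)" by simp
      then have "((deriv ^^ i) \<phi> has_real_derivative 0) (at x)"
        by (rule has_field_derivative_transform_within_open[of _ _ _ "- ?K"]) (use x Suc in auto)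
      then show "(deriv ^^ Suc i) \<phi> x = 0" using DERIV_unique 1 by blast
    qed
  qed
  then show "x \<notin> \<Omega> \<Longrightarrow> (deriv ^^ i) \<phi> x = 0"
    using assms unfolding test_function_def by blast
qed

lemma test_function_subset: "test_function \<Omega> \<phi> \<Longrightarrow> \<Omega> \<subseteq> \<Omega>' \<Longrightarrow> test_function \<Omega>' \<phi>"
  unfolding test_function_def by blast

lemma test_function_density:
  assumes "test_function \<Omega> \<phi>"
  shows "has_density ((deriv ^^ i) \<phi>) ((deriv ^^ Suc i) \<phi>) a b"
  by (rule has_density_C1)
    (auto intro!: DERIV_continuous_on[OF has_field_derivative_at_within[OF test_functionD(1)[OF assms]]]
      has_field_derivative_at_within[OF test_functionD(1)[OF assms]] simp del: funpow.simps)

text \<open>The boundary terms vanish because the end points lie outside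
  \<open>\<Omega>\<close>.\<close>

lemma integration_by_parts_test_function:
  assumes f: "has_density f f' a b" and \<phi>: "test_function \<Omega> \<phi>" and ab: "a \<le> b" "a \<notin> \<Omega>" "b \<notin> \<Omega>"
  shows "integral {a..b} (\<lambda>t. f t * (deriv ^^ Suc i) \<phi> t) = - integral {a..b} (\<lambda>t. f' t * (deriv ^^ i) \<phi> t)"
    "(\<lambda>t. f t * (deriv ^^ Suc i) \<phi> t) absolutely_integrable_on {a..b}"
    "(\<lambda>t. f' t * (deriv ^^ i) \<phi> t) absolutely_integrable_on {a..b}"
proof -
  note d = test_function_density[OF \<phi>, of _ a b]
  show 1: "(\<lambda>t. f' t * (deriv ^^ i) \<phi> t) absolutely_integrable_on {a..b}"
    by (rule absolutely_integrable_mult_continuous[OF has_densityD(1)[OF f] has_density_continuous[OF d]])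
  show 2: "(\<lambda>t. f t * (deriv ^^ Suc i) \<phi> t) absolutely_integrable_on {a..b}"
    using absolutely_integrable_mult_continuous[OF has_densityD(1)[OF d] has_density_continuous[OF f]]
    by (simp add: mult.commute)
  have "((\<lambda>t. f' t * (deriv ^^ i) \<phi> t + f t * (deriv ^^ Suc i) \<phi> t) has_integral
      f b * (deriv ^^ i) \<phi> b - f a * (deriv ^^ i) \<phi> a) {a..b}"
    using ab(1) by (intro has_densityD(2)[OF has_density_mult[OF f d]]) auto
  then have "((\<lambda>t. f' t * (deriv ^^ i) \<phi> t + f t * (deriv ^^ Suc i) \<phi> t) has_integral 0) {a..b}"
    using test_functionD(2)[OF \<phi>] ab by simp
  then have "integral {a..b} (\<lambda>t. f' t * (deriv ^^ i) \<phi> t + f t * (deriv ^^ Suc i) \<phi> t) = 0"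
    by (rule integral_unique)
  then show "integral {a..b} (\<lambda>t. f t * (deriv ^^ Suc i) \<phi> t) = - integral {a..b} (\<lambda>t. f' t * (deriv ^^ i) \<phi> t)"
    using integral_add[OF set_lebesgue_integral_eq_integral(1)[OF 1] set_lebesgue_integral_eq_integral(1)[OF 2]] by simp
qed

lemma set_integral_restrict:
  fixes f :: "real \<Rightarrow> real"
  assumes f: "f absolutely_integrable_on {a..b}" and z: "\<And>t. t \<in> \<Omega> - {a..b} \<Longrightarrow> f t = 0" "\<And>t. t \<in> {a..b} - \<Omega> \<Longrightarrow> f t = 0"
  shows "(LINT t:\<Omega>|lebesgue. f t) = integral {a..b} f"
proof -
  have "(LINT t:\<Omega>|lebesgue. f t) = (LINT t:{a..b}|lebesgue. f t)"
    unfolding set_lebesgue_integral_def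
  proof (intro Bochner_Integration.integral_cong refl)
    fix t show "indicat_real \<Omega> t *\<^sub>R f t = indicat_real {a..b} t *\<^sub>R f t"
      using z[of t] by (cases "t \<in> \<Omega>"; cases "t \<in> {a..b}") auto
  qed
  then show ?thesis using set_lebesgue_integral_eq_integral(2)[OF f] by simp
qed

lemma locally_integrable_on_subset:
  assumes "f absolutely_integrable_on {a..b}" "\<Omega> \<subseteq> {a..b}"
  shows "locally_integrable_on \<Omega> f"
  unfolding locally_integrable_on_def
proof (intro allI impI)
  fix K assume "compact K \<and> K \<subseteq> \<Omega>"
  then show "f absolutely_integrable_on K"
    using assms by (intro set_integrable_subset[OF assms(1)]) (auto dest: borel_compact)
qed

text \<open>One or two integrations by parts. An open subset of the closed interval misses its end
  points, which removes the boundary terms.\<close>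

lemma has_weak_deriv_density:
  assumes f: "has_density f f' a b" and f': "has_density f' f'' a b" and \<Omega>: "open \<Omega>" "\<Omega> \<subseteq> {a..b}" and ab: "a < b"
  shows "has_weak_deriv 1 \<Omega> f f'" "has_weak_deriv 2 \<Omega> f f''"
proof -
  have "\<Omega> \<subseteq> interior {a..b}" using \<Omega> by (rule interior_maximal[rotated])
  then have ends: "a \<notin> \<Omega>" "b \<notin> \<Omega>" by auto
  have cont: "g absolutely_integrable_on {a..b}" if "has_density g h a b" for g h
    using has_density_continuous[OF that] by (rule absolutely_integrable_continuous_real)
  note lint = locally_integrable_on_subset[OF cont[OF f] \<Omega>(2)] locally_integrable_on_subset[OF cont[OF f'] \<Omega>(2)]
    locally_integrable_on_subset[OF has_densityD(1)[OF f'] \<Omega>(2)]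
  have eq: "(LINT t:\<Omega>|lebesgue. g t * (deriv ^^ i) \<phi> t) = integral {a..b} (\<lambda>t. g t * (deriv ^^ i) \<phi> t)"
    if "test_function \<Omega> \<phi>" "(\<lambda>t. g t * (deriv ^^ i) \<phi> t) absolutely_integrable_on {a..b}" for g i \<phi>
    using that(2) \<Omega>(2) test_functionD(2)[OF that(1)] by (intro set_integral_restrict) auto
  have by_parts: "(LINT t:\<Omega>|lebesgue. g t * (deriv ^^ Suc i) \<phi> t) = - (LINT t:\<Omega>|lebesgue. h t * (deriv ^^ i) \<phi> t)"
    if "test_function \<Omega> \<phi>" "has_density g h a b" for g h i \<phi>
    using integration_by_parts_test_function[OF that(2,1) _ ends, of i] ab eq[OF that(1), of g "Suc i"] eq[OF that(1), of h i]
    by (simp del: funpow.simps)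
  show "has_weak_deriv 1 \<Omega> f f'"
    unfolding has_weak_deriv_def using lint by_parts[OF _ f, of _ 0] by simp
  show "has_weak_deriv 2 \<Omega> f f''"
    unfolding has_weak_deriv_def
    using lint by_parts[OF _ f, of _ 1] by_parts[OF _ f', of _ 0] by (simp add: numeral_2_eq_2)
qed

lemma W21_on_density:
  assumes f: "has_density f f' a b" and f': "has_density f' f'' a b" and \<Omega>: "open \<Omega>" "\<Omega> \<subseteq> {a..b}" and ab: "a < b"
  shows "W21_on \<Omega> f"
proof -
  have cont: "g absolutely_integrable_on {a..b}" if "has_density g h a b" for g h
    using has_density_continuous[OF that] by (rule absolutely_integrable_continuous_real)
  have sub: "g absolutely_integrable_on \<Omega>" if "g absolutely_integrable_on {a..b}" for g :: "real \<Rightarrow> real"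
    using that \<Omega> by (intro set_integrable_subset[OF that]) auto
  show ?thesis
    unfolding W21_on_def
    using has_weak_deriv_density[OF assms] sub[OF cont[OF f]] sub[OF cont[OF f']] sub[OF has_densityD(1)[OF f']]
    by auto
qed

text \<open>A primitive of the weak derivative g differs from f, respectively f', by a function that
  integrates to 0 against every derivative of a test function, hence by a constant.\<close>

lemma weak_deriv_imp_density:
  assumes w: "has_weak_deriv i {a<..<b} f g" and i: "i \<in> {1, 2}"
    and f: "\<And>p q. a < p \<Longrightarrow> q < b \<Longrightarrow> has_density f f' p q" "continuous_on {a<..<b} f'"
    and pq: "a < p" "q < b"
  shows "has_density (if i = 1 then f else f') g p q"
proof (cases "p \<le> q")
  case False
  then show ?thesis unfolding has_density_def by auto
next
  case True
  \<comment> \<open>A slightly larger interval inside (a, b): constancy is obtained only in its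
    interior, which has to contain p and q.\<close>
  define P where "P = (a + p) / 2"
  define Q where "Q = (q + b) / 2"
  have PQ: "a < P" "P < p" "q < Q" "Q < b" "P < Q" using pq True by (auto simp: P_def Q_def field_simps)
  have sub: "{P..Q} \<subseteq> {a<..<b}" using PQ by auto
  have g: "g absolutely_integrable_on {P..Q}"
    using w sub unfolding has_weak_deriv_def locally_integrable_on_def by blast
  have gi: "g integrable_on {P..Q}" by (rule set_lebesgue_integral_eq_integral(1)[OF g])
  define G where "G t = integral {P..t} g" for t
  have G: "has_density G g P Q"
    unfolding has_density_def
  proof (intro conjI allI impI g)
    fix x y assume xy: "P \<le> x \<and> x \<le> y \<and> y \<le> Q"
    have 1: "g integrable_on {P..y}" using xy by (intro integrable_on_subinterval[OF gi]) auto
    have "integral {P..x} g + integral {x..y} g = integral {P..y} g"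
      using xy 1 by (intro Henstock_Kurzweil_Integration.integral_combine) auto
    then have "G y - G x = integral {x..y} g" by (simp add: G_def)
    moreover have "g integrable_on {x..y}" using xy by (intro integrable_on_subinterval[OF gi]) auto
    ultimately show "(g has_integral G y - G x) {x..y}" by (simp add: integrable_integral)
  qed
  have fPQ: "has_density f f' P Q" using PQ by (intro f) auto
  let ?F = "if i = 1 then f else f'"
  have cF: "continuous_on {P..Q} ?F"
    using has_density_continuous[OF fPQ] continuous_on_subset[OF f(2) sub] by simp
  have key: "integral {P..Q} (\<lambda>t. (?F t - G t) * deriv \<phi> t) = 0" if \<phi>: "test_function {P<..<Q} \<phi>" for \<phi>
  proof -
    have \<phi>': "test_function {a<..<b} \<phi>" by (rule test_function_subset[OF \<phi>]) (use PQ in auto)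
    have eq: "(LINT t:{a<..<b}|lebesgue. h t * (deriv ^^ j) \<phi> t) = integral {P..Q} (\<lambda>t. h t * (deriv ^^ j) \<phi> t)"
      if "(\<lambda>t. h t * (deriv ^^ j) \<phi> t) absolutely_integrable_on {P..Q}" for h j
      using that PQ test_functionD(2)[OF \<phi>] by (intro set_integral_restrict) auto
    have ends: "P \<le> Q" "P \<notin> {P<..<Q}" "Q \<notin> {P<..<Q}" using PQ by auto
    note pG = integration_by_parts_test_function[OF G \<phi> ends, of 0]
    note pf = integration_by_parts_test_function[OF fPQ \<phi> ends]
    have weak: "(LINT t:{a<..<b}|lebesgue. f t * (deriv ^^ i) \<phi> t) = (- 1) ^ i * (LINT t:{a<..<b}|lebesgue. g t * \<phi> t)"
      using w \<phi>' unfolding has_weak_deriv_def by blast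
    have g\<phi>: "(LINT t:{a<..<b}|lebesgue. g t * \<phi> t) = - integral {P..Q} (\<lambda>t. G t * deriv \<phi> t)"
      using eq[of g 0] pG by simp
    have F\<phi>: "integral {P..Q} (\<lambda>t. ?F t * deriv \<phi> t) = integral {P..Q} (\<lambda>t. G t * deriv \<phi> t)
        \<and> (\<lambda>t. ?F t * deriv \<phi> t) absolutely_integrable_on {P..Q}"
    proof (cases "i = 1")
      case True
      then show ?thesis using weak eq[of f 1] pf(1,2)[of 0] g\<phi> by simp
    next
      case False
      then have "i = 2" using i by simp
      then show ?thesis using weak eq[of f 2] pf[of 1] g\<phi> by (simp add: numeral_2_eq_2)
    qed
    have "integral {P..Q} (\<lambda>t. ?F t * deriv \<phi> t - G t * deriv \<phi> t) = 0"
      using F\<phi> pG(2) by (subst integral_diff) (auto intro: set_lebesgue_integral_eq_integral(1))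
    then show ?thesis by (simp add: left_diff_distrib)
  qed
  have const: "?F x - G x = ?F y - G y" if "x \<in> {P<..<Q}" "y \<in> {P<..<Q}" for x y
    by (rule du_bois_reymond[OF _ key that]) (intro continuous_intros cF has_density_continuous[OF G])
  have "has_density G g p q" by (rule has_density_subinterval[OF G]) (use PQ in auto)
  moreover have "G y - G x = ?F y - ?F x" if "p \<le> x" "x \<le> y" "y \<le> q" for x y
    using const[of x y] that PQ by auto
  ultimately show ?thesis unfolding has_density_def by metis
qed

text \<open>The vanishing extends from half-open intervals to all Borel sets by a Dynkin argument,
  and a function with zero integral over every Borel set is zero almost everywhere.\<close>

lemma zero_interval_integrals_AE:
  fixes f :: "real \<Rightarrow> real"
  assumes f: "f absolutely_integrable_on {p..q}"
    and z: "\<And>x y. p \<le> x \<Longrightarrow> x \<le> y \<Longrightarrow> y \<le> q \<Longrightarrow> integral {x..y} f = 0"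
  shows "AE t in lebesgue. t \<in> {p..q} \<longrightarrow> f t = 0"
proof (cases "p \<le> q")
  case False
  then show ?thesis by simp
next
  case pq: True
  define F where "F t = indicat_real {p..q} t * f t" for t
  have F: "integrable lebesgue F"
    using f unfolding set_integrable_def F_def by simp
  \<comment> \<open>A Borel representative, since half-open intervals generate the Borel sets and
    not the Lebesgue sets.\<close>
  obtain F' where F': "F' \<in> borel_measurable lborel" "AE t in lborel. F t = F' t"
    using completion_ex_borel_measurable_real[of F lborel] borel_measurable_integrable[OF F] by auto
  have AEl: "AE t in lebesgue. F t = F' t" using F'(2) by (rule AE_completion)
  have F'm: "F' \<in> borel_measurable lebesgue" using F'(1) by (rule measurable_completion)
  have F'l: "integrable lebesgue F'"
    using integrable_cong_AE_imp[OF F F'm] AEl by (auto simp: eq_commute)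
  then have F'i: "integrable lborel F'" using F'(1) by (simp add: integrable_completion)
  have basic: "(LINT t:{x<..y}|lborel. F' t) = 0" for x y
  proof -
    have "(LINT t:{x<..y}|lborel. F' t) = (LINT t:{x<..y}|lebesgue. F' t)"
      unfolding set_lebesgue_integral_def
      by (rule integral_completion[symmetric]) (intro borel_measurable_scaleR borel_measurable_indicator F'(1), simp)
    also have "\<dots> = (LINT t:{x<..y}|lebesgue. F t)"
      unfolding set_lebesgue_integral_def using AEl F'm borel_measurable_integrable[OF F]
      by (intro integral_cong_AE borel_measurable_scaleR borel_measurable_indicator) auto
    also have "\<dots> = integral {max x p..min y q} f"
    proof -
      have "(LINT t:{x<..y}|lebesgue. F t) = (LINT t:{max x p..min y q}|lebesgue. f t)"
        unfolding set_lebesgue_integral_def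
      proof (rule integral_cong_AE)
        show "(\<lambda>t. indicat_real {x<..y} t *\<^sub>R F t) \<in> borel_measurable lebesgue"
          by (intro borel_measurable_scaleR borel_measurable_indicator borel_measurable_integrable[OF F]) auto
        show "(\<lambda>t. indicat_real {max x p..min y q} t *\<^sub>R f t) \<in> borel_measurable lebesgue"
          using absolutely_integrable_on_subinterval[OF f, of "max x p" "min y q"]
          unfolding set_integrable_def by (auto dest: borel_measurable_integrable)
        have "AE t in lebesgue. t \<noteq> x"
          by (rule AE_completion) (rule AE_lborel_singleton)
        then show "AE t in lebesgue. indicat_real {x<..y} t *\<^sub>R F t = indicat_real {max x p..min y q} t *\<^sub>R f t"
          by (rule eventually_mono) (auto simp: F_def indicator_def)
      qed
      then show ?thesis
        using set_lebesgue_integral_eq_integral(2)[OF absolutely_integrable_on_subinterval[OF f, of "max x p" "min y q"]] by simp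
    qed
    also have "\<dots> = 0"
      using z[of "max x p" "min y q"] by (cases "max x p \<le> min y q") auto
    finally show ?thesis .
  qed
  have si: "set_integrable lborel A F'" if "A \<in> sets borel" for A
    unfolding set_integrable_def using integrable_mult_indicator[OF _ F'i] that by simp
  have "(LINT t:A|lborel. F' t) = 0" if "A \<in> sets lborel" for A
  proof -
    have whole: "(LINT t:UNIV|lborel. F' t) = 0"
    proof -
      have "AE t in lborel. indicat_real UNIV t *\<^sub>R F' t = indicat_real {p - 1<..q} t *\<^sub>R F' t"
        using F'(2)
      proof (rule eventually_mono)
        fix t assume "F t = F' t"
        then show "indicat_real UNIV t *\<^sub>R F' t = indicat_real {p - 1<..q} t *\<^sub>R F' t"
          by (cases "t \<in> {p..q}") (auto simp: F_def)
      qed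
      then have "(LINT t:UNIV|lborel. F' t) = (LINT t:{p - 1<..q}|lborel. F' t)"
        unfolding set_lebesgue_integral_def using F'(1)
        by (intro integral_cong_AE borel_measurable_scaleR borel_measurable_indicator) auto
      then show ?thesis using basic by simp
    qed
    have A: "A \<in> sigma_sets UNIV (range (\<lambda>(a, b). {a<..b::real}))"
      using that borel_sigma_sets_Ioc by (metis sets_lborel sets_measure_of top_greatest Pow_UNIV)
    have "Int_stable (range (\<lambda>(a, b). {a<..b::real}))"
    proof (rule Int_stableI_image)
      fix i j :: "real \<times> real"
      show "\<exists>k\<in>UNIV. (case i of (a, b) \<Rightarrow> {a<..b}) \<inter> (case j of (a, b) \<Rightarrow> {a<..b}) = (case k of (a, b) \<Rightarrow> {a<..b})"
        by (intro bexI[of _ "(max (fst i) (fst j), min (snd i) (snd j))"]) (auto split: prod.splits)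
    qed
    moreover have "range (\<lambda>(a, b). {a<..b::real}) \<subseteq> Pow UNIV" by simp
    ultimately show ?thesis using A
    proof (induction rule: sigma_sets_induct_disjoint)
      case (basic A)
      then show ?case using \<open>\<And>x y. (LINT t:{x<..y}|lborel. F' t) = 0\<close> by auto
    next
      case empty
      then show ?case by (simp add: set_lebesgue_integral_def)
    next
      case (compl A)
      have Am: "A \<in> sets lborel"
        using compl(1) borel_sigma_sets_Ioc by (metis sets_lborel sets_measure_of top_greatest Pow_UNIV)
      have "(LINT t:UNIV|lborel. F' t) = (LINT t:A|lborel. F' t) + (LINT t:UNIV - A|lborel. F' t)"
        using Am by (subst set_integral_Un[symmetric]) (auto intro!: si)
      then show ?case using compl whole by simp
    next
      case (union A)
      have Am: "A i \<in> sets lborel" for i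
        using union(2) borel_sigma_sets_Ioc by (metis range_subsetD sets_lborel sets_measure_of top_greatest Pow_UNIV)
      have "(LINT t:(\<Union>i. A i)|lborel. F' t) = (\<Sum>i. (LINT t:(A i)|lborel. F' t))"
        using Am union(1)
        by (intro lebesgue_integral_countable_add) (auto simp: disjoint_family_on_def intro!: si)
      then show ?case using union(3) by simp
    qed
  qed
  then have "AE t in lborel. F' t = 0" by (rule sigma_finite_measure.density_zero[OF lborel.sigma_finite_measure_axioms F'i])
  then have "AE t in lborel. F t = 0" using F'(2) by (rule eventually_elim2) simp
  then have "AE t in lebesgue. F t = 0" by (rule AE_completion)
  then show ?thesis by (rule eventually_mono) (auto simp: F_def indicator_def)
qed

section \<open>Absolute continuity of functions of bounded variation\<close>

text \<open>The supremum of M over Lebesgue null sets is attained by a countable union Z of nearly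
  optimal ones. A null set with positive mass outside Z would exceed it.\<close>

lemma null_set_carrying_singular_part:
  assumes M: "finite_measure M" "sets M = sets borel"
  obtains Z :: "real set" where "Z \<in> sets borel" "emeasure lborel Z = 0"
    "\<And>B. B \<in> sets borel \<Longrightarrow> emeasure lborel B = 0 \<Longrightarrow> emeasure M (B - Z) = 0"
proof -
  interpret finite_measure M by fact
  define S where "S = {measure M B | B. B \<in> sets borel \<and> emeasure lborel B = 0}"
  have bdd: "bdd_above S" unfolding S_def by (auto intro!: bdd_aboveI bounded_measure)
  have ne: "S \<noteq> {}" unfolding S_def by (auto intro!: exI[of _ "{}"])
  have "\<exists>B. B \<in> sets borel \<and> emeasure lborel B = 0 \<and> Sup S - 1 / real (Suc n) < measure M B" for n
    using less_cSup_iff[OF ne bdd, of "Sup S - 1 / real (Suc n)"] unfolding S_def by auto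
  then obtain B where B: "\<And>n. B n \<in> sets borel" "\<And>n. emeasure lborel (B n) = 0"
    "\<And>n. Sup S - 1 / real (Suc n) < measure M (B n)" by metis
  define Z where "Z = (\<Union>n. B n)"
  have Z: "Z \<in> sets borel" "emeasure lborel Z = 0"
    using B unfolding Z_def by (auto intro!: emeasure_UN_eq_0)
  have "Sup S \<le> measure M Z"
  proof (rule field_le_epsilon)
    fix e :: real assume "e > 0"
    then obtain n where "1 / real (Suc n) < e" using nat_approx_posE by metis
    moreover have "measure M (B n) \<le> measure M Z"
      using B(1) Z(1) M(2) unfolding Z_def by (intro finite_measure_mono) auto
    ultimately show "Sup S \<le> measure M Z + e" using B(3)[of n] by argo
  qed
  moreover have "emeasure M (C - Z) = 0" if C: "C \<in> sets borel" "emeasure lborel C = 0"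
    and le: "Sup S \<le> measure M Z" for C
  proof -
    have "emeasure lborel (Z \<union> C) = 0"
      using emeasure_subadditive[of Z lborel C] Z C by simp
    then have "measure M (Z \<union> C) \<le> Sup S"
      using Z C unfolding S_def by (intro cSup_upper bdd[unfolded S_def]) auto
    moreover have "measure M (Z \<union> C) = measure M Z + measure M (C - Z)"
      using Z C M(2) finite_measure_Union[of Z "C - Z"] by (simp add: Un_Diff_cancel)
    ultimately have "measure M (C - Z) = 0" using le measure_nonneg[of M "C - Z"] by argo
    then show ?thesis by (simp add: emeasure_eq_measure)
  qed
  ultimately show ?thesis using that Z by blast
qed

section \<open>Stieltjes measures of a continuous function of bounded variation\<close>

lemma interval_measure_finite:
  assumes V: "mono V" "\<And>t. continuous (at_right t) V" "\<And>t. l \<le> V t" "\<And>t. V t \<le> u"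
  shows "finite_measure (interval_measure V)" "measure (interval_measure V) B \<le> u - l"
proof -
  let ?M = "interval_measure V"
  have "emeasure ?M {- real n<..real n} \<le> ennreal (u - l)" for n
  proof -
    have "emeasure ?M {- real n<..real n} = ennreal (V (real n) - V (- real n))"
      by (rule emeasure_interval_measure_Ioc) (use V in \<open>auto dest: monoD\<close>)
    also have "\<dots> \<le> ennreal (u - l)"
      using V(3)[of "- real n"] V(4)[of "real n"] by (intro ennreal_leI) argo
    finally show ?thesis .
  qed
  then have "(SUP n. emeasure ?M {- real n<..real n}) \<le> ennreal (u - l)" by (intro SUP_least)
  moreover have "(SUP n. emeasure ?M {- real n<..real n}) = emeasure ?M (\<Union>n. {- real n<..real n})"
    by (rule SUP_emeasure_incseq) (auto simp: incseq_def)
  moreover have "(\<Union>n. {- real n<..real n}) = (UNIV :: real set)"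
  proof -
    have "x \<in> (\<Union>n. {- real n<..real n})" for x :: real
    proof -
      obtain n where "\<bar>x\<bar> < real n" using reals_Archimedean2 by blast
      then show ?thesis by (auto intro!: exI[of _ n])
    qed
    then show ?thesis by auto
  qed
  ultimately have le: "emeasure ?M UNIV \<le> ennreal (u - l)" by simp
  show fin: "finite_measure ?M"
    by (rule finite_measureI) (use le in \<open>auto simp: top_unique\<close>)
  interpret finite_measure ?M by fact
  have "measure ?M B \<le> measure ?M UNIV" using bounded_measure[of B] by simp
  also have "\<dots> \<le> u - l"
  proof -
    have "l \<le> u" using V(3)[of 0] V(4)[of 0] by argo
    then show ?thesis using le by (simp add: emeasure_eq_measure)
  qed
  finally show "measure ?M B \<le> u - l" .
qed

text \<open>The signed measure df is kept as a pair of positive measures. V1 and V2 may jump; their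
  difference is continuous, so the jumps cancel.\<close>

locale continuous_bounded_variation =
  fixes f V1 V2 :: "real \<Rightarrow> real" and l1 u1 l2 u2 :: real
  assumes mono1: "mono V1" and mono2: "mono V2"
    and right1: "\<And>t. continuous (at_right t) V1" and right2: "\<And>t. continuous (at_right t) V2"
    and bounds: "\<And>t. l1 \<le> V1 t" "\<And>t. V1 t \<le> u1" "\<And>t. l2 \<le> V2 t" "\<And>t. V2 t \<le> u2"
    and f_eq: "\<And>t. f t = V1 t - V2 t" and f_cont: "\<And>t. isCont f t"
begin

abbreviation "M1 \<equiv> interval_measure V1"
abbreviation "M2 \<equiv> interval_measure V2"

sublocale M1: finite_measure M1
  by (rule interval_measure_finite(1)[OF mono1 right1 bounds(1,2)])
sublocale M2: finite_measure M2
  by (rule interval_measure_finite(1)[OF mono2 right2 bounds(3,4)])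

lemma measure_Ioc:
  assumes "x \<le> y"
  shows "measure M1 {x<..y} - measure M2 {x<..y} = f y - f x"
  using measure_interval_measure_Ioc[OF assms monoD[OF mono1] right1]
    measure_interval_measure_Ioc[OF assms monoD[OF mono2] right2] by (simp add: f_eq)

text \<open>On half-open intervals shrinking to x the masses differ by an increment of f, which
  tends to 0 by continuity.\<close>

lemma measure_singleton: "measure M1 {x} = measure M2 {x}"
proof -
  define A where "A n = {x - 1 / real (Suc n)<..x}" for n
  have dec: "decseq A"
    unfolding decseq_def
  proof (intro allI impI)
    fix m n :: nat assume "m \<le> n"
    then have "1 / real (Suc n) \<le> 1 / real (Suc m)" by (simp add: frac_le)
    then show "A n \<subseteq> A m" unfolding A_def by auto
  qed
  have int: "(\<Inter>n. A n) = {x}"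
  proof (intro equalityI subsetI)
    fix y assume "y \<in> (\<Inter>n. A n)"
    then have y: "y \<le> x" "\<And>n. x - 1 / real (Suc n) < y" by (auto simp: A_def)
    have "y = x"
    proof (rule ccontr)
      assume "y \<noteq> x"
      then obtain n where "1 / real (Suc n) < x - y" using y(1) nat_approx_posE[of "x - y"] by auto
      then show False using y(2)[of n] by argo
    qed
    then show "y \<in> {x}" by simp
  qed (auto simp: A_def)
  have A: "range A \<subseteq> sets M1" "range A \<subseteq> sets M2" unfolding A_def by auto
  have "(\<lambda>n. measure M1 (A n) - measure M2 (A n)) \<longlonglongrightarrow> measure M1 {x} - measure M2 {x}"
    using M1.finite_Lim_measure_decseq[OF A(1) dec] M2.finite_Lim_measure_decseq[OF A(2) dec]
    unfolding int by (rule tendsto_diff)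
  moreover have "(\<lambda>n. measure M1 (A n) - measure M2 (A n)) = (\<lambda>n. f x - f (x - 1 / real (Suc n)))"
    unfolding A_def by (intro ext measure_Ioc) simp
  moreover have "(\<lambda>n. f x - f (x - 1 / real (Suc n))) \<longlonglongrightarrow> f x - f (x - 0)"
    by (intro tendsto_intros isCont_tendsto_compose[OF f_cont] LIMSEQ_Suc[OF lim_1_over_n])
  ultimately show ?thesis using LIMSEQ_unique by fastforce
qed

text \<open>The signed measure \<open>M1 - M2\<close> has no singular part on E.\<close>

definition null_agreeing :: "real set \<Rightarrow> bool" where
  "null_agreeing E \<longleftrightarrow> E \<in> sets borel \<and>
     (\<forall>B\<in>sets borel. B \<subseteq> E \<longrightarrow> emeasure lborel B = 0 \<longrightarrow> emeasure M1 B = emeasure M2 B)"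

text \<open>A null subset of the union is distributed over the disjointed sets.\<close>

lemma null_agreeing_UN:
  assumes E: "\<And>n::nat. null_agreeing (E n)"
  shows "null_agreeing (\<Union>n. E n)"
  unfolding null_agreeing_def
proof (intro conjI ballI impI)
  show "(\<Union>n. E n) \<in> sets borel" using E unfolding null_agreeing_def by auto
  fix B assume B: "B \<in> sets borel" "B \<subseteq> (\<Union>n. E n)" "emeasure lborel B = 0"
  define D where "D n = B \<inter> disjointed E n" for n
  have Eb: "range E \<subseteq> sets borel" using E unfolding null_agreeing_def by auto
  then have Dn: "disjointed E n \<in> sets borel" for n using sets.range_disjointed_sets[of E borel] by auto
  have D: "D n \<in> sets borel" for n unfolding D_def using B(1) Dn by auto
  have disj: "disjoint_family D"
    using disjoint_family_disjointed[of E] unfolding D_def disjoint_family_on_def by auto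
  have un: "(\<Union>n. D n) = B" using B(2) UN_disjointed_eq[of E] unfolding D_def by auto
  have eq: "emeasure M1 (D n) = emeasure M2 (D n)" for n
  proof -
    have "emeasure lborel (D n) = 0"
      using emeasure_mono[of "D n" B lborel] B unfolding D_def by auto
    moreover have "D n \<subseteq> E n" using disjointed_subset[of E n] unfolding D_def by auto
    ultimately show ?thesis using E[of n] D unfolding null_agreeing_def by blast
  qed
  have "(\<Sum>n. emeasure M1 (D n)) = emeasure M1 (\<Union>n. D n)" "(\<Sum>n. emeasure M2 (D n)) = emeasure M2 (\<Union>n. D n)"
    using D disj by (auto intro!: suminf_emeasure)
  then show "emeasure M1 B = emeasure M2 B" using eq un by simp
qed

lemma null_agreeing_countable:
  assumes "countable E"
  shows "null_agreeing E"
proof (cases "E = {}")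
  case True
  then show ?thesis by (auto simp: null_agreeing_def)
next
  case False
  have "null_agreeing {x}" for x
  proof -
    have "emeasure M1 B = emeasure M2 B" if "B \<subseteq> {x}" for B
      using that measure_singleton[of x]
      by (auto simp: subset_singleton_iff M1.emeasure_eq_measure M2.emeasure_eq_measure)
    then show ?thesis by (auto simp: null_agreeing_def)
  qed
  then have "null_agreeing (\<Union>n. {from_nat_into E n})" by (rule null_agreeing_UN)
  moreover have "(\<Union>n. {from_nat_into E n}) = E"
    using range_from_nat_into[OF False assms] by auto
  ultimately show ?thesis by simp
qed

text \<open>f and \<open>\<Psi>\<close> agree on K only, with no information nearby. On a short
  interval meeting K, let y and z be its first and last points in K: the increment of f from y to z
  is that of \<open>\<Psi>\<close>, hence bounded by an integral of
  \<open>\<bar>\<psi>\<bar>\<close> over points close to K. This integral and the masses of the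
  neighbourhood outside K tend to 0 as the neighbourhood shrinks.\<close>

lemma null_compact_agree:
  assumes K: "compact K" "K \<subseteq> {p..q}" "emeasure lborel K = 0"
    and \<Psi>: "has_density \<Psi> \<psi> p q" and fK: "\<And>t. t \<in> K \<Longrightarrow> f t = \<Psi> t"
  shows "measure M1 K = measure M2 K"
proof (cases "K = {}")
  case True
  then show ?thesis by simp
next
  case ne: False
  then have pq: "p \<le> q" using K(2) by auto
  have Kb: "K \<in> sets borel" using K(1) by (rule borel_compact)
  \<comment> \<open>The variation measure of \<open>\<Psi>\<close> on [p, q]; Lebesgue null sets
    such as K have m-measure 0.\<close>
  define m where "m B = (LINT t:B \<inter> {p..q}|lebesgue. \<bar>\<psi> t\<bar>)" for B
  have am: "set_integrable lebesgue B (\<lambda>t. \<bar>\<psi> t\<bar>)" if "B \<in> sets borel" "B \<subseteq> {p..q}" for B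
    using set_integrable_abs[OF has_densityD(1)[OF \<Psi>]] by (rule set_integrable_subset) (use that in auto)
  have m_mono: "m B \<le> m B'" if "B \<subseteq> B'" "B \<in> sets borel" "B' \<in> sets borel" for B B'
    unfolding m_def set_lebesgue_integral_def
    using am[of "B \<inter> {p..q}"] am[of "B' \<inter> {p..q}"] that unfolding set_integrable_def
    by (intro integral_mono) (auto simp: indicator_def)
  have m_add: "m (B \<union> B') = m B + m B'" if "B \<inter> B' = {}" "B \<in> sets borel" "B' \<in> sets borel" for B B'
    unfolding m_def Int_Un_distrib2 using that by (intro set_integral_Un am) auto
  have m_interval: "\<bar>\<Psi> z - \<Psi> y\<bar> \<le> m {y<..z}" if "p \<le> y" "y \<le> z" "z \<le> q" for y z
  proof -
    have i: "\<psi> absolutely_integrable_on {y..z}" by (rule has_densityD(4)[OF \<Psi> that])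
    have "\<bar>\<Psi> z - \<Psi> y\<bar> = \<bar>integral {y..z} \<psi>\<bar>" using has_densityD(3)[OF \<Psi> that] by simp
    also have "\<dots> \<le> integral {y..z} (\<lambda>t. \<bar>\<psi> t\<bar>)"
      using integral_norm_bound_integral[of \<psi> "{y..z}" "\<lambda>t. \<bar>\<psi> t\<bar>"] i
      by (auto intro: set_lebesgue_integral_eq_integral(1) set_integrable_abs)
    also have "\<dots> = (LINT t:{y..z}|lebesgue. \<bar>\<psi> t\<bar>)"
      by (rule set_lebesgue_integral_eq_integral(2)[symmetric, OF set_integrable_abs[OF i]])
    also have "\<dots> = m {y<..z}"
      unfolding m_def set_lebesgue_integral_def
    proof (rule integral_cong_AE)
      show "(\<lambda>x. indicat_real {y..z} x *\<^sub>R \<bar>\<psi> x\<bar>) \<in> borel_measurable lebesgue"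
        using am[of "{y..z}"] that unfolding set_integrable_def by (auto dest: borel_measurable_integrable)
      show "(\<lambda>x. indicat_real ({y<..z} \<inter> {p..q}) x *\<^sub>R \<bar>\<psi> x\<bar>) \<in> borel_measurable lebesgue"
        using am[of "{y<..z} \<inter> {p..q}"] unfolding set_integrable_def by (auto dest: borel_measurable_integrable)
      have "AE t in lebesgue. t \<noteq> y" by (rule AE_completion) (rule AE_lborel_singleton)
      then show "AE x in lebesgue. indicat_real {y..z} x *\<^sub>R \<bar>\<psi> x\<bar> = indicat_real ({y<..z} \<inter> {p..q}) x *\<^sub>R \<bar>\<psi> x\<bar>"
        by (rule eventually_mono) (use that in \<open>auto simp: indicator_def\<close>)
    qed
    finally show ?thesis .
  qed
  define C where "C n = {x. infdist x K \<le> 1 / real (Suc n)}" for n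
  have Cb: "C n \<in> sets borel" for n
    unfolding C_def by (intro borel_closed closed_Collect_le continuous_intros)
  have KC: "K \<subseteq> C n" for n unfolding C_def by auto
  have decC: "decseq C"
    unfolding C_def decseq_def by (auto intro: order_trans simp: frac_le)
  have intC: "(\<Inter>n. C n) = K"
  proof
    show "(\<Inter>n. C n) \<subseteq> K"
    proof
      fix x assume "x \<in> (\<Inter>n. C n)"
      then have x: "infdist x K \<le> 1 / real (Suc n)" for n by (auto simp: C_def)
      have "infdist x K = 0"
      proof (rule ccontr)
        assume "infdist x K \<noteq> 0"
        then have "infdist x K > 0" using infdist_nonneg[of x K] by simp
        then obtain n where "1 / real (Suc n) < infdist x K" using nat_approx_posE by metis
        then show False using x[of n] by simp
      qed
      then show "x \<in> K" using in_closed_iff_infdist_zero[OF compact_imp_closed[OF K(1)] ne] by simp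
    qed
  qed (use KC in auto)
  \<comment> \<open>An error bound that is additive over intervals: the masses in \<open>C n\<close>
    outside K plus the variation of \<open>\<Psi>\<close> inside \<open>C n\<close>.\<close>
  define \<mu> where "\<mu> n u v = measure M1 ({u<..v} \<inter> (C n - K)) + measure M2 ({u<..v} \<inter> (C n - K)) + m ({u<..v} \<inter> C n)" for n u v
  define R where "R u v = \<bar>measure M1 (K \<inter> {u<..v}) - measure M2 (K \<inter> {u<..v})\<bar>" for u v
  have est: "R (p - 1) q \<le> \<mu> n (p - 1) q" for n
  proof -
    \<comment> \<open>Starting at \<open>p - 1\<close> makes the half-open interval contain K even
      if p belongs to K.\<close>
    have "p - 1 \<le> q" using pq by simp
    then show ?thesis
    proof (induction rule: Bolzano)
      case (trans u w v)
      have split: "{u<..v} = {u<..w} \<union> {w<..v}" using trans by auto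
      have "measure M (K \<inter> {u<..v}) = measure M (K \<inter> {u<..w}) + measure M (K \<inter> {w<..v})"
        if "finite_measure M" "sets M = sets borel" for M
        unfolding split Int_Un_distrib using Kb that
        by (intro finite_measure.finite_measure_Union) auto
      then have "R u v \<le> R u w + R w v"
        unfolding R_def using M1.finite_measure_axioms M2.finite_measure_axioms by (simp add: abs_triangle_ineq4 | argo)+
      moreover have "\<mu> n u v = \<mu> n u w + \<mu> n w v"
      proof -
        have "measure M ({u<..v} \<inter> (C n - K)) = measure M ({u<..w} \<inter> (C n - K)) + measure M ({w<..v} \<inter> (C n - K))"
          if "finite_measure M" "sets M = sets borel" for M
          unfolding split Int_Un_distrib2 using Kb Cb that
          by (intro finite_measure.finite_measure_Union) auto
        moreover have "m ({u<..v} \<inter> C n) = m ({u<..w} \<inter> C n) + m ({w<..v} \<inter> C n)"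
          unfolding split Int_Un_distrib2 using Cb by (intro m_add) auto
        ultimately show ?thesis
          unfolding \<mu>_def using M1.finite_measure_axioms M2.finite_measure_axioms by simp
      qed
      ultimately show ?case using trans by argo
    next
      case (local x)
      show ?case
      proof (intro exI[of _ "1 / real (Suc n)"] conjI allI impI)
        fix u v assume uv: "u \<le> x \<and> x \<le> v \<and> v - u < 1 / real (Suc n)"
        have nonneg: "0 \<le> \<mu> n u v"
          unfolding \<mu>_def m_def set_lebesgue_integral_def
          by (intro add_nonneg_nonneg Bochner_Integration.integral_nonneg) auto
        show "R u v \<le> \<mu> n u v"
        proof (cases "K \<inter> {u..v} = {}")
          case True
          then have "K \<inter> {u<..v} = {}" by auto
          then show ?thesis using nonneg unfolding R_def by simp
        next
          case False
          have cK: "compact (K \<inter> {u..v})" using K(1) by (intro compact_Int_closed) auto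
          obtain y where y: "y \<in> K" "y \<in> {u..v}" "\<And>t. t \<in> K \<inter> {u..v} \<Longrightarrow> y \<le> t"
            using compact_attains_inf[OF cK False] by auto
          obtain z where z: "z \<in> K" "z \<in> {u..v}" "\<And>t. t \<in> K \<inter> {u..v} \<Longrightarrow> t \<le> z"
            using compact_attains_sup[OF cK False] by auto
          have yz: "y \<le> z" using y z by auto
          have sub: "{y<..z} \<subseteq> C n"
          proof
            fix t assume t: "t \<in> {y<..z}"
            have "infdist t K \<le> dist t y" by (rule infdist_le[OF y(1)])
            also have "\<dots> \<le> 1 / real (Suc n)" using t uv y z by (auto simp: dist_real_def)
            finally show "t \<in> C n" by (simp add: C_def)
          qed
          \<comment> \<open>The interval from y to z omits y; the atom at y is counted separately
            and cancels by \<open>measure_singleton\<close>.\<close>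
          have Keq: "K \<inter> {u<..v} = (K \<inter> {y<..z}) \<union> (if u < y then {y} else {})"
            using y z by (auto simp: less_le)
          have r: "measure M (K \<inter> {u<..v}) = measure M {y<..z} - measure M ({y<..z} \<inter> (C n - K)) + (if u < y then measure M {y} else 0)"
            if M: "finite_measure M" "sets M = sets borel" for M
          proof -
            have "measure M (K \<inter> {u<..v}) = measure M (K \<inter> {y<..z}) + measure M (if u < y then {y} else {})"
              unfolding Keq using M Kb by (intro finite_measure.finite_measure_Union) auto
            moreover have "measure M {y<..z} = measure M (K \<inter> {y<..z}) + measure M ({y<..z} \<inter> (C n - K))"
            proof -
              have "{y<..z} = (K \<inter> {y<..z}) \<union> ({y<..z} \<inter> (C n - K))" using sub by auto
              moreover have "measure M ((K \<inter> {y<..z}) \<union> ({y<..z} \<inter> (C n - K)))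
                  = measure M (K \<inter> {y<..z}) + measure M ({y<..z} \<inter> (C n - K))"
                using M Kb Cb by (intro finite_measure.finite_measure_Union) auto
              ultimately show ?thesis by simp
            qed
            ultimately show ?thesis by (simp split: if_splits)
          qed
          have "f z - f y = \<Psi> z - \<Psi> y" using fK y z by simp
          then have "\<bar>f z - f y\<bar> \<le> m {y<..z}"
          proof -
            assume *: "f z - f y = \<Psi> z - \<Psi> y"
            have "y \<in> {p..q}" "z \<in> {p..q}" using y(1) z(1) K(2) by auto
            then show ?thesis unfolding * using m_interval[of y z] yz by simp
          qed
          moreover have "measure M1 (K \<inter> {u<..v}) - measure M2 (K \<inter> {u<..v})
              = (f z - f y) - measure M1 ({y<..z} \<inter> (C n - K)) + measure M2 ({y<..z} \<inter> (C n - K))"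
            using r[OF M1.finite_measure_axioms] r[OF M2.finite_measure_axioms] measure_Ioc[OF yz] measure_singleton[of y]
            by (simp split: if_splits)
          ultimately have "R u v \<le> m {y<..z} + measure M1 ({y<..z} \<inter> (C n - K)) + measure M2 ({y<..z} \<inter> (C n - K))"
            unfolding R_def using measure_nonneg[of M1 "{y<..z} \<inter> (C n - K)"] measure_nonneg[of M2 "{y<..z} \<inter> (C n - K)"] by argo
          moreover have "m {y<..z} \<le> m ({u<..v} \<inter> C n)"
            using sub y z Cb by (intro m_mono) auto
          moreover have "measure M1 ({y<..z} \<inter> (C n - K)) \<le> measure M1 ({u<..v} \<inter> (C n - K))"
            using y z Cb Kb by (intro M1.finite_measure_mono) auto
          moreover have "measure M2 ({y<..z} \<inter> (C n - K)) \<le> measure M2 ({u<..v} \<inter> (C n - K))"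
            using y z Cb Kb by (intro M2.finite_measure_mono) auto
          ultimately show ?thesis unfolding \<mu>_def by argo
        qed
      qed simp
    qed
  qed
  have "K \<inter> {p - 1<..q} = K" using K(2) by auto
  then have R: "R (p - 1) q = \<bar>measure M1 K - measure M2 K\<bar>" unfolding R_def by simp
  have bound: "\<mu> n (p - 1) q \<le> (measure M1 (C n) - measure M1 K) + (measure M2 (C n) - measure M2 K) + m (C n)" for n
  proof -
    have "measure M ({p - 1<..q} \<inter> (C n - K)) \<le> measure M (C n) - measure M K"
      if M: "finite_measure M" "sets M = sets borel" for M
    proof -
      have "measure M ({p - 1<..q} \<inter> (C n - K)) \<le> measure M (C n - K)"
        using M Cb Kb by (intro finite_measure.finite_measure_mono) auto
      also have "\<dots> = measure M (C n) - measure M K"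
        using M Cb Kb KC by (intro finite_measure.finite_measure_Diff) auto
      finally show ?thesis .
    qed
    moreover have "m ({p - 1<..q} \<inter> C n) \<le> m (C n)" using Cb by (intro m_mono) auto
    ultimately show ?thesis
      unfolding \<mu>_def using M1.finite_measure_axioms M2.finite_measure_axioms by (smt (verit) sets_interval_measure)
  qed
  have "(\<lambda>n. m (C n)) \<longlonglongrightarrow> 0"
  proof -
    have "(\<lambda>n. m (C n)) \<longlonglongrightarrow> (LINT t:(\<Inter>n. C n \<inter> {p..q})|lebesgue. \<bar>\<psi> t\<bar>)"
      unfolding m_def using decC Cb
      by (intro set_integral_cont_down am) (auto simp: decseq_def)
    moreover have "(\<Inter>n. C n \<inter> {p..q}) = K" using intC K(2) by auto
    moreover have "(LINT t:K|lebesgue. \<bar>\<psi> t\<bar>) = 0"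
    proof -
      have "K \<in> null_sets lebesgue" using K(3) Kb by (auto intro!: null_sets_completionI)
      then have "AE t in lebesgue. t \<notin> K" by (rule AE_not_in)
      then have "AE t in lebesgue. indicat_real K t *\<^sub>R \<bar>\<psi> t\<bar> = 0" by (rule eventually_mono) auto
      then show ?thesis unfolding set_lebesgue_integral_def by (rule integral_eq_zero_AE)
    qed
    ultimately show ?thesis by simp
  qed
  moreover have "(\<lambda>n. measure M1 (C n)) \<longlonglongrightarrow> measure M1 K" "(\<lambda>n. measure M2 (C n)) \<longlonglongrightarrow> measure M2 K"
    using M1.finite_Lim_measure_decseq[OF _ decC] M2.finite_Lim_measure_decseq[OF _ decC] Cb unfolding intC by auto
  ultimately have "(\<lambda>n. (measure M1 (C n) - measure M1 K) + (measure M2 (C n) - measure M2 K) + m (C n))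
      \<longlonglongrightarrow> (measure M1 K - measure M1 K) + (measure M2 K - measure M2 K) + 0"
    by (intro tendsto_intros)
  then have "\<bar>measure M1 K - measure M2 K\<bar> \<le> (measure M1 K - measure M1 K) + (measure M2 K - measure M2 K) + 0"
    by (rule LIMSEQ_le_const) (use R est bound order_trans in \<open>metis\<close>)
  then show ?thesis by simp
qed

text \<open>By inner regularity it suffices to compare the measures of compact subsets.\<close>

lemma null_agreeing_density:
  assumes E: "E \<in> sets borel" "E \<subseteq> {p..q}" and \<Psi>: "has_density \<Psi> \<psi> p q" and fE: "\<And>t. t \<in> E \<Longrightarrow> f t = \<Psi> t"
  shows "null_agreeing E"
  unfolding null_agreeing_def
proof (intro conjI ballI impI E(1))
  fix B assume B: "B \<in> sets borel" "B \<subseteq> E" "emeasure lborel B = 0"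
  have ex: "\<exists>K. compact K \<and> K \<subseteq> B \<and> measure M B \<le> measure M K + e"
    if M: "finite_measure M" "sets M = sets borel" and e: "e > 0" for M and e :: real
  proof -
    interpret finite_measure M by fact
    have "emeasure M B = (SUP K\<in>{K. K \<subseteq> B \<and> compact K}. emeasure M K)"
      using M B(1) by (intro inner_regular) (auto simp: emeasure_eq_measure)
    note sup = this
    show ?thesis
    proof (cases "measure M B \<le> e")
      case True
      then show ?thesis by (intro exI[of _ "{}"]) auto
    next
      case False
      then have "ennreal (measure M B - e) < emeasure M B"
        using e by (simp add: emeasure_eq_measure ennreal_less_iff)
      then obtain K where K: "K \<subseteq> B" "compact K" "ennreal (measure M B - e) < emeasure M K"
        unfolding sup less_SUP_iff by auto
      then have "measure M B - e < measure M K"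
        using False by (simp add: emeasure_eq_measure ennreal_less_iff)
      then show ?thesis using K by (intro exI[of _ K]) simp
    qed
  qed
  have "\<bar>measure M1 B - measure M2 B\<bar> \<le> e" if e: "e > 0" for e :: real
  proof -
    obtain K1 where K1: "compact K1" "K1 \<subseteq> B" "measure M1 B \<le> measure M1 K1 + e"
      using ex[OF M1.finite_measure_axioms _ e] by auto
    obtain K2 where K2: "compact K2" "K2 \<subseteq> B" "measure M2 B \<le> measure M2 K2 + e"
      using ex[OF M2.finite_measure_axioms _ e] by auto
    \<comment> \<open>One compact set that approximates B for both measures at once.\<close>
    define K where "K = K1 \<union> K2"
    have K: "compact K" "K \<subseteq> B" "K \<in> sets borel" using K1 K2 unfolding K_def by (auto intro: borel_compact)
    have "emeasure lborel K = 0" using emeasure_mono[of K B lborel] B K by auto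
    then have "measure M1 K = measure M2 K"
      using K B E by (intro null_compact_agree[OF _ _ _ \<Psi> fE]) auto
    moreover have "measure M1 K1 \<le> measure M1 K" "measure M1 K \<le> measure M1 B"
      using K B by (auto intro!: M1.finite_measure_mono simp: K_def)
    moreover have "measure M2 K2 \<le> measure M2 K" "measure M2 K \<le> measure M2 B"
      using K B by (auto intro!: M2.finite_measure_mono simp: K_def)
    ultimately show ?thesis using K1(3) K2(3) by argo
  qed
  then have "\<bar>measure M1 B - measure M2 B\<bar> \<le> 0" by (rule field_le_epsilon) simp
  then show "emeasure M1 B = emeasure M2 B" by (simp add: M1.emeasure_eq_measure M2.emeasure_eq_measure)
qed

text \<open>Off a common null carrier Z of the singular parts both measures have densities by
  Radon-Nikodym. Within E they agree on Z, so these parts cancel in every increment of f. The L1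
  bound is the sum of the total masses.\<close>

lemma null_agreeing_imp_density:
  assumes agree: "null_agreeing E" and cd: "{c..d} \<subseteq> E"
  obtains \<rho> where "has_density f \<rho> c d" "integral {c..d} (\<lambda>t. \<bar>\<rho> t\<bar>) \<le> (u1 - l1) + (u2 - l2)"
proof -
  obtain Z1 where Z1: "Z1 \<in> sets borel" "emeasure lborel Z1 = 0"
    "\<And>B. B \<in> sets borel \<Longrightarrow> emeasure lborel B = 0 \<Longrightarrow> emeasure M1 (B - Z1) = 0"
    using null_set_carrying_singular_part[OF M1.finite_measure_axioms] by auto
  obtain Z2 where Z2: "Z2 \<in> sets borel" "emeasure lborel Z2 = 0"
    "\<And>B. B \<in> sets borel \<Longrightarrow> emeasure lborel B = 0 \<Longrightarrow> emeasure M2 (B - Z2) = 0"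
    using null_set_carrying_singular_part[OF M2.finite_measure_axioms] by auto
  define Z where "Z = Z1 \<union> Z2"
  have Z: "Z \<in> sets borel" "emeasure lborel Z = 0"
    using Z1 Z2 emeasure_subadditive[of Z1 lborel Z2] unfolding Z_def by simp_all
  have dens: "\<exists>r. r \<in> borel_measurable borel \<and> (\<forall>x. 0 \<le> r x) \<and> integrable lborel r \<and> (\<integral>x. r x \<partial>lborel) \<le> w \<and>
      (\<forall>B\<in>sets borel. (LINT x:B|lborel. r x) = measure M (B - Z))"
    if M: "finite_measure M" "sets M = sets borel" "measure M UNIV \<le> w"
      and nz: "\<And>B. B \<in> sets borel \<Longrightarrow> emeasure lborel B = 0 \<Longrightarrow> emeasure M (B - Z) = 0" for M w
  proof -
    interpret finite_measure M by fact
    \<comment> \<open>The part of M off Z, which is absolutely continuous by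
      \<open>nz\<close>.\<close>
    define N where "N = density M (indicator (- Z))"
    have N: "emeasure N B = emeasure M (B - Z)" if "B \<in> sets borel" for B
    proof -
      have "emeasure N B = (\<integral>\<^sup>+x. indicator (- Z) x * indicator B x \<partial>M)"
        unfolding N_def using that Z M by (intro emeasure_density) auto
      also have "\<dots> = (\<integral>\<^sup>+x. indicator (B - Z) x \<partial>M)"
        by (intro nn_integral_cong) (auto simp: indicator_def)
      finally show ?thesis using that Z M by simp
    qed
    have "absolutely_continuous lborel N"
      unfolding absolutely_continuous_def null_sets_def using N nz M by (auto simp: N_def)
    then obtain \<rho> where \<rho>: "\<rho> \<in> borel_measurable lborel" "density lborel \<rho> = N"
      using sigma_finite_measure.Radon_Nikodym[OF lborel.sigma_finite_measure_axioms, of N] M by (auto simp: N_def)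
    have nn: "(\<integral>\<^sup>+x. \<rho> x * indicator B x \<partial>lborel) = ennreal (measure M (B - Z))" if "B \<in> sets borel" for B
      using emeasure_density[OF \<rho>(1), of B] N[OF that] that unfolding \<rho>(2) by (simp add: emeasure_eq_measure)
    have "(\<integral>\<^sup>+x. \<rho> x \<partial>lborel) = ennreal (measure M (UNIV - Z))" using nn[of UNIV] by simp
    then have fin: "(\<integral>\<^sup>+x. \<rho> x \<partial>lborel) \<noteq> \<infinity>" by simp
    then have ae: "AE x in lborel. \<rho> x \<noteq> \<infinity>" using \<rho>(1) by (rule nn_integral_PInf_AE[rotated])
    define r where "r x = enn2real (\<rho> x)" for x
    have rm: "r \<in> borel_measurable borel" unfolding r_def using \<rho>(1) by simp
    have r\<rho>: "AE x in lborel. ennreal (r x) = \<rho> x"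
      using ae by (rule eventually_mono) (auto simp: r_def less_top)
    have nnr: "(\<integral>\<^sup>+x. ennreal (r x) * indicator B x \<partial>lborel) = ennreal (measure M (B - Z))" if "B \<in> sets borel" for B
      unfolding nn[OF that, symmetric] by (rule nn_integral_cong_AE) (use r\<rho> in eventually_elim, simp)
    have r0: "0 \<le> r x" for x by (simp add: r_def)
    have int: "integrable lborel r"
      by (rule integrableI_nonneg) (use rm r0 nnr[of UNIV] in auto)
    have li: "(LINT x:B|lborel. r x) = measure M (B - Z)" if "B \<in> sets borel" for B
    proof -
      have "ennreal (LINT x:B|lborel. r x) = (\<integral>\<^sup>+x. ennreal (indicat_real B x *\<^sub>R r x) \<partial>lborel)"
        unfolding set_lebesgue_integral_def using that int r0
        by (intro nn_integral_eq_integral[symmetric] integrable_mult_indicator) auto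
      also have "\<dots> = (\<integral>\<^sup>+x. ennreal (r x) * indicator B x \<partial>lborel)"
        by (intro nn_integral_cong) (auto simp: indicator_def)
      finally show ?thesis
        using nnr[OF that] r0 by (simp add: set_lebesgue_integral_def ennreal_inj integral_nonneg_AE)
    qed
    have "(\<integral>x. r x \<partial>lborel) = measure M (UNIV - Z)"
      using li[of UNIV] by (simp add: set_lebesgue_integral_def)
    also have "\<dots> \<le> w" using M bounded_measure[of "UNIV - Z"] by (simp add: sets_eq_imp_space_eq[OF M(2)])
    finally show ?thesis using rm r0 int li by blast
  qed
  have nz1: "emeasure M1 (B - Z) = 0" if "B \<in> sets borel" "emeasure lborel B = 0" for B
    using Z1(3)[OF that] emeasure_mono[of "B - Z" "B - Z1" M1] that Z1(1) unfolding Z_def by auto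
  have nz2: "emeasure M2 (B - Z) = 0" if "B \<in> sets borel" "emeasure lborel B = 0" for B
    using Z2(3)[OF that] emeasure_mono[of "B - Z" "B - Z2" M2] that Z2(1) unfolding Z_def by auto
  obtain r1 where r1: "r1 \<in> borel_measurable borel" "\<And>x. 0 \<le> r1 x" "integrable lborel r1" "(\<integral>x. r1 x \<partial>lborel) \<le> u1 - l1"
    "\<And>B. B \<in> sets borel \<Longrightarrow> (LINT x:B|lborel. r1 x) = measure M1 (B - Z)"
    using dens[OF M1.finite_measure_axioms sets_interval_measure
      interval_measure_finite(2)[OF mono1 right1 bounds(1,2)] nz1] by blast
  obtain r2 where r2: "r2 \<in> borel_measurable borel" "\<And>x. 0 \<le> r2 x" "integrable lborel r2" "(\<integral>x. r2 x \<partial>lborel) \<le> u2 - l2"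
    "\<And>B. B \<in> sets borel \<Longrightarrow> (LINT x:B|lborel. r2 x) = measure M2 (B - Z)"
    using dens[OF M2.finite_measure_axioms sets_interval_measure
      interval_measure_finite(2)[OF mono2 right2 bounds(3,4)] nz2] by blast
  define \<rho> where "\<rho> x = r1 x - r2 x" for x
  have \<rho>: "integrable lborel \<rho>" unfolding \<rho>_def using r1 r2 by auto
  have si: "set_integrable lborel B h" if "integrable lborel h" "B \<in> sets borel" for B and h :: "real \<Rightarrow> real"
    unfolding set_integrable_def using that by (intro integrable_mult_indicator) auto
  have abs: "\<rho> absolutely_integrable_on {c..d}"
    using si[OF \<rho>, of "{c..d}"] unfolding set_integrable_def
    by (rule integrable_completion[THEN iffD2, rotated]) (use \<rho> in auto)
  have "(\<rho> has_integral f y - f x) {x..y}" if xy: "c \<le> x" "x \<le> y" "y \<le> d" for x y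
  proof -
    let ?B = "{x<..y}"
    have B: "?B \<in> sets borel" "?B \<subseteq> E" using xy cd by (auto simp: subset_iff)
    have zz: "measure M1 (?B \<inter> Z) = measure M2 (?B \<inter> Z)"
    proof -
      have "emeasure lborel (?B \<inter> Z) = 0" using emeasure_mono[of "?B \<inter> Z" Z lborel] Z by auto
      then have "emeasure M1 (?B \<inter> Z) = emeasure M2 (?B \<inter> Z)"
        using agree B Z unfolding null_agreeing_def by blast
      then show ?thesis by (simp add: M1.emeasure_eq_measure M2.emeasure_eq_measure)
    qed
    have sp: "measure M ?B = measure M (?B - Z) + measure M (?B \<inter> Z)" if "finite_measure M" "sets M = sets borel" for M
    proof -
      have "measure M ((?B - Z) \<union> (?B \<inter> Z)) = measure M (?B - Z) + measure M (?B \<inter> Z)"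
        using that Z by (intro finite_measure.finite_measure_Union) auto
      then show ?thesis by (simp add: Un_Diff_Int)
    qed
    have "f y - f x = measure M1 ?B - measure M2 ?B" using measure_Ioc[OF xy(2)] by simp
    also have "\<dots> = measure M1 (?B - Z) - measure M2 (?B - Z)"
      using sp[OF M1.finite_measure_axioms] sp[OF M2.finite_measure_axioms] zz by simp
    also have "\<dots> = (LINT t:?B|lborel. \<rho> t)"
      unfolding \<rho>_def using r1(5)[OF B(1)] r2(5)[OF B(1)] si[OF r1(3) B(1)] si[OF r2(3) B(1)]
      by (subst set_integral_diff) auto
    also have "\<dots> = (LINT t:{x..y}|lborel. \<rho> t)"
      unfolding set_lebesgue_integral_def
    proof (rule integral_cong_AE)
      have "AE t in lborel. t \<noteq> x" by (rule AE_lborel_singleton)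
      then show "AE t in lborel. indicat_real {x<..y} t *\<^sub>R \<rho> t = indicat_real {x..y} t *\<^sub>R \<rho> t"
        by (rule eventually_mono) (auto simp: indicator_def)
    qed (use \<rho> in auto)
    also have "\<dots> = integral {x..y} \<rho>"
      by (rule set_borel_integral_eq_integral(2)) (rule si[OF \<rho>], simp)
    finally have "f y - f x = integral {x..y} \<rho>" .
    moreover have "\<rho> integrable_on {x..y}"
      by (rule set_borel_integral_eq_integral(1)) (rule si[OF \<rho>], simp)
    ultimately show ?thesis by (simp add: integrable_integral)
  qed
  then have 1: "has_density f \<rho> c d" using abs unfolding has_density_def by blast
  have "integral {c..d} (\<lambda>t. \<bar>\<rho> t\<bar>) = (LINT t:{c..d}|lborel. \<bar>\<rho> t\<bar>)"
    by (rule set_borel_integral_eq_integral(2)[symmetric]) (rule si, use \<rho> in auto)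
  also have "\<dots> \<le> (\<integral>t. r1 t + r2 t \<partial>lborel)"
    unfolding set_lebesgue_integral_def
  proof (rule integral_mono)
    show "integrable lborel (\<lambda>t. indicat_real {c..d} t *\<^sub>R \<bar>\<rho> t\<bar>)"
      using si[of "\<lambda>t. \<bar>\<rho> t\<bar>" "{c..d}"] \<rho> unfolding set_integrable_def by auto
    show "integrable lborel (\<lambda>t. r1 t + r2 t)" using r1 r2 by auto
    fix t show "indicat_real {c..d} t *\<^sub>R \<bar>\<rho> t\<bar> \<le> r1 t + r2 t"
      using r1(2)[of t] r2(2)[of t] by (auto simp: \<rho>_def indicator_def)
  qed
  also have "\<dots> \<le> (u1 - l1) + (u2 - l2)" using r1(3,4) r2(3,4) by simp
  finally show ?thesis using that 1 by blast
qed

end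

section \<open>Derivatives of C1 roots\<close>

text \<open>The j-th derivative of \<open>x^k\<close>. For \<open>j > k\<close> the exponent is
  truncated to 0, but then the coefficient contains the factor \<open>k - k\<close>.\<close>

definition falling_power :: "nat \<Rightarrow> nat \<Rightarrow> real \<Rightarrow> real" where
  "falling_power j k x = (\<Prod>i<j. real k - real i) * x ^ (k - j)"

lemma falling_power_derivative:
  "(falling_power j k has_real_derivative falling_power (Suc j) k x) (at x)"
proof (cases "j < k")
  case True
  then have "((\<lambda>x. (\<Prod>i<j. real k - real i) * x ^ (k - j)) has_real_derivative
      (\<Prod>i<j. real k - real i) * (real (k - j) * x ^ (k - Suc j))) (at x)"
    by (auto intro!: derivative_eq_intros)
  then show ?thesis using True by (simp add: falling_power_def[abs_def] of_nat_diff mult.assoc)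
next
  case False
  then have "(\<Prod>i<Suc j. real k - real i) = 0" by (auto intro!: prod_zero)
  then have "falling_power (Suc j) k x = 0" unfolding falling_power_def by simp
  moreover have "falling_power j k = (\<lambda>x. \<Prod>i<j. real k - real i)"
    using False by (simp add: falling_power_def[abs_def])
  ultimately show ?thesis by simp
qed

lemma falling_power_top: "k < j \<Longrightarrow> falling_power j k x = 0" "falling_power k k x \<noteq> 0"
  unfolding falling_power_def by (auto intro!: prod_zero)

text \<open>Each isolated point is cut out of T by an interval with rational end points.\<close>

lemma countable_isolated_points:
  fixes T :: "real set"
  shows "countable {t \<in> T. \<not> t islimpt T}"
proof -
  have "\<exists>p r. p \<in> \<rat> \<and> r \<in> \<rat> \<and> T \<inter> {p<..<r} = {t}" if t: "t \<in> T" "\<not> t islimpt T" for t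
  proof -
    obtain e where e: "e > 0" "\<And>y. y \<in> T \<Longrightarrow> dist y t < e \<Longrightarrow> y = t"
      using t(2) unfolding islimpt_approachable by auto
    obtain p where p: "p \<in> \<rat>" "t - e < p" "p < t" using Rats_dense_in_real[of "t - e" t] e(1) by auto
    obtain r where r: "r \<in> \<rat>" "t < r" "r < t + e" using Rats_dense_in_real[of t "t + e"] e(1) by auto
    have "T \<inter> {p<..<r} = {t}"
    proof
      show "T \<inter> {p<..<r} \<subseteq> {t}"
      proof
        fix y assume y: "y \<in> T \<inter> {p<..<r}"
        then have "dist y t < e" using p r unfolding dist_real_def by auto
        then show "y \<in> {t}" using e(2) y by auto
      qed
    qed (use t p r in auto)
    then show ?thesis using p r by blast
  qed
  then have "{t \<in> T. \<not> t islimpt T} \<subseteq> (\<lambda>(p, r). the_elem (T \<inter> {p<..<r})) ` (\<rat> \<times> \<rat>)"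
    by (force simp: image_iff)
  then show ?thesis by (rule countable_subset) (intro countable_image countable_SIGMA countable_rat)
qed

lemma has_density_imp_derivative:
  assumes "has_density f f' c d" "continuous_on {c..d} f'" "t \<in> {c..d}"
  shows "(f has_real_derivative f' t) (at t within {c..d})"
proof -
  have "((\<lambda>x. f c + integral {c..x} f') has_real_derivative f' t) (at t within {c..d})"
    by (auto intro!: derivative_eq_intros integral_has_real_derivative assms)
  then show ?thesis
    by (rule has_field_derivative_transform_within[of _ _ _ _ 1])
      (use assms(3) has_densityD(3)[OF assms(1)] in auto)
qed

text \<open>At a limit point of T the difference quotients along T alone determine the
  derivative.\<close>

lemma derivative_zero_at_limit_point:
  fixes g :: "real \<Rightarrow> real"
  assumes "(g has_real_derivative g') (at t within S)" "t islimpt T" "T \<subseteq> S" "t \<in> T" "\<And>x. x \<in> T \<Longrightarrow> g x = 0"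
  shows "g' = 0"
proof -
  have "(g has_real_derivative g') (at t within T)" using assms(1,3) by (rule DERIV_subset)
  moreover have "((\<lambda>x. 0) has_real_derivative g') (at t within T)"
    by (rule has_field_derivative_transform_within[OF calculation, of 1]) (use assms in auto)
  then have "((\<lambda>y. (0 - 0) / (y - t)) \<longlongrightarrow> g') (at t within T)" by (simp add: has_field_derivative_iff)
  then have "((\<lambda>y. 0) \<longlongrightarrow> g') (at t within T)" by simp
  then show ?thesis
    using assms(2) tendsto_unique[of "at t within T" "\<lambda>y. 0" g' 0] by (simp add: trivial_limit_within)
qed

context continuous_bounded_variation
begin

lemma null_agreeing_countable_Union:
  assumes "countable \<E>" "\<And>E. E \<in> \<E> \<Longrightarrow> null_agreeing E"
  shows "null_agreeing (\<Union>\<E>)"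
proof (cases "\<E> = {}")
  case True
  then show ?thesis using null_agreeing_countable[of "{}"] by simp
next
  case False
  have "null_agreeing (\<Union>n. from_nat_into \<E> n)"
    using assms(2) from_nat_into[OF False] by (intro null_agreeing_UN) auto
  then show ?thesis using range_from_nat_into[OF False assms(1)] by simp
qed

text \<open>Let \<open>s\<close> be a root of multiplicity \<open>q\<close> on \<open>T\<close>. There \<open>\<partial>\<^sub>x\<^sup>q\<^sup>-\<^sup>1 Q(t, s(t))\<close> vanishes, and
  differentiating it along \<open>T\<close> at a limit point of \<open>T\<close> expresses \<open>s'\<close> by absolutely continuous functions.\<close>

lemma null_agreeing_root:
  fixes a a' a'' :: "nat \<Rightarrow> real \<Rightarrow> real" and s s' :: "real \<Rightarrow> real"
  assumes cd: "c < d"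
    and s: "\<And>t. t \<in> {c..d} \<Longrightarrow> (s has_real_derivative s' t) (at t within {c..d})" "continuous_on {c..d} s'"
    and a: "\<And>k. k \<le> N \<Longrightarrow> has_density (a k) (a' k) c d" "\<And>k. k \<le> N \<Longrightarrow> has_density (a' k) (a'' k) c d"
    and monic: "\<And>t. t \<in> {c..d} \<Longrightarrow> a N t = 1"
    and root: "\<And>t. t \<in> {c..d} \<Longrightarrow> (\<Sum>k\<le>N. a k t * s t ^ k) = 0"
    and f: "\<And>t. t \<in> {c..d} \<Longrightarrow> f t = s' t"
  shows "null_agreeing {c..d}"
proof -
  \<comment> \<open>With Q(t, x) the polynomial with coefficients \<open>a k t\<close>:
    \<open>D j\<close> is the j-th x-derivative of Q along \<open>(t, s t)\<close>, and
    \<open>B j\<close> is the same for the t-derivative of Q. Thus \<open>D j\<close> has the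
    derivative \<open>B j + D (Suc j) * s'\<close>.\<close>
  define D where "D j t = (\<Sum>k\<le>N. a k t * falling_power j k (s t))" for j t
  define B where "B j t = (\<Sum>k\<le>N. a' k t * falling_power j k (s t))" for j t
  have sd: "has_density s s' c d" by (rule has_density_C1[OF s])
  have cs: "continuous_on {c..d} s" by (rule has_density_continuous[OF sd])
  have e_der: "((\<lambda>t. falling_power j k (s t)) has_real_derivative falling_power (Suc j) k (s t) * s' t) (at t within {c..d})"
    if "t \<in> {c..d}" for j k t
    by (rule DERIV_chain2[OF falling_power_derivative s(1)[OF that]])
  have cfp: "continuous_on S (falling_power j k)" for S j k
    by (rule DERIV_continuous_on) (rule has_field_derivative_at_within[OF falling_power_derivative])
  have ce: "continuous_on {c..d} (\<lambda>t. falling_power j k (s t))" for j k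
    by (rule continuous_on_compose2[OF cfp cs]) auto
  have e_dens: "has_density (\<lambda>t. falling_power j k (s t)) (\<lambda>t. falling_power (Suc j) k (s t) * s' t) c d" for j k
    by (rule has_density_C1[OF e_der]) (auto intro!: continuous_intros ce s(2))
  have D_dens: "\<exists>h. has_density (D j) h c d" for j
    unfolding D_def[abs_def] by (rule exI, rule has_density_sum) (rule has_density_mult[OF a(1) e_dens], simp)
  have B_dens: "\<exists>h. has_density (B j) h c d" for j
    unfolding B_def[abs_def] by (rule exI, rule has_density_sum) (rule has_density_mult[OF a(2) e_dens], simp)
  have cD: "continuous_on {c..d} (D j)" for j using D_dens has_density_continuous by blast
  have D_der: "(D j has_real_derivative B j t + D (Suc j) t * s' t) (at t within {c..d})" if t: "t \<in> {c..d}" for j t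
  proof -
    have "(a k has_real_derivative a' k t) (at t within {c..d})" if "k \<le> N" for k
      by (rule has_density_imp_derivative[OF a(1)[OF that] has_density_continuous[OF a(2)[OF that]] t])
    then have "((\<lambda>t. \<Sum>k\<le>N. a k t * falling_power j k (s t)) has_real_derivative
        (\<Sum>k\<le>N. a' k t * falling_power j k (s t) + falling_power (Suc j) k (s t) * s' t * a k t)) (at t within {c..d})"
      by (intro DERIV_sum DERIV_mult e_der t) auto
    moreover have "(\<Sum>k\<le>N. a' k t * falling_power j k (s t) + falling_power (Suc j) k (s t) * s' t * a k t)
        = B j t + D (Suc j) t * s' t"
      by (simp add: B_def D_def sum.distrib sum_distrib_left mult_ac)
    ultimately show ?thesis unfolding D_def[abs_def] by simp
  qed
  have D0: "D 0 t = 0" if "t \<in> {c..d}" for t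
    using root[OF that] by (simp add: D_def falling_power_def)
  have DN: "D N t \<noteq> 0" if t: "t \<in> {c..d}" for t
  proof -
    have "D N t = (\<Sum>k\<in>{N}. a k t * falling_power N k (s t))"
      unfolding D_def using falling_power_top(1) by (intro sum.mono_neutral_right) auto
    then show ?thesis using monic[OF t] falling_power_top(2)[of N "s t"] by simp
  qed
  \<comment> \<open>The points where s is a root of multiplicity exactly q.\<close>
  define T where "T q = {t \<in> {c..d}. D q t \<noteq> 0 \<and> (\<forall>j<q. D j t = 0)}" for q
  define I where "I q = {t \<in> T q. \<not> t islimpt T q}" for q
  define S where "S q p r = T q \<inter> {p..r} - I q" for q p r
  \<comment> \<open>The windows from p to r have rational ends and contain no zero of
    \<open>D q\<close>, so that \<open>1 / D q\<close> has a density on the whole window and not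
    merely on \<open>T q\<close>.\<close>
  define \<E> where "\<E> = {I q | q. True} \<union> {S q p r | q p r. p \<in> \<rat> \<and> r \<in> \<rat> \<and> 0 < q \<and> (\<forall>t\<in>{c..d} \<inter> {p..r}. D q t \<noteq> 0)}"
  have Iq: "countable (I q)" for q unfolding I_def by (rule countable_isolated_points)
  have Tb: "T q \<in> sets borel" for q
  proof -
    have "{t \<in> {c..d}. D j t = 0} \<in> sets borel" for j
    proof -
      have "closed ({c..d} \<inter> D j -` {0})" by (rule continuous_closed_preimage[OF cD]) auto
      moreover have "{c..d} \<inter> D j -` {0} = {t \<in> {c..d}. D j t = 0}" by auto
      ultimately show ?thesis by (metis borel_closed)
    qed
    then have mem: "(({c..d} - {t \<in> {c..d}. D q t = 0}) \<inter> (\<Inter>j\<in>{..<q}. {t \<in> {c..d}. D j t = 0})) \<in> sets borel" if "0 < q"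
      using that by (intro sets.Int sets.Diff sets.finite_INT) auto
    have eq: "T q = ({c..d} - {t \<in> {c..d}. D q t = 0}) \<inter> (\<Inter>j\<in>{..<q}. {t \<in> {c..d}. D j t = 0})" if "0 < q"
      using that unfolding T_def by auto
    show ?thesis
    proof (cases "q = 0")
      case True
      have "T 0 = {}" unfolding T_def using D0 by auto
      then show ?thesis using True by simp
    next
      case False
      then have "0 < q" by simp
      from mem[OF this] show ?thesis unfolding eq[OF \<open>0 < q\<close>] .
    qed
  qed
  have cE: "countable \<E>"
  proof -
    have "\<E> \<subseteq> range I \<union> (\<lambda>(q, p, r). S q p r) ` (UNIV \<times> \<rat> \<times> \<rat>)" unfolding \<E>_def by auto
    then show ?thesis
      by (rule countable_subset) (intro countable_Un countable_image countable_SIGMA countable_rat; simp)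
  qed
  have agree: "null_agreeing E" if "E \<in> \<E>" for E
  proof -
    consider q where "E = I q" | q p r where "E = S q p r" "0 < q" "\<And>t. t \<in> {c..d} \<inter> {p..r} \<Longrightarrow> D q t \<noteq> 0"
      using \<open>E \<in> \<E>\<close> unfolding \<E>_def by blast
    then show ?thesis
    proof cases
      case 1
      then show ?thesis using null_agreeing_countable[OF Iq] by simp
    next
      case 2
      obtain j where j: "q = Suc j" using 2(2) gr0_implies_Suc by blast
      define P where "P = max c p"
      define R where "R = min d r"
      have sub: "{P..R} = {c..d} \<inter> {p..r}" by (auto simp: P_def R_def)
      obtain hD where hD: "has_density (D q) hD P R"
        using D_dens[of q] has_density_subinterval[of "D q" _ c d P R] by (auto simp: P_def R_def)
      obtain hB where hB: "has_density (B j) hB P R"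
        using B_dens[of j] has_density_subinterval[of "B j" _ c d P R] by (auto simp: P_def R_def)
      have nz: "D q t \<noteq> 0" if "t \<in> {P..R}" for t using 2(3) that unfolding sub by auto
      have d: "\<exists>h. has_density (\<lambda>t. (- 1) * (B j t * (1 / D q t))) h P R"
        by (rule exI) (rule has_density_cmult[OF has_density_mult[OF hB has_density_inverse[OF hD nz]]], simp)
      then obtain h where h: "has_density (\<lambda>t. (- 1) * (B j t * (1 / D q t))) h P R" by blast
      have "f t = (- 1) * (B j t * (1 / D q t))" if t: "t \<in> E" for t
      proof -
        have tT: "t \<in> T q" "t islimpt T q" "t \<in> {c..d}" using t unfolding 2 S_def I_def T_def by auto
        have "B j t + D (Suc j) t * s' t = 0"
          by (rule derivative_zero_at_limit_point[OF D_der[OF tT(3)] tT(2) _ tT(1)]) (auto simp: T_def j)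
        moreover have "D q t \<noteq> 0" using tT(1) by (simp add: T_def)
        ultimately have "s' t = - B j t / D q t" unfolding j by (simp add: field_simps)
        then show ?thesis using f[OF tT(3)] by simp
      qed
      moreover have "E \<in> sets borel"
        unfolding 2 S_def using Tb null_agreeing_countable[OF Iq[of q]] by (auto simp: null_agreeing_def)
      moreover have "E \<subseteq> {P..R}" unfolding 2 S_def sub T_def by auto
      ultimately show ?thesis by (intro null_agreeing_density[OF _ _ h])
    qed
  qed
  have "{c..d} \<subseteq> \<Union>\<E>"
  proof
    fix t assume t: "t \<in> {c..d}"
    \<comment> \<open>A least q exists because the polynomial is monic: \<open>D N\<close> is a
      nonzero constant.\<close>
    define q where "q = (LEAST q. D q t \<noteq> 0)"
    have q1: "D q t \<noteq> 0" unfolding q_def by (rule LeastI[of "\<lambda>q. D q t \<noteq> 0"]) (rule DN[OF t])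
    have q2: "D j t = 0" if "j < q" for j
      using not_less_Least[of j "\<lambda>q. D q t \<noteq> 0"] that unfolding q_def by blast
    note q = q1 q2
    have q0: "0 < q" using q(1) D0[OF t] by (cases q) auto
    have tT: "t \<in> T q" using q t by (simp add: T_def)
    show "t \<in> \<Union>\<E>"
    proof (cases "t islimpt T q")
      case False
      then have "t \<in> I q" using tT by (simp add: I_def)
      then show ?thesis unfolding \<E>_def by blast
    next
      case True
      obtain \<delta> where \<delta>: "\<delta> > 0" "\<And>u. u \<in> {c..d} \<Longrightarrow> \<bar>u - t\<bar> < \<delta> \<Longrightarrow> \<bar>D q u - D q t\<bar> < \<bar>D q t\<bar>"
        using continuous_on_near[OF cD t, of "\<bar>D q t\<bar>"] q(1) by (metis zero_less_abs_iff)
      obtain p where p: "p \<in> \<rat>" "t - \<delta> < p" "p < t" using Rats_dense_in_real[of "t - \<delta>" t] \<delta>(1) by auto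
      obtain r where r: "r \<in> \<rat>" "t < r" "r < t + \<delta>" using Rats_dense_in_real[of t "t + \<delta>"] \<delta>(1) by auto
      have "D q u \<noteq> 0" if "u \<in> {c..d} \<inter> {p..r}" for u
      proof -
        have "u \<in> {c..d}" "\<bar>u - t\<bar> < \<delta>" using that p r by auto
        then have "\<bar>D q u - D q t\<bar> < \<bar>D q t\<bar>" by (rule \<delta>(2))
        then show ?thesis by auto
      qed
      then have "S q p r \<in> \<E>" using p r q0 unfolding \<E>_def by blast
      moreover have "t \<in> S q p r" using tT True p r by (simp add: S_def I_def)
      ultimately show ?thesis by blast
    qed
  qed
  moreover have "null_agreeing (\<Union>\<E>)" by (rule null_agreeing_countable_Union[OF cE agree])
  ultimately show ?thesis unfolding null_agreeing_def by auto
qed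

end

section \<open>Slopes of convex functions and bounded variation\<close>

lemma convex_slopes:
  assumes "convex_on {c..d} w" "c \<le> t" "t < s" "s < r" "r \<le> d"
  shows "(w s - w t) / (s - t) \<le> (w r - w t) / (r - t)" "(w r - w t) / (r - t) \<le> (w r - w s) / (r - s)"
proof -
  have *: "(w x - w y) / (x - y) = (w y - w x) / (y - x)" for x y :: real
    by (metis minus_diff_eq minus_divide_divide)
  show "(w s - w t) / (s - t) \<le> (w r - w t) / (r - t)" "(w r - w t) / (r - t) \<le> (w r - w s) / (r - s)"
    using convex_on_slope_le[OF assms(1), of t r s] assms *[of t s] *[of t r] *[of s r] by auto
qed

text \<open>The right derivatives V of w and \<open>s' + V\<close> of \<open>s + w\<close> are
  nondecreasing, and s' is their difference. Clamping the argument continues s' to the line.\<close>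

lemma convex_C1_bounded_variation:
  fixes w s s' :: "real \<Rightarrow> real"
  assumes cd: "c < d" and w: "convex_on {c..d} w" and G: "convex_on {c..d} (\<lambda>t. s t + w t)"
    and L: "\<And>x y. x \<in> {c..d} \<Longrightarrow> y \<in> {c..d} \<Longrightarrow> \<bar>w x - w y\<bar> \<le> L * \<bar>x - y\<bar>"
    and s: "\<And>t. t \<in> {c..d} \<Longrightarrow> (s has_real_derivative s' t) (at t within {c..d})" "continuous_on {c..d} s'"
    and b: "\<And>t. t \<in> {c..d} \<Longrightarrow> \<bar>s' t\<bar> \<le> b"
  obtains V where "continuous_bounded_variation (\<lambda>t. s' (max c (min d t))) (\<lambda>t. s' (max c (min d t)) + V t) V
    (- b - L) (b + L) (- L) L"
proof -
  define sl where "sl t r = (w r - w t) / (r - t)" for t r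
  \<comment> \<open>The infimum of the forward slopes is the right derivative of w. The values -L
    and L outside keep V monotone, as L bounds all slopes.\<close>
  define V where "V t = (if t < c then - L else if d \<le> t then L else Inf (sl t ` {t<..d}))" for t
  have slb: "- L \<le> sl t r" "sl t r \<le> L" if "c \<le> t" "t < r" "r \<le> d" for t r
    using L[of r t] that unfolding sl_def by (auto simp: abs_le_iff pos_le_divide_eq pos_divide_le_eq)
  have bdd: "bdd_below (sl t ` {t<..d})" if "c \<le> t" for t
    using slb(1)[OF that] by (auto intro!: bdd_belowI)
  have V_le: "V t \<le> sl t r" if "c \<le> t" "t < r" "r \<le> d" for t r
    using that cInf_lower[OF _ bdd[of t], of "sl t r"] unfolding V_def by auto
  have V_ge: "m \<le> V t" if "c \<le> t" "t < d" "\<And>r. t < r \<Longrightarrow> r \<le> d \<Longrightarrow> m \<le> sl t r" for t m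
    using that unfolding V_def by (auto intro!: cInf_greatest)
  have LV: "- L \<le> V t" "V t \<le> L" for t
  proof -
    have "0 \<le> L"
    proof -
      have "0 \<le> L * \<bar>c - d\<bar>" using cd by (intro order_trans[OF abs_ge_zero L]) auto
      then show ?thesis using cd by (simp add: zero_le_mult_iff)
    qed
    then show "- L \<le> V t" "V t \<le> L"
      using V_ge[of t "- L"] slb[of t] V_le[of t d] by (auto simp: V_def intro: order_trans)
  qed
  have sl_mono: "sl t r \<le> sl t r'" "sl t r' \<le> sl r r'" if "c \<le> t" "t < r" "r < r'" "r' \<le> d" for t r r'
    unfolding sl_def using convex_slopes[OF w that] by auto
  have V_mono: "V t \<le> V r" if "t \<le> r" for t r
  proof -
    consider "t = r" | "t < c" | "d \<le> r" | "c \<le> t" "t < r" "r < d" using \<open>t \<le> r\<close> by linarith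
    then show ?thesis
    proof cases
      case 4
      show ?thesis
      proof (rule V_ge)
        fix r' assume r': "r < r'" "r' \<le> d"
        have "V t \<le> sl t r" using 4 by (intro V_le) auto
        also have "\<dots> \<le> sl t r'" using 4 r' by (intro sl_mono) auto
        also have "\<dots> \<le> sl r r'" using 4 r' by (intro sl_mono) auto
        finally show "V t \<le> sl r r'" .
      qed (use 4 in auto)
    qed (use LV cd in \<open>auto simp: V_def\<close>)
  qed
  have cw: "continuous_on {c..d} w"
  proof (rule lipschitz_on_continuous_on[of "\<bar>L\<bar>"], rule lipschitz_onI)
    fix x y assume "x \<in> {c..d}" "y \<in> {c..d}"
    then have "\<bar>w x - w y\<bar> \<le> L * \<bar>x - y\<bar>" by (rule L)
    also have "\<dots> \<le> \<bar>L\<bar> * \<bar>x - y\<bar>" by (intro mult_right_mono) auto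
    finally show "dist (w x) (w y) \<le> \<bar>L\<bar> * dist x y" by (simp add: dist_real_def)
  qed simp
  define g where "g t = s' (max c (min d t))" for t
  have cg: "continuous_on UNIV g"
    unfolding g_def by (rule continuous_on_compose2[OF s(2)]) (use cd in \<open>auto intro!: continuous_intros\<close>)
  have s_lim: "((\<lambda>r. (s r - s t) / (r - t)) \<longlongrightarrow> g t) (at_right t)" if "c \<le> t" "t < d" for t
  proof -
    have "((\<lambda>r. (s r - s t) / (r - t)) \<longlongrightarrow> s' t) (at t within {c..d})"
      using s(1)[of t] that by (simp add: has_field_derivative_iff)
    then have "((\<lambda>r. (s r - s t) / (r - t)) \<longlongrightarrow> s' t) (at t within {t..d})"
      by (rule tendsto_within_subset) (use that in auto)
    then show ?thesis using that by (simp add: at_within_Icc_at_right g_def max_def min_def)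
  qed
  \<comment> \<open>The slope of the chord of \<open>s + w\<close> from t to r separates its right
    derivatives at t and at r.\<close>
  have main: "g t + V t \<le> g r + V r" if tr: "c \<le> t" "t < r" "r < d" for t r
  proof -
    define G where "G t r = ((s r + w r) - (s t + w t)) / (r - t)" for t r
    have G_eq: "G t r = (s r - s t) / (r - t) + sl t r" for t r
      unfolding G_def sl_def by (simp add: add_divide_distrib[symmetric] algebra_simps)
    have G_mono: "G t r \<le> G t r'" "G t r' \<le> G r r'" if "c \<le> t" "t < r" "r < r'" "r' \<le> d" for t r r'
      unfolding G_def using convex_slopes[OF assms(3) that] by auto
    have "g t \<le> G t r - V t"
    proof (rule tendsto_upperbound[OF s_lim])
      show "\<forall>\<^sub>F x in at_right t. (s x - s t) / (x - t) \<le> G t r - V t"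
        unfolding eventually_at_right_field
      proof (intro exI[of _ r] conjI allI impI)
        fix x assume x: "t < x" "x < r"
        have "(s x - s t) / (x - t) + sl t x \<le> G t r" using G_mono(1)[of t x r] x tr by (simp add: G_eq)
        moreover have "V t \<le> sl t x" using x tr by (intro V_le) auto
        ultimately show "(s x - s t) / (x - t) \<le> G t r - V t" by argo
      qed (use tr in simp)
    qed (use tr in auto)
    moreover have "G t r - g r \<le> V r"
    proof (rule V_ge)
      fix r0 assume r0: "r < r0" "r0 \<le> d"
      have "G t r - sl r r0 \<le> g r"
      proof (rule tendsto_lowerbound[OF s_lim])
        show "\<forall>\<^sub>F x in at_right r. G t r - sl r r0 \<le> (s x - s r) / (x - r)"
          unfolding eventually_at_right_field
        proof (intro exI[of _ r0] conjI allI impI)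
          fix x assume x: "r < x" "x < r0"
          have "G t r \<le> G t x" using G_mono(1)[of t r x] x tr r0 by simp
          also have "\<dots> \<le> G r x" using G_mono(2)[of t r x] x tr r0 by simp
          finally have "G t r \<le> (s x - s r) / (x - r) + sl r x" by (simp add: G_eq)
          moreover have "sl r x \<le> sl r r0" using x tr r0 by (intro sl_mono) auto
          ultimately show "G t r - sl r r0 \<le> (s x - s r) / (x - r)" by argo
        qed (use r0 in simp)
      qed (use tr in auto)
      then show "G t r - g r \<le> sl r r0" by argo
    qed (use tr in auto)
    ultimately show ?thesis by argo
  qed
  \<comment> \<open>The comparison with d is a limit from the left, with V replaced by its bound
    L.\<close>
  have top: "g t + V t \<le> s' d + L" if t: "c \<le> t" "t < d" for t
  proof -
    have "(g \<longlongrightarrow> g d) (at_left d)"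
      using cg by (auto simp: continuous_on_def intro: tendsto_within_subset)
    then have lim: "((\<lambda>x. g x + L) \<longlongrightarrow> g d + L) (at_left d)" by (intro tendsto_intros)
    have "g t + V t \<le> g d + L"
    proof (rule tendsto_lowerbound[OF lim])
      show "\<forall>\<^sub>F x in at_left d. g t + V t \<le> g x + L"
        unfolding eventually_at_left_field
      proof (intro exI[of _ t] conjI allI impI)
        fix x assume "t < x" "x < d"
        then show "g t + V t \<le> g x + L" using main[OF t(1)] LV(2)[of x] by (meson add_left_mono order_trans)
      qed (use t in simp)
    qed simp
    then show ?thesis using cd by (simp add: g_def)
  qed
  have V1_mono: "g t + V t \<le> g r + V r" if "t \<le> r" for t r
  proof -
    have low: "g t + V t \<le> g c + V c" if "t < c" for t
      using that cd LV(1)[of c] by (simp add: g_def V_def[of t])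
    have high: "g r + V r = s' d + L" if "d \<le> r" for r using that cd by (simp add: g_def V_def)
    have mid: "g t + V t \<le> g r + V r" if "c \<le> t" "t \<le> r" for t r
    proof -
      consider "t = r" | "t < r" "r < d" | "t < d" "d \<le> r" | "d \<le> t" using \<open>t \<le> r\<close> by linarith
      then show ?thesis
        using main[of t r] top[of t] high[of r] high[of t] that by cases auto
    qed
    show ?thesis
    proof (cases "t < c")
      case True
      show ?thesis
      proof (cases "r < c")
        case True
        then show ?thesis using \<open>t < c\<close> cd by (simp add: g_def V_def)
      next
        case False
        then show ?thesis using low[OF True] mid[of c r] by argo
      qed
    next
      case False
      then show ?thesis using mid that by simp
    qed
  qed
  have V_right: "continuous (at_right t) V" for t
  proof -
    consider "t < c" | "d \<le> t" | "c \<le> t" "t < d" by linarith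
    then have "(V \<longlongrightarrow> V t) (at_right t)"
    proof cases
      case 1
      then have "\<forall>\<^sub>F x in at_right t. V t = V x"
        unfolding eventually_at_right_field by (intro exI[of _ c]) (auto simp: V_def)
      then show ?thesis by (rule Lim_transform_eventually[OF tendsto_const])
    next
      case 2
      then have "\<forall>\<^sub>F x in at_right t. V t = V x"
        using cd unfolding eventually_at_right_field by (intro exI[of _ "t + 1"]) (auto simp: V_def)
      then show ?thesis by (rule Lim_transform_eventually[OF tendsto_const])
    next
      case 3
      show ?thesis
      proof (rule order_tendstoI)
        fix m assume "m < V t"
        then show "\<forall>\<^sub>F x in at_right t. m < V x"
          using V_mono unfolding eventually_at_right_field
          by (intro exI[of _ "t + 1"]) (auto intro: less_le_trans)
      next
        \<comment> \<open>An infimum of slopes that depend continuously on the base point is upper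
          semicontinuous; monotonicity gives the other half of right continuity.\<close>
        fix m assume m: "V t < m"
        obtain r where r: "t < r" "r \<le> d" "sl t r < m"
        proof (rule ccontr)
          assume "\<not> thesis"
          then have "\<And>r. t < r \<Longrightarrow> r \<le> d \<Longrightarrow> m \<le> sl t r" using that by force
          then have "m \<le> V t" by (rule V_ge[OF 3])
          then show False using m by simp
        qed
        have "(w \<longlongrightarrow> w t) (at t within {c..d})" using cw 3 by (simp add: continuous_on_def)
        then have "(w \<longlongrightarrow> w t) (at t within {t..d})"
          by (rule tendsto_within_subset) (use 3 in auto)
        then have "(w \<longlongrightarrow> w t) (at_right t)" using 3 by (simp add: at_within_Icc_at_right)
        then have "((\<lambda>x. sl x r) \<longlongrightarrow> sl t r) (at_right t)"
          unfolding sl_def using r by (intro tendsto_intros) auto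
        then have "\<forall>\<^sub>F x in at_right t. sl x r < m" using r(3) by (rule order_tendstoD)
        moreover have "\<forall>\<^sub>F x in at_right t. V x \<le> sl x r"
          unfolding eventually_at_right_field using r 3 by (intro exI[of _ r]) (auto intro!: V_le)
        ultimately show "\<forall>\<^sub>F x in at_right t. V x < m" by eventually_elim simp
      qed
    qed
    then show ?thesis by (simp add: continuous_within)
  qed
  have gb: "\<bar>g t\<bar> \<le> b" for t unfolding g_def using b cd by auto
  have isg: "isCont g t" for t using cg by (simp add: continuous_on_eq_continuous_at)
  have "continuous_bounded_variation g (\<lambda>t. g t + V t) V (- b - L) (b + L) (- L) L"
  proof
    show "mono (\<lambda>t. g t + V t)" "mono V" by (auto intro!: monoI V1_mono V_mono)
    show "continuous (at_right t) V" for t by (rule V_right)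
    show "continuous (at_right t) (\<lambda>t. g t + V t)" for t
      by (rule continuous_add[OF continuous_at_imp_continuous_at_within[OF isg] V_right])
    show "- b - L \<le> g t + V t" "g t + V t \<le> b + L" for t
      using gb[of t] LV[of t] by (auto simp: abs_le_iff)
  qed (use LV isg in auto)
  then show ?thesis using that unfolding g_def by blast
qed

text \<open>The constant is the total mass of the two measures: \<open>2 * b + 2 * L\<close> for
  \<open>s' + V\<close> and \<open>2 * L\<close> for V.\<close>

theorem C1_root_density:
  fixes w s s' :: "real \<Rightarrow> real" and a a' a'' :: "nat \<Rightarrow> real \<Rightarrow> real"
  assumes cd: "c < d" and w: "convex_on {c..d} w" and G: "convex_on {c..d} (\<lambda>t. s t + w t)"
    and L: "\<And>x y. x \<in> {c..d} \<Longrightarrow> y \<in> {c..d} \<Longrightarrow> \<bar>w x - w y\<bar> \<le> L * \<bar>x - y\<bar>"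
    and s: "\<And>t. t \<in> {c..d} \<Longrightarrow> (s has_real_derivative s' t) (at t within {c..d})" "continuous_on {c..d} s'"
    and b: "\<And>t. t \<in> {c..d} \<Longrightarrow> \<bar>s' t\<bar> \<le> b"
    and a: "\<And>k. k \<le> N \<Longrightarrow> has_density (a k) (a' k) c d" "\<And>k. k \<le> N \<Longrightarrow> has_density (a' k) (a'' k) c d"
    and monic: "\<And>t. t \<in> {c..d} \<Longrightarrow> a N t = 1"
    and root: "\<And>t. t \<in> {c..d} \<Longrightarrow> (\<Sum>k\<le>N. a k t * s t ^ k) = 0"
  obtains \<rho> where "has_density s' \<rho> c d" "integral {c..d} (\<lambda>t. \<bar>\<rho> t\<bar>) \<le> 2 * b + 4 * L"
proof -
  obtain V where V: "continuous_bounded_variation (\<lambda>t. s' (max c (min d t))) (\<lambda>t. s' (max c (min d t)) + V t) V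
    (- b - L) (b + L) (- L) L"
    using convex_C1_bounded_variation[OF cd w G L s b] by blast
  interpret continuous_bounded_variation "\<lambda>t. s' (max c (min d t))" "\<lambda>t. s' (max c (min d t)) + V t" V
    "- b - L" "b + L" "- L" L by (rule V)
  have f: "s' (max c (min d t)) = s' t" if "t \<in> {c..d}" for t
  proof -
    have "max c (min d t) = t" using that by auto
    then show ?thesis by simp
  qed
  have "null_agreeing {c..d}" by (rule null_agreeing_root[OF cd s a monic root f])
  then obtain \<rho> where \<rho>: "has_density (\<lambda>t. s' (max c (min d t))) \<rho> c d"
    "integral {c..d} (\<lambda>t. \<bar>\<rho> t\<bar>) \<le> (b + L - (- b - L)) + (L - - L)"
    using null_agreeing_imp_density by blast
  have "has_density s' \<rho> c d" by (rule has_density_cong[OF \<rho>(1) f]) auto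
  then show ?thesis using that[of \<rho>] \<rho>(2) by (simp add: algebra_simps)
qed

section \<open>Curves with difference-convex entries\<close>

text \<open>The class W^{2,1} on a compact interval, with f and f' absolutely continuous up to the
  end points.\<close>

definition W21_density :: "real \<Rightarrow> real \<Rightarrow> (real \<Rightarrow> real) \<Rightarrow> bool" where
  "W21_density c d f \<longleftrightarrow> (\<exists>f' f''. has_density f f' c d \<and> has_density f' f'' c d)"

lemma W21_density_const: "W21_density c d (\<lambda>t. x)"
  unfolding W21_density_def using has_density_const by blast

lemma W21_density_add: "W21_density c d f \<Longrightarrow> W21_density c d g \<Longrightarrow> W21_density c d (\<lambda>t. f t + g t)"
  unfolding W21_density_def by (blast intro: has_density_add)

lemma W21_density_diff: "W21_density c d f \<Longrightarrow> W21_density c d g \<Longrightarrow> W21_density c d (\<lambda>t. f t - g t)"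
  unfolding W21_density_def by (blast intro: has_density_diff)

lemma W21_density_mult: "W21_density c d f \<Longrightarrow> W21_density c d g \<Longrightarrow> W21_density c d (\<lambda>t. f t * g t)"
  unfolding W21_density_def
proof (elim exE conjE)
  fix f' f'' g' g''
  assume *: "has_density f f' c d" "has_density f' f'' c d" "has_density g g' c d" "has_density g' g'' c d"
  show "\<exists>h' h''. has_density (\<lambda>t. f t * g t) h' c d \<and> has_density h' h'' c d"
    by (rule exI, rule exI, rule conjI, rule has_density_mult[OF *(1,3)],
      rule has_density_add[OF has_density_mult[OF *(2,3)] has_density_mult[OF *(1,4)]])
qed

definition W21_density_complex :: "real \<Rightarrow> real \<Rightarrow> (real \<Rightarrow> complex) \<Rightarrow> bool" where
  "W21_density_complex c d f \<longleftrightarrow> W21_density c d (\<lambda>t. Re (f t)) \<and> W21_density c d (\<lambda>t. Im (f t))"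

lemma W21_density_complex_intros:
  "W21_density_complex c d (\<lambda>t. x)"
  "W21_density_complex c d f \<Longrightarrow> W21_density_complex c d g \<Longrightarrow> W21_density_complex c d (\<lambda>t. f t + g t)"
  "W21_density_complex c d f \<Longrightarrow> W21_density_complex c d g \<Longrightarrow> W21_density_complex c d (\<lambda>t. f t * g t)"
  "W21_density_complex c d f \<Longrightarrow> W21_density_complex c d (\<lambda>t. cnj (f t))"
  "W21_density_complex c d f \<Longrightarrow> W21_density_complex c d (\<lambda>t. - f t)"
  unfolding W21_density_complex_def
  using W21_density_mult[OF W21_density_const[of c d "-1"]]
  by (auto intro!: W21_density_const W21_density_add W21_density_diff W21_density_mult)

lemma W21_density_complex_sum:
  "(\<And>i. i \<in> I \<Longrightarrow> W21_density_complex c d (f i)) \<Longrightarrow> W21_density_complex c d (\<lambda>t. \<Sum>i\<in>I. f i t)"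
  by (induction I rule: infinite_finite_induct) (auto intro: W21_density_complex_intros)

definition W21_density_poly :: "real \<Rightarrow> real \<Rightarrow> (real \<Rightarrow> complex poly) \<Rightarrow> bool" where
  "W21_density_poly c d p \<longleftrightarrow> (\<forall>k. W21_density_complex c d (\<lambda>t. coeff (p t) k))"

lemma W21_density_poly_intros:
  "W21_density_poly c d (\<lambda>t. p0)"
  "W21_density_poly c d p \<Longrightarrow> W21_density_poly c d q \<Longrightarrow> W21_density_poly c d (\<lambda>t. p t + q t)"
  "W21_density_poly c d p \<Longrightarrow> W21_density_poly c d q \<Longrightarrow> W21_density_poly c d (\<lambda>t. p t * q t)"
  unfolding W21_density_poly_def coeff_mult coeff_add
  by (auto intro!: W21_density_complex_intros W21_density_complex_sum)

lemma W21_density_poly_sum: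
  "(\<And>i. i \<in> I \<Longrightarrow> W21_density_poly c d (f i)) \<Longrightarrow> W21_density_poly c d (\<lambda>t. \<Sum>i\<in>I. f i t)"
  by (induction I rule: infinite_finite_induct) (auto intro: W21_density_poly_intros)

lemma W21_density_poly_prod:
  "(\<And>i. i \<in> I \<Longrightarrow> W21_density_poly c d (f i)) \<Longrightarrow> W21_density_poly c d (\<lambda>t. \<Prod>i\<in>I. f i t)"
  by (induction I rule: infinite_finite_induct) (auto intro: W21_density_poly_intros)

text \<open>By the Leibniz formula the coefficients are polynomials in the entries, and the class is
  an algebra.\<close>

lemma W21_density_char_poly:
  assumes A: "\<And>t. G t \<in> carrier_mat n n" and W: "\<And>i j. i < n \<Longrightarrow> j < n \<Longrightarrow> W21_density_complex c d (\<lambda>t. G t $$ (i, j))"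
  shows "W21_density_complex c d (\<lambda>t. coeff (char_poly (G t)) k)"
proof -
  have entry: "char_poly_matrix (G t) $$ (i, j) = [:- (G t $$ (i, j)), if i = j then 1 else 0:]"
    if "i < n" "j < n" for t i j
    using A[of t] that by (auto simp: char_poly_matrix_def)
  have We: "W21_density_poly c d (\<lambda>t. [:- (G t $$ (i, j)), if i = j then 1 else 0:])" if "i < n" "j < n" for i j
    unfolding W21_density_poly_def
  proof
    fix k
    show "W21_density_complex c d (\<lambda>t. coeff [:- (G t $$ (i, j)), if i = j then 1 else 0:] k)"
      by (cases k) (auto intro!: W21_density_complex_intros W[OF that] simp: coeff_pCons split: nat.splits)
  qed
  have "char_poly (G t) = (\<Sum>p\<in>{p. p permutes {0..<n}}. signof p *
      (\<Prod>i\<in>{0..<n}. [:- (G t $$ (i, p i)), if i = p i then 1 else 0:]))" for t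
  proof -
    have cm: "char_poly_matrix (G t) \<in> carrier_mat n n" using A by simp
    have "(\<Prod>i\<in>{0..<n}. char_poly_matrix (G t) $$ (i, p i)) = (\<Prod>i\<in>{0..<n}. [:- (G t $$ (i, p i)), if i = p i then 1 else 0:])"
      if "p permutes {0..<n}" for p
      using that by (intro prod.cong refl entry) (auto simp: permutes_in_image)
    then show ?thesis
      unfolding char_poly_def det_def'[OF cm] by (intro sum.cong) auto
  qed
  moreover have "W21_density_poly c d (\<lambda>t. \<Sum>p\<in>{p. p permutes {0..<n}}. signof p *
      (\<Prod>i\<in>{0..<n}. [:- (G t $$ (i, p i)), if i = p i then 1 else 0:]))"
    by (intro W21_density_poly_sum W21_density_poly_intros W21_density_poly_prod We)
      (auto simp: permutes_in_image)
  ultimately show ?thesis unfolding W21_density_poly_def by simp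
qed

lemma sum_even_indices:
  fixes g :: "nat \<Rightarrow> real" and n :: nat
  shows "(\<Sum>k\<le>2 * n. if even k then g (k div 2) else 0) = (\<Sum>k\<le>n. g k)"
  by (induction n) (auto simp: atMost_Suc)

text \<open>The polynomial is the characteristic polynomial of the Gram matrix at
  \<open>x^2\<close>: monic of degree 2n, with coefficients at even exponents only. Passing to real
  parts of the coefficients keeps the real roots.\<close>

lemma singular_value_polynomial:
  assumes A: "\<And>t. A t \<in> carrier_mat m n"
    and W: "\<And>i j. i < m \<Longrightarrow> j < n \<Longrightarrow> W21_density_complex c d (\<lambda>t. A t $$ (i, j))"
  obtains a a' a'' :: "nat \<Rightarrow> real \<Rightarrow> real" where
    "\<And>k. has_density (a k) (a' k) c d" "\<And>k. has_density (a' k) (a'' k) c d" "\<And>t. a (2 * n) t = 1"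
    "\<And>t p. p < n \<Longrightarrow> (\<Sum>k\<le>2 * n. a k t * (singular_values (A t) ! p) ^ k) = 0"
proof -
  define G where "G t = mat_adjoint (A t) * A t" for t
  define b where "b k t = Re (coeff (char_poly (G t)) k)" for k t
  define a where "a k t = (if even k then b (k div 2) t else 0)" for k t
  have G: "G t \<in> carrier_mat n n" for t unfolding G_def by (rule gram_carrier[OF A])
  have "W21_density_complex c d (\<lambda>t. G t $$ (i, j))" if "i < n" "j < n" for i j
    unfolding G_def using that
    by (simp only: gram_entry[OF A]) (intro W21_density_complex_sum W21_density_complex_intros W, auto)
  then have "W21_density_complex c d (\<lambda>t. coeff (char_poly (G t)) k)" for k
    by (rule W21_density_char_poly[OF G])
  then have "W21_density c d (b k)" for k unfolding b_def[abs_def] W21_density_complex_def by blast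
  then have "W21_density c d (a k)" for k
    unfolding a_def[abs_def] using W21_density_const by (cases "even k") auto
  then obtain a' a'' where a: "\<And>k. has_density (a k) (a' k) c d" "\<And>k. has_density (a' k) (a'' k) c d"
    unfolding W21_density_def by metis
  have top: "a (2 * n) t = 1" for t
    using degree_monic_char_poly[OF G[of t]] by (simp add: a_def b_def)
  have root: "(\<Sum>k\<le>2 * n. a k t * x ^ k) = 0" if p: "p < n" and x: "x = singular_values (A t) ! p" for t p x
  proof -
    have cp: "char_poly (G t) = (\<Prod>p\<leftarrow>[0..<n]. [:- of_real ((singular_values (A t) ! p)\<^sup>2), 1:])"
      using singular_values_basis[OF A[of t]] unfolding G_def by metis
    have "poly (char_poly (G t)) (of_real (x\<^sup>2)) = 0"
      unfolding cp x poly_prod_list prod_list_zero_iff using p by (auto simp: image_iff intro!: bexI[of _ p])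
    then have "(\<Sum>k\<le>n. coeff (char_poly (G t)) k * (of_real (x\<^sup>2)) ^ k) = 0"
      unfolding poly_altdef using degree_monic_char_poly[OF G[of t]] by simp
    then have "Re (\<Sum>k\<le>n. coeff (char_poly (G t)) k * of_real ((x\<^sup>2) ^ k)) = 0"
      by simp
    then have "(\<Sum>k\<le>n. b k t * (x\<^sup>2) ^ k) = 0" by (simp add: b_def del: of_real_power)
    moreover have "(\<Sum>k\<le>2 * n. a k t * x ^ k) = (\<Sum>k\<le>2 * n. if even k then b (k div 2) t * (x\<^sup>2) ^ (k div 2) else 0)"
      by (intro sum.cong refl) (auto simp: a_def power_mult[symmetric] elim!: evenE)
    ultimately show ?thesis by (simp add: sum_even_indices[of "\<lambda>k. b k t * (x\<^sup>2) ^ k"])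
  qed
  show ?thesis by (rule that[OF a top root[OF _ refl]])
qed

section \<open>Convexifying the sums of the largest singular values\<close>

definition top_sum :: "(real \<Rightarrow> complex mat) \<Rightarrow> nat \<Rightarrow> real \<Rightarrow> real" where
  "top_sum A k t = (\<Sum>p<k. singular_values (A t) ! p)"

text \<open>\<open>g 0\<close> and \<open>g 1\<close> are the convex parts of the real parts of the
  entries, \<open>g 2\<close> and \<open>g 3\<close> those of the imaginary parts. The factor l
  bounds the moduli of the Ky Fan coefficients.\<close>

definition dc_weight :: "nat \<Rightarrow> nat \<Rightarrow> nat \<Rightarrow> (nat \<Rightarrow> nat \<Rightarrow> nat \<Rightarrow> real \<Rightarrow> real) \<Rightarrow> real \<Rightarrow> real" where
  "dc_weight l m n g t = (\<Sum>i<m. \<Sum>j<n. real l * (g 0 i j t + g 1 i j t + g 2 i j t + g 3 i j t))"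

definition dc_base :: "nat \<Rightarrow> nat \<Rightarrow> nat \<Rightarrow> (real \<Rightarrow> complex mat) \<Rightarrow> (nat \<Rightarrow> nat \<Rightarrow> nat \<Rightarrow> real \<Rightarrow> real) \<Rightarrow> real \<Rightarrow> real" where
  "dc_base l m n A g t = (\<Sum>k<l. top_sum A k t + dc_weight l m n g t)"

definition dc_branch :: "nat \<Rightarrow> nat \<Rightarrow> nat \<Rightarrow> (real \<Rightarrow> complex mat) \<Rightarrow> (nat \<Rightarrow> nat \<Rightarrow> nat \<Rightarrow> real \<Rightarrow> real) \<Rightarrow> nat \<Rightarrow> real \<Rightarrow> real" where
  "dc_branch l m n A g k t = singular_values (A t) ! k + dc_base l m n A g t"

definition dc_compensator :: "nat \<Rightarrow> nat \<Rightarrow> nat \<Rightarrow> (real \<Rightarrow> complex mat) \<Rightarrow> (nat \<Rightarrow> nat \<Rightarrow> nat \<Rightarrow> real \<Rightarrow> real) \<Rightarrow> real \<Rightarrow> real" where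
  "dc_compensator l m n A g t = dc_base l m n A g t + pairmax l (dc_branch l m n A g) t"

text \<open>Near t only branches that agree with s at t are selected, so every difference quotient
  of s at t is one of a branch.\<close>

lemma selection_derivative_bound:
  fixes s :: "real \<Rightarrow> real" and F :: "nat \<Rightarrow> real \<Rightarrow> real"
  assumes s: "(s has_real_derivative D) (at t within {c..d})" and t: "t \<in> {c..d}" "c < d"
    and F: "\<And>p x y. p < k \<Longrightarrow> x \<in> {c..d} \<Longrightarrow> y \<in> {c..d} \<Longrightarrow> \<bar>F p x - F p y\<bar> \<le> L * \<bar>x - y\<bar>"
    and sel: "\<And>x. x \<in> {c..d} \<Longrightarrow> \<exists>p<k. s x = F p x"
  shows "\<bar>D\<bar> \<le> L"
proof -
  have cs: "(s \<longlongrightarrow> s t) (at t within {c..d})"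
    using DERIV_continuous[OF s] by (simp add: continuous_within)
  have cF: "(F p \<longlongrightarrow> F p t) (at t within {c..d})" if "p < k" for p
  proof -
    have "((\<lambda>x. L * \<bar>x - t\<bar>) \<longlongrightarrow> L * \<bar>t - t\<bar>) (at t within {c..d})" by (intro tendsto_intros)
    then have lim0: "((\<lambda>x. L * \<bar>x - t\<bar>) \<longlongrightarrow> 0) (at t within {c..d})" by simp
    have "((\<lambda>x. F p x - F p t) \<longlongrightarrow> 0) (at t within {c..d})"
    proof (rule Lim_null_comparison[OF _ lim0])
      show "\<forall>\<^sub>F x in at t within {c..d}. norm (F p x - F p t) \<le> L * \<bar>x - t\<bar>"
        unfolding eventually_at_filter
        by (rule always_eventually) (simp add: F[OF that _ t(1)])
    qed
    then show ?thesis by (simp add: LIM_zero_iff)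
  qed
  have "\<forall>\<^sub>F x in at t within {c..d}. F p t \<noteq> s t \<longrightarrow> F p x \<noteq> s x" if "p < k" for p
  proof (cases "F p t = s t")
    case False
    have "((\<lambda>x. F p x - s x) \<longlongrightarrow> F p t - s t) (at t within {c..d})" by (intro tendsto_diff cF[OF that] cs)
    then have "\<forall>\<^sub>F x in at t within {c..d}. F p x - s x \<noteq> 0" using False by (intro tendsto_imp_eventually_ne) auto
    then show ?thesis by (rule eventually_mono) auto
  qed simp
  then have ev: "\<forall>\<^sub>F x in at t within {c..d}. \<forall>p\<in>{..<k}. F p t \<noteq> s t \<longrightarrow> F p x \<noteq> s x"
    by (intro eventually_ball_finite) auto
  have "\<forall>\<^sub>F x in at t within {c..d}. \<bar>(s x - s t) / (x - t)\<bar> \<le> L"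
    using ev unfolding eventually_at_filter
  proof (rule eventually_mono, intro impI)
    fix x assume x: "x \<noteq> t \<longrightarrow> x \<in> {c..d} \<longrightarrow> (\<forall>p\<in>{..<k}. F p t \<noteq> s t \<longrightarrow> F p x \<noteq> s x)" "x \<noteq> t" "x \<in> {c..d}"
    obtain p where p: "p < k" "s x = F p x" using sel[OF x(3)] by blast
    then have "s t = F p t" using x by (metis lessThan_iff)
    then have "\<bar>s x - s t\<bar> \<le> L * \<bar>x - t\<bar>" using F[OF p(1) x(3) t(1)] p by simp
    then show "\<bar>(s x - s t) / (x - t)\<bar> \<le> L" using x(2) by (simp add: pos_divide_le_eq)
  qed
  moreover have "((\<lambda>x. \<bar>(s x - s t) / (x - t)\<bar>) \<longlongrightarrow> \<bar>D\<bar>) (at t within {c..d})"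
    using s by (intro tendsto_rabs) (simp add: has_field_derivative_iff)
  moreover have "at t within {c..d} \<noteq> bot"
    using t by (simp add: trivial_limit_within islimpt_Icc)
  ultimately show ?thesis by (intro tendsto_upperbound)
qed

locale dc_curve =
  fixes l m n :: nat and A :: "real \<Rightarrow> complex mat" and g :: "nat \<Rightarrow> nat \<Rightarrow> nat \<Rightarrow> real \<Rightarrow> real" and c d L :: real
  assumes l: "l = min m n" and cd: "c < d"
    and A: "\<And>t. t \<in> {c..d} \<Longrightarrow> A t \<in> carrier_mat m n"
    and rank: "\<And>t. t \<in> {c..d} \<Longrightarrow> vec_space.rank m (A t) = l"
    and g: "\<And>q i j. q < 4 \<Longrightarrow> i < m \<Longrightarrow> j < n \<Longrightarrow> convex_on {c..d} (g q i j)"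
    and Lip: "\<And>q i j x y. q < 4 \<Longrightarrow> i < m \<Longrightarrow> j < n \<Longrightarrow> x \<in> {c..d} \<Longrightarrow> y \<in> {c..d} \<Longrightarrow>
      \<bar>g q i j x - g q i j y\<bar> \<le> L * \<bar>x - y\<bar>"
    and Re_A: "\<And>i j t. i < m \<Longrightarrow> j < n \<Longrightarrow> t \<in> {c..d} \<Longrightarrow> Re (A t $$ (i, j)) = g 0 i j t - g 1 i j t"
    and Im_A: "\<And>i j t. i < m \<Longrightarrow> j < n \<Longrightarrow> t \<in> {c..d} \<Longrightarrow> Im (A t $$ (i, j)) = g 2 i j t - g 3 i j t"
begin

text \<open>The Lipschitz constant of a Ky Fan functional along the curve: m times n coefficients of
  modulus at most l, and entries that vary at rate at most 4 L.\<close>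

definition "Lam = real l * 4 * L * real m * real n"

lemma functional:
  assumes t: "t \<in> {c..d}" and k: "k \<le> l"
  obtains \<gamma> :: "nat \<Rightarrow> nat \<Rightarrow> complex" where
    "\<And>i j. i < m \<Longrightarrow> j < n \<Longrightarrow> cmod (\<gamma> i j) \<le> real l"
    "top_sum A k t = Re (\<Sum>i<m. \<Sum>j<n. \<gamma> i j * A t $$ (i, j))"
    "\<And>x. x \<in> {c..d} \<Longrightarrow> Re (\<Sum>i<m. \<Sum>j<n. \<gamma> i j * A x $$ (i, j)) \<le> top_sum A k x"
proof -
  have "0 < singular_values (A t) ! p" if "p < k" for p
    by (rule singular_values_pos_below_rank[OF A[OF t]]) (use that k rank[OF t] in simp)
  moreover have "k \<le> n" using k l by simp
  ultimately obtain \<gamma> where \<gamma>: "\<And>i j. i < m \<Longrightarrow> j < n \<Longrightarrow> cmod (\<gamma> i j) \<le> real k"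
    "(\<Sum>p<k. singular_values (A t) ! p) = Re (\<Sum>i<m. \<Sum>j<n. \<gamma> i j * A t $$ (i, j))"
    "\<And>B. B \<in> carrier_mat m n \<Longrightarrow> Re (\<Sum>i<m. \<Sum>j<n. \<gamma> i j * B $$ (i, j)) \<le> (\<Sum>p<k. singular_values B ! p)"
    using ky_fan_functional[OF A[OF t], of k] by blast
  show ?thesis
  proof (rule that[of \<gamma>])
    show "cmod (\<gamma> i j) \<le> real l" if "i < m" "j < n" for i j
      using \<gamma>(1)[OF that] k by (meson of_nat_mono order_trans)
  qed (use \<gamma>(2,3) A in \<open>auto simp: top_sum_def\<close>)
qed

text \<open>For \<open>a' = (g0 - g1) + i (g2 - g3)\<close> the coefficients of the convex parts in
  \<open>Re (\<gamma> a')\<close> may have either sign; adding l to each makes them nonnegative. The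
  signs at \<open>g 2\<close> and \<open>g 3\<close> are reversed because of the term
  \<open>- Im \<gamma> Im a'\<close>.\<close>

lemma g_sum_nonneg_comb:
  assumes x: "\<bar>a\<bar> \<le> real l" "\<bar>b\<bar> \<le> real l" and ij: "i < m" "j < n"
  shows "convex_on {c..d} (\<lambda>t. (real l + a) * g 0 i j t + (real l - a) * g 1 i j t + (real l - b) * g 2 i j t + (real l + b) * g 3 i j t)"
  using x by (intro convex_on_add convex_on_cmul g ij) auto

text \<open>The supporting functional at the intermediate point z is exact at z and a lower bound at
  x and y; after the weight is added it is convex.\<close>

lemma top_sum_convex:
  assumes k: "k \<le> l"
  shows "convex_on {c..d} (\<lambda>t. top_sum A k t + dc_weight l m n g t)"
proof (rule convex_onI)
  fix u x y :: real assume u: "0 < u" "u < 1" and xy: "x \<in> {c..d}" "y \<in> {c..d}"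
  define z where "z = (1 - u) *\<^sub>R x + u *\<^sub>R y"
  have z: "z \<in> {c..d}" using convexD_alt[of "{c..d}" x y u] u xy unfolding z_def by simp
  obtain \<gamma> :: "nat \<Rightarrow> nat \<Rightarrow> complex" where \<gamma>: "\<And>i j. i < m \<Longrightarrow> j < n \<Longrightarrow> cmod (\<gamma> i j) \<le> real l"
    "top_sum A k z = Re (\<Sum>i<m. \<Sum>j<n. \<gamma> i j * A z $$ (i, j))"
    "\<And>x. x \<in> {c..d} \<Longrightarrow> Re (\<Sum>i<m. \<Sum>j<n. \<gamma> i j * A x $$ (i, j)) \<le> top_sum A k x"
    using functional[OF z k] by blast
  define \<Phi> where "\<Phi> t = Re (\<Sum>i<m. \<Sum>j<n. \<gamma> i j * A t $$ (i, j)) + dc_weight l m n g t" for t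
  define \<Psi> where "\<Psi> t = (\<Sum>i<m. \<Sum>j<n. (real l + Re (\<gamma> i j)) * g 0 i j t + (real l - Re (\<gamma> i j)) * g 1 i j t
      + (real l - Im (\<gamma> i j)) * g 2 i j t + (real l + Im (\<gamma> i j)) * g 3 i j t)" for t
  have \<Phi>\<Psi>: "\<Phi> t = \<Psi> t" if "t \<in> {c..d}" for t
  proof -
    have "\<Phi> t = (\<Sum>i<m. \<Sum>j<n. Re (\<gamma> i j * A t $$ (i, j)) + real l * (g 0 i j t + g 1 i j t + g 2 i j t + g 3 i j t))"
      unfolding \<Phi>_def dc_weight_def by (simp add: sum.distrib)
    also have "\<dots> = \<Psi> t"
      unfolding \<Psi>_def using that
      by (intro sum.cong refl) (simp add: Re_A Im_A algebra_simps)
    finally show ?thesis .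
  qed
  have "convex_on {c..d} \<Psi>"
    unfolding \<Psi>_def[abs_def]
  proof (intro convex_on_finite_sum g_sum_nonneg_comb)
    fix i j assume "i \<in> {..<m}" "j \<in> {..<n}"
    then have "cmod (\<gamma> i j) \<le> real l" by (intro \<gamma>(1)) auto
    then show "\<bar>Re (\<gamma> i j)\<bar> \<le> real l" "\<bar>Im (\<gamma> i j)\<bar> \<le> real l"
      using abs_Re_le_cmod abs_Im_le_cmod order_trans by blast+
  qed auto
  then have "\<Psi> z \<le> (1 - u) * \<Psi> x + u * \<Psi> y"
    unfolding z_def using u xy by (intro convex_onD) auto
  also have "\<dots> \<le> (1 - u) * (top_sum A k x + dc_weight l m n g x) + u * (top_sum A k y + dc_weight l m n g y)"
    unfolding \<Phi>\<Psi>[OF xy(1), symmetric] \<Phi>\<Psi>[OF xy(2), symmetric] \<Phi>_def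
    using \<gamma>(3)[OF xy(1)] \<gamma>(3)[OF xy(2)] u by (intro add_mono mult_left_mono) auto
  finally show "top_sum A k ((1 - u) *\<^sub>R x + u *\<^sub>R y) + dc_weight l m n g ((1 - u) *\<^sub>R x + u *\<^sub>R y)
      \<le> (1 - u) * (top_sum A k x + dc_weight l m n g x) + u * (top_sum A k y + dc_weight l m n g y)"
    using \<Phi>\<Psi>[OF z] \<gamma>(2) unfolding \<Phi>_def z_def by simp
qed simp

text \<open>The functional that is exact at x bounds the increment from above; exchanging x and y
  gives the other side.\<close>

lemma top_sum_lipschitz:
  assumes k: "k \<le> l" and xy: "x \<in> {c..d}" "y \<in> {c..d}"
  shows "\<bar>top_sum A k x - top_sum A k y\<bar> \<le> Lam * \<bar>x - y\<bar>"
proof -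
  have le: "top_sum A k x - top_sum A k y \<le> Lam * \<bar>x - y\<bar>" if xy: "x \<in> {c..d}" "y \<in> {c..d}" for x y
  proof -
    obtain \<gamma> :: "nat \<Rightarrow> nat \<Rightarrow> complex" where \<gamma>: "\<And>i j. i < m \<Longrightarrow> j < n \<Longrightarrow> cmod (\<gamma> i j) \<le> real l"
      "top_sum A k x = Re (\<Sum>i<m. \<Sum>j<n. \<gamma> i j * A x $$ (i, j))"
      "\<And>x. x \<in> {c..d} \<Longrightarrow> Re (\<Sum>i<m. \<Sum>j<n. \<gamma> i j * A x $$ (i, j)) \<le> top_sum A k x"
      using functional[OF xy(1) k] by blast
    have "top_sum A k x - top_sum A k y
        \<le> Re (\<Sum>i<m. \<Sum>j<n. \<gamma> i j * A x $$ (i, j)) - Re (\<Sum>i<m. \<Sum>j<n. \<gamma> i j * A y $$ (i, j))"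
      using \<gamma>(2) \<gamma>(3)[OF xy(2)] by simp
    also have "\<dots> = (\<Sum>i<m. \<Sum>j<n. Re (\<gamma> i j * (A x $$ (i, j) - A y $$ (i, j))))"
      by (simp add: sum_subtractf[symmetric] algebra_simps)
    also have "\<dots> \<le> (\<Sum>i<m. \<Sum>j<n. real l * (4 * L * \<bar>x - y\<bar>))"
    proof (intro sum_mono)
      fix i j assume "i \<in> {..<m}" "j \<in> {..<n}"
      then have ij: "i < m" "j < n" by auto
      have "\<bar>g q i j x - g q i j y\<bar> \<le> L * \<bar>x - y\<bar>" if "q < 4" for q by (rule Lip[OF that ij xy])
      note B = this[of 0, simplified] this[of 1, simplified] this[of 2, simplified] this[of 3, simplified]
      have "Re (A x $$ (i, j) - A y $$ (i, j)) = (g 0 i j x - g 0 i j y) - (g 1 i j x - g 1 i j y)"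
        "Im (A x $$ (i, j) - A y $$ (i, j)) = (g 2 i j x - g 2 i j y) - (g 3 i j x - g 3 i j y)"
        using Re_A[OF ij xy(1)] Re_A[OF ij xy(2)] Im_A[OF ij xy(1)] Im_A[OF ij xy(2)] by simp_all
      then have "\<bar>Re (A x $$ (i, j) - A y $$ (i, j))\<bar> \<le> L * \<bar>x - y\<bar> + L * \<bar>x - y\<bar>"
        "\<bar>Im (A x $$ (i, j) - A y $$ (i, j))\<bar> \<le> L * \<bar>x - y\<bar> + L * \<bar>x - y\<bar>"
        using order_trans[OF abs_triangle_ineq4 add_mono[OF B(1,2)]]
          order_trans[OF abs_triangle_ineq4 add_mono[OF B(3,4)]] by simp_all
      then have "\<bar>Re (A x $$ (i, j) - A y $$ (i, j))\<bar> + \<bar>Im (A x $$ (i, j) - A y $$ (i, j))\<bar> \<le> 4 * L * \<bar>x - y\<bar>"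
        by simp
      then have "cmod (A x $$ (i, j) - A y $$ (i, j)) \<le> 4 * L * \<bar>x - y\<bar>"
        using cmod_le[of "A x $$ (i, j) - A y $$ (i, j)"] by (rule order_trans[rotated])
      then have "cmod (\<gamma> i j) * cmod (A x $$ (i, j) - A y $$ (i, j)) \<le> real l * (4 * L * \<bar>x - y\<bar>)"
        using \<gamma>(1)[OF ij] by (intro mult_mono) auto
      then show "Re (\<gamma> i j * (A x $$ (i, j) - A y $$ (i, j))) \<le> real l * (4 * L * \<bar>x - y\<bar>)"
        using complex_Re_le_cmod[of "\<gamma> i j * (A x $$ (i, j) - A y $$ (i, j))"] by (simp only: norm_mult)
    qed
    also have "\<dots> = Lam * \<bar>x - y\<bar>"
    unfolding Lam_def sum_constant card_lessThan by (simp only: mult_ac)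
    finally show ?thesis .
  qed
  show ?thesis using le[OF xy] le[OF xy(2,1)] by (simp add: abs_le_iff abs_minus_commute)
qed

lemma dc_weight_lipschitz:
  assumes xy: "x \<in> {c..d}" "y \<in> {c..d}"
  shows "\<bar>dc_weight l m n g x - dc_weight l m n g y\<bar> \<le> Lam * \<bar>x - y\<bar>"
proof -
  have e: "dc_weight l m n g x - dc_weight l m n g y = (\<Sum>i<m. \<Sum>j<n. real l * ((g 0 i j x - g 0 i j y)
      + (g 1 i j x - g 1 i j y) + (g 2 i j x - g 2 i j y) + (g 3 i j x - g 3 i j y)))"
    unfolding dc_weight_def sum_subtractf[symmetric] by (intro sum.cong refl) (simp add: algebra_simps)
  have "\<bar>(\<Sum>i<m. \<Sum>j<n. real l * ((g 0 i j x - g 0 i j y)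
      + (g 1 i j x - g 1 i j y) + (g 2 i j x - g 2 i j y) + (g 3 i j x - g 3 i j y)))\<bar>
      \<le> (\<Sum>i<m. \<Sum>j<n. real l * (4 * L * \<bar>x - y\<bar>))"
  proof (intro order_trans[OF sum_abs] sum_mono)
    fix i j assume "i \<in> {..<m}" "j \<in> {..<n}"
    then have ij: "i < m" "j < n" by auto
    have "\<bar>g q i j x - g q i j y\<bar> \<le> L * \<bar>x - y\<bar>" if "q < 4" for q by (rule Lip[OF that ij xy])
    from this[of 0] this[of 1] this[of 2] this[of 3]
    have "\<bar>(g 0 i j x - g 0 i j y) + (g 1 i j x - g 1 i j y) + (g 2 i j x - g 2 i j y) + (g 3 i j x - g 3 i j y)\<bar> \<le> 4 * L * \<bar>x - y\<bar>"
      by (simp add: abs_le_iff)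
    then show "\<bar>real l * ((g 0 i j x - g 0 i j y) + (g 1 i j x - g 1 i j y) + (g 2 i j x - g 2 i j y) + (g 3 i j x - g 3 i j y))\<bar>
        \<le> real l * (4 * L * \<bar>x - y\<bar>)"
      by (simp add: abs_mult mult_left_mono)
  qed
  also have "\<dots> = Lam * \<bar>x - y\<bar>"
    unfolding Lam_def sum_constant card_lessThan by (simp only: mult_ac)
  finally show ?thesis unfolding e .
qed

lemma singular_value_lipschitz:
  assumes "k < l" "x \<in> {c..d}" "y \<in> {c..d}"
  shows "\<bar>singular_values (A x) ! k - singular_values (A y) ! k\<bar> \<le> 2 * Lam * \<bar>x - y\<bar>"
proof -
  have e: "singular_values (A x) ! k - singular_values (A y) ! k
      = (top_sum A (Suc k) x - top_sum A (Suc k) y) - (top_sum A k x - top_sum A k y)"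
    by (simp add: top_sum_def)
  have "\<bar>top_sum A (Suc k) x - top_sum A (Suc k) y\<bar> \<le> Lam * \<bar>x - y\<bar>" "\<bar>top_sum A k x - top_sum A k y\<bar> \<le> Lam * \<bar>x - y\<bar>"
    using assms by (auto intro!: top_sum_lipschitz)
  from order_trans[OF abs_triangle_ineq4 add_mono[OF this]]
  show ?thesis unfolding e by (simp add: mult_ac)
qed

lemma dc_base_lipschitz:
  assumes xy: "x \<in> {c..d}" "y \<in> {c..d}"
  shows "\<bar>dc_base l m n A g x - dc_base l m n A g y\<bar> \<le> real l * (2 * Lam) * \<bar>x - y\<bar>"
proof -
  have "\<bar>dc_base l m n A g x - dc_base l m n A g y\<bar> \<le> (\<Sum>k<l. 2 * Lam * \<bar>x - y\<bar>)"
    unfolding dc_base_def sum_subtractf[symmetric]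
  proof (intro order_trans[OF sum_abs] sum_mono)
    fix k assume "k \<in> {..<l}"
    then have "\<bar>top_sum A k x - top_sum A k y\<bar> \<le> Lam * \<bar>x - y\<bar>" by (intro top_sum_lipschitz xy) auto
    then show "\<bar>top_sum A k x + dc_weight l m n g x - (top_sum A k y + dc_weight l m n g y)\<bar> \<le> 2 * Lam * \<bar>x - y\<bar>"
      using dc_weight_lipschitz[OF xy] by (simp add: abs_le_iff)
  qed
  then show ?thesis by simp
qed

lemma dc_branch_lipschitz:
  assumes "k < l" "x \<in> {c..d}" "y \<in> {c..d}"
  shows "\<bar>dc_branch l m n A g k x - dc_branch l m n A g k y\<bar> \<le> (2 * Lam + real l * (2 * Lam)) * \<bar>x - y\<bar>"
  using singular_value_lipschitz[OF assms] dc_base_lipschitz[OF assms(2,3)]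
  unfolding dc_branch_def distrib_right by (simp add: abs_le_iff)

lemma dc_base_convex: "convex_on {c..d} (dc_base l m n A g)"
  unfolding dc_base_def[abs_def] by (intro convex_on_finite_sum top_sum_convex) auto

text \<open>Adding the singular value with index k to the base turns the sum of k values into the
  sum of k + 1 values; every summand remains a convexified sum of the largest values.\<close>

lemma dc_branch_convex:
  assumes k: "k < l"
  shows "convex_on {c..d} (dc_branch l m n A g k)"
proof -
  have "dc_branch l m n A g k t = (top_sum A (Suc k) t + dc_weight l m n g t)
      + (\<Sum>i\<in>{..<l} - {k}. top_sum A i t + dc_weight l m n g t)" for t
  proof -
    have "dc_base l m n A g t = (top_sum A k t + dc_weight l m n g t)
        + (\<Sum>i\<in>{..<l} - {k}. top_sum A i t + dc_weight l m n g t)"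
      unfolding dc_base_def by (rule sum.remove) (use k in auto)
    moreover have "top_sum A (Suc k) t = singular_values (A t) ! k + top_sum A k t" by (simp add: top_sum_def)
    ultimately show ?thesis by (simp add: dc_branch_def)
  qed
  then have eq: "dc_branch l m n A g k = (\<lambda>t. (top_sum A (Suc k) t + dc_weight l m n g t)
      + (\<Sum>i\<in>{..<l} - {k}. top_sum A i t + dc_weight l m n g t))" by blast
  show ?thesis
    unfolding eq by (intro convex_on_add convex_on_finite_sum top_sum_convex) (use k in auto)
qed

lemma lipschitz_imp_continuous:
  fixes f :: "real \<Rightarrow> real" and K :: real
  assumes "\<And>x y. x \<in> {c..d} \<Longrightarrow> y \<in> {c..d} \<Longrightarrow> \<bar>f x - f y\<bar> \<le> K * \<bar>x - y\<bar>"
  shows "continuous_on {c..d} f"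
proof (rule lipschitz_on_continuous_on[of "\<bar>K\<bar>"], rule lipschitz_onI)
  fix x y assume "x \<in> {c..d}" "y \<in> {c..d}"
  then have "\<bar>f x - f y\<bar> \<le> K * \<bar>x - y\<bar>" by (rule assms)
  also have "\<dots> \<le> \<bar>K\<bar> * \<bar>x - y\<bar>" by (intro mult_right_mono) auto
  finally show "dist (f x) (f y) \<le> \<bar>K\<bar> * dist x y" by (simp add: dist_real_def)
qed simp

lemma selection_convex:
  assumes s: "continuous_on {c..d} s" "\<And>t. t \<in> {c..d} \<Longrightarrow> \<exists>k<l. s t = singular_values (A t) ! k"
  shows "convex_on {c..d} (dc_compensator l m n A g)" "convex_on {c..d} (\<lambda>t. s t + dc_compensator l m n A g t)"
proof -
  have cb: "continuous_on {c..d} (dc_branch l m n A g k)" if "k < l" for k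
    by (rule lipschitz_imp_continuous[OF dc_branch_lipschitz[OF that]])
  have cs: "continuous_on {c..d} (\<lambda>t. s t + dc_base l m n A g t)"
    by (intro continuous_intros s lipschitz_imp_continuous[OF dc_base_lipschitz])
  have sel: "\<exists>k<l. s t + dc_base l m n A g t = dc_branch l m n A g k t" if "t \<in> {c..d}" for t
    using s(2)[OF that] by (auto simp: dc_branch_def)
  note conv = convex_on_selection[OF dc_branch_convex cb cs sel]
  show "convex_on {c..d} (dc_compensator l m n A g)"
    unfolding dc_compensator_def[abs_def] by (intro convex_on_add dc_base_convex conv(1))
  show "convex_on {c..d} (\<lambda>t. s t + dc_compensator l m n A g t)"
    using conv(2) by (simp add: dc_compensator_def add.assoc)
qed

text \<open>The constant of \<open>dc_base\<close> plus \<open>l * l\<close> pairs, each with the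
  constant of \<open>dc_branch\<close>.\<close>

definition "Lcomp = real l * (2 * Lam) + real (l * l) * (2 * Lam + real l * (2 * Lam))"

lemma compensator_lipschitz:
  assumes xy: "x \<in> {c..d}" "y \<in> {c..d}"
  shows "\<bar>dc_compensator l m n A g x - dc_compensator l m n A g y\<bar> \<le> Lcomp * \<bar>x - y\<bar>"
proof -
  let ?K = "(2 * Lam + real l * (2 * Lam)) * \<bar>x - y\<bar>"
  have "\<bar>pairmax l (dc_branch l m n A g) x - pairmax l (dc_branch l m n A g) y\<bar> \<le> (\<Sum>p\<in>{..<l} \<times> {..<l}. ?K)"
    unfolding pairmax_def sum_subtractf[symmetric]
  proof (intro order_trans[OF sum_abs] sum_mono)
    fix p assume p: "p \<in> {..<l} \<times> {..<l}"
    have "\<bar>dc_branch l m n A g (fst p) x - dc_branch l m n A g (fst p) y\<bar> \<le> ?K"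
      "\<bar>dc_branch l m n A g (snd p) x - dc_branch l m n A g (snd p) y\<bar> \<le> ?K"
      using p by (auto intro!: dc_branch_lipschitz xy)
    then show "\<bar>max (dc_branch l m n A g (fst p) x) (dc_branch l m n A g (snd p) x)
        - max (dc_branch l m n A g (fst p) y) (dc_branch l m n A g (snd p) y)\<bar> \<le> ?K"
      by (auto simp: max_def abs_le_iff)
  qed
  then have "\<bar>pairmax l (dc_branch l m n A g) x - pairmax l (dc_branch l m n A g) y\<bar> \<le> real (l * l) * ?K"
    by simp
  then show ?thesis
    using dc_base_lipschitz[OF xy] unfolding dc_compensator_def Lcomp_def
    by (simp add: abs_le_iff algebra_simps)
qed

theorem singular_value_density:
  assumes W: "\<And>i j. i < m \<Longrightarrow> j < n \<Longrightarrow> W21_density_complex c d (\<lambda>t. A t $$ (i, j))"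
    and s: "\<And>t. t \<in> {c..d} \<Longrightarrow> (s has_real_derivative s' t) (at t within {c..d})" "continuous_on {c..d} s'"
    and sel: "\<And>t. t \<in> {c..d} \<Longrightarrow> \<exists>k<l. s t = singular_values (A t) ! k"
  obtains \<rho> where "has_density s' \<rho> c d" "integral {c..d} (\<lambda>t. \<bar>\<rho> t\<bar>) \<le> 2 * (2 * Lam) + 4 * Lcomp"
    "\<And>t. t \<in> {c..d} \<Longrightarrow> \<bar>s' t\<bar> \<le> 2 * Lam"
proof -
  have cs: "continuous_on {c..d} s" by (rule DERIV_continuous_on[OF s(1)])
  note conv = selection_convex[OF cs sel]
  have b: "\<bar>s' t\<bar> \<le> 2 * Lam" if "t \<in> {c..d}" for t
    by (rule selection_derivative_bound[OF s(1)[OF that] that cd singular_value_lipschitz sel])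
  \<comment> \<open>Continued by constants outside [c, d], since
    \<open>singular_value_polynomial\<close> works with matrices for all real t.\<close>
  define A' where "A' t = A (max c (min d t))" for t
  have id: "max c (min d t) = t" if "t \<in> {c..d}" for t using that by auto
  have A': "A' t \<in> carrier_mat m n" for t unfolding A'_def using cd by (intro A) auto
  have "W21_density_complex c d (\<lambda>t. A' t $$ (i, j))" if "i < m" "j < n" for i j
  proof -
    have "W21_density c d f'" if "W21_density c d f" "\<And>t. t \<in> {c..d} \<Longrightarrow> f t = f' t" for f f'
      using that has_density_cong unfolding W21_density_def by metis
    then show ?thesis using W[OF that] id unfolding W21_density_complex_def A'_def by (metis (no_types, lifting))
  qed
  then obtain a a' a'' where a: "\<And>k. has_density (a k) (a' k) c d" "\<And>k. has_density (a' k) (a'' k) c d"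
    "\<And>t. a (2 * n) t = 1" "\<And>t p. p < n \<Longrightarrow> (\<Sum>k\<le>2 * n. a k t * (singular_values (A' t) ! p) ^ k) = 0"
    using singular_value_polynomial[of A', OF A'] by blast
  have root: "(\<Sum>k\<le>2 * n. a k t * s t ^ k) = 0" if t: "t \<in> {c..d}" for t
  proof -
    obtain k where "k < l" "s t = singular_values (A t) ! k" using sel[OF t] by blast
    then show ?thesis using a(4)[of k t] id[OF t] l by (simp add: A'_def)
  qed
  obtain \<rho> where "has_density s' \<rho> c d" "integral {c..d} (\<lambda>t. \<bar>\<rho> t\<bar>) \<le> 2 * (2 * Lam) + 4 * Lcomp"
    using C1_root_density[OF cd conv compensator_lipschitz s b a(1,2,3) root] by blast
  then show ?thesis using that b by blast
qed

end

section \<open>C1 eigenvalues of Hermitian curves\<close>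

text \<open>An eigenbasis of M that also diagonalizes the compression of M' to each eigenspace. The
  numbers \<open>\<mu>\<close> are the first-order changes of the eigenvalues in the direction
  M'.\<close>

definition adapted_basis ::
    "nat \<Rightarrow> (nat \<Rightarrow> nat \<Rightarrow> complex) \<Rightarrow> (nat \<Rightarrow> nat \<Rightarrow> complex) \<Rightarrow> (nat \<Rightarrow> nat \<Rightarrow> complex) \<Rightarrow> (nat \<Rightarrow> real) \<Rightarrow> (nat \<Rightarrow> real) \<Rightarrow> bool" where
  "adapted_basis n M M' u \<theta> \<mu> \<longleftrightarrow> orthon n n u \<and>
     (\<forall>p<n. \<forall>i<n. mv n M (u p) i = of_real (\<theta> p) * u p i) \<and>
     (\<forall>p<n. \<forall>q<n. \<theta> p = \<theta> q \<longrightarrow> ip n (u p) (mv n M' (u q)) = (if p = q then of_real (\<mu> p) else 0))"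

lemma ip_parseval:
  assumes "orthon n n v"
  shows "ip n x y = (\<Sum>r<n. ip n x (v r) * ip n (v r) y)"
proof -
  have "ip n x y = ip n x (\<lambda>i. \<Sum>r<n. ip n (v r) y * v r i)"
    by (rule ip_cong[OF refl]) (rule parseval(2)[OF assms])
  then show ?thesis unfolding ip_sum_right ip_scale_right by (simp add: mult.commute)
qed

lemma tendsto_ip_mv:
  assumes "\<And>i. i < n \<Longrightarrow> (\<lambda>k. x k i) \<longlonglongrightarrow> x0 i" "\<And>i. i < n \<Longrightarrow> (\<lambda>k. y k i) \<longlonglongrightarrow> y0 i"
    "\<And>i j. i < n \<Longrightarrow> j < n \<Longrightarrow> (\<lambda>k. M k i j) \<longlonglongrightarrow> M0 i j"
  shows "(\<lambda>k. ip n (x k) (y k)) \<longlonglongrightarrow> ip n x0 y0"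
    "(\<lambda>k. ip n (x k) (mv n (M k) (y k))) \<longlonglongrightarrow> ip n x0 (mv n M0 y0)"
    "i < n \<Longrightarrow> (\<lambda>k. mv n (M k) (y k) i) \<longlonglongrightarrow> mv n M0 y0 i"
  unfolding ip_def mv_def by (intro tendsto_intros assms; simp)+

text \<open>First-order perturbation theory along a sequence. Expansion in the limit basis v turns
  the eigenvalue equation into an exact identity, in which the other eigenspaces contribute products
  of a vanishing and a bounded factor. It serves both to construct adapted bases and to
  differentiate along a curve.\<close>

lemma perturbed_eigenbasis_limit:
  fixes \<epsilon> :: "nat \<Rightarrow> real" and lam :: "nat \<Rightarrow> nat \<Rightarrow> real"
  assumes M0: "herm n M0"
    and u: "\<And>k. orthon n n (u k)"
    and ev: "\<And>k p i. p < n \<Longrightarrow> i < n \<Longrightarrow> mv n (M k) (u k p) i = of_real (lam k p) * u k p i"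
    and \<epsilon>: "\<And>k. \<epsilon> k \<noteq> 0" "\<epsilon> \<longlonglongrightarrow> 0"
    and M: "\<And>k i j. i < n \<Longrightarrow> j < n \<Longrightarrow> M k i j = M0 i j + of_real (\<epsilon> k) * B k i j"
    and B: "\<And>i j. i < n \<Longrightarrow> j < n \<Longrightarrow> (\<lambda>k. B k i j) \<longlonglongrightarrow> M1 i j"
    and uv: "\<And>p i. p < n \<Longrightarrow> i < n \<Longrightarrow> (\<lambda>k. u k p i) \<longlonglongrightarrow> v p i"
  obtains \<theta> \<mu> where "adapted_basis n M0 M1 v \<theta> \<mu>" "\<And>p. p < n \<Longrightarrow> (\<lambda>k. lam k p) \<longlonglongrightarrow> \<theta> p"
    "\<And>p. p < n \<Longrightarrow> (\<lambda>k. (lam k p - \<theta> p) / \<epsilon> k) \<longlonglongrightarrow> \<mu> p"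
proof -
  define \<theta> where "\<theta> p = Re (ip n (v p) (mv n M0 (v p)))" for p
  define \<mu> where "\<mu> p = Re (ip n (v p) (mv n M1 (v p)))" for p
  have \<epsilon>c: "(\<lambda>k. complex_of_real (\<epsilon> k)) \<longlonglongrightarrow> 0" using \<epsilon>(2) by (metis of_real_0 tendsto_of_real)
  have Mlim: "(\<lambda>k. M k i j) \<longlonglongrightarrow> M0 i j" if "i < n" "j < n" for i j
  proof -
    have "(\<lambda>k. M0 i j + of_real (\<epsilon> k) * B k i j) \<longlonglongrightarrow> M0 i j + 0 * M1 i j"
      by (intro tendsto_intros \<epsilon>c B that)
    then show ?thesis using M[OF that] by simp
  qed
  have v: "orthon n n v"
    unfolding orthon_def
  proof (intro allI impI)
    fix p q assume pq: "p < n" "q < n"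
    have "(\<lambda>k. ip n (u k p) (u k q)) \<longlonglongrightarrow> ip n (v p) (v q)"
      by (rule tendsto_ip_mv(1)[OF uv uv Mlim]) (use pq in auto)
    moreover have "(\<lambda>k. ip n (u k p) (u k q)) = (\<lambda>k. if p = q then 1 else 0)"
      using u pq unfolding orthon_def by auto
    ultimately show "ip n (v p) (v q) = (if p = q then 1 else 0)" by (metis LIMSEQ_const_iff)
  qed
  have uMu: "ip n (u k p) (mv n (M k) (u k q)) = (if p = q then of_real (lam k q) else 0)" if "p < n" "q < n" for k p q
  proof -
    have "ip n (u k p) (mv n (M k) (u k q)) = ip n (u k p) (\<lambda>i. of_real (lam k q) * u k q i)"
      by (rule ip_cong[OF refl]) (rule ev[OF that(2)])
    then show ?thesis using u[of k] that unfolding orthon_def ip_scale_right by auto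
  qed
  have lam: "(\<lambda>k. lam k p) \<longlonglongrightarrow> \<theta> p" if p: "p < n" for p
  proof -
    have "(\<lambda>k. Re (ip n (u k p) (mv n (M k) (u k p)))) \<longlonglongrightarrow> \<theta> p"
      unfolding \<theta>_def by (intro tendsto_intros tendsto_ip_mv(2)[OF uv uv Mlim] p) auto
    then show ?thesis using uMu[OF p p] by simp
  qed
  have ev0: "mv n M0 (v p) i = of_real (\<theta> p) * v p i" if "p < n" "i < n" for p i
  proof (rule LIMSEQ_unique)
    show "(\<lambda>k. mv n (M k) (u k p) i) \<longlonglongrightarrow> mv n M0 (v p) i"
      by (rule tendsto_ip_mv(3)[OF uv uv Mlim]) (use that in auto)
    show "(\<lambda>k. mv n (M k) (u k p) i) \<longlonglongrightarrow> of_real (\<theta> p) * v p i"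
      unfolding ev[OF that] by (intro tendsto_intros lam uv that)
  qed
  have vM0: "ip n (v r) (mv n M0 x) = of_real (\<theta> r) * ip n (v r) x" if "r < n" for r x
  proof -
    have "ip n (v r) (mv n M0 x) = ip n (mv n M0 (v r)) x" by (simp add: herm_ip[OF M0])
    also have "\<dots> = ip n (\<lambda>i. of_real (\<theta> r) * v r i) x" by (rule ip_cong[OF _ refl]) (rule ev0[OF that])
    finally show ?thesis by (simp add: ip_scale_left)
  qed
  have Mx: "ip n y (mv n (M k) x) = ip n y (mv n M0 x) + of_real (\<epsilon> k) * ip n y (mv n (B k) x)" for k x y
  proof -
    have "ip n y (mv n (M k) x) = ip n y (\<lambda>i. mv n M0 x i + of_real (\<epsilon> k) * mv n (B k) x i)"
    proof (rule ip_cong[OF refl])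
      fix i assume "i < n"
      then show "mv n (M k) x i = mv n M0 x i + of_real (\<epsilon> k) * mv n (B k) x i"
        unfolding mv_def using M by (simp add: sum_distrib_left sum.distrib algebra_simps)
    qed
    then show ?thesis by (simp add: ip_linear)
  qed
  \<comment> \<open>Coordinates of the perturbed eigenvectors in the limit basis; they tend to those
    of the identity matrix.\<close>
  define w where "w k r p = ip n (v r) (u k p)" for k r p
  have w_lim: "(\<lambda>k. w k r p) \<longlonglongrightarrow> (if r = p then 1 else 0)" if "r < n" "p < n" for r p
  proof -
    have "(\<lambda>k. ip n (v r) (u k p)) \<longlonglongrightarrow> ip n (v r) (v p)"
      by (rule tendsto_ip_mv(1)[OF tendsto_const uv Mlim]) (use that in auto)
    then show ?thesis using v that unfolding w_def orthon_def by auto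
  qed
  text \<open>Components along the other eigenspaces of \<open>M0\<close> are of order \<open>\<epsilon>\<close>.\<close>
  have w_small: "\<exists>L. (\<lambda>k. w k r p / of_real (\<epsilon> k)) \<longlonglongrightarrow> L" if rp: "r < n" "p < n" "\<theta> r \<noteq> \<theta> p" for r p
  proof -
    define b where "b k = ip n (v r) (mv n (B k) (u k p))" for k
    have b: "b \<longlonglongrightarrow> ip n (v r) (mv n M1 (v p))"
      unfolding b_def by (rule tendsto_ip_mv(2)[OF tendsto_const uv B]) (use rp in auto)
    have eq: "of_real (lam k p - \<theta> r) * w k r p = of_real (\<epsilon> k) * b k" for k
    proof -
      have "ip n (v r) (mv n (M k) (u k p)) = of_real (lam k p) * w k r p"
      proof -
        have "ip n (v r) (mv n (M k) (u k p)) = ip n (v r) (\<lambda>i. of_real (lam k p) * u k p i)"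
          by (rule ip_cong[OF refl]) (rule ev[OF rp(2)])
        then show ?thesis by (simp add: ip_scale_right w_def)
      qed
      then show ?thesis unfolding Mx vM0[OF rp(1)] b_def w_def by (simp add: algebra_simps)
    qed
    have ne: "\<forall>\<^sub>F k in sequentially. lam k p \<noteq> \<theta> r"
      using lam[OF rp(2)] rp(3) by (intro tendsto_imp_eventually_ne) auto
    have "(\<lambda>k. b k / of_real (lam k p - \<theta> r)) \<longlonglongrightarrow> ip n (v r) (mv n M1 (v p)) / of_real (\<theta> p - \<theta> r)"
      by (intro tendsto_intros b lam) (use rp in auto)
    then have "(\<lambda>k. w k r p / of_real (\<epsilon> k)) \<longlonglongrightarrow> ip n (v r) (mv n M1 (v p)) / of_real (\<theta> p - \<theta> r)"
    proof (rule Lim_transform_eventually)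
      show "\<forall>\<^sub>F k in sequentially. b k / of_real (lam k p - \<theta> r) = w k r p / of_real (\<epsilon> k)"
        using ne
      proof eventually_elim
        case (elim k)
        then have "complex_of_real (lam k p - \<theta> r) \<noteq> 0" by simp
        moreover have "complex_of_real (\<epsilon> k) \<noteq> 0" using \<epsilon>(1) by simp
        ultimately show ?case using eq[of k] by (simp add: frac_eq_eq mult.commute del: of_real_diff)
      qed
    qed
    then show ?thesis by blast
  qed
  have main: "(\<lambda>k. (if p = q then of_real ((lam k q - \<theta> q) / \<epsilon> k) else 0)) \<longlonglongrightarrow> ip n (v p) (mv n M1 (v q))"
    if pq: "p < n" "q < n" "\<theta> p = \<theta> q" for p q
  proof -
    \<comment> \<open>For r outside the eigenspace of p and q, \<open>w k r p\<close> tends to 0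
      while \<open>w k r q / \<epsilon> k\<close> converges by \<open>w_small\<close>. Inside the
      eigenspace the coefficient is 0.\<close>
    have summand: "(\<lambda>k. of_real (\<theta> r - \<theta> q) * cnj (w k r p) * (w k r q / of_real (\<epsilon> k))) \<longlonglongrightarrow> 0" if r: "r < n" for r
    proof (cases "\<theta> r = \<theta> q")
      case False
      then obtain L where L: "(\<lambda>k. w k r q / of_real (\<epsilon> k)) \<longlonglongrightarrow> L" using w_small[OF r pq(2)] by blast
      have "r \<noteq> p" using False pq(3) by auto
      then have "(\<lambda>k. w k r p) \<longlonglongrightarrow> 0" using w_lim[OF r pq(1)] by simp
      then have "(\<lambda>k. of_real (\<theta> r - \<theta> q) * cnj (w k r p) * (w k r q / of_real (\<epsilon> k))) \<longlonglongrightarrow> of_real (\<theta> r - \<theta> q) * cnj 0 * L"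
        by (intro tendsto_intros L)
      then show ?thesis by simp
    qed simp
    \<comment> \<open>Subtract \<open>\<theta> q\<close> from the matrix element of
      \<open>M k\<close> between the perturbed eigenvectors, expand the part with M0 in the basis v,
      and divide by \<open>\<epsilon> k\<close>.\<close>
    have eq: "(if p = q then of_real ((lam k q - \<theta> q) / \<epsilon> k) else 0)
        = (\<Sum>r<n. of_real (\<theta> r - \<theta> q) * cnj (w k r p) * (w k r q / of_real (\<epsilon> k))) + ip n (u k p) (mv n (B k) (u k q))" for k
    proof -
      have e0: "complex_of_real (\<epsilon> k) \<noteq> 0" using \<epsilon>(1) by simp
      have h1: "ip n (u k p) (mv n M0 (u k q)) = (\<Sum>r<n. of_real (\<theta> r) * cnj (w k r p) * w k r q)"
        unfolding ip_parseval[OF v, of "u k p" "mv n M0 (u k q)"]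
        by (intro sum.cong refl) (simp add: vM0 w_def cnj_ip)
      have h2: "of_real (\<theta> q) * (if p = q then 1 else 0) = (\<Sum>r<n. of_real (\<theta> q) * cnj (w k r p) * w k r q)"
      proof -
        have "(if p = q then 1 else 0) = ip n (u k p) (u k q)" using u[of k] pq unfolding orthon_def by auto
        also have "\<dots> = (\<Sum>r<n. cnj (w k r p) * w k r q)"
          unfolding ip_parseval[OF v, of "u k p" "u k q"] by (simp add: w_def cnj_ip)
        finally show ?thesis by (simp add: sum_distrib_left mult.assoc)
      qed
      have d: "(\<Sum>r<n. of_real (\<theta> r - \<theta> q) * cnj (w k r p) * w k r q)
          = (\<Sum>r<n. of_real (\<theta> r) * cnj (w k r p) * w k r q) - (\<Sum>r<n. of_real (\<theta> q) * cnj (w k r p) * w k r q)"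
        by (simp add: sum_subtractf left_diff_distrib)
      have "(if p = q then of_real (lam k q) else 0) - of_real (\<theta> q) * (if p = q then 1 else 0)
          = (\<Sum>r<n. of_real (\<theta> r - \<theta> q) * cnj (w k r p) * w k r q) + of_real (\<epsilon> k) * ip n (u k p) (mv n (B k) (u k q))"
        unfolding d h2 uMu[OF pq(1,2), symmetric] Mx h1 by simp
      then have "((if p = q then of_real (lam k q) else 0) - of_real (\<theta> q) * (if p = q then 1 else 0)) / of_real (\<epsilon> k)
          = (\<Sum>r<n. of_real (\<theta> r - \<theta> q) * cnj (w k r p) * (w k r q / of_real (\<epsilon> k))) + ip n (u k p) (mv n (B k) (u k q))"
        using e0 by (simp add: add_divide_distrib sum_divide_distrib)
      moreover have "((if p = q then of_real (lam k q) else 0) - of_real (\<theta> q) * (if p = q then 1 else 0)) / complex_of_real (\<epsilon> k)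
          = (if p = q then of_real ((lam k q - \<theta> q) / \<epsilon> k) else 0)" by simp
      ultimately show ?thesis by simp
    qed
    have "(\<lambda>k. (\<Sum>r<n. of_real (\<theta> r - \<theta> q) * cnj (w k r p) * (w k r q / of_real (\<epsilon> k))) + ip n (u k p) (mv n (B k) (u k q)))
        \<longlonglongrightarrow> (\<Sum>r<n. 0) + ip n (v p) (mv n M1 (v q))"
      by (intro tendsto_add tendsto_sum summand tendsto_ip_mv(2)[OF uv uv B]) (use pq in auto)
    then show ?thesis unfolding eq by simp
  qed
  have quot: "(\<lambda>k. (lam k p - \<theta> p) / \<epsilon> k) \<longlonglongrightarrow> \<mu> p" if p: "p < n" for p
  proof -
    have "(\<lambda>k. Re (of_real ((lam k p - \<theta> p) / \<epsilon> k))) \<longlonglongrightarrow> Re (ip n (v p) (mv n M1 (v p)))"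
      using main[OF p p refl] by (intro tendsto_Re) simp
    then show ?thesis by (simp add: \<mu>_def)
  qed
  have "ip n (v p) (mv n M1 (v q)) = (if p = q then of_real (\<mu> p) else 0)" if pq: "p < n" "q < n" "\<theta> p = \<theta> q" for p q
  proof (cases "p = q")
    case True
    have "(\<lambda>k. complex_of_real ((lam k p - \<theta> p) / \<epsilon> k)) \<longlonglongrightarrow> of_real (\<mu> p)"
      by (intro tendsto_of_real quot pq)
    then show ?thesis using main[OF pq] True LIMSEQ_unique by fastforce
  next
    case False
    then show ?thesis using main[OF pq] by (simp add: LIMSEQ_const_iff)
  qed
  then have "adapted_basis n M0 M1 v \<theta> \<mu>" unfolding adapted_basis_def using v ev0 by blast
  then show ?thesis using that lam quot by blast
qed

lemma orthon_bounded:
  assumes "\<And>k. orthon n n (u k)" "s \<in> {..<n} \<times> {..<n}"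
  shows "bounded (range (\<lambda>k. u k (fst s) (snd s)))"
proof (rule boundedI[of _ 1])
  fix x assume "x \<in> range (\<lambda>k. u k (fst s) (snd s))"
  then obtain k where x: "x = u k (fst s) (snd s)" by blast
  have "(cmod x)\<^sup>2 \<le> 1"
    using cmod_le_nrm2[of "snd s" n "u k (fst s)"] orthon_nrm2[OF assms(1)[of k], of "fst s"] assms(2) unfolding x by auto
  then show "norm x \<le> 1" by (simp add: abs_square_le_1)
qed

text \<open>Adapted bases are limits of eigenbases of \<open>M0 + M1 / (k + 1)\<close> along a
  subsequence; the eigenspaces of M0 do not have to be treated one by one.\<close>

lemma adapted_basis_exists:
  assumes "herm n M0" "herm n M1"
  obtains u \<theta> \<mu> where "adapted_basis n M0 M1 u \<theta> \<mu>"
proof -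
  define \<epsilon> where "\<epsilon> k = 1 / real (Suc k)" for k
  define M where "M k i j = M0 i j + of_real (\<epsilon> k) * M1 i j" for k i j
  have "herm n (M k)" for k
    unfolding herm_def
  proof (intro allI impI)
    fix i j assume "i < n" "j < n"
    then have "M0 j i = cnj (M0 i j)" "M1 j i = cnj (M1 i j)" using assms unfolding herm_def by blast+
    then show "M k j i = cnj (M k i j)"
      by (simp only: M_def complex_cnj_add complex_cnj_mult complex_cnj_complex_of_real)
  qed
  then have "\<forall>k. \<exists>u \<theta>. orthon n n u \<and> (\<forall>p<n. \<forall>i<n. mv n (M k) (u p) i = of_real (\<theta> p) * u p i)"
    using hermitian_spectral by metis
  then obtain u lam where u: "\<And>k. orthon n n (u k)"
    "\<And>k p i. p < n \<Longrightarrow> i < n \<Longrightarrow> mv n (M k) (u k p) i = of_real (lam k p) * u k p i" by metis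
  define W where "W k s = u k (fst s) (snd s)" for k and s :: "nat \<times> nat"
  have W: "bounded (range (\<lambda>k. W k s))" if "s \<in> {..<n} \<times> {..<n}" for s
    unfolding W_def by (rule orthon_bounded[OF u(1) that])
  have "finite ({..<n} \<times> {..<n})" by simp
  from finite_convergent_subsequence[of _ W, OF this W]
  obtain r v where r: "strict_mono (r :: nat \<Rightarrow> nat)"
    and v': "\<And>s. s \<in> {..<n} \<times> {..<n} \<Longrightarrow> (\<lambda>k. W (r k) s) \<longlonglongrightarrow> v s" by metis
  have v: "(\<lambda>k. u (r k) (fst s) (snd s)) \<longlonglongrightarrow> v s" if "s \<in> {..<n} \<times> {..<n}" for s
    using v'[OF that] unfolding W_def .
  have "\<epsilon> \<longlonglongrightarrow> 0" unfolding \<epsilon>_def by (rule LIMSEQ_Suc[OF lim_1_over_n])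
  from LIMSEQ_subseq_LIMSEQ[OF this r] have "(\<lambda>k. \<epsilon> (r k)) \<longlonglongrightarrow> 0" by (simp add: o_def)
  then have elim: "(\<lambda>k. \<epsilon> (r k)) \<longlonglongrightarrow> 0" .
  have e0: "\<epsilon> (r k) \<noteq> 0" for k unfolding \<epsilon>_def by simp
  define V where "V p i = v (p, i)" for p i
  have V: "(\<lambda>k. u (r k) p i) \<longlonglongrightarrow> V p i" if "p < n" "i < n" for p i
    using v[of "(p, i)"] that by (simp add: V_def)
  have Mr: "M (r k) i j = M0 i j + of_real (\<epsilon> (r k)) * M1 i j" for k i j by (simp add: M_def)
  show ?thesis
  proof (rule perturbed_eigenbasis_limit)
    show "herm n M0" by (rule assms(1))
    show "orthon n n (u (r k))" for k by (rule u(1))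
    show "mv n (M (r k)) (u (r k) p) i = of_real (lam (r k) p) * u (r k) p i" if "p < n" "i < n" for k p i
      by (rule u(2)[OF that])
    show "\<epsilon> (r k) \<noteq> 0" for k by (rule e0)
    show "(\<lambda>k. \<epsilon> (r k)) \<longlonglongrightarrow> 0" by (rule elim)
    show "M (r k) i j = M0 i j + of_real (\<epsilon> (r k)) * (\<lambda>k. M1) k i j" for k i j by (simp add: Mr)
    show "(\<lambda>k. (\<lambda>k. M1) k i j) \<longlonglongrightarrow> M1 i j" for i j by simp
    show "(\<lambda>k. u (r k) p i) \<longlonglongrightarrow> V p i" if "p < n" "i < n" for p i by (rule V[OF that])
    show thesis if "adapted_basis n M0 M1 V \<theta> \<mu>" for \<theta> \<mu> using \<open>\<And>u \<theta> \<mu>. adapted_basis n M0 M1 u \<theta> \<mu> \<Longrightarrow> thesis\<close> that .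
  qed
qed

text \<open>The unitary matrix between the two bases vanishes except between indices with equal
  pairs of eigenvalue and derivative. Summing the squared moduli of such a block by rows and by
  columns gives equal numbers of indices.\<close>

lemma adapted_basis_unique:
  assumes herm: "herm n M0" and u: "adapted_basis n M0 M1 u \<theta> \<mu>" and v: "adapted_basis n M0 M1 v \<theta>' \<mu>'"
  obtains \<pi> where "\<pi> permutes {..<n}" "\<And>p. p < n \<Longrightarrow> \<theta> p = \<theta>' (\<pi> p) \<and> \<mu> p = \<mu>' (\<pi> p)"
proof -
  have ou: "orthon n n u" and ov: "orthon n n v" using u v unfolding adapted_basis_def by auto
  define W where "W p q = ip n (u p) (v q)" for p q
  have W1: "\<theta> p = \<theta>' q" if "p < n" "q < n" "W p q \<noteq> 0" for p q
  proof -
    have "of_real (\<theta> p) * W p q = ip n (mv n M0 (u p)) (v q)"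
    proof -
      have "ip n (mv n M0 (u p)) (v q) = ip n (\<lambda>i. of_real (\<theta> p) * u p i) (v q)"
        using u that unfolding adapted_basis_def by (intro ip_cong) auto
      then show ?thesis by (simp add: ip_scale_left W_def)
    qed
    also have "\<dots> = ip n (u p) (mv n M0 (v q))" by (rule herm_ip[OF herm])
    also have "\<dots> = of_real (\<theta>' q) * W p q"
    proof -
      have "ip n (u p) (mv n M0 (v q)) = ip n (u p) (\<lambda>i. of_real (\<theta>' q) * v q i)"
        using v that unfolding adapted_basis_def by (intro ip_cong) auto
      then show ?thesis by (simp add: ip_scale_right W_def)
    qed
    finally show ?thesis using that(3) by simp
  qed
  have W2: "\<mu> p = \<mu>' q" if pq: "p < n" "q < n" "W p q \<noteq> 0" for p q
  proof -
    have eq: "\<theta> p = \<theta>' q" by (rule W1[OF pq])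
    have "ip n (u p) (mv n M1 (v q)) = of_real (\<mu> p) * W p q"
    proof -
      have "mv n M1 (v q) = mv n M1 (\<lambda>i. \<Sum>r<n. W r q * u r i)"
        unfolding W_def by (rule mv_cong) (rule parseval(2)[OF ou])
      then have "ip n (u p) (mv n M1 (v q)) = (\<Sum>r<n. W r q * ip n (u p) (mv n M1 (u r)))"
        by (simp add: mv_sum mv_scale ip_linear)
      also have "\<dots> = (\<Sum>r<n. if r = p then of_real (\<mu> p) * W p q else 0)"
      proof (intro sum.cong refl)
        fix r assume "r \<in> {..<n}"
        then have r: "r < n" by simp
        show "W r q * ip n (u p) (mv n M1 (u r)) = (if r = p then of_real (\<mu> p) * W p q else 0)"
        proof (cases "W r q = 0")
          case False
          then have "\<theta> p = \<theta> r" using W1[OF r pq(2)] eq by simp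
          then have "ip n (u p) (mv n M1 (u r)) = (if p = r then of_real (\<mu> p) else 0)"
            using u r pq(1) unfolding adapted_basis_def by blast
          then show ?thesis by auto
        qed (use pq in auto)
      qed
      finally show ?thesis using pq by simp
    qed
    moreover have "ip n (u p) (mv n M1 (v q)) = of_real (\<mu>' q) * W p q"
    proof -
      have "ip n (u p) (mv n M1 (v q)) = (\<Sum>r<n. W p r * ip n (v r) (mv n M1 (v q)))"
        unfolding ip_parseval[OF ov, of "u p" "mv n M1 (v q)"] W_def ..
      also have "\<dots> = (\<Sum>r<n. if r = q then of_real (\<mu>' q) * W p q else 0)"
      proof (intro sum.cong refl)
        fix r assume "r \<in> {..<n}"
        then have r: "r < n" by simp
        show "W p r * ip n (v r) (mv n M1 (v q)) = (if r = q then of_real (\<mu>' q) * W p q else 0)"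
        proof (cases "W p r = 0")
          case False
          then have "\<theta>' r = \<theta>' q" using W1[OF pq(1) r] eq by simp
          then have "ip n (v r) (mv n M1 (v q)) = (if r = q then of_real (\<mu>' r) else 0)"
            using v r pq(2) unfolding adapted_basis_def by blast
          then show ?thesis by auto
        qed (use pq in auto)
      qed
      finally show ?thesis using pq by simp
    qed
    ultimately show ?thesis using pq(3) by simp
  qed
  define f where "f p = (\<theta> p, \<mu> p)" for p
  define f' where "f' q = (\<theta>' q, \<mu>' q)" for q
  have Wf: "W p q = 0" if "p < n" "q < n" "f p \<noteq> f' q" for p q
    using W1[OF that(1,2)] W2[OF that(1,2)] that(3) unfolding f_def f'_def by auto
  have row: "(\<Sum>q<n. (cmod (W p q))\<^sup>2) = 1" if "p < n" for p
  proof -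
    have "(\<Sum>q<n. (cmod (W p q))\<^sup>2) = (\<Sum>q<n. (cmod (ip n (v q) (u p)))\<^sup>2)"
      unfolding W_def by (intro sum.cong refl) (metis cnj_ip complex_mod_cnj)
    then show ?thesis using parseval(1)[OF ov, of "u p"] orthon_nrm2[OF ou that] by simp
  qed
  have col: "(\<Sum>p<n. (cmod (W p q))\<^sup>2) = 1" if "q < n" for q
    unfolding W_def using parseval(1)[OF ou, of "v q"] orthon_nrm2[OF ov that] by simp
  have card: "card {p \<in> {..<n}. f p = z} = card {q \<in> {..<n}. f' q = z}" for z
  proof -
    let ?P = "{p \<in> {..<n}. f p = z}" and ?Q = "{q \<in> {..<n}. f' q = z}"
    have "real (card ?P) = (\<Sum>p\<in>?P. \<Sum>q<n. (cmod (W p q))\<^sup>2)" using row by simp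
    also have "\<dots> = (\<Sum>p\<in>?P. \<Sum>q\<in>?Q. (cmod (W p q))\<^sup>2)"
      by (intro sum.cong refl sum.mono_neutral_right) (auto intro!: Wf)
    also have "\<dots> = (\<Sum>q\<in>?Q. \<Sum>p\<in>?P. (cmod (W p q))\<^sup>2)" by (rule sum.swap)
    also have "\<dots> = (\<Sum>q\<in>?Q. \<Sum>p<n. (cmod (W p q))\<^sup>2)"
      by (intro sum.cong refl sum.mono_neutral_left) (auto intro!: Wf)
    also have "\<dots> = real (card ?Q)" using col by simp
    finally show ?thesis by simp
  qed
  have "image_mset f (mset_set {..<n}) = image_mset f' (mset_set {..<n})"
  proof (rule multiset_eqI)
    fix z
    have "{..<n} \<inter> h -` {z} = {p \<in> {..<n}. h p = z}" for h :: "nat \<Rightarrow> real \<times> real" by auto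
    then show "count (image_mset f (mset_set {..<n})) z = count (image_mset f' (mset_set {..<n})) z"
      using card[of z] by (simp add: count_image_mset Int_commute)
  qed
  then obtain \<pi> where "\<pi> permutes {..<n}" "\<forall>p\<in>{..<n}. f p = f' (\<pi> p)"
    using image_mset_eq_implies_permutes[of "{..<n}" f f'] by auto
  then show ?thesis using that unfolding f_def f'_def by auto
qed

locale C1_hermitian_curve =
  fixes n :: nat and H H' :: "real \<Rightarrow> nat \<Rightarrow> nat \<Rightarrow> complex"
  assumes herm: "\<And>t. herm n (H t)" "\<And>t. herm n (H' t)"
    and deriv: "\<And>t i j. i < n \<Longrightarrow> j < n \<Longrightarrow> ((\<lambda>s. Re (H s i j)) has_real_derivative Re (H' t i j)) (at t)"
      "\<And>t i j. i < n \<Longrightarrow> j < n \<Longrightarrow> ((\<lambda>s. Im (H s i j)) has_real_derivative Im (H' t i j)) (at t)"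
    and cont: "\<And>t i j. i < n \<Longrightarrow> j < n \<Longrightarrow> isCont (\<lambda>s. H' s i j) t"
begin

text \<open>Compactness yields a limit basis along a subsequence. It is adapted at t0, so by
  uniqueness its pairs are those at t0 up to a permutation.\<close>

lemma sequential_limit:
  assumes u: "\<And>t. adapted_basis n (H t) (H' t) (u t) (lam t) (mu t)"
    and X: "X \<longlonglongrightarrow> t0" "\<And>k. X k \<noteq> t0"
  obtains r :: "nat \<Rightarrow> nat" and \<pi> where "strict_mono r" "\<pi> permutes {..<n}"
    "\<And>p. p < n \<Longrightarrow> (\<lambda>k. lam (X (r k)) p) \<longlonglongrightarrow> lam t0 (\<pi> p)"
    "\<And>p. p < n \<Longrightarrow> (\<lambda>k. mu (X (r k)) p) \<longlonglongrightarrow> mu t0 (\<pi> p)"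
    "\<And>p. p < n \<Longrightarrow> (\<lambda>k. (lam (X (r k)) p - lam t0 (\<pi> p)) / (X (r k) - t0)) \<longlonglongrightarrow> mu t0 (\<pi> p)"
proof -
  have ou: "orthon n n (u t)" for t using u unfolding adapted_basis_def by blast
  define W where "W k s = u (X k) (fst s) (snd s)" for k and s :: "nat \<times> nat"
  have W: "bounded (range (\<lambda>k. W k s))" if "s \<in> {..<n} \<times> {..<n}" for s
    unfolding W_def by (rule orthon_bounded[OF ou that])
  have "finite ({..<n} \<times> {..<n})" by simp
  from finite_convergent_subsequence[of _ W, OF this W]
  obtain r v where r: "strict_mono (r :: nat \<Rightarrow> nat)"
    and v': "\<And>s. s \<in> {..<n} \<times> {..<n} \<Longrightarrow> (\<lambda>k. W (r k) s) \<longlonglongrightarrow> v s" by metis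
  have v: "(\<lambda>k. u (X (r k)) (fst s) (snd s)) \<longlonglongrightarrow> v s" if "s \<in> {..<n} \<times> {..<n}" for s
    using v'[OF that] unfolding W_def .
  define V where "V p i = v (p, i)" for p i
  have V: "(\<lambda>k. u (X (r k)) p i) \<longlonglongrightarrow> V p i" if "p < n" "i < n" for p i
    using v[of "(p, i)"] that by (simp add: V_def)
  have Xr: "(\<lambda>k. X (r k)) \<longlonglongrightarrow> t0" using LIMSEQ_subseq_LIMSEQ[OF X(1) r] by (simp add: o_def)
  define \<epsilon> where "\<epsilon> k = X (r k) - t0" for k
  define B where "B k i j = (H (X (r k)) i j - H t0 i j) / of_real (\<epsilon> k)" for k i j
  have e0: "\<epsilon> k \<noteq> 0" for k using X(2) by (simp add: \<epsilon>_def)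
  have elim: "\<epsilon> \<longlonglongrightarrow> 0" unfolding \<epsilon>_def using Xr by (simp add: LIM_zero)
  have B: "(\<lambda>k. B k i j) \<longlonglongrightarrow> H' t0 i j" if "i < n" "j < n" for i j
  proof -
    have at: "filterlim (\<lambda>k. X (r k)) (at t0) sequentially"
      using Xr X(2) by (auto simp: filterlim_at)
    have "(\<lambda>k. (Re (H (X (r k)) i j) - Re (H t0 i j)) / \<epsilon> k) \<longlonglongrightarrow> Re (H' t0 i j)"
      using filterlim_compose[OF deriv(1)[OF that, of t0, unfolded has_field_derivative_iff] at] by (simp add: \<epsilon>_def)
    moreover have "(\<lambda>k. (Im (H (X (r k)) i j) - Im (H t0 i j)) / \<epsilon> k) \<longlonglongrightarrow> Im (H' t0 i j)"
      using filterlim_compose[OF deriv(2)[OF that, of t0, unfolded has_field_derivative_iff] at] by (simp add: \<epsilon>_def)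
    ultimately show ?thesis by (simp add: tendsto_complex_iff B_def)
  qed
  have H'lim: "(\<lambda>k. H' (X (r k)) i j) \<longlonglongrightarrow> H' t0 i j" if "i < n" "j < n" for i j
    by (rule isCont_tendsto_compose[OF cont[OF that] Xr])
  have evr: "mv n (H (X (r k))) (u (X (r k)) p) i = of_real (lam (X (r k)) p) * u (X (r k)) p i" if "p < n" "i < n" for k p i
    using u that unfolding adapted_basis_def by blast
  have Hr: "H (X (r k)) i j = H t0 i j + of_real (\<epsilon> k) * B k i j" for k i j
    using e0[of k] by (simp add: B_def)
  obtain \<theta> \<mu> where ad: "adapted_basis n (H t0) (H' t0) V \<theta> \<mu>"
    and l1: "\<And>p. p < n \<Longrightarrow> (\<lambda>k. lam (X (r k)) p) \<longlonglongrightarrow> \<theta> p"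
    and l2: "\<And>p. p < n \<Longrightarrow> (\<lambda>k. (lam (X (r k)) p - \<theta> p) / \<epsilon> k) \<longlonglongrightarrow> \<mu> p"
    using perturbed_eigenbasis_limit[OF herm(1), of "\<lambda>k. u (X (r k))" "\<lambda>k. H (X (r k))" "\<lambda>k. lam (X (r k))" \<epsilon> t0 B "H' t0" V,
        OF ou evr e0 elim Hr B V] by blast
  have l3: "(\<lambda>k. mu (X (r k)) p) \<longlonglongrightarrow> \<mu> p" if p: "p < n" for p
  proof -
    have "(\<lambda>k. Re (ip n (u (X (r k)) p) (mv n (H' (X (r k))) (u (X (r k)) p)))) \<longlonglongrightarrow> Re (ip n (V p) (mv n (H' t0) (V p)))"
      by (intro tendsto_Re tendsto_ip_mv(2)[OF V V H'lim]) (use p in auto)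
    moreover have "ip n (u t p) (mv n (H' t) (u t p)) = of_real (mu t p)" for t
      using u[of t] p unfolding adapted_basis_def by auto
    moreover have "ip n (V p) (mv n (H' t0) (V p)) = of_real (\<mu> p)"
      using ad p unfolding adapted_basis_def by auto
    ultimately show ?thesis by simp
  qed
  obtain \<pi> where \<pi>: "\<pi> permutes {..<n}" "\<And>p. p < n \<Longrightarrow> \<theta> p = lam t0 (\<pi> p) \<and> \<mu> p = mu t0 (\<pi> p)"
    using adapted_basis_unique[OF herm(1) ad u] by blast
  show ?thesis
    by (rule that[OF r \<pi>(1)]) (use l1 l2 l3 \<pi>(2) in \<open>auto simp: \<epsilon>_def\<close>)
qed

theorem C1_eigenvalues:
  obtains \<theta> \<theta>' :: "nat \<Rightarrow> real \<Rightarrow> real" where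
    "\<And>p t. p < n \<Longrightarrow> (\<theta> p has_real_derivative \<theta>' p t) (at t)" "\<And>p. p < n \<Longrightarrow> continuous_on UNIV (\<theta>' p)"
    "\<And>t. \<exists>u. orthon n n u \<and> (\<forall>p<n. \<forall>i<n. mv n (H t) (u p) i = of_real (\<theta> p t) * u p i)"
proof -
  have "\<forall>t. \<exists>u lam mu. adapted_basis n (H t) (H' t) u lam mu"
    using adapted_basis_exists[OF herm] by metis
  then obtain u lam mu where u: "\<And>t. adapted_basis n (H t) (H' t) (u t) (lam t) (mu t)" by metis
  \<comment> \<open>Eigenvalue and derivative are selected together: a continuous selection of the
    eigenvalues alone could switch branches at a crossing and lose differentiability.\<close>
  define z where "z t p = Complex (lam t p) (mu t p)" for t p
  have "unordered_continuous {..<n} UNIV z"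
    unfolding unordered_continuous_def
  proof (intro ballI allI impI, rule ccontr)
    fix t0 e assume e: "(0::real) < e" and neg: "\<not> (\<exists>\<delta>>0. \<forall>t\<in>UNIV. \<bar>t - t0\<bar> < \<delta> \<longrightarrow>
      (\<exists>\<pi>. \<pi> permutes {..<n} \<and> (\<forall>k\<in>{..<n}. cmod (z t k - z t0 (\<pi> k)) < e)))"
    have "\<exists>t. \<bar>t - t0\<bar> < 1 / real (Suc k) \<and> \<not> (\<exists>\<pi>. \<pi> permutes {..<n} \<and> (\<forall>p\<in>{..<n}. cmod (z t p - z t0 (\<pi> p)) < e))" for k
      using neg by (metis UNIV_I of_nat_0_less_iff zero_less_Suc zero_less_divide_1_iff)
    then obtain X where X: "\<And>k. \<bar>X k - t0\<bar> < 1 / real (Suc k)"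
      "\<And>k. \<not> (\<exists>\<pi>. \<pi> permutes {..<n} \<and> (\<forall>p\<in>{..<n}. cmod (z (X k) p - z t0 (\<pi> p)) < e))" by metis
    have "(\<lambda>k. X k - t0) \<longlonglongrightarrow> 0"
      by (rule Lim_null_comparison[OF _ LIMSEQ_Suc[OF lim_1_over_n]]) (use X(1) in \<open>auto intro!: always_eventually less_imp_le\<close>)
    then have Xlim: "X \<longlonglongrightarrow> t0" by (simp add: LIM_zero_iff)
    have Xne: "X k \<noteq> t0" for k
    proof
      assume "X k = t0"
      then have "\<forall>p\<in>{..<n}. cmod (z (X k) p - z t0 (id p)) < e" using e by simp
      then show False using X(2)[of k] permutes_id by blast
    qed
    obtain r :: "nat \<Rightarrow> nat" and \<pi> where r: "strict_mono r" "\<pi> permutes {..<n}"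
      "\<And>p. p < n \<Longrightarrow> (\<lambda>k. lam (X (r k)) p) \<longlonglongrightarrow> lam t0 (\<pi> p)"
      "\<And>p. p < n \<Longrightarrow> (\<lambda>k. mu (X (r k)) p) \<longlonglongrightarrow> mu t0 (\<pi> p)"
      "\<And>p. p < n \<Longrightarrow> (\<lambda>k. (lam (X (r k)) p - lam t0 (\<pi> p)) / (X (r k) - t0)) \<longlonglongrightarrow> mu t0 (\<pi> p)"
      using sequential_limit[OF u Xlim Xne] by blast
    have "(\<lambda>k. z (X (r k)) p) \<longlonglongrightarrow> z t0 (\<pi> p)" if "p < n" for p
      unfolding z_def using r(3,4)[OF that] by (rule tendsto_Complex)
    then have "\<forall>\<^sub>F k in sequentially. cmod (z (X (r k)) p - z t0 (\<pi> p)) < e" if "p < n" for p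
      using e that unfolding tendsto_iff dist_norm by blast
    then have "\<forall>\<^sub>F k in sequentially. \<forall>p\<in>{..<n}. cmod (z (X (r k)) p - z t0 (\<pi> p)) < e"
      by (intro eventually_ball_finite) auto
    then obtain k where "\<forall>p\<in>{..<n}. cmod (z (X (r k)) p - z t0 (\<pi> p)) < e"
      unfolding eventually_sequentially by blast
    then show False using X(2) r(2) by blast
  qed
  then obtain x where x: "continuous_selection {..<n} UNIV z x"
    using unordered_continuous_selection[of "{..<n}" z] by auto
  define \<theta> where "\<theta> p t = Re (x t p)" for p t
  define \<theta>' where "\<theta>' p t = Im (x t p)" for p t
  have cx: "continuous_on UNIV (\<lambda>t. x t p)" if "p < n" for p
    using x that unfolding continuous_selection_def by auto
  have st: "same_tuple {..<n} (x t) (z t)" for t using x unfolding continuous_selection_def by auto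
  have der: "(\<theta> p has_real_derivative \<theta>' p t0) (at t0)" if p: "p < n" for p t0
  proof -
    have "((\<lambda>s. (\<theta> p s - \<theta> p t0) / (s - t0)) \<longlongrightarrow> \<theta>' p t0) (at t0)"
      unfolding tendsto_at_iff_sequentially
    proof (intro allI impI, rule ccontr)
      fix Y assume Y: "\<forall>i. Y i \<in> UNIV - {t0}" "Y \<longlonglongrightarrow> t0"
        and neg: "\<not> ((\<lambda>s. (\<theta> p s - \<theta> p t0) / (s - t0)) \<circ> Y) \<longlonglongrightarrow> \<theta>' p t0"
      define h where "h k = (\<theta> p (Y k) - \<theta> p t0) / (Y k - t0)" for k
      obtain e where e: "e > 0" "\<not> (\<forall>\<^sub>F k in sequentially. dist (h k) (\<theta>' p t0) < e)"
        using neg unfolding tendsto_iff h_def o_def by blast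
      then have "infinite {k. \<not> dist (h k) (\<theta>' p t0) < e}"
        unfolding cofinite_eq_sequentially[symmetric] eventually_cofinite by simp
      then obtain a where a: "strict_mono (a :: nat \<Rightarrow> nat)" "\<And>k. \<not> dist (h (a k)) (\<theta>' p t0) < e"
        using infinite_enumerate by blast
      have Ya: "(\<lambda>k. Y (a k)) \<longlonglongrightarrow> t0" using LIMSEQ_subseq_LIMSEQ[OF Y(2) a(1)] by (simp add: o_def)
      have Yne: "Y (a k) \<noteq> t0" for k using Y(1) by blast
      obtain r :: "nat \<Rightarrow> nat" and \<pi> where r: "strict_mono r" "\<pi> permutes {..<n}"
        "\<And>p. p < n \<Longrightarrow> (\<lambda>k. lam (Y (a (r k))) p) \<longlonglongrightarrow> lam t0 (\<pi> p)"
        "\<And>p. p < n \<Longrightarrow> (\<lambda>k. mu (Y (a (r k))) p) \<longlonglongrightarrow> mu t0 (\<pi> p)"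
        "\<And>p. p < n \<Longrightarrow> (\<lambda>k. (lam (Y (a (r k))) p - lam t0 (\<pi> p)) / (Y (a (r k)) - t0)) \<longlonglongrightarrow> mu t0 (\<pi> p)"
        using sequential_limit[OF u Ya Yne] by blast
      \<comment> \<open>The selected entry may come from varying indices; by the pigeonhole
        principle one index occurs infinitely often.\<close>
      have "\<exists>j<n. x (Y (a (r k))) p = z (Y (a (r k))) j" for k
        using st[of "Y (a (r k))"] p unfolding same_tuple_def
        by (metis lessThan_iff permutes_in_image)
      then obtain J where J: "\<And>k. J k < n" "\<And>k. x (Y (a (r k))) p = z (Y (a (r k))) (J k)" by metis
      have "range J \<subseteq> {..<n}" using J(1) by blast
      then have "finite (range J)" using finite_subset finite_lessThan by metis
      then obtain j0 where "infinite (J -` {J j0})"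
        using pigeonhole_infinite[of UNIV J] by (auto simp: vimage_def)
      then obtain b where b: "strict_mono (b :: nat \<Rightarrow> nat)" "\<And>k. J (b k) = J j0"
        using infinite_enumerate by (metis vimage_singleton_eq)
      define j where "j = J j0"
      define T where "T k = Y (a (r (b k)))" for k
      have j: "j < n" using J(1) by (simp add: j_def)
      have xT: "x (T k) p = z (T k) j" for k using J(2)[of "b k"] b(2) by (simp add: T_def j_def)
      have T: "T \<longlonglongrightarrow> t0"
        using LIMSEQ_subseq_LIMSEQ[OF LIMSEQ_subseq_LIMSEQ[OF Ya r(1)] b(1)] by (simp add: o_def T_def[abs_def])
      have xlim: "(\<lambda>k. x (T k) p) \<longlonglongrightarrow> x t0 p"
        using cx[OF p] T by (auto simp: continuous_on_eq_continuous_at intro: isCont_tendsto_compose[of _ "\<lambda>t. x t p"])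
      have s1: "(\<lambda>k. lam (T k) j) \<longlonglongrightarrow> lam t0 (\<pi> j)" "(\<lambda>k. mu (T k) j) \<longlonglongrightarrow> mu t0 (\<pi> j)"
        "(\<lambda>k. (lam (T k) j - lam t0 (\<pi> j)) / (T k - t0)) \<longlonglongrightarrow> mu t0 (\<pi> j)"
        using LIMSEQ_subseq_LIMSEQ[OF r(3)[OF j] b(1)] LIMSEQ_subseq_LIMSEQ[OF r(4)[OF j] b(1)]
          LIMSEQ_subseq_LIMSEQ[OF r(5)[OF j] b(1)] by (simp_all add: o_def T_def)
      have lamT: "lam (T k) j = \<theta> p (T k)" "mu (T k) j = \<theta>' p (T k)" for k
        using xT[of k] by (simp_all add: z_def \<theta>_def \<theta>'_def)
      \<comment> \<open>Continuity of the selection identifies the limit pair with the selected pair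
        at t0.\<close>
      have "lam t0 (\<pi> j) = \<theta> p t0"
        using LIMSEQ_unique[OF s1(1)] tendsto_Re[OF xlim] unfolding lamT by (simp add: \<theta>_def)
      moreover have "mu t0 (\<pi> j) = \<theta>' p t0"
        using LIMSEQ_unique[OF s1(2)] tendsto_Im[OF xlim] unfolding lamT by (simp add: \<theta>'_def)
      ultimately have "(\<lambda>k. h (a (r (b k)))) \<longlonglongrightarrow> \<theta>' p t0"
        using s1(3) unfolding h_def lamT by (simp add: T_def)
      then have "\<forall>\<^sub>F k in sequentially. dist (h (a (r (b k)))) (\<theta>' p t0) < e"
        using e(1) unfolding tendsto_iff by blast
      then show False using a(2) by (auto simp: eventually_sequentially)
    qed
    then show ?thesis by (simp add: has_field_derivative_iff)
  qed
  have c': "continuous_on UNIV (\<theta>' p)" if "p < n" for p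
    unfolding \<theta>'_def[abs_def] by (intro continuous_intros cx that)
  have eig: "\<exists>u. orthon n n u \<and> (\<forall>p<n. \<forall>i<n. mv n (H t) (u p) i = of_real (\<theta> p t) * u p i)" for t
  proof -
    obtain \<pi> where \<pi>: "\<pi> permutes {..<n}" "\<And>p. p < n \<Longrightarrow> x t p = z t (\<pi> p)"
      using st[of t] unfolding same_tuple_def by auto
    have pn: "\<pi> p < n" if "p < n" for p using permutes_in_image[OF \<pi>(1), of p] that by simp
    have inj: "\<pi> p = \<pi> q \<longleftrightarrow> p = q" for p q using permutes_inj[OF \<pi>(1)] by (auto dest: injD)
    have "orthon n n (\<lambda>p. u t (\<pi> p))"
      using u[of t] pn inj unfolding adapted_basis_def orthon_def by auto
    moreover have "mv n (H t) (u t (\<pi> p)) i = of_real (\<theta> p t) * u t (\<pi> p) i" if "p < n" "i < n" for p i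
    proof -
      have "\<theta> p t = lam t (\<pi> p)" using \<pi>(2)[OF that(1)] by (simp add: \<theta>_def z_def)
      then show ?thesis using u[of t] pn that unfolding adapted_basis_def by auto
    qed
    ultimately show ?thesis by blast
  qed
  show ?thesis by (rule that[OF der c' eig])
qed

end

text \<open>Positivity characterizes the first l values without reference to a numbering, so they
  can be picked out of unsorted eigenvalues.\<close>

lemma filter_pos_singular_values:
  assumes A: "A \<in> carrier_mat m n" and l: "l = min m n" "vec_space.rank m A = l"
  shows "filter_mset (\<lambda>x. 0 < x) (mset (singular_values A)) = mset (take l (singular_values A))"
    "size (mset (take l (singular_values A))) = l" "length (singular_values A) = n"
proof -
  let ?s = "singular_values A"
  show len: "length ?s = n" using singular_values_basis[OF A] by metis
  then show "size (mset (take l ?s)) = l" using l by simp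
  have "\<forall>x\<in>set (take l ?s). 0 < x"
    using singular_values_pos_below_rank[OF A] l(2) len by (auto simp: in_set_conv_nth)
  moreover have "\<forall>x\<in>set (drop l ?s). \<not> 0 < x"
  proof
    fix x assume "x \<in> set (drop l ?s)"
    then obtain i where "i < length (drop l ?s)" "x = drop l ?s ! i" by (metis in_set_conv_nth)
    then have i: "i < n - l" "x = ?s ! (l + i)" using len by auto
    then have "m \<le> l + i" "l + i < n" using l(1) by auto
    then show "\<not> 0 < x" using singular_values_zero_above_rows[OF A] i by simp
  qed
  ultimately have "filter (\<lambda>x. 0 < x) (take l ?s @ drop l ?s) = take l ?s"
    unfolding filter_append by (simp add: filter_id_conv filter_empty_conv)
  then have "filter (\<lambda>x. 0 < x) ?s = take l ?s" by simp
  then show "filter_mset (\<lambda>x. 0 < x) (mset ?s) = mset (take l ?s)" by (metis mset_filter)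
qed

lemma has_vector_derivative_complex_parts:
  assumes "((\<lambda>s. Re (f s)) has_real_derivative Re D) (at t)" "((\<lambda>s. Im (f s)) has_real_derivative Im D) (at t)"
  shows "(f has_vector_derivative D) (at t)"
proof -
  have "((\<lambda>s. complex_of_real (Re (f s)) + \<i> * complex_of_real (Im (f s))) has_vector_derivative
      (complex_of_real (Re D) + \<i> * complex_of_real (Im D))) (at t)"
    using assms
    by (intro has_vector_derivative_add has_vector_derivative_mult_right has_vector_derivative_of_real)
  then show ?thesis by (simp add: complex_eq[symmetric])
qed

theorem C1_singular_value_system:
  fixes A :: "real \<Rightarrow> complex mat"
  assumes A: "\<And>t. A t \<in> carrier_mat m n" and C1: "mat_components m n (C1_on UNIV) A"
    and l: "l = min m n" and rank: "\<And>t. vec_space.rank m (A t) = l"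
  obtains \<sigma> \<sigma>' :: "real \<Rightarrow> nat \<Rightarrow> real" where "singular_value_system l UNIV A \<sigma>"
    "\<And>t j. j < l \<Longrightarrow> ((\<lambda>t. \<sigma> t j) has_real_derivative \<sigma>' t j) (at t)"
    "\<And>j. j < l \<Longrightarrow> continuous_on UNIV (\<lambda>t. \<sigma>' t j)"
proof -
  have "\<forall>i j. \<exists>f'. i < m \<and> j < n \<longrightarrow> (\<forall>t. ((\<lambda>t. Re (A t $$ (i, j))) has_real_derivative f' t) (at t)) \<and> continuous_on UNIV f'"
    using C1 unfolding mat_components_def C1_on_def by (metis UNIV_I)
  then obtain R where R: "\<And>i j t. i < m \<Longrightarrow> j < n \<Longrightarrow> ((\<lambda>t. Re (A t $$ (i, j))) has_real_derivative R i j t) (at t)"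
    "\<And>i j. i < m \<Longrightarrow> j < n \<Longrightarrow> continuous_on UNIV (R i j)" by metis
  have "\<forall>i j. \<exists>f'. i < m \<and> j < n \<longrightarrow> (\<forall>t. ((\<lambda>t. Im (A t $$ (i, j))) has_real_derivative f' t) (at t)) \<and> continuous_on UNIV f'"
    using C1 unfolding mat_components_def C1_on_def by (metis UNIV_I)
  then obtain J where J: "\<And>i j t. i < m \<Longrightarrow> j < n \<Longrightarrow> ((\<lambda>t. Im (A t $$ (i, j))) has_real_derivative J i j t) (at t)"
    "\<And>i j. i < m \<Longrightarrow> j < n \<Longrightarrow> continuous_on UNIV (J i j)" by metis
  define D where "D t i j = Complex (R i j t) (J i j t)" for t i j
  define H where "H t i j = (\<Sum>a<m. cnj (A t $$ (a, i)) * A t $$ (a, j))" for t i j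
  define H' where "H' t i j = (\<Sum>a<m. cnj (A t $$ (a, i)) * D t a j + cnj (D t a i) * A t $$ (a, j))" for t i j
  have dA: "((\<lambda>s. A s $$ (i, j)) has_vector_derivative D t i j) (at t)" if "i < m" "j < n" for i j t
    by (rule has_vector_derivative_complex_parts) (simp_all add: D_def R(1)[OF that] J(1)[OF that])
  have cA: "isCont (\<lambda>s. A s $$ (i, j)) t" if "i < m" "j < n" for i j t
    using has_vector_derivative_continuous[OF dA[OF that]] .
  have cD: "isCont (\<lambda>s. D s i j) t" if "i < m" "j < n" for i j t
    using R(2)[OF that] J(2)[OF that] unfolding D_def
    by (auto simp: continuous_on_eq_continuous_at isCont_def intro!: tendsto_Complex)
  have dH: "((\<lambda>s. H s i j) has_vector_derivative H' t i j) (at t)" if ij: "i < n" "j < n" for i j t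
    unfolding H_def H'_def
    by (intro has_vector_derivative_sum has_vector_derivative_mult
        bounded_linear.has_vector_derivative[OF bounded_linear_cnj] dA ij) auto
  interpret C1_hermitian_curve n H H'
  proof
    show "herm n (H t)" for t
      unfolding herm_def H_def by (simp add: mult.commute)
    show "herm n (H' t)" for t
      unfolding herm_def H'_def by (simp add: mult.commute add.commute)
    show "((\<lambda>s. Re (H s i j)) has_real_derivative Re (H' t i j)) (at t)" if "i < n" "j < n" for t i j
      unfolding has_real_derivative_iff_has_vector_derivative
      by (rule bounded_linear.has_vector_derivative[OF bounded_linear_Re dH[OF that]])
    show "((\<lambda>s. Im (H s i j)) has_real_derivative Im (H' t i j)) (at t)" if "i < n" "j < n" for t i j
      unfolding has_real_derivative_iff_has_vector_derivative
      by (rule bounded_linear.has_vector_derivative[OF bounded_linear_Im dH[OF that]])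
    show "isCont (\<lambda>s. H' s i j) t" if "i < n" "j < n" for t i j
      unfolding H'_def by (intro continuous_intros cA cD that) auto
  qed
  obtain \<theta> \<theta>' where \<theta>: "\<And>p t. p < n \<Longrightarrow> (\<theta> p has_real_derivative \<theta>' p t) (at t)"
    "\<And>p. p < n \<Longrightarrow> continuous_on UNIV (\<theta>' p)"
    and ev: "\<And>t. \<exists>u. orthon n n u \<and> (\<forall>p<n. \<forall>i<n. mv n (H t) (u p) i = of_real (\<theta> p t) * u p i)"
    using C1_eigenvalues by blast
  have ms: "mset (singular_values (A t)) = mset (map (\<lambda>p. sqrt (\<theta> p t)) [0..<n])" for t
  proof -
    obtain u where u: "orthon n n u" "\<And>p i. p < n \<Longrightarrow> i < n \<Longrightarrow> mv n (H t) (u p) i = of_real (\<theta> p t) * u p i"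
      using ev[of t] by blast
    have "mv n (mf (mat_adjoint (A t) * A t)) (u p) i = of_real (\<theta> p t) * u p i" if "p < n" "i < n" for p i
      using u(2)[OF that] gram_entry[OF A[of t] that(2)] unfolding mv_def H_def by simp
    then show ?thesis by (rule mset_singular_values[OF A u(1)])
  qed
  \<comment> \<open>The indices of the positive eigenvalues. Positivity persists nearby, so N can
    locally only grow; as it always has l elements, it is constant.\<close>
  define N where "N t = {p. p < n \<and> 0 < \<theta> p t}" for t
  have finN: "finite (N t)" for t unfolding N_def by simp
  have posms: "image_mset (\<lambda>p. sqrt (\<theta> p t)) (mset_set (N t)) = mset (take l (singular_values (A t)))" for t
  proof -
    have "mset (take l (singular_values (A t))) = filter_mset (\<lambda>x. 0 < x) (image_mset (\<lambda>p. sqrt (\<theta> p t)) (mset_set {0..<n}))"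
      using filter_pos_singular_values(1)[OF A l rank] unfolding ms by simp
    also have "\<dots> = image_mset (\<lambda>p. sqrt (\<theta> p t)) (filter_mset (\<lambda>p. 0 < \<theta> p t) (mset_set {0..<n}))"
      unfolding filter_mset_image_mset by simp
    also have "filter_mset (\<lambda>p. 0 < \<theta> p t) (mset_set {0..<n}) = mset_set (N t)"
      unfolding filter_mset_mset_set[OF finite_atLeastLessThan] by (rule arg_cong[of _ _ mset_set]) (auto simp: N_def)
    finally show ?thesis by simp
  qed
  have cardN: "card (N t) = l" for t
  proof -
    have "size (image_mset (\<lambda>p. sqrt (\<theta> p t)) (mset_set (N t))) = l"
      unfolding posms by (rule filter_pos_singular_values(2)[OF A l rank])
    then show ?thesis by simp
  qed
  have Nconst: "N t = N 0" for t
  proof (rule connected_local_const[of UNIV])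
    show "\<forall>a\<in>UNIV. \<forall>\<^sub>F b in at a within UNIV. N a = N b"
    proof
      fix a :: real
      have "\<forall>\<^sub>F b in at a. 0 < \<theta> p b" if "p \<in> N a" for p
        using that DERIV_isCont[OF \<theta>(1)[of p a]] unfolding N_def isCont_def
        by (auto intro: order_tendstoD)
      then have "\<forall>\<^sub>F b in at a. \<forall>p\<in>N a. 0 < \<theta> p b"
        using finN by (simp add: eventually_ball_finite)
      then show "\<forall>\<^sub>F b in at a. N a = N b"
      proof (rule eventually_mono)
        fix b assume "\<forall>p\<in>N a. 0 < \<theta> p b"
        then have "N a \<subseteq> N b" unfolding N_def by auto
        then show "N a = N b" using card_subset_eq[OF finN] cardN by metis
      qed
    qed
  qed auto
  obtain e where e: "bij_betw e {0..<l} (N 0)"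
    using ex_bij_betw_nat_finite[OF finN[of 0]] cardN by metis
  have "e j \<in> N t" if "j < l" for j t
    unfolding Nconst[of t] using bij_betwE[OF e] that by simp
  then have eN: "e j < n" "0 < \<theta> (e j) t" if "j < l" for j t
    using that unfolding N_def by blast+
  show ?thesis
  proof (rule that[of "\<lambda>t j. sqrt (\<theta> (e j) t)" "\<lambda>t j. inverse (sqrt (\<theta> (e j) t)) / 2 * \<theta>' (e j) t"])
    show "singular_value_system l UNIV A (\<lambda>t j. sqrt (\<theta> (e j) t))"
      unfolding singular_value_system_def
    proof
      fix t
      have "mset_set (N 0) = image_mset e (mset_set {0..<l})"
        using e by (metis bij_betw_def image_mset_mset_set)
      then show "mset (map (\<lambda>j. sqrt (\<theta> (e j) t)) [0..<l]) = mset (take l (singular_values (A t)))"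
        unfolding posms[symmetric] Nconst[of t] by (simp add: multiset.map_comp o_def)
    qed
    show "((\<lambda>t. sqrt (\<theta> (e j) t)) has_real_derivative inverse (sqrt (\<theta> (e j) t)) / 2 * \<theta>' (e j) t) (at t)"
      if "j < l" for t j
      by (rule DERIV_chain2[OF DERIV_real_sqrt[OF eN(2)[OF that]] \<theta>(1)[OF eN(1)[OF that]]])
    show "continuous_on UNIV (\<lambda>t. inverse (sqrt (\<theta> (e j) t)) / 2 * \<theta>' (e j) t)" if j: "j < l" for j
    proof -
      have "continuous_on UNIV (\<theta> (e j))"
        using DERIV_isCont[OF \<theta>(1)[OF eN(1)[OF j]]] by (simp add: continuous_on_eq_continuous_at)
      moreover have "sqrt (\<theta> (e j) t) \<noteq> 0" for t using eN(2)[OF j, of t] by simp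
      ultimately show ?thesis
        by (intro continuous_on_mult continuous_on_divide continuous_on_inverse continuous_on_real_sqrt
            continuous_on_const \<theta>(2)[OF eN(1)[OF j]]) auto
    qed
  qed
qed

section \<open>Uniform difference-convexity\<close>

text \<open>Slopes inside [c, d] lie between those of adjacent chords of length e in the enlarged
  interval, which are at most \<open>2 * B / e\<close> in modulus.\<close>

lemma convex_on_lipschitz_inner:
  fixes f :: "real \<Rightarrow> real"
  assumes f: "convex_on {c - e..d + e} f" and e: "0 < e"
    and B: "\<And>t. t \<in> {c - e..d + e} \<Longrightarrow> \<bar>f t\<bar> \<le> B" and xy: "x \<in> {c..d}" "y \<in> {c..d}"
  shows "\<bar>f x - f y\<bar> \<le> 2 * B / e * \<bar>x - y\<bar>"
  using xy
proof (induction x y rule: linorder_wlog)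
  case (le x y)
  show ?case
  proof (cases "x = y")
    case False
    then have lt: "x < y" using le by simp
    have cd: "c \<le> x" "y \<le> d" using le by auto
    have slope: "(f y - f x) / (y - x) \<le> (f (y + e) - f y) / (y + e - y)"
      using convex_slopes[OF f, of x y "y + e"] cd lt e by auto
    have slope': "(f x - f (x - e)) / (x - (x - e)) \<le> (f y - f x) / (y - x)"
      using convex_slopes[OF f, of "x - e" x y] cd lt e by auto
    have b: "\<bar>f (y + e)\<bar> \<le> B" "\<bar>f y\<bar> \<le> B" "\<bar>f x\<bar> \<le> B" "\<bar>f (x - e)\<bar> \<le> B"
      using B cd lt e by auto
    have "(f (y + e) - f y) / (y + e - y) \<le> 2 * B / e" "- (2 * B / e) \<le> (f x - f (x - e)) / (x - (x - e))"
      using b e by (auto simp: divide_right_mono minus_divide_left simp del: minus_divide_left[symmetric])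
    then have "\<bar>(f y - f x) / (y - x)\<bar> \<le> 2 * B / e" using slope slope' by linarith
    then have "\<bar>f y - f x\<bar> \<le> 2 * B / e * (y - x)"
      using lt by (simp add: abs_divide pos_divide_le_eq)
    then show ?thesis using lt by (simp add: abs_minus_commute)
  qed simp
next
  case (sym x y)
  then show ?case by (simp add: abs_minus_commute)
qed

text \<open>One plus the sum of the moduli is a common bound that is positive even for empty
  S.\<close>

lemma finite_uniform_bound:
  fixes P :: "'a \<Rightarrow> real \<Rightarrow> bool"
  assumes "finite S" and P: "\<And>s. s \<in> S \<Longrightarrow> \<exists>L. P s L" and mono: "\<And>s L L'. P s L \<Longrightarrow> L \<le> L' \<Longrightarrow> P s L'"
  obtains L where "L > 0" "\<And>s. s \<in> S \<Longrightarrow> P s L"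
proof -
  obtain f where f: "\<And>s. s \<in> S \<Longrightarrow> P s (f s)" using P by metis
  have "P s (1 + (\<Sum>s\<in>S. \<bar>f s\<bar>))" if "s \<in> S" for s
  proof (rule mono[OF f[OF that]])
    have "\<bar>f s\<bar> \<le> (\<Sum>s\<in>S. \<bar>f s\<bar>)" using assms(1) that by (intro member_le_sum) auto
    then show "f s \<le> 1 + (\<Sum>s\<in>S. \<bar>f s\<bar>)" by simp
  qed
  moreover have "0 < 1 + (\<Sum>s\<in>S. \<bar>f s\<bar>)" by (intro add_pos_nonneg sum_nonneg) auto
  ultimately show ?thesis using that by blast
qed

definition slice_DC :: "(real \<Rightarrow> real) \<Rightarrow> real \<Rightarrow> real \<Rightarrow> real \<Rightarrow> (real \<Rightarrow> real) \<Rightarrow> (real \<Rightarrow> real) \<Rightarrow> bool" where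
  "slice_DC f L c d g h \<longleftrightarrow> convex_on {c..d} g \<and> convex_on {c..d} h \<and>
     (\<forall>x\<in>{c..d}. \<forall>y\<in>{c..d}. \<bar>g x - g y\<bar> \<le> L * \<bar>x - y\<bar> \<and> \<bar>h x - h y\<bar> \<le> L * \<bar>x - y\<bar>) \<and>
     (\<forall>t\<in>{c..d}. f t = g t - h t \<and> \<bar>f t\<bar> \<le> L)"

text \<open>L bounds Lipschitz constants and values, and its inverse is the admissible length. So
  the property is monotone in L, and finitely many entries can share one L.\<close>

definition uniform_DC :: "(real \<times> 'r) set \<Rightarrow> (real \<times> 'r \<Rightarrow> real) \<Rightarrow> real \<Rightarrow> bool" where
  "uniform_DC K f L \<longleftrightarrow> 0 < L \<and>
     (\<forall>c d r. c < d \<and> d - c < 1 / L \<and> (c, r) \<in> K \<longrightarrow> (\<exists>g h. slice_DC (\<lambda>t. f (t, r)) L c d g h))"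

lemma slice_DC_mono: "slice_DC f L c d g h \<Longrightarrow> L \<le> L' \<Longrightarrow> slice_DC f L' c d g h"
  unfolding slice_DC_def by (meson abs_ge_zero mult_right_mono order_trans)

lemma uniform_DC_mono:
  assumes "uniform_DC K f L" "L \<le> L'"
  shows "uniform_DC K f L'"
proof -
  have "0 < L" "0 < L'" "1 / L' \<le> 1 / L" using assms unfolding uniform_DC_def by (auto intro: divide_left_mono)
  then show ?thesis
    using assms slice_DC_mono unfolding uniform_DC_def by (meson order_less_le_trans)
qed

text \<open>On a small ball both convex parts are bounded, which makes them Lipschitz on the slices of
  the ball of half the radius; the Lebesgue number of a finite subcover makes this uniform.\<close>

lemma locally_DC_uniform:
  fixes f :: "real \<times> 'r::euclidean_space \<Rightarrow> real"
  assumes U: "open U" and K: "compact K" "K \<subseteq> U" and f: "locally_DC_on U f"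
  obtains L where "uniform_DC K f L"
proof -
  have "\<exists>e>0. \<exists>B. \<exists>g h. convex_on (cball p e) g \<and> convex_on (cball p e) h \<and>
      (\<forall>x\<in>cball p e. \<bar>g x\<bar> \<le> B \<and> \<bar>h x\<bar> \<le> B \<and> f x = g x - h x)" if "p \<in> K" for p
  proof -
    have "p \<in> U" using K(2) that by blast
    from bspec[OF f[unfolded locally_DC_on_def] this]
    obtain V N where V: "openin (top_of_set U) V" "p \<in> V" "V \<subseteq> N" "N \<subseteq> U" and N: "DC_on N f"
      by (elim exE conjE)
    obtain g h where gh: "convex_on N g" "continuous_on N g" "convex_on N h" "continuous_on N h"
      "\<And>x. x \<in> N \<Longrightarrow> f x = g x - h x" using N unfolding DC_on_def by blast
    have "open V" using V(1) U by (meson openin_open_trans)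
    then obtain e where e: "e > 0" "cball p e \<subseteq> V" using V(2) open_contains_cball by blast
    have sub: "cball p e \<subseteq> N" using e V by blast
    have "bounded (g ` cball p e)" "bounded (h ` cball p e)"
      using gh(2,4) sub by (auto intro!: compact_imp_bounded compact_continuous_image intro: continuous_on_subset)
    then obtain B1 B2 where "\<forall>x\<in>cball p e. \<bar>g x\<bar> \<le> B1" "\<forall>x\<in>cball p e. \<bar>h x\<bar> \<le> B2"
      unfolding bounded_iff by auto
    then have "\<forall>x\<in>cball p e. \<bar>g x\<bar> \<le> max B1 B2 \<and> \<bar>h x\<bar> \<le> max B1 B2 \<and> f x = g x - h x"
      using gh(5) sub by (auto simp: le_max_iff_disj)
    moreover have "convex_on (cball p e) g" "convex_on (cball p e) h"
      using gh(1,3) sub by (auto intro: convex_on_subset)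
    ultimately show ?thesis using e(1) by blast
  qed
  then obtain e B g h where e: "\<And>p. p \<in> K \<Longrightarrow> 0 < e p"
    and gh: "\<And>p. p \<in> K \<Longrightarrow> convex_on (cball p (e p)) (g p) \<and> convex_on (cball p (e p)) (h p)"
    "\<And>p x. p \<in> K \<Longrightarrow> x \<in> cball p (e p) \<Longrightarrow> \<bar>g p x\<bar> \<le> B p \<and> \<bar>h p x\<bar> \<le> B p \<and> f x = g p x - h p x" by metis
  obtain P where P: "P \<subseteq> K" "finite P" "K \<subseteq> (\<Union>p\<in>P. ball p (e p / 2))"
    by (rule compactE_image[OF K(1), of K "\<lambda>p. ball p (e p / 2)"]) (use e in auto)
  obtain \<delta> where \<delta>: "0 < \<delta>" "\<And>x. x \<in> K \<Longrightarrow> \<exists>G\<in>(\<lambda>p. ball p (e p / 2)) ` P. ball x \<delta> \<subseteq> G"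
    using Heine_Borel_lemma[OF K(1), of "(\<lambda>p. ball p (e p / 2)) ` P"] P(3) by auto
  obtain M where M: "M > 0" "\<And>p. p \<in> P \<Longrightarrow> 2 * B p / (e p / 2) \<le> M \<and> 2 * B p \<le> M"
  proof (rule finite_uniform_bound[OF P(2), of "\<lambda>p L. 2 * B p / (e p / 2) \<le> L \<and> 2 * B p \<le> L"])
    show "\<exists>L. 2 * B p / (e p / 2) \<le> L \<and> 2 * B p \<le> L" for p
      by (rule exI[of _ "max (2 * B p / (e p / 2)) (2 * B p)"]) simp
  qed (blast intro: order_trans)+
  \<comment> \<open>M bounds the Lipschitz constants and the values; \<open>1 / \<delta>\<close>
    keeps intervals shorter than \<open>1 / L\<close> within the Lebesgue number.\<close>
  define L where "L = max M (1 / \<delta>)"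
  have L: "0 < L" "M \<le> L" "1 / L \<le> \<delta>"
    using M(1) \<delta>(1) by (auto simp: L_def max_def field_simps split: if_splits)
  have "\<exists>g h. slice_DC (\<lambda>t. f (t, r)) L c d g h" if cd: "c < d" "d - c < 1 / L" "(c, r) \<in> K" for c d r
  proof -
    obtain p where p: "p \<in> P" "ball (c, r) \<delta> \<subseteq> ball p (e p / 2)" using \<delta>(2)[OF cd(3)] by blast
    have pK: "p \<in> K" using p P by blast
    have half: "(t, r) \<in> ball p (e p / 2)" if "t \<in> {c..d}" for t
      using p(2) that cd L by (auto simp: dist_Pair_Pair dist_real_def subset_iff)
    \<comment> \<open>The slice lies in the ball of half the radius, so its enlargement by half the
      radius lies in the full ball; this is the room that \<open>convex_on_lipschitz_inner\<close>
      requires.\<close>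
    have full: "(t, r) \<in> cball p (e p)" if t: "t \<in> {c - e p / 2..d + e p / 2}" for t
    proof -
      define t' where "t' = max c (min d t)"
      have "dist p (t', r) < e p / 2" using half[of t'] cd by (auto simp: t'_def)
      moreover have "dist (t', r) (t, r) \<le> e p / 2"
        using t cd e[OF pK] by (auto simp: dist_Pair_Pair dist_real_def t'_def max_def min_def)
      ultimately show ?thesis using dist_triangle[of p "(t, r)" "(t', r)"] by simp
    qed
    have sub: "t \<in> {c - e p / 2..d + e p / 2}" if "t \<in> {c..d}" for t using that e[OF pK] by auto
    have slice: "convex_on {c - e p / 2..d + e p / 2} (\<lambda>t. w (t, r))" if w: "convex_on (cball p (e p)) w" for w
    proof (rule convex_onI)
      fix u x y :: real assume u: "0 < u" "u < 1" and xy: "x \<in> {c - e p / 2..d + e p / 2}" "y \<in> {c - e p / 2..d + e p / 2}"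
      have "w ((1 - u) *\<^sub>R (x, r) + u *\<^sub>R (y, r)) \<le> (1 - u) * w (x, r) + u * w (y, r)"
        by (rule convex_onD[OF w]) (use u full xy in auto)
      moreover have "(1 - u) *\<^sub>R (x, r) + u *\<^sub>R (y, r) = ((1 - u) *\<^sub>R x + u *\<^sub>R y, r)"
        by (simp add: scaleR_add_left[symmetric])
      ultimately show "w ((1 - u) *\<^sub>R x + u *\<^sub>R y, r) \<le> (1 - u) * w (x, r) + u * w (y, r)" by simp
    qed simp
    have lip: "\<bar>w (x, r) - w (y, r)\<bar> \<le> L * \<bar>x - y\<bar>"
      if w: "convex_on (cball p (e p)) w" "\<And>x. x \<in> cball p (e p) \<Longrightarrow> \<bar>w x\<bar> \<le> B p" and xy: "x \<in> {c..d}" "y \<in> {c..d}" for w x y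
    proof -
      have "\<bar>w (x, r) - w (y, r)\<bar> \<le> 2 * B p / (e p / 2) * \<bar>x - y\<bar>"
        by (rule convex_on_lipschitz_inner[OF slice[OF w(1)] _ w(2)[OF full] xy]) (use e[OF pK] in auto)
      also have "\<dots> \<le> L * \<bar>x - y\<bar>" using M(2)[OF p(1)] L(2) by (intro mult_right_mono) auto
      finally show ?thesis .
    qed
    have cv: "convex_on {c..d} (\<lambda>t. w (t, r))" if w: "convex_on (cball p (e p)) w" for w
      by (rule convex_on_subset[OF slice[OF w]]) (use e[OF pK] in auto)
    have "f (t, r) = g p (t, r) - h p (t, r) \<and> \<bar>f (t, r)\<bar> \<le> L" if "t \<in> {c..d}" for t
      using gh(2)[OF pK full[OF sub[OF that]]] M(2)[OF p(1)] L(2) by linarith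
    moreover have "convex_on {c..d} (\<lambda>t. g p (t, r))" "convex_on {c..d} (\<lambda>t. h p (t, r))"
      using gh(1)[OF pK] cv by blast+
    moreover have "\<bar>g p (x, r) - g p (y, r)\<bar> \<le> L * \<bar>x - y\<bar>" "\<bar>h p (x, r) - h p (y, r)\<bar> \<le> L * \<bar>x - y\<bar>"
      if "x \<in> {c..d}" "y \<in> {c..d}" for x y
      using gh[OF pK] lip that by blast+
    ultimately have "slice_DC (\<lambda>t. f (t, r)) L c d (\<lambda>t. g p (t, r)) (\<lambda>t. h p (t, r))"
      unfolding slice_DC_def by blast
    then show ?thesis by blast
  qed
  then have "uniform_DC K f L" unfolding uniform_DC_def using L(1) by blast
  then show ?thesis by (rule that)
qed

lemma mat_components_uniform_bound:
  fixes P :: "('a \<Rightarrow> real) \<Rightarrow> real \<Rightarrow> bool"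
  assumes "mat_components m n Q A" and P: "\<And>f. Q f \<Longrightarrow> \<exists>L. P f L" and mono: "\<And>f L L'. P f L \<Longrightarrow> L \<le> L' \<Longrightarrow> P f L'"
  obtains L where "L > 0" "mat_components m n (\<lambda>f. P f L) A"
proof -
  let ?S = "(\<lambda>(i, j) x. Re (A x $$ (i, j))) ` ({..<m} \<times> {..<n}) \<union> (\<lambda>(i, j) x. Im (A x $$ (i, j))) ` ({..<m} \<times> {..<n})"
  obtain L where L: "L > 0" "\<And>s. s \<in> ?S \<Longrightarrow> P s L"
  proof (rule finite_uniform_bound[of ?S P])
    show "finite ?S" by simp
    show "\<exists>L. P s L" if "s \<in> ?S" for s
      using assms(1) that by (auto simp: mat_components_def intro!: P)
  qed (use mono in auto)
  have "mat_components m n (\<lambda>f. P f L) A"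
    unfolding mat_components_def
  proof (intro allI impI conjI)
    fix i j assume "i < m" "j < n"
    then have "(i, j) \<in> {..<m} \<times> {..<n}" by simp
    then show "P (\<lambda>x. Re (A x $$ (i, j))) L" "P (\<lambda>x. Im (A x $$ (i, j))) L" by (intro L(2); force)+
  qed
  then show ?thesis using that L(1) by blast
qed

text \<open>The convex parts may change from slice to slice; only L is common, and only L enters the
  bounds.\<close>

lemma dc_curve_slices:
  fixes A :: "real \<Rightarrow> complex mat"
  assumes l: "l = min m n" and cd: "c < d"
    and A: "\<And>t. t \<in> {c..d} \<Longrightarrow> A t \<in> carrier_mat m n" "\<And>t. t \<in> {c..d} \<Longrightarrow> vec_space.rank m (A t) = l"
    and dc: "mat_components m n (\<lambda>f. \<exists>g h. slice_DC f L c d g h) A"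
  obtains g where "dc_curve l m n A g c d L"
proof -
  have "\<forall>i j. \<exists>g h g' h'. i < m \<and> j < n \<longrightarrow> slice_DC (\<lambda>t. Re (A t $$ (i, j))) L c d g h \<and> slice_DC (\<lambda>t. Im (A t $$ (i, j))) L c d g' h'"
    using dc unfolding mat_components_def by blast
  then obtain g h g' h' where gh: "\<And>i j. i < m \<Longrightarrow> j < n \<Longrightarrow> slice_DC (\<lambda>t. Re (A t $$ (i, j))) L c d (g i j) (h i j)"
    "\<And>i j. i < m \<Longrightarrow> j < n \<Longrightarrow> slice_DC (\<lambda>t. Im (A t $$ (i, j))) L c d (g' i j) (h' i j)" by metis
  define G where "G q i j = [g i j, h i j, g' i j, h' i j] ! q" for q i j
  have G: "convex_on {c..d} (G q i j)" "\<bar>G q i j x - G q i j y\<bar> \<le> L * \<bar>x - y\<bar>"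
    if "q < 4" "i < m" "j < n" "x \<in> {c..d}" "y \<in> {c..d}" for q i j x y
  proof -
    have "q \<in> {0, 1, 2, 3}" using that(1) by auto
    then show "convex_on {c..d} (G q i j)" "\<bar>G q i j x - G q i j y\<bar> \<le> L * \<bar>x - y\<bar>"
      using gh[OF that(2,3)] that(4,5) unfolding slice_DC_def by (auto simp: G_def)
  qed
  have "dc_curve l m n A G c d L"
  proof
    show "convex_on {c..d} (G q i j)" if "q < 4" "i < m" "j < n" for q i j
      by (rule G(1)[OF that, of c c]) (use cd in auto)
    show "Re (A t $$ (i, j)) = G 0 i j t - G 1 i j t" "Im (A t $$ (i, j)) = G 2 i j t - G 3 i j t"
      if "i < m" "j < n" "t \<in> {c..d}" for i j t
      using gh[OF that(1,2)] that(3) unfolding slice_DC_def by (simp_all add: G_def)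
  qed (use l cd A G(2) in auto)
  then show ?thesis by (rule that)
qed

section \<open>Sobolev norms\<close>

text \<open>The weak derivative yields a density on compact subintervals of (a, b). Its
  integrability up to the ends and the continuity of f' extend the identity to [a, b].\<close>

lemma W21_on_imp_density:
  assumes ab: "a < b" and f: "\<And>t. t \<in> {a..b} \<Longrightarrow> (f has_real_derivative f' t) (at t within {a..b})" "continuous_on {a..b} f'"
    and W: "W21_on {a<..<b} f"
  shows "W21_density a b f"
proof -
  have d: "has_density f f' a b" by (rule has_density_C1[OF f])
  obtain g where g: "g absolutely_integrable_on {a<..<b}" "has_weak_deriv 2 {a<..<b} f g"
    using W unfolding W21_on_def by blast
  have inner: "has_density f' g p q" if "a < p" "q < b" for p q
    using weak_deriv_imp_density[OF g(2) _ has_density_subinterval[OF d] continuous_on_subset[OF f(2)] that] by force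
  have gi: "g absolutely_integrable_on {a..b}"
    using g(1) by (rule absolutely_integrable_spike_set)
      (auto intro: negligible_subset[of "{a, b}"])
  \<comment> \<open>F is constant in the interior and continuous on [a, b], hence constant
    there.\<close>
  define F where "F x = integral {a..x} g - f' x" for x
  have cF: "continuous_on (closure {a<..<b}) F"
    unfolding F_def using ab f(2) gi
    by (auto intro!: continuous_on_diff indefinite_integral_continuous_1 simp: absolutely_integrable_on_def)
  have gint: "g integrable_on {x..y}" if "a \<le> x" "y \<le> b" for x y
    by (rule integrable_subinterval_real[of g a b]) (use gi that in \<open>auto simp: absolutely_integrable_on_def\<close>)
  have diff: "integral {a..y} g - integral {a..x} g = integral {x..y} g" if "a \<le> x" "x \<le> y" "y \<le> b" for x y
    using Henstock_Kurzweil_Integration.integral_combine[OF that(1,2) gint] that by simp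
  define z where "z = (a + b) / 2"
  have z: "a < z" "z < b" using ab by (auto simp: z_def)
  have "F x = F y" if "a < x" "x \<le> y" "y < b" for x y
    using diff[of x y] has_densityD(3)[OF inner[of x y], of x y] that by (simp add: F_def)
  then have "F x = F z" if "x \<in> {a<..<b}" for x
    using that z by (metis greaterThanLessThan_iff linorder_le_cases)
  then have F: "F x = F z" if "x \<in> {a..b}" for x
    by (rule continuous_constant_on_closure[OF cF]) (use that ab in simp_all)
  have "has_density f' g a b"
    unfolding has_density_def
  proof (intro conjI allI impI gi)
    fix x y assume xy: "a \<le> x \<and> x \<le> y \<and> y \<le> b"
    then have "integral {x..y} g = f' y - f' x"
      using diff[of x y] F[of x] F[of y] by (simp add: F_def)
    then show "(g has_integral f' y - f' x) {x..y}"
      using gint[of x y] xy by (metis has_integral_integral)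
  qed
  then show ?thesis unfolding W21_density_def using d by blast
qed

lemma has_density_AE_unique:
  assumes "\<And>p q. a < p \<Longrightarrow> q < b \<Longrightarrow> has_density f g p q" "\<And>p q. a < p \<Longrightarrow> q < b \<Longrightarrow> has_density f h p q"
  shows "AE t in lebesgue. t \<in> {a<..<b} \<longrightarrow> g t = h t"
proof -
  have "AE t in lebesgue. t \<in> {a + 1 / real (Suc k)..b - 1 / real (Suc k)} \<longrightarrow> g t - h t = 0" for k
  proof (rule zero_interval_integrals_AE)
    let ?p = "a + 1 / real (Suc k)" and ?q = "b - 1 / real (Suc k)"
    have d: "has_density (\<lambda>t. f t - f t) (\<lambda>t. g t - h t) ?p ?q"
      by (intro has_density_diff assms) auto
    show "(\<lambda>t. g t - h t) absolutely_integrable_on {?p..?q}" by (rule has_densityD(1)[OF d])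
    show "integral {x..y} (\<lambda>t. g t - h t) = 0" if "?p \<le> x" "x \<le> y" "y \<le> ?q" for x y
      using has_densityD(3)[OF d that] by simp
  qed
  then have "AE t in lebesgue. \<forall>k. t \<in> {a + 1 / real (Suc k)..b - 1 / real (Suc k)} \<longrightarrow> g t - h t = 0"
    unfolding AE_all_countable by blast
  then show ?thesis
  proof (rule AE_mp, intro AE_I2 impI)
    fix t assume *: "\<forall>k. t \<in> {a + 1 / real (Suc k)..b - 1 / real (Suc k)} \<longrightarrow> g t - h t = 0" and t: "t \<in> {a<..<b}"
    obtain k where "1 / real (Suc k) < min (t - a) (b - t)"
      using reals_Archimedean[of "min (t - a) (b - t)"] t by (auto simp: inverse_eq_divide)
    then have "t \<in> {a + 1 / real (Suc k)..b - 1 / real (Suc k)}" by auto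
    with * have "g t - h t = 0" by blast
    then show "g t = h t" by simp
  qed
qed

text \<open>\<open>weak_deriv\<close> is a chosen representative; identifying it with the density
  almost everywhere makes \<open>W21_norm\<close> accessible to estimates.\<close>

lemma weak_deriv_AE:
  assumes ab: "a < b" and f: "has_density f f' a b" "has_density f' f'' a b" and i: "i \<in> {1, 2}"
  shows "AE t in lebesgue. t \<in> {a<..<b} \<longrightarrow> weak_deriv i {a<..<b} f t = (if i = 1 then f' t else f'' t)"
proof -
  have "\<exists>g. has_weak_deriv i {a<..<b} f g"
    using has_weak_deriv_density[OF f _ _ ab, of "{a<..<b}"] i by (auto simp: greaterThanLessThan_subseteq_atLeastAtMost_iff)
  then have w: "has_weak_deriv i {a<..<b} f (weak_deriv i {a<..<b} f)"
    unfolding weak_deriv_def by (rule someI_ex)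
  have cf': "continuous_on {a<..<b} f'"
    by (rule continuous_on_subset[OF has_density_continuous[OF f(2)]]) auto
  have "AE t in lebesgue. t \<in> {a<..<b} \<longrightarrow> weak_deriv i {a<..<b} f t = (if i = 1 then f' else f'') t"
  proof (rule has_density_AE_unique)
    fix p q assume pq: "a < p" "q < b"
    show "has_density (if i = 1 then f else f') (weak_deriv i {a<..<b} f) p q"
      by (rule weak_deriv_imp_density[OF w i _ cf' pq]) (auto intro: has_density_subinterval[OF f(1)])
    show "has_density (if i = 1 then f else f') (if i = 1 then f' else f'') p q"
      using has_density_subinterval[OF f(1), of p q] has_density_subinterval[OF f(2), of p q] pq by auto
  qed
  then show ?thesis by (rule AE_mp) auto
qed

lemma L2_integral_bound:
  fixes u :: "nat \<Rightarrow> real \<Rightarrow> real"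
  assumes u: "\<And>j. j < l \<Longrightarrow> u j absolutely_integrable_on {a..b}" "\<And>j. j < l \<Longrightarrow> integral {a..b} (\<lambda>t. \<bar>u j t\<bar>) \<le> C"
    and v: "\<And>j. j < l \<Longrightarrow> AE t in lebesgue. t \<in> {a<..<b} \<longrightarrow> v t j = u j t"
  shows "(LINT t:{a<..<b}|lebesgue. L2_set (v t) {..<l}) \<le> real l * C"
proof -
  let ?F = "\<lambda>t. \<Sum>j<l. \<bar>u j t\<bar>"
  have abs: "(\<lambda>t. \<bar>u j t\<bar>) absolutely_integrable_on {a..b}" if "j < l" for j
    using set_integrable_norm[OF u(1)[OF that]] by simp
  have F: "?F absolutely_integrable_on {a..b}"
    by (rule absolutely_integrable_sum) (use abs in auto)
  have "(LINT t:{a<..<b}|lebesgue. L2_set (v t) {..<l}) \<le> (LINT t:{a..b}|lebesgue. ?F t)"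
    unfolding set_lebesgue_integral_def
  \<comment> \<open>Comparison with a nonnegative integrable majorant. If the left-hand integrand is
    not integrable, its integral is 0 by convention and the inequality holds as well.\<close>
  proof (rule integral_mono_AE')
    show "integrable lebesgue (\<lambda>t. indicat_real {a..b} t *\<^sub>R ?F t)" using F unfolding set_integrable_def .
    have "AE t in lebesgue. \<forall>j\<in>{..<l}. t \<in> {a<..<b} \<longrightarrow> v t j = u j t"
      by (rule AE_finite_allI) (use v in auto)
    then show "AE t in lebesgue. indicat_real {a<..<b} t *\<^sub>R L2_set (v t) {..<l} \<le> indicat_real {a..b} t *\<^sub>R ?F t"
    proof (rule AE_mp, intro AE_I2 impI)
      fix t assume *: "\<forall>j\<in>{..<l}. t \<in> {a<..<b} \<longrightarrow> v t j = u j t"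
      show "indicat_real {a<..<b} t *\<^sub>R L2_set (v t) {..<l} \<le> indicat_real {a..b} t *\<^sub>R ?F t"
      proof (cases "t \<in> {a<..<b}")
        case True
        then have "(\<Sum>j<l. \<bar>v t j\<bar>) = ?F t" using * by (intro sum.cong) auto
        moreover have "t \<in> {a..b}" using True by auto
        ultimately show ?thesis using L2_set_le_sum_abs[of "v t" "{..<l}"] True by simp
      next
        case False
        then show ?thesis by (simp add: sum_nonneg)
      qed
    qed
  qed (simp add: sum_nonneg)
  also have "\<dots> = integral {a..b} ?F" by (rule set_lebesgue_integral_eq_integral(2)[OF F])
  also have "\<dots> = (\<Sum>j<l. integral {a..b} (\<lambda>t. \<bar>u j t\<bar>))"
    by (rule integral_sum) (use abs in \<open>auto simp: absolutely_integrable_on_def\<close>)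
  also have "\<dots> \<le> (\<Sum>j<l. C)" by (rule sum_mono) (use u(2) in auto)
  finally show ?thesis by simp
qed

lemma W21_norm_bound:
  assumes ab: "a < b" and s: "\<And>j. j < l \<Longrightarrow> has_density (\<lambda>t. s t j) (s' j) a b" "\<And>j. j < l \<Longrightarrow> has_density (s' j) (s'' j) a b"
    and C: "\<And>j t. j < l \<Longrightarrow> t \<in> {a..b} \<Longrightarrow> \<bar>s t j\<bar> \<le> C" "\<And>j t. j < l \<Longrightarrow> t \<in> {a..b} \<Longrightarrow> \<bar>s' j t\<bar> \<le> C"
      "\<And>j. j < l \<Longrightarrow> integral {a..b} (\<lambda>t. \<bar>s'' j t\<bar>) \<le> C'"
  shows "W21_norm l {a<..<b} s \<le> real l * (2 * C * (b - a) + C')"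
proof -
  have cont: "continuous_on {a..b} (\<lambda>t. s t j)" "continuous_on {a..b} (s' j)" if "j < l" for j
    using has_density_continuous s that by blast+
  have bound: "integral {a..b} (\<lambda>t. \<bar>f t\<bar>) \<le> C * (b - a)"
    if "continuous_on {a..b} f" "\<And>t. t \<in> {a..b} \<Longrightarrow> \<bar>f t\<bar> \<le> C" for f :: "real \<Rightarrow> real"
  proof -
    have "integral {a..b} (\<lambda>t. \<bar>f t\<bar>) \<le> integral {a..b} (\<lambda>t. C)"
      by (rule integral_le) (use that in \<open>auto intro!: integrable_continuous_real continuous_intros\<close>)
    then show ?thesis using ab by (simp add: mult.commute)
  qed
  have 0: "(LINT t:{a<..<b}|lebesgue. L2_set (s t) {..<l}) \<le> real l * (C * (b - a))"
    by (rule L2_integral_bound[where u = "\<lambda>j t. s t j"])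
      (auto intro!: absolutely_integrable_continuous_real cont bound C)
  have 1: "(LINT t:{a<..<b}|lebesgue. L2_set (\<lambda>j. weak_deriv 1 {a<..<b} (\<lambda>t. s t j) t) {..<l}) \<le> real l * (C * (b - a))"
  proof (rule L2_integral_bound[where u = s'])
    show "AE t in lebesgue. t \<in> {a<..<b} \<longrightarrow> weak_deriv 1 {a<..<b} (\<lambda>t. s t j) t = s' j t" if "j < l" for j
      using weak_deriv_AE[OF ab s[OF that], of 1] by simp
  qed (auto intro!: absolutely_integrable_continuous_real cont bound C)
  have 2: "(LINT t:{a<..<b}|lebesgue. L2_set (\<lambda>j. weak_deriv 2 {a<..<b} (\<lambda>t. s t j) t) {..<l}) \<le> real l * C'"
  proof (rule L2_integral_bound[where u = s''])
    show "AE t in lebesgue. t \<in> {a<..<b} \<longrightarrow> weak_deriv 2 {a<..<b} (\<lambda>t. s t j) t = s'' j t" if "j < l" for j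
      using weak_deriv_AE[OF ab s[OF that], of 2] by simp
  qed (use has_densityD(1)[OF s(2)] C(3) in auto)
  have sum2: "(\<Sum>i\<in>{1, 2::nat}. f i) = f 1 + f 2" for f :: "nat \<Rightarrow> real" by simp
  have "W21_norm l {a<..<b} s \<le> real l * (C * (b - a)) + (real l * (C * (b - a)) + real l * C')"
    unfolding W21_norm_def sum2 by (intro add_mono 0 1 2)
  also have "\<dots> = real l * (2 * C * (b - a) + C')" by (simp add: algebra_simps)
  finally show ?thesis .
qed

lemma has_density_chain:
  assumes ab: "a < b" and \<delta>: "0 < \<delta>"
    and piece: "\<And>c d. a \<le> c \<Longrightarrow> c < d \<Longrightarrow> d \<le> b \<Longrightarrow> d - c < \<delta> \<Longrightarrow>
      \<exists>\<rho>. has_density f \<rho> c d \<and> integral {c..d} (\<lambda>t. \<bar>\<rho> t\<bar>) \<le> C"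
  obtains \<rho> where "has_density f \<rho> a b" "integral {a..b} (\<lambda>t. \<bar>\<rho> t\<bar>) \<le> real (nat \<lceil>(b - a) / \<delta>\<rceil> + 1) * C"
proof -
  \<comment> \<open>The number of equal pieces; the summand 1 makes their length strictly smaller
    than \<open>\<delta>\<close>.\<close>
  define N where "N = nat \<lceil>(b - a) / \<delta>\<rceil> + 1"
  define h where "h = (b - a) / real N"
  have "(b - a) / \<delta> < real N" "0 < real N" unfolding N_def by linarith+
  then have h: "0 < h" "h < \<delta>" "a + real N * h = b"
    using ab \<delta> unfolding h_def by (auto simp: field_simps)
  have "k \<le> N \<Longrightarrow> \<exists>\<rho>. has_density f \<rho> a (a + real k * h) \<and> integral {a..a + real k * h} (\<lambda>t. \<bar>\<rho> t\<bar>) \<le> real k * C" for k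
  proof (induction k)
    case 0
    have "has_density f (\<lambda>t. 0) a a"
      unfolding has_density_def
    proof (intro conjI allI impI)
      fix x y assume "a \<le> x \<and> x \<le> y \<and> y \<le> a"
      then have "x = a" "y = a" by auto
      then show "((\<lambda>t. 0) has_integral f y - f x) {x..y}" by simp
    qed simp
    then show ?case by auto
  next
    case (Suc k)
    then obtain \<rho> where \<rho>: "has_density f \<rho> a (a + real k * h)" "integral {a..a + real k * h} (\<lambda>t. \<bar>\<rho> t\<bar>) \<le> real k * C"
      by auto
    have e: "a \<le> a + real k * h" "a + real k * h < a + real (Suc k) * h" using h(1) by (auto simp: algebra_simps)
    have "real (Suc k) * h \<le> real N * h" using Suc.prems h(1) by (intro mult_right_mono) auto
    then have "a + real (Suc k) * h \<le> b" using h(3) by linarith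
    moreover have "a + real (Suc k) * h - (a + real k * h) < \<delta>" using h(2) by (simp add: algebra_simps)
    ultimately obtain \<rho>' where \<rho>': "has_density f \<rho>' (a + real k * h) (a + real (Suc k) * h)"
      "integral {a + real k * h..a + real (Suc k) * h} (\<lambda>t. \<bar>\<rho>' t\<bar>) \<le> C"
      using piece[OF e] by blast
    note patch = has_density_patch[OF \<rho>(1) \<rho>'(1) e(1) less_imp_le[OF e(2)]]
    have "integral {a..a + real (Suc k) * h} (\<lambda>t. \<bar>if t \<le> a + real k * h then \<rho> t else \<rho>' t\<bar>) \<le> real (Suc k) * C"
      unfolding patch(2) using \<rho>(2) \<rho>'(2) by (simp add: algebra_simps)
    then show ?case using patch(1) by blast
  qed
  from this[of N] h(3) show ?thesis using that unfolding N_def by auto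
qed

lemma cube_eq_box:
  "cube {a<..<b} = box (\<chi> i. a) (\<chi> i. b)" "cube {a..b} = cbox (\<chi> i. a) (\<chi> i. b)"
  unfolding cube_def by (auto simp: mem_box_cart)

text \<open>The midpoint shows that the open box is not empty, so its closure is the closed
  box.\<close>

lemma closure_cylinder:
  assumes "a < b"
  shows "closure ({a<..<b} \<times> (cube {a<..<b} :: (real ^ 'k) set)) = {a..b} \<times> cube {a..b}"
proof -
  have "(\<chi> i. (a + b) / 2) \<in> (cube {a<..<b} :: (real ^ 'k) set)"
    using assms by (simp add: cube_def)
  then have "box (\<chi> i. a) (\<chi> i. b) \<noteq> ({} :: (real ^ 'k) set)" unfolding cube_eq_box by blast
  then show ?thesis using assms unfolding closure_Times cube_eq_box by simp
qed

lemma singular_value_systemD: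
  assumes "singular_value_system l J A \<sigma>" "t \<in> J" "j < l"
  shows "\<exists>k<l. \<sigma> t j = singular_values (A t) ! k"
proof -
  have "mset (map (\<sigma> t) [0..<l]) = mset (take l (singular_values (A t)))"
    using assms unfolding singular_value_system_def by blast
  from arg_cong[OF this, of set_mset] have "\<sigma> t ` {0..<l} = set (take l (singular_values (A t)))" by simp
  then have "\<sigma> t j \<in> set (take l (singular_values (A t)))" using assms(3) by force
  then show ?thesis by (auto simp: in_set_conv_nth)
qed

text \<open>Each singular value is at most the sum of the first l, which the Ky Fan functional
  expresses through entries of modulus at most 2 L.\<close>

lemma singular_value_bound:
  assumes A: "A \<in> carrier_mat m n" and l: "l = min m n" "vec_space.rank m A = l"
    and L: "\<And>i j. i < m \<Longrightarrow> j < n \<Longrightarrow> \<bar>Re (A $$ (i, j))\<bar> \<le> L \<and> \<bar>Im (A $$ (i, j))\<bar> \<le> L" and k: "k < l"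
  shows "\<bar>singular_values A ! k\<bar> \<le> real m * (real n * (real l * (2 * L)))"
proof -
  have pos: "0 < singular_values A ! p" if "p < l" for p
    by (rule singular_values_pos_below_rank[OF A]) (use l that in simp)
  have "l \<le> n" using l by simp
  then obtain c where c: "\<And>i j. i < m \<Longrightarrow> j < n \<Longrightarrow> cmod (c i j) \<le> real l"
    "(\<Sum>p<l. singular_values A ! p) = Re (\<Sum>i<m. \<Sum>j<n. c i j * A $$ (i, j))"
    "\<And>B. B \<in> carrier_mat m n \<Longrightarrow> Re (\<Sum>i<m. \<Sum>j<n. c i j * B $$ (i, j)) \<le> (\<Sum>p<l. singular_values B ! p)"
    using ky_fan_functional[OF A, of l] pos by blast
  have "singular_values A ! k \<le> (\<Sum>p<l. singular_values A ! p)"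
    using k pos by (intro member_le_sum) (auto intro: less_imp_le)
  also have "\<dots> \<le> cmod (\<Sum>i<m. \<Sum>j<n. c i j * A $$ (i, j))" unfolding c(2) by (rule complex_Re_le_cmod)
  also have "\<dots> \<le> (\<Sum>i<m. \<Sum>j<n. real l * (2 * L))"
  proof (intro order_trans[OF norm_sum] sum_mono)
    fix i j assume ij: "i \<in> {..<m}" "j \<in> {..<n}"
    have "cmod (A $$ (i, j)) \<le> \<bar>Re (A $$ (i, j))\<bar> + \<bar>Im (A $$ (i, j))\<bar>" by (rule cmod_le)
    also have "\<dots> \<le> 2 * L" using L[of i j] ij by simp
    finally show "cmod (c i j * A $$ (i, j)) \<le> real l * (2 * L)"
      unfolding norm_mult using c(1)[of i j] ij by (intro mult_mono) auto
  qed
  finally show ?thesis using pos[OF k] by simp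
qed

section \<open>Regular systems of singular values\<close>

text \<open>The constant of \<open>C1_root_density\<close> with \<open>2 * Lam\<close> as bound for
  s' and \<open>Lcomp\<close> as Lipschitz constant of the compensator, written out to show that it
  depends on l, m, n and L only.\<close>

definition curve_bound :: "nat \<Rightarrow> nat \<Rightarrow> nat \<Rightarrow> real \<Rightarrow> real" where
  "curve_bound l m n L = (let \<Lambda> = real l * 4 * L * real m * real n in
     2 * (2 * \<Lambda>) + 4 * (real l * (2 * \<Lambda>) + real (l * l) * (2 * \<Lambda> + real l * (2 * \<Lambda>))))"

lemma curve_bound_ge:
  assumes "0 \<le> real l * 4 * L * real m * real n"
  shows "2 * (real l * 4 * L * real m * real n) \<le> curve_bound l m n L"
    "real m * (real n * (real l * (2 * L))) \<le> curve_bound l m n L"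
proof -
  define \<Lambda> where "\<Lambda> = real l * 4 * L * real m * real n"
  have \<Lambda>: "0 \<le> \<Lambda>" using assms by (simp add: \<Lambda>_def)
  have "0 \<le> 4 * (real l * (2 * \<Lambda>) + real (l * l) * (2 * \<Lambda> + real l * (2 * \<Lambda>)))"
    using \<Lambda> by (intro mult_nonneg_nonneg add_nonneg_nonneg) auto
  then have "2 * (2 * \<Lambda>) \<le> curve_bound l m n L" unfolding curve_bound_def Let_def \<Lambda>_def[symmetric] by linarith
  moreover have "real m * (real n * (real l * (2 * L))) = \<Lambda> / 2" by (simp add: \<Lambda>_def)
  ultimately show "2 * (real l * 4 * L * real m * real n) \<le> curve_bound l m n L"
    "real m * (real n * (real l * (2 * L))) \<le> curve_bound l m n L"
    using \<Lambda> unfolding \<Lambda>_def[symmetric] by linarith+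
qed

lemma dc_curve_density:
  assumes dc: "dc_curve l m n A g c d L"
    and W: "\<And>i j. i < m \<Longrightarrow> j < n \<Longrightarrow> W21_density_complex c d (\<lambda>t. A t $$ (i, j))"
    and s: "\<And>t. t \<in> {c..d} \<Longrightarrow> (s has_real_derivative s' t) (at t within {c..d})" "continuous_on {c..d} s'"
    and sel: "\<And>t. t \<in> {c..d} \<Longrightarrow> \<exists>k<l. s t = singular_values (A t) ! k"
  shows "\<exists>\<rho>. has_density s' \<rho> c d \<and> integral {c..d} (\<lambda>t. \<bar>\<rho> t\<bar>) \<le> curve_bound l m n L"
    "t \<in> {c..d} \<Longrightarrow> \<bar>s' t\<bar> \<le> curve_bound l m n L"
proof -
  interpret dc_curve l m n A g c d L by (rule dc)
  obtain \<rho> where \<rho>: "has_density s' \<rho> c d" "integral {c..d} (\<lambda>t. \<bar>\<rho> t\<bar>) \<le> 2 * (2 * Lam) + 4 * Lcomp"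
    "\<And>t. t \<in> {c..d} \<Longrightarrow> \<bar>s' t\<bar> \<le> 2 * Lam"
    using singular_value_density[OF W s sel] by blast
  have "2 * (2 * Lam) + 4 * Lcomp = curve_bound l m n L"
    unfolding Lam_def Lcomp_def curve_bound_def Let_def ..
  with \<rho> show "\<exists>\<rho>. has_density s' \<rho> c d \<and> integral {c..d} (\<lambda>t. \<bar>\<rho> t\<bar>) \<le> curve_bound l m n L" by metis
  assume t: "t \<in> {c..d}"
  have "\<bar>s' t\<bar> \<le> 2 * (real l * 4 * L * real m * real n)" using \<rho>(3)[OF t] unfolding Lam_def .
  moreover from this have "0 \<le> real l * 4 * L * real m * real n" by linarith
  ultimately show "\<bar>s' t\<bar> \<le> curve_bound l m n L" using curve_bound_ge(1) order_trans by blast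
qed

lemma mat_components_W21_density:
  assumes ab: "a < b" and C1: "mat_components m n (C1_on {a..b}) A" and W: "mat_components m n (W21_on {a<..<b}) A"
    and ij: "i < m" "j < n"
  shows "W21_density_complex a b (\<lambda>t. A t $$ (i, j))"
proof -
  have "W21_density a b f" if "C1_on {a..b} f" "W21_on {a<..<b} f" for f
    using that W21_on_imp_density[OF ab] unfolding C1_on_def by blast
  then show ?thesis using C1 W ij unfolding mat_components_def W21_density_complex_def by blast
qed

lemma W21_density_complex_subinterval:
  "W21_density_complex a b f \<Longrightarrow> a \<le> c \<Longrightarrow> d \<le> b \<Longrightarrow> W21_density_complex c d f"
  unfolding W21_density_complex_def W21_density_def using has_density_subinterval by metis

text \<open>All estimates are in terms of \<open>curve_bound\<close>, hence uniform over curves with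
  the same L. The interval is cut into pieces shorter than \<open>1 / L\<close>, and their number
  enters the bound for s''.\<close>

lemma singular_value_family_bounds:
  fixes A :: "real \<Rightarrow> complex mat" and \<sigma> :: "real \<Rightarrow> nat \<Rightarrow> real"
  assumes l: "l = min m n" and ab: "a < b" and L: "0 < L"
    and A: "\<And>t. t \<in> {a..b} \<Longrightarrow> A t \<in> carrier_mat m n" "\<And>t. t \<in> {a..b} \<Longrightarrow> vec_space.rank m (A t) = l"
    and dc: "\<And>c d. a \<le> c \<Longrightarrow> c < d \<Longrightarrow> d \<le> b \<Longrightarrow> d - c < 1 / L \<Longrightarrow> mat_components m n (\<lambda>f. \<exists>g h. slice_DC f L c d g h) A"
    and C1: "mat_components m n (C1_on {a..b}) A" and W: "mat_components m n (W21_on {a<..<b}) A"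
    and \<sigma>: "singular_value_system l {a..b} A \<sigma>" "tuple_components l (C1_on {a..b}) \<sigma>"
  obtains s' s'' where
    "\<And>j t. j < l \<Longrightarrow> t \<in> {a..b} \<Longrightarrow> ((\<lambda>t. \<sigma> t j) has_real_derivative s' j t) (at t within {a..b})"
    "\<And>j. j < l \<Longrightarrow> has_density (\<lambda>t. \<sigma> t j) (s' j) a b" "\<And>j. j < l \<Longrightarrow> has_density (s' j) (s'' j) a b"
    "\<And>j t. j < l \<Longrightarrow> t \<in> {a..b} \<Longrightarrow> \<bar>\<sigma> t j\<bar> \<le> curve_bound l m n L"
    "\<And>j t. j < l \<Longrightarrow> t \<in> {a..b} \<Longrightarrow> \<bar>s' j t\<bar> \<le> curve_bound l m n L"
    "\<And>j. j < l \<Longrightarrow> integral {a..b} (\<lambda>t. \<bar>s'' j t\<bar>) \<le> real (nat \<lceil>(b - a) / (1 / L)\<rceil> + 1) * curve_bound l m n L"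
proof -
  let ?C = "curve_bound l m n L"
  have "\<exists>s'. (\<forall>t\<in>{a..b}. ((\<lambda>t. \<sigma> t j) has_real_derivative s' t) (at t within {a..b})) \<and> continuous_on {a..b} s'" if "j < l" for j
    using \<sigma>(2) that unfolding tuple_components_def C1_on_def by blast
  then obtain s' where s': "\<And>j t. j < l \<Longrightarrow> t \<in> {a..b} \<Longrightarrow> ((\<lambda>t. \<sigma> t j) has_real_derivative s' j t) (at t within {a..b})"
    "\<And>j. j < l \<Longrightarrow> continuous_on {a..b} (s' j)" by metis
  have sel: "\<exists>k<l. \<sigma> t j = singular_values (A t) ! k" if "j < l" "t \<in> {a..b}" for j t
    by (rule singular_value_systemD[OF \<sigma>(1) that(2,1)])
  have piece: "\<exists>\<rho>. has_density (s' j) \<rho> c d \<and> integral {c..d} (\<lambda>t. \<bar>\<rho> t\<bar>) \<le> ?C" "t \<in> {c..d} \<Longrightarrow> \<bar>s' j t\<bar> \<le> ?C"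
    if j: "j < l" and cd: "a \<le> c" "c < d" "d \<le> b" "d - c < 1 / L" for j c d t
  proof -
    have sub: "t \<in> {a..b}" if "t \<in> {c..d}" for t using that cd by auto
    obtain g where g: "dc_curve l m n A g c d L"
      using dc_curve_slices[OF l cd(2) A(1)[OF sub] A(2)[OF sub] dc[OF cd]] by blast
    have s: "((\<lambda>t. \<sigma> t j) has_real_derivative s' j t) (at t within {c..d})" if "t \<in> {c..d}" for t
      by (rule DERIV_subset[OF s'(1)[OF j sub[OF that]]]) (use sub in blast)
    have c: "continuous_on {c..d} (s' j)"
      by (rule continuous_on_subset[OF s'(2)[OF j]]) (use sub in blast)
    have w: "W21_density_complex c d (\<lambda>t. A t $$ (i, k))" if "i < m" "k < n" for i k
      by (rule W21_density_complex_subinterval[OF mat_components_W21_density[OF ab C1 W that] cd(1,3)])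
    show "\<exists>\<rho>. has_density (s' j) \<rho> c d \<and> integral {c..d} (\<lambda>t. \<bar>\<rho> t\<bar>) \<le> ?C"
      by (rule dc_curve_density(1)[OF g w s c sel[OF j sub]])
    show "t \<in> {c..d} \<Longrightarrow> \<bar>s' j t\<bar> \<le> ?C"
      by (rule dc_curve_density(2)[OF g w s c sel[OF j sub]])
  qed
  \<comment> \<open>Pointwise bounds come from placing t into a short interval, to its right or, at
    the end b, to its left.\<close>
  have near: "\<exists>c d. a \<le> c \<and> c < d \<and> d \<le> b \<and> d - c < 1 / L \<and> t \<in> {c..d}" if t: "t \<in> {a..b}" for t
  proof (cases "t < b")
    case True
    then show ?thesis using t L by (intro exI[of _ t] exI[of _ "min b (t + 1 / (2 * L))"]) (auto simp: min_def field_simps)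
  next
    case False
    then show ?thesis using t L ab by (intro exI[of _ "max a (b - 1 / (2 * L))"] exI[of _ b]) (auto simp: max_def field_simps)
  qed
  have bs: "\<bar>s' j t\<bar> \<le> ?C" if "j < l" "t \<in> {a..b}" for j t
    using near[OF that(2)] piece(2)[OF that(1)] by blast
  have b\<sigma>: "\<bar>\<sigma> t j\<bar> \<le> ?C" if j: "j < l" and t: "t \<in> {a..b}" for j t
  proof -
    obtain c d where cd: "a \<le> c" "c < d" "d \<le> b" "d - c < 1 / L" "t \<in> {c..d}" using near[OF t] by blast
    have AL: "\<bar>Re (A t $$ (i, k))\<bar> \<le> L \<and> \<bar>Im (A t $$ (i, k))\<bar> \<le> L" if "i < m" "k < n" for i k
      using dc[OF cd(1-4)] that cd(5) unfolding mat_components_def slice_DC_def by blast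
    obtain k where k: "k < l" "\<sigma> t j = singular_values (A t) ! k" using sel[OF j t] by blast
    have "\<bar>\<sigma> t j\<bar> \<le> real m * (real n * (real l * (2 * L)))"
      unfolding k(2) by (rule singular_value_bound[OF A(1)[OF t] l A(2)[OF t] AL k(1)])
    also have "\<dots> \<le> ?C" by (rule curve_bound_ge(2)) (use L in simp)
    finally show ?thesis .
  qed
  have "\<exists>\<rho>. has_density (s' j) \<rho> a b \<and> integral {a..b} (\<lambda>t. \<bar>\<rho> t\<bar>) \<le> real (nat \<lceil>(b - a) / (1 / L)\<rceil> + 1) * ?C" if j: "j < l" for j
    using has_density_chain[OF ab, of "1 / L" "s' j" ?C, OF _ piece(1)[OF j]] L by force
  then obtain s'' where s'': "\<And>j. j < l \<Longrightarrow> has_density (s' j) (s'' j) a b"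
    "\<And>j. j < l \<Longrightarrow> integral {a..b} (\<lambda>t. \<bar>s'' j t\<bar>) \<le> real (nat \<lceil>(b - a) / (1 / L)\<rceil> + 1) * ?C" by metis
  show ?thesis
    by (rule that[OF s'(1) has_density_C1[OF s'(1) s'(2)] s''(1) b\<sigma> bs s''(2)])
qed

lemma C1_on_subset: "C1_on S f \<Longrightarrow> T \<subseteq> S \<Longrightarrow> C1_on T f"
  unfolding C1_on_def by (meson DERIV_subset continuous_on_subset subsetD)

text \<open>The convex parts are fixed on the whole line and only L depends on [c, d]. So the
  compensator is one function, convex on every interval, which gives difference-convexity on the
  line.\<close>

lemma DC_curve_dc_curve:
  fixes A :: "real \<Rightarrow> complex mat"
  assumes l: "l = min m n" and A: "\<And>t. A t \<in> carrier_mat m n" "\<And>t. vec_space.rank m (A t) = l"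
    and DC: "mat_components m n (DC_on UNIV) A"
  obtains g where "\<And>c d. c < d \<Longrightarrow> \<exists>L. dc_curve l m n A g c d L"
proof -
  have *: "\<exists>g h. convex_on UNIV g \<and> convex_on UNIV h \<and> (\<forall>x. f x = g x - h x)" if "DC_on UNIV f" for f :: "real \<Rightarrow> real"
    using that unfolding DC_on_def by blast
  have "\<forall>i j. \<exists>g h g' h'. i < m \<and> j < n \<longrightarrow> convex_on UNIV g \<and> convex_on UNIV h \<and> convex_on UNIV g' \<and> convex_on UNIV h' \<and>
      (\<forall>t. Re (A t $$ (i, j)) = g t - h t \<and> Im (A t $$ (i, j)) = g' t - h' t)"
    using DC * unfolding mat_components_def by meson
  then obtain g h g' h' where gh: "\<And>i j. i < m \<Longrightarrow> j < n \<Longrightarrow> convex_on UNIV (g i j) \<and> convex_on UNIV (h i j) \<and>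
      convex_on UNIV (g' i j) \<and> convex_on UNIV (h' i j) \<and>
      (\<forall>t. Re (A t $$ (i, j)) = g i j t - h i j t \<and> Im (A t $$ (i, j)) = g' i j t - h' i j t)" by metis
  define G where "G q i j = [g i j, h i j, g' i j, h' i j] ! q" for q i j
  have G: "convex_on UNIV (G q i j)" if "q < 4" "i < m" "j < n" for q i j
  proof -
    have "q \<in> {0, 1, 2, 3}" using that(1) by auto
    then show ?thesis using gh[OF that(2,3)] by (auto simp: G_def)
  qed
  have "\<exists>L. dc_curve l m n A G c d L" if cd: "c < d" for c d
  proof -
    let ?S = "{..<4::nat} \<times> {..<m} \<times> {..<n}"
    let ?P = "\<lambda>(q, i, j) L. \<forall>x\<in>{c..d}. \<forall>y\<in>{c..d}. \<bar>G q i j x - G q i j y\<bar> \<le> L * \<bar>x - y\<bar>"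
    have fin: "finite ?S" by simp
    have lip: "\<exists>L. ?P s L" if sS: "s \<in> ?S" for s
    proof -
      obtain q i j where s: "s = (q, i, j)" "q < 4" "i < m" "j < n" using sS by auto
      have "continuous_on {c - 1..d + 1} (G q i j)"
        by (rule continuous_on_subset[OF convex_on_continuous[OF open_UNIV G[OF s(2-4)]]]) simp
      then have "bounded (G q i j ` {c - 1..d + 1})" by (intro compact_imp_bounded compact_continuous_image) auto
      then obtain B where "\<forall>t\<in>{c - 1..d + 1}. \<bar>G q i j t\<bar> \<le> B" unfolding bounded_iff by auto
      then have B: "\<bar>G q i j t\<bar> \<le> B" if "t \<in> {c - 1..d + 1}" for t using that by blast
      have "convex_on {c - 1..d + 1} (G q i j)" by (rule convex_on_subset[OF G[OF s(2-4)]]) auto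
      from convex_on_lipschitz_inner[OF this _ B] show ?thesis unfolding s(1) by (intro exI[of _ "2 * B / 1"]) simp
    qed
    have mono: "?P s L'" if PL: "?P s L" and le: "L \<le> L'" for s L L'
    proof -
      obtain q i j where s: "s = (q, i, j)" by (cases s)
      have "L * \<bar>x - y\<bar> \<le> L' * \<bar>x - y\<bar>" for x y :: real using le by (intro mult_right_mono) auto
      then show ?thesis using PL unfolding s prod.case by (meson order_trans)
    qed
    obtain L where L: "L > 0" "\<And>s. s \<in> ?S \<Longrightarrow> ?P s L"
    proof (rule finite_uniform_bound[of ?S ?P])
      show "\<exists>L. ?P s L" if "s \<in> ?S" for s by (rule lip[OF that])
      show "?P s L'" if "?P s L" "L \<le> L'" for s L L' by (rule mono[OF that])
    qed (use fin in blast)+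
    have "dc_curve l m n A G c d L"
    proof
      show "convex_on {c..d} (G q i j)" if "q < 4" "i < m" "j < n" for q i j
        by (rule convex_on_subset[OF G[OF that]]) auto
      show "\<bar>G q i j x - G q i j y\<bar> \<le> L * \<bar>x - y\<bar>" if "q < 4" "i < m" "j < n" "x \<in> {c..d}" "y \<in> {c..d}" for q i j x y
        using L(2)[of "(q, i, j)"] that by simp
      show "Re (A t $$ (i, j)) = G 0 i j t - G 1 i j t" "Im (A t $$ (i, j)) = G 2 i j t - G 3 i j t"
        if "i < m" "j < n" "t \<in> {c..d}" for i j t
        using gh[OF that(1,2)] by (simp_all add: G_def)
    qed (use l cd A in auto)
    then show ?thesis by blast
  qed
  then show ?thesis by (rule that)
qed

lemma singular_value_system_regular:
  fixes A :: "real \<Rightarrow> complex mat"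
  assumes l: "l = min m n" and A: "\<And>t. A t \<in> carrier_mat m n" "\<And>t. vec_space.rank m (A t) = l"
    and C1: "mat_components m n (C1_on UNIV) A" and DC: "mat_components m n (DC_on UNIV) A"
    and W: "mat_components m n (W21_loc_on UNIV) A"
  shows "\<exists>\<sigma>. singular_value_system l UNIV A \<sigma> \<and> tuple_components l (C1_on UNIV) \<sigma> \<and>
    tuple_components l (DC_on UNIV) \<sigma> \<and> tuple_components l (W21_loc_on UNIV) \<sigma>"
proof -
  obtain \<sigma> \<sigma>' where \<sigma>: "singular_value_system l UNIV A \<sigma>"
    and der: "\<And>t j. j < l \<Longrightarrow> ((\<lambda>t. \<sigma> t j) has_real_derivative \<sigma>' t j) (at t)"
    and c': "\<And>j. j < l \<Longrightarrow> continuous_on UNIV (\<lambda>t. \<sigma>' t j)"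
    using C1_singular_value_system[OF A(1) C1 l A(2)] by blast
  obtain g where g: "\<And>c d. c < d \<Longrightarrow> \<exists>L. dc_curve l m n A g c d L" using DC_curve_dc_curve[OF l A DC] by blast
  have sel: "\<exists>k<l. \<sigma> t j = singular_values (A t) ! k" if "j < l" for t j
    by (rule singular_value_systemD[OF \<sigma> UNIV_I that])
  have cont: "continuous_on S (\<lambda>t. \<sigma> t j)" if "j < l" for S j
    using DERIV_isCont[OF der[OF that]] by (simp add: continuous_at_imp_continuous_on)
  have "tuple_components l (C1_on UNIV) \<sigma>"
    unfolding tuple_components_def C1_on_def
  proof (intro allI impI)
    fix j assume j: "j < l"
    show "\<exists>f'. (\<forall>t\<in>UNIV. ((\<lambda>t. \<sigma> t j) has_real_derivative f' t) (at t)) \<and> continuous_on UNIV f'"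
      by (rule exI[of _ "\<lambda>t. \<sigma>' t j"]) (simp add: der[OF j] c'[OF j])
  qed
  moreover have "tuple_components l (DC_on UNIV) \<sigma>"
    unfolding tuple_components_def DC_on_def
  proof (intro allI impI)
    fix j assume j: "j < l"
    let ?h = "dc_compensator l m n A g"
    have "convex_on {c..d} ?h \<and> convex_on {c..d} (\<lambda>t. \<sigma> t j + ?h t)" if cd: "c < d" for c d
    proof -
      obtain L where "dc_curve l m n A g c d L" using g[OF cd] by blast
      from dc_curve.selection_convex[OF this cont[OF j] sel[OF j]] show ?thesis by blast
    qed
    then have conv: "convex_on UNIV ?h" "convex_on UNIV (\<lambda>t. \<sigma> t j + ?h t)"
      by (blast intro: convex_on_UNIV_real)+
    show "\<exists>g h. convex_on UNIV g \<and> continuous_on UNIV g \<and> convex_on UNIV h \<and> continuous_on UNIV h \<and> (\<forall>t\<in>UNIV. \<sigma> t j = g t - h t)"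
      by (rule exI[of _ "\<lambda>t. \<sigma> t j + ?h t"], rule exI[of _ ?h]) (simp add: conv convex_on_continuous)
  qed
  moreover have "tuple_components l (W21_loc_on UNIV) \<sigma>"
    unfolding tuple_components_def W21_loc_on_def
  proof (intro allI impI, elim conjE)
    fix j V assume j: "j < l" and V: "open (V :: real set)" "compact (closure V)"
    obtain B where B: "\<And>x. x \<in> V \<Longrightarrow> \<bar>x\<bar> \<le> B"
      using compact_imp_bounded[OF V(2)] closure_subset[of V] unfolding bounded_iff by (auto simp: subset_iff)
    \<comment> \<open>Absolute value and margin give c < d also when V is empty and B is
      arbitrary.\<close>
    define c d where "c = - \<bar>B\<bar> - 1" and "d = \<bar>B\<bar> + 1"
    have cd: "c < d" by (simp add: c_def d_def)
    have Vcd: "V \<subseteq> {c..d}" using B by (force simp: c_def d_def)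
    have entry: "W21_density_complex c d (\<lambda>t. A t $$ (i, k))" if "i < m" "k < n" for i k
    proof (rule mat_components_W21_density[OF cd _ _ that])
      show "mat_components m n (C1_on {c..d}) A" using C1 unfolding mat_components_def by (blast intro: C1_on_subset)
      have "W21_loc_on UNIV f \<Longrightarrow> W21_on {c<..<d} f" for f unfolding W21_loc_on_def using cd by simp
      then show "mat_components m n (W21_on {c<..<d}) A" using W unfolding mat_components_def by blast
    qed
    obtain L where L: "dc_curve l m n A g c d L" using g[OF cd] by blast
    have der': "((\<lambda>t. \<sigma> t j) has_real_derivative \<sigma>' t j) (at t within {c..d})" for t
      by (rule DERIV_subset[OF der[OF j]]) simp
    have c'': "continuous_on {c..d} (\<lambda>t. \<sigma>' t j)" by (rule continuous_on_subset[OF c'[OF j]]) simp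
    obtain \<rho> where "has_density (\<lambda>t. \<sigma>' t j) \<rho> c d"
      using dc_curve_density(1)[OF L entry der' c'' sel[OF j]] by blast
    then show "W21_on V (\<lambda>t. \<sigma> t j)" by (rule W21_on_density[OF has_density_C1[OF der' c''] _ V(1) Vcd cd])
  qed
  ultimately show ?thesis using \<sigma> by blast
qed

lemma singular_value_family_regular:
  fixes A :: "real \<times> (real ^ 'k) \<Rightarrow> complex mat" and \<sigma> :: "real ^ 'k \<Rightarrow> real \<Rightarrow> nat \<Rightarrow> real"
  assumes l: "l = min m n" and ab: "a < b" and U: "open U" "closure ({a<..<b} \<times> cube {a<..<b}) \<subseteq> U"
    and A: "\<And>x. x \<in> U \<Longrightarrow> A x \<in> carrier_mat m n" "\<And>x. x \<in> U \<Longrightarrow> vec_space.rank m (A x) = l"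
    and DC: "mat_components m n (locally_DC_on U) A"
    and C1: "\<And>r. r \<in> cube {a..b} \<Longrightarrow> mat_components m n (C1_on {a..b}) (\<lambda>t. A (t, r))"
    and W: "\<And>r. r \<in> cube {a..b} \<Longrightarrow> mat_components m n (W21_on {a<..<b}) (\<lambda>t. A (t, r))"
    and \<sigma>: "\<And>r. r \<in> cube {a..b} \<Longrightarrow> singular_value_system l {a..b} (\<lambda>t. A (t, r)) (\<sigma> r)"
      "\<And>r. r \<in> cube {a..b} \<Longrightarrow> tuple_components l (C1_on {a..b}) (\<sigma> r)"
  shows "C1_bounded_family l {a..b} (cube {a..b}) \<sigma>"
    "\<exists>M :: real ^ 'k \<Rightarrow> real. M absolutely_integrable_on cube {a<..<b} \<and> (\<forall>r\<in>cube {a<..<b}. 0 \<le> M r) \<and>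
       (AE r\<in>cube {a<..<b} in lebesgue.
          tuple_components l (W21_on {a<..<b}) (\<sigma> r) \<and> W21_norm l {a<..<b} (\<sigma> r) \<le> M r)"
proof -
  \<comment> \<open>The closure of the cylinder; its compactness makes difference-convexity
    uniform.\<close>
  define K where "K = {a..b} \<times> (cube {a..b} :: (real ^ 'k) set)"
  have K: "compact K" "K \<subseteq> U"
    using U(2) unfolding closure_cylinder[OF ab] K_def by (simp_all add: cube_eq_box compact_Times)
  obtain L where L: "L > 0" "mat_components m n (\<lambda>f. uniform_DC K f L) A"
  proof (rule mat_components_uniform_bound[OF DC, of "uniform_DC K"])
    show "\<exists>L. uniform_DC K f L" if "locally_DC_on U f" for f using locally_DC_uniform[OF U(1) K that] by blast
  qed (blast intro: uniform_DC_mono)+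
  let ?C = "curve_bound l m n L" and ?N = "real (nat \<lceil>(b - a) / (1 / L)\<rceil> + 1)"
  have "0 \<le> real l * 4 * L * real m * real n" using L(1) by simp
  from curve_bound_ge(1)[OF this] this have C0: "0 \<le> ?C" by linarith
  have bounds: "\<exists>s' s''. (\<forall>j<l. \<forall>t\<in>{a..b}. ((\<lambda>t. \<sigma> r t j) has_real_derivative s' j t) (at t within {a..b})) \<and>
    (\<forall>j<l. has_density (\<lambda>t. \<sigma> r t j) (s' j) a b \<and> has_density (s' j) (s'' j) a b) \<and>
    (\<forall>j<l. \<forall>t\<in>{a..b}. \<bar>\<sigma> r t j\<bar> \<le> ?C \<and> \<bar>s' j t\<bar> \<le> ?C) \<and> (\<forall>j<l. integral {a..b} (\<lambda>t. \<bar>s'' j t\<bar>) \<le> ?N * ?C)"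
    if r: "r \<in> cube {a..b}" for r
  proof -
    have trU: "(t, r) \<in> U" if "t \<in> {a..b}" for t using K(2) r that unfolding K_def by blast
    have dc: "mat_components m n (\<lambda>f. \<exists>g h. slice_DC f L c d g h) (\<lambda>t. A (t, r))"
      if "a \<le> c" "c < d" "d \<le> b" "d - c < 1 / L" for c d
    proof -
      have cr: "(c, r) \<in> K" using that r unfolding K_def by auto
      have "\<exists>g h. slice_DC (\<lambda>t. f (t, r)) L c d g h" if f: "uniform_DC K f L" for f
        using f that \<open>c < d\<close> \<open>d - c < 1 / L\<close> cr unfolding uniform_DC_def by blast
      then show ?thesis using L(2) unfolding mat_components_def by blast
    qed
    show ?thesis
      by (rule singular_value_family_bounds[OF l ab L(1) A(1)[OF trU] A(2)[OF trU] dc C1[OF r] W[OF r] \<sigma>(1)[OF r] \<sigma>(2)[OF r]]) blast+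
  qed
  show "C1_bounded_family l {a..b} (cube {a..b}) \<sigma>"
    unfolding C1_bounded_family_def
  proof (intro conjI ballI exI[of _ ?C] allI impI)
    fix r t j assume r: "r \<in> (cube {a..b} :: (real ^ 'k) set)" and t: "t \<in> {a..b}" and j: "j < l"
    obtain s' s'' where s: "\<forall>j<l. \<forall>t\<in>{a..b}. ((\<lambda>t. \<sigma> r t j) has_real_derivative s' j t) (at t within {a..b})"
      "\<forall>j<l. \<forall>t\<in>{a..b}. \<bar>\<sigma> r t j\<bar> \<le> ?C \<and> \<bar>s' j t\<bar> \<le> ?C" using bounds[OF r] by blast
    have "vector_derivative (\<lambda>s. \<sigma> r s j) (at t within {a..b}) = s' j t"
      using s(1) t j unfolding has_real_derivative_iff_has_vector_derivative
      by (intro vector_derivative_within_closed_interval[OF ab t]) blast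
    then show "\<bar>\<sigma> r t j\<bar> \<le> ?C" "\<bar>vector_derivative (\<lambda>s. \<sigma> r s j) (at t within {a..b})\<bar> \<le> ?C"
      using s(2) t j by auto
  qed (rule \<sigma>(2))
  \<comment> \<open>The bound of \<open>W21_norm_bound\<close> with the common constant for values
    and first derivatives and the chained constant for the second. It does not depend on r, hence is
    integrable over the bounded cube.\<close>
  let ?M = "real l * (2 * ?C * (b - a) + ?N * ?C)"
  have cubes: "cube {a<..<b} \<subseteq> (cube {a..b} :: (real ^ 'k) set)"
    unfolding cube_def by (simp add: subset_iff less_imp_le)
  have W21: "tuple_components l (W21_on {a<..<b}) (\<sigma> r) \<and> W21_norm l {a<..<b} (\<sigma> r) \<le> ?M" if rc: "r \<in> cube {a<..<b}" for r
  proof -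
    have "r \<in> cube {a..b}" using rc cubes by blast
    from bounds[OF this]
    obtain s' s'' where s: "\<forall>j<l. has_density (\<lambda>t. \<sigma> r t j) (s' j) a b \<and> has_density (s' j) (s'' j) a b"
      "\<forall>j<l. \<forall>t\<in>{a..b}. \<bar>\<sigma> r t j\<bar> \<le> ?C \<and> \<bar>s' j t\<bar> \<le> ?C" "\<forall>j<l. integral {a..b} (\<lambda>t. \<bar>s'' j t\<bar>) \<le> ?N * ?C"
      by blast
    have "W21_on {a<..<b} (\<lambda>t. \<sigma> r t j)" if "j < l" for j
      using s(1) that by (intro W21_on_density[OF _ _ _ _ ab, of _ "s' j" "s'' j"]) auto
    moreover have "W21_norm l {a<..<b} (\<sigma> r) \<le> ?M"
      by (rule W21_norm_bound[OF ab, where s' = s' and s'' = s'']) (use s in blast)+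
    ultimately show ?thesis unfolding tuple_components_def by blast
  qed
  have "(\<lambda>r. ?M) absolutely_integrable_on (cube {a..b} :: (real ^ 'k) set)"
    unfolding cube_eq_box by (rule absolutely_integrable_continuous) simp
  then have "(\<lambda>r. ?M) absolutely_integrable_on (cube {a<..<b} :: (real ^ 'k) set)"
    by (rule set_integrable_subset) (use cubes in \<open>auto simp: cube_eq_box\<close>)
  moreover have "0 \<le> ?M" using C0 ab by simp
  ultimately show "\<exists>M :: real ^ 'k \<Rightarrow> real. M absolutely_integrable_on cube {a<..<b} \<and> (\<forall>r\<in>cube {a<..<b}. 0 \<le> M r) \<and>
       (AE r\<in>cube {a<..<b} in lebesgue.
          tuple_components l (W21_on {a<..<b}) (\<sigma> r) \<and> W21_norm l {a<..<b} (\<sigma> r) \<le> M r)"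
    using W21 by (intro exI[of _ "\<lambda>r. ?M"]) auto
qed

theorem theorem0p7p2:
  fixes m n l :: nat
  assumes "m \<ge> 1" and "n \<ge> 1" and "l = min m n"
  shows
    "(\<forall>A :: real \<Rightarrow> complex mat.
        (\<forall>t. A t \<in> carrier_mat m n) \<and>
        mat_components m n (C1_on UNIV) A \<and>
        mat_components m n (DC_on UNIV) A \<and>
        mat_components m n (W21_loc_on UNIV) A \<and>
        (\<forall>t. vec_space.rank m (A t) = l) \<longrightarrow>
        (\<exists>\<sigma>. singular_value_system l UNIV A \<sigma> \<and>
             tuple_components l (C1_on UNIV) \<sigma> \<and>
             tuple_components l (DC_on UNIV) \<sigma> \<and>
             tuple_components l (W21_loc_on UNIV) \<sigma>))
     \<and>
     (\<forall>(a :: real) (b :: real) (U :: (real \<times> (real ^ 'k)) set)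
        (A :: real \<times> (real ^ 'k) \<Rightarrow> complex mat) (\<sigma> :: real ^ 'k \<Rightarrow> real \<Rightarrow> nat \<Rightarrow> real).
        a < b \<and>
        open U \<and> closure ({a<..<b} \<times> cube {a<..<b}) \<subseteq> U \<and>
        (\<forall>x\<in>U. A x \<in> carrier_mat m n) \<and>
        (\<forall>x\<in>U. vec_space.rank m (A x) = l) \<and>
        mat_components m n (locally_DC_on U) A \<and>
        (\<forall>r\<in>cube {a..b}.
           mat_components m n (C1_on {a..b}) (\<lambda>t. A (t, r)) \<and>
           mat_components m n (W21_on {a<..<b}) (\<lambda>t. A (t, r))) \<and>
        (\<forall>r\<in>cube {a..b}.
           singular_value_system l {a..b} (\<lambda>t. A (t, r)) (\<sigma> r) \<and>
           tuple_components l (C1_on {a..b}) (\<sigma> r)) \<longrightarrow>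
        C1_bounded_family l {a..b} (cube {a..b}) \<sigma> \<and>
        (\<exists>M :: real ^ 'k \<Rightarrow> real.
           M absolutely_integrable_on cube {a<..<b} \<and>
           (\<forall>r\<in>cube {a<..<b}. 0 \<le> M r) \<and>
           (AE r\<in>cube {a<..<b} in lebesgue.
              tuple_components l (W21_on {a<..<b}) (\<sigma> r) \<and>
              W21_norm l {a<..<b} (\<sigma> r) \<le> M r)))"
proof (intro conjI allI impI)
  fix A :: "real \<Rightarrow> complex mat"
  assume *: "(\<forall>t. A t \<in> carrier_mat m n) \<and> mat_components m n (C1_on UNIV) A \<and> mat_components m n (DC_on UNIV) A \<and>
    mat_components m n (W21_loc_on UNIV) A \<and> (\<forall>t. vec_space.rank m (A t) = l)"
  show "\<exists>\<sigma>. singular_value_system l UNIV A \<sigma> \<and> tuple_components l (C1_on UNIV) \<sigma> \<and>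
    tuple_components l (DC_on UNIV) \<sigma> \<and> tuple_components l (W21_loc_on UNIV) \<sigma>"
    by (rule singular_value_system_regular[OF assms(3)]) (use * in blast)+
next
  fix a b :: real and U :: "(real \<times> (real ^ 'k)) set" and A :: "real \<times> (real ^ 'k) \<Rightarrow> complex mat"
    and \<sigma> :: "real ^ 'k \<Rightarrow> real \<Rightarrow> nat \<Rightarrow> real"
  assume *: "a < b \<and> open U \<and> closure ({a<..<b} \<times> cube {a<..<b}) \<subseteq> U \<and>
    (\<forall>x\<in>U. A x \<in> carrier_mat m n) \<and> (\<forall>x\<in>U. vec_space.rank m (A x) = l) \<and> mat_components m n (locally_DC_on U) A \<and>
    (\<forall>r\<in>cube {a..b}. mat_components m n (C1_on {a..b}) (\<lambda>t. A (t, r)) \<and> mat_components m n (W21_on {a<..<b}) (\<lambda>t. A (t, r))) \<and>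
    (\<forall>r\<in>cube {a..b}. singular_value_system l {a..b} (\<lambda>t. A (t, r)) (\<sigma> r) \<and> tuple_components l (C1_on {a..b}) (\<sigma> r))"
  show "C1_bounded_family l {a..b} (cube {a..b}) \<sigma>"
    by (rule singular_value_family_regular(1)[OF assms(3), of a b U A]) (use * in blast)+
  show "\<exists>M :: real ^ 'k \<Rightarrow> real. M absolutely_integrable_on cube {a<..<b} \<and> (\<forall>r\<in>cube {a<..<b}. 0 \<le> M r) \<and>
    (AE r\<in>cube {a<..<b} in lebesgue.
       tuple_components l (W21_on {a<..<b}) (\<sigma> r) \<and> W21_norm l {a<..<b} (\<sigma> r) \<le> M r)"
    by (rule singular_value_family_regular(2)[OF assms(3), of a b U A]) (use * in blast)+
qed

end
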